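(* Let $(M,g)$ be a complete Riemannian manifold that is asymptotically hyperbolic in the sense of Wang: there is a chart at infinity $\Phi:M\setminus K\to\mathbb{H}^n\setminus K'$ such that, with $e=\Phi_*g-b$, the tensor $\overline{e}=\rho^{2-n}e$ extends smoothly to a symmetric 2-tensor on $\overline{B}_1(0)\setminus K'$ satisfying $\overline{e}_{ij}x^i=0$. Then for every $\epsilon>0$ the operator $P(e,\cdot):C^\epsilon(\mathbb{S}_1(0),\mathbb{R})\to\mathbb{R}$ is well defined, and for all $v\in C^\epsilon(\mathbb{S}_1(0),\mathbb{R})$ $$P(e,v)=n\int_{\mathbb{S}_1(0)}m\,v\,d\mu^\sigma,$$ where $m$ is the restriction to $\mathbb{S}_1(0)$ of $\mathrm{tr}_\delta(\overline{e})$, the trace with respect to the Euclidean metric $\delta$.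
   Context: Hyperbolic space: $n\ge 3$; $\mathbb{H}^n=B_1(0)$ is the open unit ball of $\mathbb{R}^n$ with the metric $b=\rho^{-2}\delta$, where $\delta$ is the Euclidean metric and $\rho=\frac{1-|x|^2}{2}$. $D$ is the Levi-Civita connection of $b$ ($Df$ also denotes the $b$-gradient of $f$); $\mathrm{div},\Delta=\mathrm{tr}\,\mathrm{Hess},\mathrm{tr}$ are taken with respect to $b$; $d\mu^b$ is the volume measure of $b$. $\mathbb{S}_1(0)$ is the Euclidean unit sphere, $\sigma$ its round metric, $d\mu^\sigma$ its measure. A chart at infinity is a diffeomorphism $\Phi:M\setminus K\to\mathbb{H}^n\setminus K'$, with $K,K'$ compact, such that $C^{-1}b\le\Phi_*g\le Cb$ for some $C>1$. $x=(x^1,\dots,x^n)$ are the Cartesian coordinates and indices of $\overline{e}_{ij}$ refer to them. Charges: for $v\in C^0(\mathbb{S}_1(0),\mathbb{R})$ let $V=\mathcal{D}(v)$ be the unique $C^2$ solution on $\mathbb{H}^n$ of $\Delta V=nV$ such that $\rho V$ extends continuously to $\overline{B}_1(0)$ with $\rho V|_{\mathbb{S}_1(0)}=v$. Set $P(e,v)=p(e,V)$, where $$p(e,V)=\lim_{k\to\infty}\int_{\mathbb{H}^n}\Big[V\big(\mathrm{div}(e)-d\,\mathrm{tr}(e)\big)(-D\overline{\chi}_k)+\mathrm{tr}(e)\,dV(-D\overline{\chi}_k)-e(DV,-D\overline{\chi}_k)\Big]\,d\mu^b .$$ Here $(\overline{\chi}_k)_k$ is any sequence of compactly supported Lipschitz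 functions on $\mathbb{H}^n$, uniformly bounded together with their Lipschitz constants with respect to $b$, such that the sets $\overline{\chi}_k^{-1}(1)$ form an increasing sequence of compact sets with union $\mathbb{H}^n$; the integrand is taken to be $0$ on $K'$, where $e$ is not defined. "$P(e,\cdot)$ is well defined on $C^\epsilon$" means that for each $v\in C^\epsilon(\mathbb{S}_1(0),\mathbb{R})$ this limit exists and does not depend on the sequence $(\overline{\chi}_k)_k$. $C^\epsilon$ is the usual Hölder space ($C^k$ if $\epsilon=k$ is an integer).
   Formalization: The cutoff sequences are also required to have some set where the cutoff equals 1 contain a neighbourhood of K'; this holds for every usual exhaustion by compact sets, and without it the defining integrals can fail to exist, since derivatives of e may be non-integrable near K'. *)

theory Defs
  imports "HOL-Analysis.Analysis"
begin

section \<open>Differentiability classes\<close>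

definition partial :: "'n::finite \<Rightarrow> (real^'n \<Rightarrow> 'b::real_normed_vector) \<Rightarrow> real^'n \<Rightarrow> 'b" where
  "partial i f x = frechet_derivative f (at x) (axis i 1)"

text \<open>The set \<open>U\<close> is meant to be open.\<close>

primrec Ck_on :: "nat \<Rightarrow> (real^'n::finite) set \<Rightarrow> (real^'n \<Rightarrow> 'b::real_normed_vector) \<Rightarrow> bool" where
  "Ck_on 0 U f \<longleftrightarrow> continuous_on U f"
| "Ck_on (Suc k) U f \<longleftrightarrow> (\<forall>x\<in>U. f differentiable (at x)) \<and> (\<forall>i. Ck_on k U (partial i f))"

text \<open>Smoothness on an arbitrary subset, in particular on a closed ball up to the boundary:
  near every point of \<open>S\<close> there is a smooth extension to an open neighbourhood.\<close>

definition smooth_on :: "(real^'n::finite) set \<Rightarrow> (real^'n \<Rightarrow> 'b::real_normed_vector) \<Rightarrow> bool" where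
  "smooth_on S f \<longleftrightarrow>
     (\<forall>x\<in>S. \<exists>U F. open U \<and> x \<in> U \<and> (\<forall>k. Ck_on k U F) \<and> (\<forall>y\<in>U \<inter> S. F y = f y))"

text \<open>The space \<open>C\<^sup>\<epsilon>\<close> of the unit sphere; only the values of \<open>v\<close> on the sphere matter.
  Derivatives are those of the extension of \<open>v\<close> that is homogeneous of degree 0.  With \<open>k = \<lfloor>\<epsilon>\<rfloor>\<close>,
  the space is \<open>C\<^sup>k\<close> if \<open>\<epsilon> = k\<close>, and otherwise consists of the \<open>C\<^sup>k\<close> functions whose derivatives
  of order \<open>k\<close> are Hoelder continuous with exponent \<open>\<epsilon> - k\<close>.\<close>

definition holder_space :: "real \<Rightarrow> (real^'n::finite \<Rightarrow> real) set" where
  "holder_space \<epsilon> = {v.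
     let k = nat \<lfloor>\<epsilon>\<rfloor>; \<alpha> = \<epsilon> - real k; w = (\<lambda>x. v (x /\<^sub>R norm x)) in
       Ck_on k (- {0}) w \<and>
       (\<alpha> > 0 \<longrightarrow>
          (\<forall>is. length is = k \<longrightarrow>
             (\<exists>C. \<forall>x\<in>sphere 0 1. \<forall>y\<in>sphere 0 1.
                \<bar>foldr partial is w x - foldr partial is w y\<bar> \<le> C * dist x y powr \<alpha>)))}"


section \<open>Riemannian manifolds\<close>

type_synonym ('m, 'n) chart = "'m set \<times> ('m \<Rightarrow> real^'n)"

definition carrier_of :: "('m, 'n::finite) chart set \<Rightarrow> 'm set" where
  "carrier_of A = (\<Union>c\<in>A. fst c)"

text \<open>The manifold is \<open>carrier_of A\<close>, an open subset of the type \<open>'m\<close>; the Hausdorff property and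
  second countability come from the sort of \<open>'m\<close>.\<close>

definition smooth_atlas ::
    "('m::{t2_space, second_countable_topology}, 'n::finite) chart set \<Rightarrow> bool" where
  "smooth_atlas A \<longleftrightarrow>
     (\<forall>(U, \<phi>)\<in>A. open U \<and> open (\<phi> ` U) \<and> homeomorphism U (\<phi> ` U) \<phi> (inv_into U \<phi>)) \<and>
     (\<forall>(U, \<phi>)\<in>A. \<forall>(W, \<psi>)\<in>A. smooth_on (\<phi> ` (U \<inter> W)) (\<psi> \<circ> inv_into U \<phi>))"

definition jacobian :: "(real^'n::finite \<Rightarrow> real^'n) \<Rightarrow> real^'n \<Rightarrow> real^'n^'n" where
  "jacobian f x = matrix (frechet_derivative f (at x))"

text \<open>A Riemannian metric is given by its component matrices \<open>g c p\<close> at \<open>p\<close> in each chart \<open>c\<close>,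
  subject to the transformation law of covariant 2-tensors.\<close>

definition riemannian_metric ::
    "('m::topological_space, 'n::finite) chart set \<Rightarrow> (('m, 'n) chart \<Rightarrow> 'm \<Rightarrow> real^'n^'n) \<Rightarrow> bool" where
  "riemannian_metric A g \<longleftrightarrow>
     (\<forall>c\<in>A. smooth_on (snd c ` fst c) (g c \<circ> inv_into (fst c) (snd c)) \<and>
        (\<forall>p\<in>fst c. transpose (g c p) = g c p \<and> (\<forall>u. u \<noteq> 0 \<longrightarrow> u \<bullet> (g c p *v u) > 0))) \<and>
     (\<forall>c\<in>A. \<forall>d\<in>A. \<forall>p\<in>fst c \<inter> fst d.
        let J = jacobian (snd d \<circ> inv_into (fst c) (snd c)) (snd c p) in
          g c p = transpose J ** g d p ** J)"

definition chart_at :: "('m, 'n::finite) chart set \<Rightarrow> 'm \<Rightarrow> ('m, 'n) chart" where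
  "chart_at A p = (SOME c. c \<in> A \<and> p \<in> fst c)"

definition curves ::
    "('m::topological_space, 'n::finite) chart set \<Rightarrow> 'm \<Rightarrow> 'm \<Rightarrow> (real \<Rightarrow> 'm) set" where
  "curves A p q = {\<gamma>. continuous_on {0..1} \<gamma> \<and> \<gamma> ` {0..1} \<subseteq> carrier_of A \<and> \<gamma> 0 = p \<and> \<gamma> 1 = q \<and>
     (\<forall>c\<in>A. \<forall>a b. 0 \<le> a \<and> a < b \<and> b \<le> 1 \<and> \<gamma> ` {a..b} \<subseteq> fst c \<longrightarrow>
        (snd c \<circ> \<gamma>) piecewise_C1_differentiable_on {a..b})}"

text \<open>For a Riemannian metric the speed does not depend on the chart chosen by \<open>chart_at\<close>.\<close>

definition speed ::
    "('m, 'n::finite) chart set \<Rightarrow> (('m, 'n) chart \<Rightarrow> 'm \<Rightarrow> real^'n^'n) \<Rightarrow> (real \<Rightarrow> 'm) \<Rightarrow> real \<Rightarrow> real" where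
  "speed A g \<gamma> t =
     (let c = chart_at A (\<gamma> t); u = vector_derivative (snd c \<circ> \<gamma>) (at t)
      in sqrt (u \<bullet> (g c (\<gamma> t) *v u)))"

text \<open>The distance is infinite between points of different connected components.  The library's
  piecewise \<open>C\<^sup>1\<close> curves may have unbounded derivatives near the exceptional points; the
  nonnegative integral gives those which are not rectifiable infinite length.\<close>

definition riem_dist ::
    "('m::topological_space, 'n::finite) chart set \<Rightarrow> (('m, 'n) chart \<Rightarrow> 'm \<Rightarrow> real^'n^'n)
       \<Rightarrow> 'm \<Rightarrow> 'm \<Rightarrow> ennreal" where
  "riem_dist A g p q = (INF \<gamma>\<in>curves A p q. \<integral>\<^sup>+t\<in>{0..1}. ennreal (speed A g \<gamma> t) \<partial>lborel)"

definition riem_complete ::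
    "('m::topological_space, 'n::finite) chart set \<Rightarrow> (('m, 'n) chart \<Rightarrow> 'm \<Rightarrow> real^'n^'n) \<Rightarrow> bool" where
  "riem_complete A g \<longleftrightarrow>
     (\<forall>s :: nat \<Rightarrow> 'm. range s \<subseteq> carrier_of A \<and>
        (\<forall>\<epsilon>>0. \<exists>N. \<forall>i\<ge>N. \<forall>j\<ge>N. riem_dist A g (s i) (s j) < \<epsilon>) \<longrightarrow>
        (\<exists>p\<in>carrier_of A. (\<lambda>i. riem_dist A g (s i) p) \<longlonglongrightarrow> 0))"


section \<open>Levi-Civita calculus of a metric on an open subset of Euclidean space\<close>

text \<open>Here \<open>h\<close> is a field of metric matrices and \<open>e\<close> a field of symmetric 2-tensors, both given by
  their Cartesian components.\<close>

definition christoffel ::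
    "(real^'n::finite \<Rightarrow> real^'n^'n) \<Rightarrow> 'n \<Rightarrow> 'n \<Rightarrow> 'n \<Rightarrow> real^'n \<Rightarrow> real" where
  "christoffel h k i j x =
     (\<Sum>l\<in>UNIV. matrix_inv (h x) $ k $ l *
        (partial i (\<lambda>y. h y $ j $ l) x + partial j (\<lambda>y. h y $ i $ l) x
          - partial l (\<lambda>y. h y $ i $ j) x)) / 2"

definition gradient ::
    "(real^'n::finite \<Rightarrow> real^'n^'n) \<Rightarrow> (real^'n \<Rightarrow> real) \<Rightarrow> real^'n \<Rightarrow> real^'n" where
  "gradient h f x = (\<chi> i. \<Sum>j\<in>UNIV. matrix_inv (h x) $ i $ j * partial j f x)"

definition hessian ::
    "(real^'n::finite \<Rightarrow> real^'n^'n) \<Rightarrow> (real^'n \<Rightarrow> real) \<Rightarrow> real^'n \<Rightarrow> real^'n^'n" where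
  "hessian h f x =
     (\<chi> i j. partial i (partial j f) x - (\<Sum>k\<in>UNIV. christoffel h k i j x * partial k f x))"

definition tensor_trace ::
    "(real^'n::finite \<Rightarrow> real^'n^'n) \<Rightarrow> (real^'n \<Rightarrow> real^'n^'n) \<Rightarrow> real^'n \<Rightarrow> real" where
  "tensor_trace h e x = (\<Sum>i\<in>UNIV. \<Sum>j\<in>UNIV. matrix_inv (h x) $ i $ j * e x $ i $ j)"

definition laplacian ::
    "(real^'n::finite \<Rightarrow> real^'n^'n) \<Rightarrow> (real^'n \<Rightarrow> real) \<Rightarrow> real^'n \<Rightarrow> real" where
  "laplacian h f = tensor_trace h (hessian h f)"

text \<open>\<open>cov_deriv h e k i j\<close> is the component \<open>D\<^sub>k e\<^sub>i\<^sub>j\<close>.\<close>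

definition cov_deriv ::
    "(real^'n::finite \<Rightarrow> real^'n^'n) \<Rightarrow> (real^'n \<Rightarrow> real^'n^'n) \<Rightarrow> 'n \<Rightarrow> 'n \<Rightarrow> 'n \<Rightarrow> real^'n \<Rightarrow> real" where
  "cov_deriv h e k i j x =
     partial k (\<lambda>y. e y $ i $ j) x
       - (\<Sum>l\<in>UNIV. christoffel h l k i x * e x $ l $ j)
       - (\<Sum>l\<in>UNIV. christoffel h l k j x * e x $ i $ l)"

definition tensor_div ::
    "(real^'n::finite \<Rightarrow> real^'n^'n) \<Rightarrow> (real^'n \<Rightarrow> real^'n^'n) \<Rightarrow> real^'n \<Rightarrow> real^'n" where
  "tensor_div h e x =
     (\<chi> j. \<Sum>k\<in>UNIV. \<Sum>i\<in>UNIV. matrix_inv (h x) $ k $ i * cov_deriv h e k i j x)"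


section \<open>Hyperbolic space\<close>

definition rho :: "real^'n::finite \<Rightarrow> real" where
  "rho x = (1 - (norm x)\<^sup>2) / 2"

definition hyp_metric :: "real^'n::finite \<Rightarrow> real^'n^'n" where
  "hyp_metric x = mat (1 / (rho x)\<^sup>2)"

definition hyp_volume :: "(real^'n::finite) measure" where
  "hyp_volume =
     density (restrict_space lebesgue (ball 0 1)) (\<lambda>x. ennreal (sqrt (det (hyp_metric x))))"

text \<open>The Riemannian distance of \<open>b\<close>: the unit ball is a manifold with one global chart.\<close>

definition hyp_dist :: "real^'n::finite \<Rightarrow> real^'n \<Rightarrow> ennreal" where
  "hyp_dist = riem_dist {(ball 0 1, id)} (\<lambda>_. hyp_metric)"

text \<open>The measure of the round metric: the image of \<open>n\<close> times Lebesgue measure on the punctured unit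
  ball under radial projection, so that a Borel subset \<open>E\<close> of the sphere has \<open>n\<close> times the volume
  of the cone over \<open>E\<close>.\<close>

definition sphere_measure :: "(real^'n::finite) measure" where
  "sphere_measure = scale_measure (of_nat CARD('n))
     (distr (restrict_space lborel (ball 0 1 - {0})) (restrict_space borel (sphere 0 1))
        (\<lambda>x. x /\<^sub>R norm x))"


section \<open>Asymptotically hyperbolic manifolds\<close>

definition pushforward ::
    "('m, 'n::finite) chart set \<Rightarrow> (('m, 'n) chart \<Rightarrow> 'm \<Rightarrow> real^'n^'n) \<Rightarrow> 'm set \<Rightarrow> ('m \<Rightarrow> real^'n)
       \<Rightarrow> real^'n \<Rightarrow> real^'n^'n" where
  "pushforward A g K \<Phi> y =
     (let \<Psi> = inv_into (carrier_of A - K) \<Phi>; c = chart_at A (\<Psi> y); J = jacobian (snd c \<circ> \<Psi>) y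
      in transpose J ** g c (\<Psi> y) ** J)"

definition chart_at_infinity ::
    "('m::topological_space, 'n::finite) chart set \<Rightarrow> (('m, 'n) chart \<Rightarrow> 'm \<Rightarrow> real^'n^'n) \<Rightarrow> 'm set
       \<Rightarrow> (real^'n) set \<Rightarrow> ('m \<Rightarrow> real^'n) \<Rightarrow> bool" where
  "chart_at_infinity A g K K' \<Phi> \<longleftrightarrow>
     compact K \<and> K \<subseteq> carrier_of A \<and> compact K' \<and> K' \<subseteq> ball 0 1 \<and>
     homeomorphism (carrier_of A - K) (ball 0 1 - K') \<Phi> (inv_into (carrier_of A - K) \<Phi>) \<and>
     (\<forall>(U, \<phi>)\<in>A. smooth_on (\<phi> ` (U - K)) (\<Phi> \<circ> inv_into U \<phi>) \<and>
        smooth_on (\<Phi> ` (U - K)) (\<phi> \<circ> inv_into (carrier_of A - K) \<Phi>)) \<and>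
     (\<exists>C>1. \<forall>y\<in>ball 0 1 - K'. \<forall>u.
        inverse C * (u \<bullet> (hyp_metric y *v u)) \<le> u \<bullet> (pushforward A g K \<Phi> y *v u) \<and>
        u \<bullet> (pushforward A g K \<Phi> y *v u) \<le> C * (u \<bullet> (hyp_metric y *v u)))"


section \<open>Charges\<close>

text \<open>The operator \<open>\<D>\<close>.  Membership in \<open>extensional\<close> only fixes the irrelevant values off the
  ball.\<close>

definition dirichlet_solution :: "(real^'n::finite \<Rightarrow> real) \<Rightarrow> (real^'n \<Rightarrow> real) \<Rightarrow> bool" where
  "dirichlet_solution v V \<longleftrightarrow>
     Ck_on 2 (ball 0 1) V \<and>
     (\<forall>x\<in>ball 0 1. laplacian hyp_metric V x = real CARD('n) * V x) \<and>
     (\<exists>W. continuous_on (cball 0 1) W \<and> (\<forall>x\<in>ball 0 1. W x = rho x * V x) \<and>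
        (\<forall>x\<in>sphere 0 1. W x = v x))"

definition dirichlet_op :: "(real^'n::finite \<Rightarrow> real) \<Rightarrow> real^'n \<Rightarrow> real" where
  "dirichlet_op v = (THE V. dirichlet_solution v V \<and> V \<in> extensional (ball 0 1))"

text \<open>A Lipschitz function \<open>\<zeta>\<close> is differentiable almost everywhere, so its gradient is defined
  off a null set.\<close>

definition charge_integrand ::
    "(real^'n::finite) set \<Rightarrow> (real^'n \<Rightarrow> real^'n^'n) \<Rightarrow> (real^'n \<Rightarrow> real) \<Rightarrow> (real^'n \<Rightarrow> real)
       \<Rightarrow> real^'n \<Rightarrow> real" where
  "charge_integrand K' e V \<zeta> x =
     (if x \<in> K' then 0
      else let X = - gradient hyp_metric \<zeta> x in
        V x * (\<Sum>j\<in>UNIV. (tensor_div hyp_metric e x $ j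
                 - partial j (tensor_trace hyp_metric e) x) * X $ j)
          + tensor_trace hyp_metric e x * (\<Sum>j\<in>UNIV. partial j V x * X $ j)
          - gradient hyp_metric V x \<bullet> (e x *v X))"

text \<open>The last condition is needed because the derivatives of \<open>e\<close> need not be bounded, nor
  integrable, near the boundary of \<open>K'\<close>.  An increasing sequence of compact sets with union the
  ball may fail to contain a neighbourhood of \<open>K'\<close> (for example, closed balls from which punctured
  balls of radius \<open>1/k\<close> around a boundary point of \<open>K'\<close> are removed), and then the integrals
  defining the charge need not exist.\<close>

definition cutoff_sequence :: "(real^'n::finite) set \<Rightarrow> (nat \<Rightarrow> real^'n \<Rightarrow> real) \<Rightarrow> bool" where
  "cutoff_sequence K' \<zeta> \<longleftrightarrow>
     (\<forall>k. \<exists>S. compact S \<and> S \<subseteq> ball 0 1 \<and> (\<forall>x\<in>ball 0 1 - S. \<zeta> k x = 0)) \<and>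
     (\<exists>B. \<forall>k. \<forall>x\<in>ball 0 1. \<bar>\<zeta> k x\<bar> \<le> B) \<and>
     (\<exists>L. \<forall>k. \<forall>x\<in>ball 0 1. \<forall>y\<in>ball 0 1.
        ennreal \<bar>\<zeta> k x - \<zeta> k y\<bar> \<le> ennreal L * hyp_dist x y) \<and>
     (\<forall>k. compact {x\<in>ball 0 1. \<zeta> k x = 1}) \<and>
     incseq (\<lambda>k. {x\<in>ball 0 1. \<zeta> k x = 1}) \<and>
     (\<Union>k. {x\<in>ball 0 1. \<zeta> k x = 1}) = ball 0 1 \<and>
     (\<exists>k. K' \<subseteq> interior {x\<in>ball 0 1. \<zeta> k x = 1})"

text \<open>\<open>l\<close> is the limit for every sequence of cutoff functions.  The library's integral is 0 for
  non-integrable functions, so integrability is part of the existence of the limit.\<close>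

definition charge_limit ::
    "(real^'n::finite) set \<Rightarrow> (real^'n \<Rightarrow> real^'n^'n) \<Rightarrow> (real^'n \<Rightarrow> real) \<Rightarrow> real \<Rightarrow> bool" where
  "charge_limit K' e V l \<longleftrightarrow>
     (\<forall>\<zeta>. cutoff_sequence K' \<zeta> \<longrightarrow>
        (\<forall>\<^sub>F k in sequentially. integrable hyp_volume (charge_integrand K' e V (\<zeta> k))) \<and>
        (\<lambda>k. integral\<^sup>L hyp_volume (charge_integrand K' e V (\<zeta> k))) \<longlonglongrightarrow> l)"

definition charge_p ::
    "(real^'n::finite) set \<Rightarrow> (real^'n \<Rightarrow> real^'n^'n) \<Rightarrow> (real^'n \<Rightarrow> real) \<Rightarrow> real" where
  "charge_p K' e V = (THE l. charge_limit K' e V l)"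

definition charge_P ::
    "(real^'n::finite) set \<Rightarrow> (real^'n \<Rightarrow> real^'n^'n) \<Rightarrow> (real^'n \<Rightarrow> real) \<Rightarrow> real" where
  "charge_P K' e v = charge_p K' e (dirichlet_op v)"

definition charge_P_well_defined ::
    "(real^'n::finite) set \<Rightarrow> (real^'n \<Rightarrow> real^'n^'n) \<Rightarrow> (real^'n \<Rightarrow> real) set \<Rightarrow> bool" where
  "charge_P_well_defined K' e F \<longleftrightarrow> (\<forall>v\<in>F. \<exists>!l. charge_limit K' e (dirichlet_op v) l)"

end

theory Submission
  imports Defs
begin

text \<open>In Cartesian coordinates, tangentiality of \<open>ebar\<close> reduces the charge integrand of a cutoff
  function \<open>\<zeta>\<close>, as a density for Lebesgue measure, to \<open>- n W m x \<bullet> \<nabla>\<zeta> + \<rho> R \<bullet> \<nabla>\<zeta>\<close>, where \<open>W = \<rho> V\<close>,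
  \<open>m\<close> is the Euclidean trace of \<open>ebar\<close>, and \<open>R\<close> involves at most first derivatives of \<open>ebar\<close>
  and \<open>W\<close>. Since \<open>\<zeta>\<close> is Lipschitz for the hyperbolic distance, \<open>\<bar>\<nabla>\<zeta>\<bar> \<le> C / \<rho>\<close>. The Poisson kernel
  \<open>(\<rho> / \<bar>x - \<xi>\<bar>\<^sup>2)\<^sup>n\<close> gives, for \<open>v\<close> of Hoelder class \<open>\<alpha>\<close>, the bounds \<open>\<bar>\<nabla>W\<bar> \<le> C \<rho>\<^sup>\<alpha> / \<rho>\<close> and
  \<open>\<bar>W x - v (x / \<bar>x\<bar>)\<bar> \<le> C \<rho>\<^sup>\<alpha>\<close>. Hence, up to terms dominated by the integrable function
  \<open>\<rho>\<^sup>\<alpha> / \<rho>\<close>, the integrand is \<open>- n h x \<bullet> \<nabla>\<zeta> / \<bar>x\<bar>\<^sup>n\<close> near the boundary, with \<open>h\<close> the extension of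
  \<open>m v\<close> that is homogeneous of degree 0. As \<open>\<nabla>\<zeta>\<^sub>k\<close> eventually vanishes at almost every given point,
  dominated convergence disposes of the error terms, and integration along rays turns the main
  term into an integral of \<open>n m v\<close> over the sphere.\<close>

section \<open>Rademacher's theorem\<close>

text \<open>A cutoff is only Lipschitz, while the integrand contains its derivatives. Two facts
  repair this: a Borel gradient exists almost everywhere, and it vanishes almost everywhere on the
  level set 1. The second is essential because a point may lie in all late sets
  \<open>\<zeta> k = 1\<close> without being interior to any of them. The obstacle that shapes the
  estimates is that \<open>1 / rho\<close>, the size of the gradients, is not integrable up to the
  sphere. Every error term must therefore gain a factor \<open>rho powr \<alpha>\<close>, and this
  is what Hoelder continuity of \<open>v\<close> provides. The weight \<open>1 / |x|^n\<close> is
  chosen because the field \<open>h x / |x|^n\<close> is divergence free for \<open>h\<close>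
  homogeneous of degree 0, so its pairing with a gradient reduces to boundary values. The radius 1/2
  merely keeps away from the singularity at 0. Two factors \<open>n\<close> occur: one stands in
  front of the leading term, the other comes from writing the flux over the ball and is absorbed by
  the normalisation of \<open>sphere_measure\<close>. No kernel integral is evaluated: normalisation
  and decay follow by comparison with powers of the hyperbolic cosine of the distance to the
  origin.\<close>

text \<open>Vitali covering: the short intervals on which \<open>F\<close> grows by less than
  \<open>p\<close> times their length cover \<open>E\<close> finely, so countably many disjoint ones
  exhaust it up to a null set, and their images are again disjoint intervals. Lipschitz continuity
  keeps the image of the null remainder null.\<close>

lemma emeasure_image_le_slope:
  fixes F :: "real \<Rightarrow> real"
  assumes lip: "C-lipschitz_on UNIV F" and mono: "strict_mono F" and surj: "surj F"
    and E: "E \<in> sets borel" and p: "0 < p"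
    and freq: "\<And>x. x \<in> E \<Longrightarrow> \<exists>\<^sub>F y in at x. (F y - F x) / (y - x) < p"
  shows "emeasure lebesgue (F ` E) \<le> ennreal p * emeasure lebesgue E"
proof (cases "emeasure lebesgue E = \<infinity>")
  case True
  then show ?thesis using p by (simp add: ennreal_mult_top)
next
  case False
  have less: "F u < F v \<longleftrightarrow> u < v" for u v using mono by (simp add: strict_mono_less)
  have le: "F u \<le> F v \<longleftrightarrow> u \<le> v" for u v using mono by (simp add: strict_mono_less_eq)
  have main: "emeasure lebesgue (F ` E) \<le> ennreal p * (emeasure lebesgue E + ennreal \<eta>)" if \<eta>: "\<eta> > 0" for \<eta>
  proof -
    \<comment> \<open>Confining the intervals to \<open>U\<close> bounds their total length by the
      measure of \<open>E\<close> plus \<open>\<eta>\<close>.\<close>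
    obtain U where U: "open U" "E \<subseteq> U" "emeasure lborel (U - E) < \<eta>"
      using outer_regular_lborel[OF E \<eta>] .
    define K where "K = {(u,v). u < v \<and> {u..v} \<subseteq> U \<and> F v - F u < p * (v - u)}"
    define a where "a = (\<lambda>(u,v). (u + v) / 2 :: real)"
    define r where "r = (\<lambda>(u,v). (v - u) / 2 :: real)"
    have rpos: "0 < r i" if "i \<in> K" for i
      using that by (auto simp: K_def r_def)
    have cb: "cball (a i) (r i) = {fst i..snd i}" for i
      by (cases i) (auto simp: a_def r_def cball_eq_atLeastAtMost field_simps)
    have "\<exists>i. i \<in> K \<and> x \<in> cball (a i) (r i) \<and> r i < d" if x: "x \<in> E" and d: "0 < d" for x d
    proof -
      obtain \<delta> where \<delta>: "\<delta> > 0" "ball x \<delta> \<subseteq> U"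
        using U x openE by (metis subset_eq)
      have "\<forall>\<^sub>F y in at x. y \<noteq> x \<and> dist y x < min d \<delta>"
        using d \<delta> by (auto simp: eventually_at intro!: exI[of _ "min d \<delta>"])
      from frequently_eventually_frequently[OF freq[OF x] this]
      obtain y where y: "(F y - F x) / (y - x) < p" "y \<noteq> x" "dist y x < min d \<delta>"
        using frequently_ex by blast
      define u v where "u = min x y" and "v = max x y"
      have uv: "u < v" using y by (auto simp: u_def v_def)
      have "{u..v} \<subseteq> ball x \<delta>" using y by (auto simp: u_def v_def dist_real_def)
      moreover have "F v - F u < p * (v - u)"
      proof (cases "x < y")
        case True
        then show ?thesis using y by (simp add: u_def v_def pos_divide_less_eq)
      next
        case False
        then have "y < x" using y by simp
        then show ?thesis using y by (simp add: u_def v_def neg_divide_less_eq algebra_simps)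
      qed
      ultimately have "(u,v) \<in> K" using uv \<delta> by (auto simp: K_def)
      moreover have "x \<in> cball (a (u,v)) (r (u,v))" unfolding cb by (auto simp: u_def v_def)
      moreover have "r (u,v) < d" using y by (auto simp: r_def u_def v_def dist_real_def min_def max_def split: if_splits)
      ultimately show ?thesis by blast
    qed
    then obtain D where D: "countable D" "D \<subseteq> K"
      "pairwise (\<lambda>i j. disjnt (cball (a i) (r i)) (cball (a j) (r j))) D"
      "negligible (E - (\<Union>i\<in>D. cball (a i) (r i)))"
      using Vitali_covering_theorem_cballs[of K r E a thesis] rpos by blast
    define N where "N = E - (\<Union>i\<in>D. {fst i..snd i})"
    have N: "negligible N" using D(4) by (simp add: N_def cb)
    have FN: "negligible (F ` N)"
    proof (rule negligible_locally_Lipschitz_image[OF _ N])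
      show "\<exists>T B. open T \<and> x \<in> T \<and> (\<forall>y\<in>N \<inter> T. norm (F y - F x) \<le> B * norm (y - x))" for x
        using lipschitz_onD[OF lip] by (intro exI[of _ UNIV] exI[of _ C]) (auto simp: dist_norm)
    qed simp
    have dis: "disjoint_family_on (\<lambda>i. {fst i..snd i}) D"
      using D(3) by (auto simp: disjoint_family_on_def pairwise_def disjnt_def cb)
    have disF: "disjoint_family_on (\<lambda>i. {F (fst i)..F (snd i)}) D"
      unfolding disjoint_family_on_def
    proof (intro ballI impI, rule ccontr)
      fix i j assume ij: "i \<in> D" "j \<in> D" "i \<noteq> j" "{F (fst i)..F (snd i)} \<inter> {F (fst j)..F (snd j)} \<noteq> {}"
      then obtain t where "F t \<in> {F (fst i)..F (snd i)} \<inter> {F (fst j)..F (snd j)}"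
        using surj by (metis ex_in_conv surjD)
      then have "t \<in> {fst i..snd i} \<inter> {fst j..snd j}" by (simp add: le)
      then show False using disjoint_family_onD[OF dis ij(1-3)] by blast
    qed
    have sub: "F ` E \<subseteq> (\<Union>i\<in>D. {F (fst i)..F (snd i)}) \<union> F ` N"

    proof
      fix z assume "z \<in> F ` E"
      then obtain x where x: "z = F x" "x \<in> E" by auto
      show "z \<in> (\<Union>i\<in>D. {F (fst i)..F (snd i)}) \<union> F ` N"
        using x by (cases "x \<in> N") (auto simp: N_def le)
    qed
    have meas: "(\<Union>i\<in>D. {F (fst i)..F (snd i)}) \<in> sets lebesgue"
      using D(1) by (intro sets.countable_UN') auto
    have "emeasure lebesgue (F ` E) \<le> emeasure lebesgue ((\<Union>i\<in>D. {F (fst i)..F (snd i)}) \<union> F ` N)"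
      using meas FN by (intro emeasure_mono sub sets.Un) (auto simp: negligible_iff_null_sets)
    also have "\<dots> = emeasure lebesgue (\<Union>i\<in>D. {F (fst i)..F (snd i)})"
      using FN meas by (intro emeasure_Un_null_set) (auto simp: negligible_iff_null_sets)
    also have "\<dots> = (\<integral>\<^sup>+i. emeasure lebesgue {F (fst i)..F (snd i)} \<partial>count_space D)"
      using D(1) disF by (intro emeasure_UN_countable) auto
    also have "\<dots> \<le> (\<integral>\<^sup>+i. ennreal p * emeasure lebesgue {fst i..snd i} \<partial>count_space D)"
    proof (intro nn_integral_mono, simp)
      fix i assume "i \<in> D"
      then have i: "fst i < snd i" "F (snd i) - F (fst i) < p * (snd i - fst i)" using D(2) by (auto simp: K_def)
      then have "F (fst i) \<le> F (snd i)" by (simp add: le)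
      then show "emeasure lborel {F (fst i)..F (snd i)} \<le> ennreal p * emeasure lborel {fst i..snd i}"
        using i p by (simp add: ennreal_mult[symmetric] ennreal_leI)
    qed
    also have "\<dots> = ennreal p * (\<integral>\<^sup>+i. emeasure lebesgue {fst i..snd i} \<partial>count_space D)"
      by (intro nn_integral_cmult) auto
    also have "(\<integral>\<^sup>+i. emeasure lebesgue {fst i..snd i} \<partial>count_space D) = emeasure lebesgue (\<Union>i\<in>D. {fst i..snd i})"
      using D(1) dis by (intro emeasure_UN_countable[symmetric]) auto
    also have "\<dots> \<le> emeasure lebesgue U"
      using D(2) U(1) by (intro emeasure_mono) (fastforce simp: K_def)+
    also have "emeasure lebesgue U = emeasure lebesgue E + emeasure lebesgue (U - E)"
      using U E by (subst plus_emeasure) (auto simp: Un_absorb1)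
    also have "emeasure lebesgue (U - E) \<le> ennreal \<eta>" using U E by (simp add: less_imp_le)
    finally show ?thesis by (meson add_left_mono mult_left_mono order_trans zero_le)
  qed
  show ?thesis
  proof (rule ennreal_le_epsilon)
    fix e :: real assume e: "0 < e"
    have "ennreal p * ennreal (e/p) = ennreal e" using p e by (simp add: ennreal_mult[symmetric])
    then show "emeasure lebesgue (F ` E) \<le> ennreal p * emeasure lebesgue E + ennreal e"
      using main[of "e/p"] p e by (simp add: distrib_left)
  qed
qed

text \<open>With the second point \<open>y\<close> fixed the condition on \<open>x\<close> is open
  by continuity, and even an uncountable union over \<open>y\<close> remains open; letting the
  distance shrink along a sequence exhibits the set as a countable intersection of open
  sets.\<close>

lemma frequently_slope_borel:
  fixes F :: "real \<Rightarrow> real"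
  assumes cont: "continuous_on UNIV F"
  shows "{x. \<exists>\<^sub>F y in at x. (F y - F x) / (y - x) < p} \<in> sets borel"
proof -
  define G where "G = (\<lambda>n::nat. \<Union>y. {x. x \<noteq> y \<and> dist y x < inverse (Suc n) \<and> (F y - F x) / (y - x) < p})"
  have cF: "isCont F x" for x using cont by (simp add: continuous_on_eq_continuous_at)
  \<comment> \<open>The quotient is not continuous across \<open>x = y\<close>; splitting by the
    sign of \<open>y - x\<close> clears the denominator and leaves strict inequalities between
    continuous functions.\<close>
  have eq: "{x. x \<noteq> y \<and> dist y x < e \<and> (F y - F x) / (y - x) < p}
      = {x. x < y \<and> dist y x < e \<and> F y - F x < p * (y - x)} \<union>
        {x. y < x \<and> dist y x < e \<and> F x - F y < p * (x - y)}" for y e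
    by (auto simp: divide_simps algebra_simps split: if_splits)
  have "open (G n)" for n
    unfolding G_def eq
    by (intro open_UN ballI open_Un open_Collect_conj open_Collect_less continuous_intros
        continuous_on_subset[OF cont]) auto
  moreover have "{x. \<exists>\<^sub>F y in at x. (F y - F x) / (y - x) < p} = (\<Inter>n. G n)"
  proof (intro set_eqI iffI)
    fix x assume x: "x \<in> {x. \<exists>\<^sub>F y in at x. (F y - F x) / (y - x) < p}"
    show "x \<in> (\<Inter>n. G n)"
    proof
      fix n
      have "\<forall>\<^sub>F y in at x. y \<noteq> x \<and> dist y x < inverse (Suc n)"
        unfolding eventually_at by (rule exI[of _ "inverse (Suc n)"]) auto
      from frequently_eventually_frequently[OF _ this] x
      obtain y where "(F y - F x) / (y - x) < p" "y \<noteq> x" "dist y x < inverse (Suc n)"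
        using frequently_ex by blast
      then show "x \<in> G n" by (auto simp: G_def)
    qed
  next
    fix x assume x: "x \<in> (\<Inter>n. G n)"
    have "\<exists>y. y \<noteq> x \<and> dist y x < e \<and> (F y - F x) / (y - x) < p" if e: "e > 0" for e
    proof -
      obtain n where n: "inverse (real (Suc n)) < e" using reals_Archimedean[OF e] by blast
      have "x \<in> G n" using x by blast
      then show ?thesis using n unfolding G_def by force
    qed
    then show "x \<in> {x. \<exists>\<^sub>F y in at x. (F y - F x) / (y - x) < p}"
      unfolding mem_Collect_eq frequently_def eventually_at by (metis UNIV_I)
  qed
  ultimately show ?thesis by auto
qed

text \<open>If the lower and upper limits differed, two rationals would fit between them. This
  reduces differentiability to countably many exceptional sets, one for each rational pair; the
  bound \<open>C\<close> makes the limit finite.\<close>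

lemma convergent_slope:
  fixes g :: "'a::t2_space \<Rightarrow> real"
  assumes F: "F \<noteq> bot" and bd: "\<And>y. \<bar>g y\<bar> \<le> C"
    and no: "\<And>p q. p \<in> \<rat> \<Longrightarrow> q \<in> \<rat> \<Longrightarrow> p < q \<Longrightarrow> \<not> ((\<exists>\<^sub>F y in F. g y < p) \<and> (\<exists>\<^sub>F y in F. q < g y))"
  shows "\<exists>l. (g \<longlongrightarrow> l) F"
proof -
  let ?G = "\<lambda>y. ereal (g y)"
  have LL: "Liminf F ?G = Limsup F ?G"
  proof (rule ccontr)
    assume "Liminf F ?G \<noteq> Limsup F ?G"
    then have lt: "Liminf F ?G < Limsup F ?G" using Liminf_le_Limsup[OF F, of ?G] by auto
    obtain p where p: "Liminf F ?G < ereal (real_of_rat p)" "ereal (real_of_rat p) < Limsup F ?G"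
      using ereal_dense3[OF lt] by blast
    obtain q where q: "ereal (real_of_rat p) < ereal (real_of_rat q)" "ereal (real_of_rat q) < Limsup F ?G"
      using ereal_dense3[OF p(2)] by blast
    have "\<exists>\<^sub>F y in F. g y < real_of_rat p"
    proof (rule ccontr)
      assume "\<not> ?thesis"
      then have "\<forall>\<^sub>F y in F. ereal (real_of_rat p) \<le> ?G y" by (simp add: not_frequently not_less)
      then have "ereal (real_of_rat p) \<le> Liminf F ?G" by (rule Liminf_bounded)
      with p show False by auto
    qed
    moreover have "\<exists>\<^sub>F y in F. real_of_rat q < g y"
    proof (rule ccontr)
      assume "\<not> ?thesis"
      then have "\<forall>\<^sub>F y in F. ?G y \<le> ereal (real_of_rat q)" by (simp add: not_frequently not_less)
      then have "Limsup F ?G \<le> ereal (real_of_rat q)" by (rule Limsup_bounded)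
      with q show False by auto
    qed
    ultimately show False using no[of "real_of_rat p" "real_of_rat q"] q by auto
  qed
  have bd2: "- C \<le> g y" "g y \<le> C" for y using bd[of y] by linarith+
  have "ereal (-C) \<le> Liminf F ?G" using bd by (intro Liminf_bounded always_eventually) (use bd2 in simp)
  moreover have "Limsup F ?G \<le> ereal C" using bd by (intro Limsup_bounded always_eventually) (use bd2 in simp)
  ultimately obtain l where "Limsup F ?G = ereal l" using LL by (cases "Limsup F ?G") auto
  then have "(?G \<longlongrightarrow> ereal l) F"
    unfolding tendsto_iff_Liminf_eq_Limsup[OF F] using LL by simp
  then show ?thesis by auto
qed

text \<open>Let \<open>S\<close> be a bounded piece of the set where slopes occur both below
  \<open>p\<close> and above \<open>q\<close>, with \<open>p < q\<close>. The slope estimate for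
  \<open>F\<close> bounds the measure of \<open>F\<close>
  S\<open>by\<close>p\<open>times that of\<close>S\<open>; the same estimate for the inverse, which
  is 1-Lipschitz by the expansion hypothesis, bounds the measure of\<close>S\<open>by\<close>1 /
  q\<open>times that of\<close>F \<open>S\<close>. Together they force measure 0.\<close>

lemma bilipschitz_differentiable_AE:
  fixes F :: "real \<Rightarrow> real"
  assumes lip: "C-lipschitz_on UNIV F" and expand: "\<And>x y. x < y \<Longrightarrow> y - x \<le> F y - F x"
  shows "AE x in lborel. F differentiable at x"
proof -
  have cont: "continuous_on UNIV F" using lip by (rule lipschitz_on_continuous_on)
  have cF: "isCont F x" for x using cont by (simp add: continuous_on_eq_continuous_at)
  have mono: "strict_mono F" using expand by (force intro!: strict_monoI)
  have surj: "surj F"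
  proof (rule surjI[where f = "\<lambda>y. SOME x. F x = y"], rule someI_ex)
    fix y
    define R where "R = \<bar>y - F 0\<bar> + 1"
    have "F (-R) \<le> y" "y \<le> F R" using expand[of "-R" 0] expand[of 0 R] abs_ge_self[of "y - F 0"] abs_ge_minus_self[of "y - F 0"] abs_ge_zero[of "y - F 0"] unfolding R_def by linarith+
    moreover have "-R \<le> R" by (simp add: R_def)
    ultimately show "\<exists>x. F x = y" using IVT[of F "-R" y R] cF by blast
  qed
  have inj: "inj F" using mono strict_mono_imp_inj_on by blast
  define G where "G = inv F"
  have FG [simp]: "F (G y) = y" for y unfolding G_def by (rule surj_f_inv_f[OF surj])
  have GF [simp]: "G (F x) = x" for x unfolding G_def by (rule inv_f_f[OF inj])
  have expand': "\<bar>y - x\<bar> \<le> \<bar>F y - F x\<bar>" for x y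
    using expand[of x y] expand[of y x] by (cases x y rule: linorder_cases) auto
  have lipG: "1-lipschitz_on UNIV G"
    by (rule lipschitz_onI) (use expand' in \<open>auto simp: dist_real_def\<close>, metis FG abs_minus_commute)
  have monoG: "strict_mono G"
    by (rule strict_monoI) (metis FG mono strict_mono_less)
  have surjG: "surj G" by (metis GF surj_def)
  have contG: "continuous_on UNIV G" using lipG by (rule lipschitz_on_continuous_on)
  have C: "C \<ge> 0" using lip by (rule lipschitz_on_nonneg)
  define g where "g = (\<lambda>x y. (F y - F x) / (y - x))"
  have gC: "\<bar>g x y\<bar> \<le> C" for x y
    using lipschitz_onD[OF lip, of y x] C by (cases "x = y") (auto simp: g_def dist_real_def divide_simps)
  have g1: "1 \<le> g x y" if "x \<noteq> y" for x y
    using that expand[of x y] expand[of y x] by (cases x y rule: linorder_cases) (auto simp: g_def divide_simps)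
  define B where "B = (\<lambda>p q. {x. (\<exists>\<^sub>F y in at x. g x y < p)} \<inter> {x. (\<exists>\<^sub>F y in at x. q < g x y)})"
  \<comment> \<open>Large slopes of \<open>F\<close> are small slopes of \<open>- F\<close>, so one
    measurability lemma serves both conditions.\<close>
  have Bq: "{x. (\<exists>\<^sub>F y in at x. q < g x y)} = {x. (\<exists>\<^sub>F y in at x. ((\<lambda>y. - F y) y - (\<lambda>y. - F y) x) / (y - x) < - q)}" for q
  proof -
    have "(- F y - - F x) / (y - x) = - g x y" for x y
      unfolding g_def by (simp only: minus_divide_left) simp
    then have "(q < g x y) = ((- F y - - F x) / (y - x) < - q)" for x y
      by (simp only: neg_less_iff_less)
    then show ?thesis by simp
  qed
  have Bm: "B p q \<in> sets borel" for p q
    unfolding B_def Bq using frequently_slope_borel[OF cont, of p] frequently_slope_borel[of "\<lambda>y. - F y" "-q"] cont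
    by (intro sets.Int) (auto simp: g_def intro: continuous_intros)
  have null: "B p q \<in> null_sets lborel" if pq: "p < q" for p q
  proof (cases "1 < p")
    case False
    have "B p q = {}"
    proof -
      have "\<not> (\<exists>\<^sub>F y in at x. g x y < p)" for x

      proof -
        have "\<forall>\<^sub>F y in at x. \<not> g x y < p"
          unfolding eventually_at using g1[of x] False by (intro exI[of _ 1]) force
        then show ?thesis by (simp add: frequently_def)
      qed
      then show ?thesis by (auto simp: B_def)
    qed
    then show ?thesis by simp
  next
    case p1: True
    \<comment> \<open>A bounded window has finite measure \<open>m\<close>, so that
      \<open>m \<le> p / q * m\<close> implies \<open>m = 0\<close>.\<close>
    have bounded: "B p q \<inter> {-real n..real n} \<in> null_sets lborel" for n :: nat
    proof -
      define S where "S = B p q \<inter> {-real n..real n}"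
      have Sm: "S \<in> sets borel" unfolding S_def using Bm by auto
      have FS: "F ` S = G -` S" by (auto simp: image_iff) (metis FG)
      have FSm: "F ` S \<in> sets borel" unfolding FS

        using measurable_sets[OF borel_measurable_continuous_onI[OF contG] Sm] by simp
      have le1: "emeasure lebesgue (F ` S) \<le> ennreal p * emeasure lebesgue S"
        by (rule emeasure_image_le_slope[OF lip mono surj Sm]) (use p1 in \<open>auto simp: S_def B_def g_def\<close>)
      have le2: "emeasure lebesgue (G ` (F ` S)) \<le> ennreal (1/q) * emeasure lebesgue (F ` S)"
      proof (rule emeasure_image_le_slope[OF lipG monoG surjG FSm])
        show "0 < 1 / q" using p1 pq by auto
        fix z assume "z \<in> F ` S"
        then obtain x where x: "z = F x" "x \<in> S" by auto
        then have fr: "\<exists>\<^sub>F y in at x. q < g x y" by (auto simp: S_def B_def)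
        show "\<exists>\<^sub>F w in at z. (G w - G z) / (w - z) < 1 / q"
        proof (rule ccontr)
          assume "\<not> ?thesis"
          then have ev: "\<forall>\<^sub>F w in at (F x). \<not> (G w - G z) / (w - z) < 1 / q"
            by (simp add: not_frequently x)
          \<comment> \<open>Continuity and injectivity of \<open>F\<close> let a statement about all
            points near \<open>F x\<close> be pulled back to points near \<open>x\<close>, where
            slopes of \<open>G\<close> become reciprocals of slopes of \<open>F\<close>.\<close>
          have "filterlim F (at (F x)) (at x)"
            unfolding filterlim_at using cF[of x] inj
            by (auto simp: isCont_def inj_eq eventually_at intro!: exI[of _ 1])
          then have "\<forall>\<^sub>F y in at x. \<not> (G (F y) - G z) / (F y - z) < 1 / q"
            using ev by (auto simp: filterlim_iff)
          then have "\<forall>\<^sub>F y in at x. \<not> (q < g x y)"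
          proof (eventually_elim, intro notI)
            fix y assume h: "\<not> (G (F y) - G z) / (F y - z) < 1 / q" "q < g x y"
            then have "g x y > 0" using p1 pq by auto
            moreover have "(G (F y) - G z) / (F y - z) = 1 / g x y" by (simp add: x g_def)
            ultimately show False using h p1 pq by (simp add: frac_less2)
          qed
          then show False using fr by (simp add: frequently_def)
        qed
      qed
      have "G ` (F ` S) = S" by (auto simp: image_iff)
      then have "emeasure lebesgue S \<le> ennreal (1/q) * (ennreal p * emeasure lebesgue S)"

        using order_trans[OF le2 mult_left_mono[OF le1 zero_le]] by simp
      also have "\<dots> = ennreal (p/q) * emeasure lebesgue S"
        using p1 pq by (simp add: mult.assoc[symmetric] ennreal_mult[symmetric])
      finally have ineq: "emeasure lebesgue S \<le> ennreal (p/q) * emeasure lebesgue S" .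
      have "emeasure lebesgue S \<le> emeasure lebesgue {-real n..real n}"
        by (rule emeasure_mono) (auto simp: S_def)
      then have "emeasure lebesgue S < \<infinity>" using le_less_trans by (fastforce simp: ennreal_less_top)
      then obtain m where m: "emeasure lebesgue S = ennreal m" "m \<ge> 0"
        by (metis ennreal_cases infinity_ennreal_def less_irrefl)
      have "m \<le> p/q * m" using ineq m p1 pq by (simp add: ennreal_mult[symmetric])
      then have "m * (1 - p/q) \<le> 0" by (simp add: algebra_simps)
      moreover have "1 - p/q > 0" using p1 pq by auto
      ultimately have "m \<le> 0" by (simp add: mult_le_0_iff)
      then have "emeasure lborel S = 0" using m Sm by simp
      then show ?thesis using Sm by (auto simp: S_def null_sets_def)
    qed
    have "B p q = (\<Union>n::nat. B p q \<inter> {-real n..real n})"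
    proof -
      have "\<exists>n::nat. x \<in> {-real n..real n}" for x :: real
        using real_arch_simple[of "\<bar>x\<bar>"] by (auto simp: abs_le_iff minus_le_iff)
      then show ?thesis by auto
    qed
    then show ?thesis using bounded null_sets_UN[of "\<lambda>n. B p q \<inter> {-real n..real n}" lborel] by metis
  qed
  have "AE x in lborel. \<forall>pq\<in>{(p,q). p \<in> \<rat> \<and> q \<in> \<rat> \<and> p < q}. x \<notin> B (fst pq) (snd pq)"
  proof (subst AE_ball_countable)
    show "countable {(p::real,q). p \<in> \<rat> \<and> q \<in> \<rat> \<and> p < q}"
      by (rule countable_subset[of _ "\<rat> \<times> \<rat>"]) (auto simp: countable_rat)
  qed (auto intro: AE_not_in null)
  then show ?thesis
  proof eventually_elim
    case (elim x)
    have "\<exists>l. (g x \<longlongrightarrow> l) (at x)"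
      by (rule convergent_slope[OF _ gC]) (use elim in \<open>auto simp: B_def\<close>)
    then obtain l where "(g x \<longlongrightarrow> l) (at x)" by blast
    then have "(F has_real_derivative l) (at x)" by (simp add: has_field_derivative_iff g_def)
    then show ?case using real_differentiable_def by blast
  qed
qed

text \<open>Adding \<open>(L + 1) * x\<close> raises every slope to at least 1 and does not affect
  differentiability.\<close>

lemma lipschitz_differentiable_AE_real:
  fixes f :: "real \<Rightarrow> real"
  assumes lip: "L-lipschitz_on UNIV f"
  shows "AE x in lborel. f differentiable at x"
proof -
  define F where "F = (\<lambda>x. f x + (L + 1) * x)"
  have L: "L \<ge> 0" using lip by (rule lipschitz_on_nonneg)
  have d: "\<bar>f y - f x\<bar> \<le> L * \<bar>y - x\<bar>" for x y
    using lipschitz_onD[OF lip, of y x] by (simp add: dist_real_def)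
  have "(L + (L+1))-lipschitz_on UNIV F"
    unfolding F_def using L
    by (intro lipschitz_on_add[OF lip] lipschitz_onI) (auto simp: dist_real_def right_diff_distrib[symmetric] abs_mult)
  moreover have "y - x \<le> F y - F x" if "x < y" for x y
    using d[of y x] that by (auto simp: F_def algebra_simps abs_if split: if_splits)
  ultimately have "AE x in lborel. F differentiable at x" by (rule bilipschitz_differentiable_AE)
  then show ?thesis
  proof eventually_elim
    case (elim x)
    then have "(\<lambda>x. F x - (L+1) * x) differentiable at x" by (intro derivative_intros) auto
    then show ?case by (simp add: F_def)
  qed
qed

text \<open>Translating along \<open>v\<close> does not change the measure of \<open>N\<close>, so by Fubini that measure is an average
  over parallel lines; no choice of coordinates adapted to \<open>v\<close> is needed.\<close>

lemma AE_lborel_lines: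
  fixes v :: "'a::euclidean_space"
  assumes N: "N \<in> sets borel" and lines: "\<And>x. AE t::real in lborel. x + t *\<^sub>R v \<notin> N"
  shows "AE x in lborel. x \<notin> N"
proof -
  have [measurable]: "N \<in> sets borel" by fact
  have "(\<integral>\<^sup>+t. \<integral>\<^sup>+x. indicator N (x + t *\<^sub>R v) \<partial>lborel \<partial>(lborel :: real measure))
     = (\<integral>\<^sup>+x. \<integral>\<^sup>+t. indicator N (x + t *\<^sub>R v) \<partial>lborel \<partial>lborel)"
    by (rule lborel_pair.Fubini') measurable
  also have "\<dots> = (\<integral>\<^sup>+x. 0 \<partial>(lborel :: 'a measure))"
  proof (rule nn_integral_cong)
    fix x
    show "(\<integral>\<^sup>+t. indicator N (x + t *\<^sub>R v) \<partial>(lborel :: real measure)) = 0"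
      using lines[of x] by (subst nn_integral_0_iff_AE) (auto elim!: eventually_mono)
  qed
  finally have 0: "(\<integral>\<^sup>+t. \<integral>\<^sup>+x. indicator N (x + t *\<^sub>R v) \<partial>lborel \<partial>(lborel :: real measure)) = 0" by simp
  have "(\<integral>\<^sup>+x. indicator N (x + t *\<^sub>R v) \<partial>lborel) = emeasure lborel N" for t
  proof -
    have "emeasure lborel N = (\<integral>\<^sup>+x. indicator N x \<partial>distr lborel borel ((+) (t *\<^sub>R v)))"
      by (simp add: lborel_distr_plus)
    also have "\<dots> = (\<integral>\<^sup>+x. indicator N (x + t *\<^sub>R v) \<partial>lborel)"
      by (subst nn_integral_distr) (auto simp: add.commute)
    finally show ?thesis by simp
  qed
  with 0 have "emeasure lborel N = 0" by simp
  then show ?thesis by (intro AE_not_in) (simp add: null_sets_def)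
qed

section \<open>Directional derivatives and their additivity\<close>

text \<open>Here the increment \<open>t\<close> is fixed and nonzero while \<open>x\<close> varies,
  so the quotient is continuous in \<open>x\<close> and each inner set is open.\<close>

lemma frequently_quotient_borel:
  fixes f :: "'a::euclidean_space \<Rightarrow> real"
  assumes cont: "continuous_on UNIV f"
  shows "{x. \<exists>\<^sub>F t in at 0. (f (x + t *\<^sub>R v) - f x) / t < p} \<in> sets borel"
proof -
  define G where "G = (\<lambda>n::nat. \<Union>t\<in>{t. t \<noteq> 0 \<and> \<bar>t\<bar> < inverse (Suc n)}. {x. (f (x + t *\<^sub>R v) - f x) / t < p})"
  have "open (G n)" for n
    unfolding G_def
    by (intro open_UN ballI open_Collect_less continuous_intros continuous_on_compose2[OF cont]) auto
  moreover have "{x. \<exists>\<^sub>F t in at 0. (f (x + t *\<^sub>R v) - f x) / t < p} = (\<Inter>n. G n)"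
  proof (intro set_eqI iffI)
    fix x assume x: "x \<in> {x. \<exists>\<^sub>F t in at 0. (f (x + t *\<^sub>R v) - f x) / t < p}"
    show "x \<in> (\<Inter>n. G n)"
    proof
      fix n
      have "\<forall>\<^sub>F t in at (0::real). t \<noteq> 0 \<and> \<bar>t\<bar> < inverse (Suc n)"
        unfolding eventually_at by (rule exI[of _ "inverse (Suc n)"]) auto
      from frequently_eventually_frequently[OF _ this] x
      obtain t where "(f (x + t *\<^sub>R v) - f x) / t < p" "t \<noteq> 0" "\<bar>t\<bar> < inverse (Suc n)"
        using frequently_ex by blast
      then show "x \<in> G n" by (auto simp: G_def)
    qed
  next
    fix x assume x: "x \<in> (\<Inter>n. G n)"
    have "\<exists>t. t \<noteq> 0 \<and> dist t 0 < e \<and> (f (x + t *\<^sub>R v) - f x) / t < p" if e: "e > 0" for e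
    proof -
      obtain n where n: "inverse (real (Suc n)) < e" using reals_Archimedean[OF e] by blast
      have "x \<in> G n" using x by blast
      then show ?thesis using n unfolding G_def by force
    qed
    then show "x \<in> {x. \<exists>\<^sub>F t in at 0. (f (x + t *\<^sub>R v) - f x) / t < p}"
      unfolding mem_Collect_eq frequently_def eventually_at by (metis UNIV_I)
  qed
  ultimately show ?thesis by auto
qed

lemma lipschitz_quotient_bound:
  fixes f :: "'a::euclidean_space \<Rightarrow> real"
  assumes "L-lipschitz_on UNIV f"
  shows "\<bar>(f (x + t *\<^sub>R v) - f x) / t\<bar> \<le> L * norm v"
proof (cases "t = 0")
  case True
  then show ?thesis using lipschitz_on_nonneg[OF assms] by simp
next
  case False
  have "\<bar>f (x + t *\<^sub>R v) - f x\<bar> \<le> L * (\<bar>t\<bar> * norm v)"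
    using lipschitz_onD[OF assms, of "x + t *\<^sub>R v" x] by (simp add: dist_norm)
  then show ?thesis using False by (simp add: abs_divide divide_simps mult.commute mult.left_commute)
qed

text \<open>Along every line the one-variable theorem applies, so each Borel set
  \<open>B p r\<close> of oscillating quotients meets the line in a null set; the criterion by
  parallel lines then makes \<open>B p r\<close> null in the whole space.\<close>

lemma lipschitz_directional_derivative_AE:
  fixes f :: "'a::euclidean_space \<Rightarrow> real"
  assumes lip: "L-lipschitz_on UNIV f"
  shows "AE x in lborel. \<exists>D. ((\<lambda>t. (f (x + t *\<^sub>R v) - f x) / t) \<longlongrightarrow> D) (at 0)"
proof -
  have cont: "continuous_on UNIV f" using lip by (rule lipschitz_on_continuous_on)
  have L: "L \<ge> 0" using lip by (rule lipschitz_on_nonneg)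
  define q where "q = (\<lambda>x t. (f (x + t *\<^sub>R v) - f x) / t)"
  define B where "B = (\<lambda>p r. {x. (\<exists>\<^sub>F t in at 0. q x t < p)} \<inter> {x. (\<exists>\<^sub>F t in at 0. r < q x t)})"
  have Bq: "{x. (\<exists>\<^sub>F t in at 0. r < q x t)} = {x. (\<exists>\<^sub>F t in at 0. ((\<lambda>y. - f y) (x + t *\<^sub>R v) - (\<lambda>y. - f y) x) / t < - r)}" for r
  proof -
    have "(- f (x + t *\<^sub>R v) - - f x) / t = - q x t" for x t
      unfolding q_def by (simp only: minus_divide_left) simp
    then show ?thesis by (simp only: neg_less_iff_less)
  qed
  have Bm: "B p r \<in> sets borel" for p r
    unfolding B_def Bq using frequently_quotient_borel[OF cont, of v p] frequently_quotient_borel[of "\<lambda>y. - f y" v "-r"] cont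
    by (intro sets.Int) (auto simp: q_def intro: continuous_intros)
  have lineAE: "AE t in lborel. x + t *\<^sub>R v \<notin> B p r" if "p < r" for x p r
  proof -
    define h where "h = (\<lambda>t. f (x + t *\<^sub>R v))"
    have "(L * norm v)-lipschitz_on UNIV h"
    proof (rule lipschitz_onI)
      fix s t
      have "dist (h s) (h t) \<le> L * norm ((x + s *\<^sub>R v) - (x + t *\<^sub>R v))"
        using lipschitz_onD[OF lip, of "x + s *\<^sub>R v" "x + t *\<^sub>R v"] by (simp add: h_def dist_norm)
      also have "(x + s *\<^sub>R v) - (x + t *\<^sub>R v) = (s - t) *\<^sub>R v" by (simp add: algebra_simps)
      finally show "dist (h s) (h t) \<le> L * norm v * dist s t" by (simp add: dist_norm ac_simps)
    qed (use L in auto)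
    then have "AE t in lborel. h differentiable (at t)" by (rule lipschitz_differentiable_AE_real)
    then show ?thesis
    proof eventually_elim
      case (elim t)
      then obtain D where "(h has_real_derivative D) (at t)" using real_differentiable_def by blast
      then have "((\<lambda>s. (h (t + s) - h t) / s) \<longlongrightarrow> D) (at 0)" by (simp add: DERIV_def)
      then have lim: "(q (x + t *\<^sub>R v) \<longlongrightarrow> D) (at 0)" by (simp add: h_def q_def algebra_simps)
      show ?case
      proof
        assume "x + t *\<^sub>R v \<in> B p r"
        then have fr: "\<exists>\<^sub>F s in at 0. q (x + t *\<^sub>R v) s < p" "\<exists>\<^sub>F s in at 0. r < q (x + t *\<^sub>R v) s"
          by (auto simp: B_def)
        show False
        proof (cases "D < r")
          case True
          then have "\<forall>\<^sub>F s in at 0. q (x + t *\<^sub>R v) s < r" using lim by (rule order_tendstoD(2)[rotated])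
          then have "\<forall>\<^sub>F s in at 0. \<not> r < q (x + t *\<^sub>R v) s" by eventually_elim auto
          then show False using fr by (simp add: frequently_def)
        next
          case False
          then have "p < D" using that by simp
          then have "\<forall>\<^sub>F s in at 0. p < q (x + t *\<^sub>R v) s" using lim by (rule order_tendstoD(1)[rotated])
          then have "\<forall>\<^sub>F s in at 0. \<not> q (x + t *\<^sub>R v) s < p" by eventually_elim auto
          then show False using fr by (simp add: frequently_def)
        qed
      qed
    qed
  qed
  have "AE x in lborel. \<forall>pr\<in>{(p,r). p \<in> \<rat> \<and> r \<in> \<rat> \<and> p < r}. x \<notin> B (fst pr) (snd pr)"
  proof (subst AE_ball_countable)
    show "countable {(p::real,r). p \<in> \<rat> \<and> r \<in> \<rat> \<and> p < r}"
      by (rule countable_subset[of _ "\<rat> \<times> \<rat>"]) (auto simp: countable_rat)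
  qed (auto intro!: AE_lborel_lines[OF Bm] lineAE)
  then show ?thesis
  proof eventually_elim
    case (elim x)
    have "\<bar>q x t\<bar> \<le> L * norm v" for t
      unfolding q_def using lip by (rule lipschitz_quotient_bound)
    then have "\<exists>l. (q x \<longlongrightarrow> l) (at 0)"
      by (rule convergent_slope[rotated]) (use elim in \<open>auto simp: B_def\<close>)
    then show ?case by (simp add: q_def)
  qed
qed

text \<open>The measure with density \<open>1 + h / c\<close> gives every box its volume, hence is
  Lebesgue measure, and densities are unique up to null sets. The constant
  \<open>c = \<bar>C\<bar> + 1\<close> keeps this density nonnegative and the divisor
  nonzero.\<close>

lemma AE_zero_if_box_integrals_zero:
  fixes h :: "'a::euclidean_space \<Rightarrow> real"
  assumes [measurable]: "h \<in> borel_measurable borel" and bd: "\<And>x. \<bar>h x\<bar> \<le> C"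
    and int0: "\<And>l u. (LINT x|lborel. indicator (box l u) x * h x) = 0"
  shows "AE x in lborel. h x = 0"
proof -
  define c where "c = \<bar>C\<bar> + 1"
  have c: "c > 0" "\<And>x. \<bar>h x\<bar> \<le> c" using bd by (auto simp: c_def) (metis abs_ge_self add_increasing2 order_trans zero_le_one)
  define M where "M = density lborel (\<lambda>x. ennreal (1 + h x / c))"
  have nn: "0 \<le> 1 + h x / c" for x using c(2)[of x] c(1) by (auto simp: field_simps abs_le_iff)
  have "lborel = M"
  proof (rule lborel_eqI)
    fix l u :: 'a assume le: "\<And>b. b \<in> Basis \<Longrightarrow> l \<bullet> b \<le> u \<bullet> b"
    have fin: "emeasure lborel (box l u) < \<infinity>" by (simp add: emeasure_lborel_box_eq)
    have i1: "integrable lborel (\<lambda>x. indicator (box l u) x :: real)"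
      using fin by (intro integrable_real_indicator) auto
    have i2: "integrable lborel (\<lambda>x. indicator (box l u) x * h x)"
      by (rule Bochner_Integration.integrable_bound[OF integrable_mult_right[OF i1, of c]])
         (use c in \<open>auto simp: indicator_def\<close>)
    have "emeasure M (box l u) = (\<integral>\<^sup>+x. ennreal (indicator (box l u) x * (1 + h x / c)) \<partial>lborel)"
      unfolding M_def by (subst emeasure_density) (auto intro!: nn_integral_cong simp: indicator_def)
    also have "\<dots> = ennreal (LINT x|lborel. indicator (box l u) x * (1 + h x / c))"
    proof (rule nn_integral_eq_integral)
      have "integrable lborel (\<lambda>x. indicator (box l u) x + (indicator (box l u) x * h x) / c)"
        using i1 i2 by (intro Bochner_Integration.integrable_add integrable_divide)
      then show "integrable lborel (\<lambda>x. indicator (box l u) x * (1 + h x / c))" by (simp add: algebra_simps)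
    qed (use nn in \<open>auto simp: indicator_def\<close>)
    also have "(LINT x|lborel. indicator (box l u) x * (1 + h x / c))
        = (LINT x|lborel. indicator (box l u) x + (indicator (box l u) x * h x) / c)"
      by (simp add: algebra_simps)
    also have "\<dots> = measure lborel (box l u)"
      using i1 i2 int0 by (subst Bochner_Integration.integral_add) auto
    finally have "emeasure M (box l u) = emeasure lborel (box l u)"
      using fin by (simp add: emeasure_eq_ennreal_measure less_top)
    then show "emeasure M (box l u) = (\<Prod>b\<in>Basis. (u - l) \<bullet> b)"
      using le by (simp add: emeasure_lborel_box)
  qed (simp add: M_def)
  then have "density lborel (\<lambda>x. 1) = density lborel (\<lambda>x::'a. ennreal (1 + h x / c))"
    unfolding M_def by (simp add: density_1)
  then have "AE x in lborel. 1 = ennreal (1 + h x / c)"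
    by (subst (asm) sigma_finite_measure.density_unique_iff[OF sigma_finite_lborel]) auto
  then show ?thesis
  proof eventually_elim
    case (elim x)
    then have "1 + h x / c = 1" using nn[of x] by (metis ennreal_1 ennreal_inj zero_le_one)
    then show ?case using c by simp
  qed
qed

text \<open>The limit runs only over the increments \<open>1 / (n + 1)\<close>: this makes the
  function Borel at once, and it equals the directional derivative wherever that exists.\<close>

definition dirderiv :: "('a::euclidean_space \<Rightarrow> real) \<Rightarrow> 'a \<Rightarrow> 'a \<Rightarrow> real" where
  "dirderiv f v x = lim (\<lambda>n. (f (x + inverse (real (Suc n)) *\<^sub>R v) - f x) / inverse (real (Suc n)))"

lemma dirderivI:
  assumes "((\<lambda>t. (f (x + t *\<^sub>R v) - f x) / t) \<longlongrightarrow> D) (at 0)"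
  shows "(\<lambda>n. (f (x + inverse (real (Suc n)) *\<^sub>R v) - f x) / inverse (real (Suc n))) \<longlonglongrightarrow> D" "dirderiv f v x = D"
proof -
  have "filterlim (\<lambda>n. inverse (real (Suc n))) (at 0) sequentially"
    unfolding filterlim_at using LIMSEQ_inverse_real_of_nat by auto
  from filterlim_compose[OF assms this]
  show 1: "(\<lambda>n. (f (x + inverse (real (Suc n)) *\<^sub>R v) - f x) / inverse (real (Suc n))) \<longlonglongrightarrow> D" .
  show "dirderiv f v x = D" unfolding dirderiv_def by (rule limI[OF 1])
qed

lemma dirderiv_borel:
  fixes f :: "'a::euclidean_space \<Rightarrow> real"
  assumes [measurable]: "f \<in> borel_measurable borel"
  shows "dirderiv f v \<in> borel_measurable borel"
  unfolding dirderiv_def by (rule borel_measurable_lim_metric) measurable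

lemma integral_lborel_translate:
  fixes h :: "'a::euclidean_space \<Rightarrow> real"
  shows "(LINT x|lborel. h (x + c)) = (LINT x|lborel. h x)"
proof (cases "h \<in> borel_measurable borel")
  case True
  have "(LINT x|lborel. h x) = (LINT x|distr lborel borel ((+) c). h x)" by (simp add: lborel_distr_plus)
  also have "\<dots> = (LINT x|lborel. h (x + c))"
    by (subst integral_distr) (use True in \<open>auto simp: add.commute\<close>)
  finally show ?thesis by simp
next
  case False
  have "\<not> (\<lambda>x. h (x + c)) \<in> borel_measurable borel"
  proof
    assume "(\<lambda>x. h (x + c)) \<in> borel_measurable borel"
    then have "(\<lambda>x. h (x - c + c)) \<in> borel_measurable borel"
      by (rule measurable_compose[rotated]) auto
    with False show False by simp
  qed
  then have "\<not> integrable lborel (\<lambda>x. h (x + c))"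
    using borel_measurable_integrable[of lborel "\<lambda>x. h (x + c)"] by auto
  moreover have "\<not> integrable lborel h"
    using False borel_measurable_integrable[of lborel h] by auto
  ultimately show ?thesis by (simp add: not_integrable_integral_eq)
qed

text \<open>Both sides have the same integral over every box: after a translation of the integration variable
  the difference quotients in direction \<open>v + w\<close> split, and dominated convergence applies.\<close>

lemma dirderiv_add_AE:
  fixes f :: "'a::euclidean_space \<Rightarrow> real"
  assumes lip: "L-lipschitz_on UNIV f"
  shows "AE x in lborel. dirderiv f (v + w) x = dirderiv f v x + dirderiv f w x"
proof -
  have cont: "continuous_on UNIV f" using lip by (rule lipschitz_on_continuous_on)
  have [measurable]: "f \<in> borel_measurable borel" by (rule borel_measurable_continuous_onI[OF cont])
  have L: "L \<ge> 0" using lip by (rule lipschitz_on_nonneg)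
  note dirderiv_borel[measurable]
  define \<delta> where "\<delta> = (\<lambda>n. inverse (real (Suc n)))"
  have d0: "\<delta> \<longlonglongrightarrow> 0" unfolding \<delta>_def by (rule LIMSEQ_inverse_real_of_nat)
  have dpos: "0 < \<delta> n" "\<delta> n \<le> 1" for n by (auto simp: \<delta>_def field_simps)
  define q where "q = (\<lambda>v n x. (f (x + \<delta> n *\<^sub>R v) - f x) / \<delta> n)"
  have [measurable]: "q v n \<in> borel_measurable borel" for v n unfolding q_def by measurable
  have qb: "\<bar>q v n x\<bar> \<le> L * norm v" for v n x
    unfolding q_def by (rule lipschitz_quotient_bound[OF lip])
  have qlim: "AE x in lborel. (\<lambda>n. q v n x) \<longlonglongrightarrow> dirderiv f v x" for v
    using lipschitz_directional_derivative_AE[OF lip, of v]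
    by eventually_elim (use dirderivI in \<open>force simp: q_def \<delta>_def\<close>)
  have db: "AE x in lborel. \<bar>dirderiv f v x\<bar> \<le> L * norm v" for v
    using qlim[of v]
    by eventually_elim (rule LIMSEQ_le_const2[OF tendsto_rabs], assumption, use qb in auto)
  \<comment> \<open>Where the limit fails to exist \<open>dirderiv\<close> has an unknown value;
    truncation gives a bound valid everywhere, as the box criterion demands, and changes nothing
    almost everywhere.\<close>
  define clip where "clip = (\<lambda>v x. max (- (L * norm v)) (min (L * norm v) (dirderiv f v x)))"
  have [measurable]: "clip v \<in> borel_measurable borel" for v unfolding clip_def by measurable
  have clipb: "\<bar>clip v x\<bar> \<le> L * norm v" for v x
  proof -
    have "0 \<le> L * norm v" using L by simp
    then show ?thesis unfolding clip_def by linarith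
  qed
  have clipAE: "AE x in lborel. clip v x = dirderiv f v x" for v
    using db[of v] by eventually_elim (auto simp: clip_def)
  define h where "h = (\<lambda>x. clip (v + w) x - (clip v x + clip w x))"
  have "AE x in lborel. h x = 0"
  proof (rule AE_zero_if_box_integrals_zero)
    show "h \<in> borel_measurable borel" unfolding h_def by measurable
    show "\<bar>h x\<bar> \<le> L * norm (v + w) + L * norm v + L * norm w" for x
      using clipb[of "v+w" x] clipb[of v x] clipb[of w x] unfolding h_def by linarith
    fix l u :: 'a
    define B where "B = box l u"
    define b where "b = (indicator B :: 'a \<Rightarrow> real)"
    have [measurable]: "B \<in> sets borel" "b \<in> borel_measurable borel" by (auto simp: B_def b_def)
    obtain R where R: "B \<subseteq> ball 0 R" "R > 0"
      using bounded_box[of l u] bounded_subset_ballD[of B 0] by (auto simp: B_def)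
    \<comment> \<open>The ball of radius \<open>R'\<close> contains all translates of the box by
      \<open>t *\<^sub>R v\<close> with \<open>t\<close> between 0 and 1, so one dominating function
      serves all \<open>n\<close>.\<close>
    define R' where "R' = R + norm v"
    define D where "D = (indicator (cball 0 R') :: 'a \<Rightarrow> real)"
    have iD: "integrable lborel D"
      unfolding D_def by (intro integrable_real_indicator) (use emeasure_lborel_cball_finite[of 0 R'] in \<open>auto simp: infinity_ennreal_def\<close>)
    have b_le: "b (x - t *\<^sub>R v) \<le> D x" if "0 \<le> t" "t \<le> 1" for x t
    proof (cases "x - t *\<^sub>R v \<in> B")
      case True
      then have "norm (x - t *\<^sub>R v) < R" using R by auto
      moreover have "norm x \<le> norm (x - t *\<^sub>R v) + norm (t *\<^sub>R v)" using norm_triangle_sub by (metis add.commute)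
      moreover have "norm (t *\<^sub>R v) \<le> norm v" using that by (simp add: mult_left_le_one_le)
      ultimately show ?thesis using True by (simp add: b_def D_def R'_def)
    qed (simp add: b_def D_def)
    have bn: "0 \<le> b x" "b x \<le> D x" for x using b_le[of 0 x] by (auto simp: b_def)
    have Dn: "0 \<le> D x" for x by (simp add: D_def)
    have lim1: "(\<lambda>n. LINT x|lborel. b (x - \<delta> n *\<^sub>R w') * q z n x) \<longlonglongrightarrow> (LINT x|lborel. b x * clip z x)"
      if w': "w' = 0 \<or> w' = v" for z w'
    proof (rule integral_dominated_convergence[where w = "\<lambda>x. D x * (L * norm z)"])
      \<comment> \<open>Away from the null frontier the indicator of the shifted box is eventually
        constant.\<close>
      have "AE x in lborel. x \<notin> frontier B"
        using negligible_convex_frontier[of B]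
        by (intro AE_not_in) (auto simp: B_def negligible_iff_null_sets null_sets_completion_iff)
      then show "AE x in lborel. (\<lambda>n. b (x - \<delta> n *\<^sub>R w') * q z n x) \<longlonglongrightarrow> b x * clip z x"
        using qlim[of z] clipAE[of z]
      proof eventually_elim
        case (elim x)
        have xl: "(\<lambda>n. x - \<delta> n *\<^sub>R w') \<longlonglongrightarrow> x"
          using tendsto_diff[OF tendsto_const tendsto_scaleR[OF d0 tendsto_const], of x w'] by simp
        have "\<forall>\<^sub>F n in sequentially. b (x - \<delta> n *\<^sub>R w') = b x"
        proof (cases "x \<in> B")
          case True
          have "\<forall>\<^sub>F n in sequentially. x - \<delta> n *\<^sub>R w' \<in> B"
            by (rule topological_tendstoD[OF xl]) (use True in \<open>auto simp: B_def\<close>)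
          then show ?thesis by eventually_elim (use True in \<open>simp add: b_def\<close>)
        next
          case False
          then have "x \<in> - closure B" using elim closure_Un_frontier[of B] by auto
          then have "\<forall>\<^sub>F n in sequentially. x - \<delta> n *\<^sub>R w' \<in> - closure B"
            by (intro topological_tendstoD[OF xl]) auto
          then show ?thesis
            by eventually_elim (use False closure_subset[of B] in \<open>auto simp: b_def indicator_def\<close>)
        qed
        then have "(\<lambda>n. b (x - \<delta> n *\<^sub>R w')) \<longlonglongrightarrow> b x" by (rule tendsto_eventually)
        then show ?case using elim by (intro tendsto_mult) auto
      qed
      show "AE x in lborel. norm (b (x - \<delta> n *\<^sub>R w') * q z n x) \<le> D x * (L * norm z)" for n
      proof (intro AE_I2)
        fix x
        have "b (x - \<delta> n *\<^sub>R w') \<le> D x"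
          using w' b_le[of "\<delta> n" x] dpos[of n] bn(2)[of x] by auto
        then show "norm (b (x - \<delta> n *\<^sub>R w') * q z n x) \<le> D x * (L * norm z)"
          using qb[of z n x] bn(1) Dn by (auto simp: abs_mult intro!: mult_mono)
      qed
      show "integrable lborel (\<lambda>x. D x * (L * norm z))" using iD by simp
    qed measurable
    have int: "integrable lborel (\<lambda>x. b (x - \<delta> n *\<^sub>R w') * q z n (x + c))" if "w' = 0 \<or> w' = v" for n w' z c
    proof (rule Bochner_Integration.integrable_bound[of _ "\<lambda>x. D x * (L * norm z)"])
      show "AE x in lborel. norm (b (x - \<delta> n *\<^sub>R w') * q z n (x + c)) \<le> norm (D x * (L * norm z))"
      proof (intro AE_I2)
        fix x
        have "b (x - \<delta> n *\<^sub>R w') \<le> D x"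
          using that b_le[of "\<delta> n" x] dpos[of n] bn(2)[of x] by auto
        then show "norm (b (x - \<delta> n *\<^sub>R w') * q z n (x + c)) \<le> norm (D x * (L * norm z))"
          using qb[of z n "x + c"] bn(1)[of "x - \<delta> n *\<^sub>R w'"] L by (auto simp: abs_mult intro!: mult_mono)
      qed
    qed (use iD in simp, measurable)
    \<comment> \<open>The quotient in direction \<open>v + w\<close> is the
      \<open>w\<close>-quotient at the shifted point plus the \<open>v\<close>-quotient; translation
      invariance moves the shift onto the indicator of the box.\<close>
    have split: "(LINT x|lborel. b x * q (v + w) n x)
        = (LINT x|lborel. b (x - \<delta> n *\<^sub>R v) * q w n x) + (LINT x|lborel. b x * q v n x)" for n
    proof -
      have "q (v + w) n x = q w n (x + \<delta> n *\<^sub>R v) + q v n x" for x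
        by (simp add: q_def add_divide_distrib[symmetric] algebra_simps)
      then have "(LINT x|lborel. b x * q (v + w) n x)
        = (LINT x|lborel. b x * q w n (x + \<delta> n *\<^sub>R v) + b x * q v n x)" by (simp add: algebra_simps)
      also have "\<dots> = (LINT x|lborel. b x * q w n (x + \<delta> n *\<^sub>R v)) + (LINT x|lborel. b x * q v n x)"
        using int[of 0 n w "\<delta> n *\<^sub>R v"] int[of 0 n v 0] by (intro Bochner_Integration.integral_add) auto
      also have "(LINT x|lborel. b x * q w n (x + \<delta> n *\<^sub>R v)) = (LINT x|lborel. b (x - \<delta> n *\<^sub>R v) * q w n x)"
        using integral_lborel_translate[of "\<lambda>x. b (x - \<delta> n *\<^sub>R v) * q w n x" "\<delta> n *\<^sub>R v"] by simp
      finally show ?thesis .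
    qed
    have "(\<lambda>n. LINT x|lborel. b x * q (v + w) n x) \<longlonglongrightarrow> (LINT x|lborel. b x * clip w x) + (LINT x|lborel. b x * clip v x)"
      unfolding split using lim1[of v w] lim1[of 0 v] by (intro tendsto_add) auto
    moreover have "(\<lambda>n. LINT x|lborel. b x * q (v + w) n x) \<longlonglongrightarrow> (LINT x|lborel. b x * clip (v + w) x)"
      using lim1[of 0 "v + w"] by simp
    ultimately have eq: "(LINT x|lborel. b x * clip (v + w) x) = (LINT x|lborel. b x * clip w x) + (LINT x|lborel. b x * clip v x)"
      using LIMSEQ_unique by blast
    have ic: "integrable lborel (\<lambda>x. b x * clip z x)" for z
      by (rule Bochner_Integration.integrable_bound[of _ "\<lambda>x. D x * (L * norm z)"])
         (use iD bn clipb[of z] L Dn in \<open>auto simp: abs_mult abs_of_nonneg[OF Dn] intro!: mult_mono AE_I2\<close>)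
    have "(LINT x|lborel. b x * h x) = (LINT x|lborel. b x * clip (v + w) x - (b x * clip v x + b x * clip w x))"
      by (simp add: h_def algebra_simps)
    also have "\<dots> = 0" using eq ic by simp
    finally show "(LINT x|lborel. indicator (box l u) x * h x) = 0" by (simp add: b_def B_def)
  qed
  then show ?thesis using clipAE[of v] clipAE[of w] clipAE[of "v + w"]
    by eventually_elim (auto simp: h_def)
qed

lemma dirderiv_scaleR:
  fixes f :: "'a::real_vector \<Rightarrow> real"
  assumes "((\<lambda>t. (f (x + t *\<^sub>R v) - f x) / t) \<longlongrightarrow> D) (at 0)"
  shows "((\<lambda>t. (f (x + t *\<^sub>R (c *\<^sub>R v)) - f x) / t) \<longlongrightarrow> c * D) (at 0)"
proof (cases "c = 0")
  case False
  have "filterlim (\<lambda>t. t * c) (at 0) (at 0)"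
    unfolding filterlim_at using False
    by (auto simp: eventually_at intro!: exI[of _ 1] tendsto_eq_intros)
  from tendsto_mult[OF tendsto_const filterlim_compose[OF assms this], of c]
  moreover have "c * ((f (x + (t * c) *\<^sub>R v) - f x) / (t * c)) = (f (x + t *\<^sub>R (c *\<^sub>R v)) - f x) / t" for t
    using False by (cases "t = 0") (simp_all add: scaleR_scaleR)
  ultimately show ?thesis by (simp only:)
qed simp

section \<open>The full derivative and its behaviour on level sets\<close>

text \<open>Almost everywhere the directional derivatives exist and agree with a linear form
  simultaneously for a countable dense set of directions. Compactness of the unit sphere makes
  finitely many of these directions enough for a given accuracy, and the Lipschitz bound covers all
  others.\<close>

theorem rademacher:
  fixes f :: "'a::euclidean_space \<Rightarrow> real"
  assumes lip: "L-lipschitz_on UNIV f"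
  obtains G where "G \<in> borel_measurable borel" "AE x in lborel. (f has_derivative (\<lambda>h. G x \<bullet> h)) (at x)"
proof -
  have cont: "continuous_on UNIV f" using lip by (rule lipschitz_on_continuous_on)
  have [measurable]: "f \<in> borel_measurable borel" by (rule borel_measurable_continuous_onI[OF cont])
  have L: "L \<ge> 0" using lip by (rule lipschitz_on_nonneg)
  define G where "G = (\<lambda>x. \<Sum>b\<in>Basis. dirderiv f b x *\<^sub>R b)"
  have Gm: "G \<in> borel_measurable borel"
    unfolding G_def using dirderiv_borel[of f] by measurable
  define Q where "Q = {v::'a. \<forall>b\<in>Basis. v \<bullet> b \<in> \<rat>}"
  have Qc: "countable Q"
  proof -
    have "Q \<subseteq> (\<lambda>r. \<Sum>b\<in>Basis. r b *\<^sub>R b) ` (Pi\<^sub>E Basis (\<lambda>_. \<rat>))"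
    proof
      fix v assume v: "v \<in> Q"
      have "v = (\<Sum>b\<in>Basis. restrict (\<lambda>b. v \<bullet> b) Basis b *\<^sub>R b)"
        by (simp add: euclidean_representation)
      then show "v \<in> (\<lambda>r. \<Sum>b\<in>Basis. r b *\<^sub>R b) ` (Pi\<^sub>E Basis (\<lambda>_. \<rat>))"
        using v by (intro image_eqI[of _ _ "restrict (\<lambda>b. v \<bullet> b) Basis"]) (auto simp: Q_def)
    qed
    moreover have "countable ((\<lambda>r. \<Sum>b\<in>Basis. r b *\<^sub>R b :: 'a) ` (Pi\<^sub>E Basis (\<lambda>_. \<rat>)))"
      by (intro countable_image countable_PiE) (auto simp: countable_rat)
    ultimately show ?thesis using countable_subset by blast
  qed
  have Qd: "closure Q = UNIV"
  proof -
    have "(\<Union>f \<in> Basis \<rightarrow> \<rat>. { \<Sum>i :: 'a \<in> Basis. f i *\<^sub>R i }) \<subseteq> Q"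
      by (auto simp: Q_def inner_sum_left inner_Basis if_distrib cong: if_cong)
    from closure_mono[OF this] show ?thesis using closure_rational_coordinates by blast
  qed
  have conv: "AE x in lborel. ((\<lambda>t. (f (x + t *\<^sub>R v) - f x) / t) \<longlongrightarrow> dirderiv f v x) (at 0)" for v
    using lipschitz_directional_derivative_AE[OF lip, of v]
    by eventually_elim (metis dirderivI(2))
  have lin: "AE x in lborel. dirderiv f (\<Sum>b\<in>A. r b *\<^sub>R b) x = (\<Sum>b\<in>A. r b * dirderiv f b x)"
    if "finite A" for A and r :: "'a \<Rightarrow> real"
    using that
  proof (induction A)
    case empty
    show ?case by (auto simp: dirderiv_def)
  next
    case (insert a A)
    show ?case
      using insert.IH dirderiv_add_AE[OF lip, of "r a *\<^sub>R a" "\<Sum>b\<in>A. r b *\<^sub>R b"] conv[of a]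
    proof eventually_elim
      case (elim x)
      have "dirderiv f (r a *\<^sub>R a) x = r a * dirderiv f a x"
        by (rule dirderivI(2)[OF dirderiv_scaleR[OF elim(3)]])
      then show ?case using elim insert.hyps by simp
    qed
  qed
  \<comment> \<open>The exceptional null set depends on \<open>v\<close>; therefore only the
    countably many directions in \<open>Q\<close> are used at one point.\<close>
  have GQ: "AE x in lborel. dirderiv f v x = G x \<bullet> v" for v
    using lin[OF finite_Basis, of "\<lambda>b. v \<bullet> b"]
    unfolding euclidean_representation
    by eventually_elim (simp add: G_def inner_sum_left, simp add: inner_commute mult.commute)
  have "AE x in lborel. \<forall>v\<in>Q. ((\<lambda>t. (f (x + t *\<^sub>R v) - f x) / t) \<longlongrightarrow> G x \<bullet> v) (at 0)"
    unfolding AE_ball_countable[OF Qc]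
  proof
    show "AE x in lborel. ((\<lambda>t. (f (x + t *\<^sub>R v) - f x) / t) \<longlongrightarrow> G x \<bullet> v) (at 0)" for v
      using conv[of v] GQ[of v] by eventually_elim simp
  qed
  then have "AE x in lborel. (f has_derivative (\<lambda>h. G x \<bullet> h)) (at x)"
  proof eventually_elim
    case (elim x)
    show ?case
      unfolding has_derivative_at_alt
    proof (intro conjI allI impI)
      show "bounded_linear (\<lambda>h. G x \<bullet> h)" by (rule bounded_linear_inner_right)
      fix e :: real assume e: "e > 0"
      \<comment> \<open>Three errors, \<open>\<eta> * t\<close>, \<open>L * (t * \<eta>)\<close> and
        \<open>norm (G x) * (t * \<eta>)\<close>, must add up to \<open>e * t\<close>.\<close>
      define \<eta> where "\<eta> = e / (1 + L + norm (G x))"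
      have pos: "1 + L + norm (G x) > 0" using L norm_ge_zero[of "G x"] by linarith
      have \<eta>: "\<eta> > 0" "\<eta> * (1 + L + norm (G x)) = e" using e pos by (auto simp: \<eta>_def)
      have "sphere 0 1 \<subseteq> (\<Union>v\<in>Q. ball v \<eta>)"
      proof
        fix u :: 'a
        have "u \<in> closure Q" by (simp add: Qd)
        then obtain v where "v \<in> Q" "dist v u < \<eta>" using \<eta>(1) unfolding closure_approachable by blast
        then show "u \<in> (\<Union>v\<in>Q. ball v \<eta>)" by auto
      qed
      then obtain S where S: "S \<subseteq> Q" "finite S" "sphere 0 1 \<subseteq> (\<Union>v\<in>S. ball v \<eta>)"
        using compactE_image[of "sphere (0::'a) 1" Q "\<lambda>v. ball v \<eta>"] by auto
      have "\<forall>\<^sub>F t in at 0. \<forall>v\<in>S. dist ((f (x + t *\<^sub>R v) - f x) / t) (G x \<bullet> v) < \<eta>"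
        using S elim \<eta>(1) by (intro eventually_ball_finite) (auto dest: tendstoD)
      then obtain d where d: "d > 0" "\<And>t v. t \<noteq> 0 \<Longrightarrow> \<bar>t\<bar> < d \<Longrightarrow> v \<in> S \<Longrightarrow> \<bar>(f (x + t *\<^sub>R v) - f x) / t - G x \<bullet> v\<bar> < \<eta>"
        unfolding eventually_at by (auto simp: dist_real_def)
      show "\<exists>d>0. \<forall>y. norm (y - x) < d \<longrightarrow> norm (f y - f x - G x \<bullet> (y - x)) \<le> e * norm (y - x)"
      proof (intro exI[of _ d] conjI allI impI d(1))
        fix y assume y: "norm (y - x) < d"
        show "norm (f y - f x - G x \<bullet> (y - x)) \<le> e * norm (y - x)"
        proof (cases "y = x")
          case False
          define t where "t = norm (y - x)"
          define u where "u = (1/t) *\<^sub>R (y - x)"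
          have t: "t > 0" "t < d" using False y by (auto simp: t_def)
          have yx: "y - x = t *\<^sub>R u" using t by (simp add: u_def)
          have "norm u = 1" using t by (simp add: u_def t_def)
          then obtain v where v: "v \<in> S" "norm (v - u) < \<eta>" using S(3) by (force simp: dist_norm)
          have 1: "\<bar>f (x + t *\<^sub>R v) - f x - t * (G x \<bullet> v)\<bar> \<le> \<eta> * t"
          proof -
            have "f (x + t *\<^sub>R v) - f x - t * (G x \<bullet> v) = t * ((f (x + t *\<^sub>R v) - f x) / t - G x \<bullet> v)"
              using t by (simp add: field_simps)
            then show ?thesis using d(2)[of t v] t v by (simp add: abs_mult)
          qed
          have 2: "\<bar>f y - f (x + t *\<^sub>R v)\<bar> \<le> L * (t * \<eta>)"
          proof -
            have "dist y (x + t *\<^sub>R v) = t * norm (u - v)"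
            proof -
              have "y - (x + t *\<^sub>R v) = t *\<^sub>R (u - v)" using yx by (simp add: algebra_simps)
              then show ?thesis using t by (simp add: dist_norm)
            qed
            also have "\<dots> \<le> t * \<eta>" using v t by (simp add: norm_minus_commute)
            finally show ?thesis
              using lipschitz_onD[OF lip, of y "x + t *\<^sub>R v"] L by (simp add: dist_real_def) (meson mult_left_mono order_trans)
          qed
          have 3: "\<bar>t * (G x \<bullet> v) - G x \<bullet> (y - x)\<bar> \<le> norm (G x) * (t * \<eta>)"
          proof -
            have "t * (G x \<bullet> v) - G x \<bullet> (y - x) = t * (G x \<bullet> (v - u))"
              unfolding yx by (simp add: inner_diff_right algebra_simps)
            also have "\<bar>\<dots>\<bar> \<le> t * (norm (G x) * norm (v - u))"
              using t Cauchy_Schwarz_ineq2[of "G x" "v - u"] by (simp add: abs_mult)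
            also have "\<dots> \<le> t * (norm (G x) * \<eta>)" using t v by (intro mult_left_mono) auto
            finally show ?thesis by (simp add: algebra_simps)
          qed
          have "\<bar>f y - f x - G x \<bullet> (y - x)\<bar> \<le> \<eta> * t + L * (t * \<eta>) + norm (G x) * (t * \<eta>)"
            using 1 2 3 by linarith
          also have "\<dots> = (\<eta> * (1 + L + norm (G x))) * t" by (simp add: algebra_simps)
          also have "\<dots> = e * t" unfolding \<eta>(2) ..
          finally show ?thesis by (simp add: t_def)
        qed simp
      qed
    qed
  qed
  then show thesis using that Gm by blast
qed

section \<open>Integration along rays\<close>

text \<open>By the Lindelof property countably many of the isolating balls cover \<open>T\<close>,
  and each of them contains a single point of \<open>T\<close>.\<close>

lemma isolated_imp_countable:
  fixes T :: "'a::{metric_space, second_countable_topology} set"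
  assumes "\<And>t. t \<in> T \<Longrightarrow> \<exists>e>0. \<forall>s\<in>T. dist s t < e \<longrightarrow> s = t"
  shows "countable T"
proof -
  obtain e where e: "\<And>t. t \<in> T \<Longrightarrow> e t > 0" "\<And>t s. t \<in> T \<Longrightarrow> s \<in> T \<Longrightarrow> dist s t < e t \<Longrightarrow> s = t"
    using assms by metis
  obtain F where F: "F \<subseteq> (\<lambda>t. ball t (e t)) ` T" "countable F" "\<Union>F = \<Union>((\<lambda>t. ball t (e t)) ` T)"
    by (rule Lindelof[of "(\<lambda>t. ball t (e t)) ` T"]) auto
  have "countable (S \<inter> T)" if "S \<in> F" for S
  proof -
    obtain t where t: "t \<in> T" "S = ball t (e t)" using F(1) \<open>S \<in> F\<close> by auto
    have "S \<inter> T \<subseteq> {t}" using e(2)[OF t(1)] t by (auto simp: dist_commute)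
    then show ?thesis by (rule countable_subset) simp
  qed
  then have "countable (\<Union>S\<in>F. S \<inter> T)" using F(2) by blast
  moreover have "T \<subseteq> (\<Union>S\<in>F. S \<inter> T)"
  proof
    fix t assume t: "t \<in> T"
    then have "t \<in> \<Union>F" unfolding F(3) using e(1)[OF t] by force
    then show "t \<in> (\<Union>S\<in>F. S \<inter> T)" using t by auto
  qed
  ultimately show ?thesis by (rule countable_subset[rotated])
qed

text \<open>A point of a level set is either isolated in it along a given line, which happens only for
  countably many points of that line, or admits difference quotients arbitrarily close to 0.\<close>

lemma lipschitz_level_set_AE:
  fixes f :: "'a::euclidean_space \<Rightarrow> real"
  assumes lip: "L-lipschitz_on UNIV f"
  shows "AE x in lborel. f x = c \<longrightarrow> (\<forall>D. (f has_derivative D) (at x) \<longrightarrow> D = (\<lambda>_. 0))"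
proof -
  have key: "AE x in lborel. f x = c \<longrightarrow> (\<exists>\<^sub>F t in at 0. (f (x + t *\<^sub>R b) - f x) / t < p)"
    if lip: "L-lipschitz_on UNIV f" and p: "p > 0" for f :: "'a \<Rightarrow> real" and b p c
  proof -
    have cont: "continuous_on UNIV f" using lip by (rule lipschitz_on_continuous_on)
    have [measurable]: "f \<in> borel_measurable borel" by (rule borel_measurable_continuous_onI[OF cont])
    define N where "N = {x. f x = c} - {x. \<exists>\<^sub>F t in at 0. (f (x + t *\<^sub>R b) - f x) / t < p}"
    have N: "N \<in> sets borel"
      unfolding N_def
    proof (rule sets.Diff)
      show "{x. f x = c} \<in> sets borel" using measurable_sets[of f borel borel "{c}"] by (simp add: vimage_def)
    qed (rule frequently_quotient_borel[OF cont])
    have "AE x in lborel. x \<notin> N"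
    proof (rule AE_lborel_lines[OF N])
      fix x
      define T where "T = {t. x + t *\<^sub>R b \<in> N}"
      have "countable T"
      proof (rule isolated_imp_countable)
        show "\<exists>e>0. \<forall>s\<in>T. dist s t < e \<longrightarrow> s = t" if t: "t \<in> T" for t
        proof -
          have "\<forall>\<^sub>F s in at 0. \<not> (f (x + t *\<^sub>R b + s *\<^sub>R b) - f (x + t *\<^sub>R b)) / s < p" and ft: "f (x + t *\<^sub>R b) = c"
            using t by (auto simp: T_def N_def not_frequently)
          then obtain e where e: "e > 0"
            "\<And>s. s \<noteq> 0 \<Longrightarrow> \<bar>s\<bar> < e \<Longrightarrow> \<not> (f (x + t *\<^sub>R b + s *\<^sub>R b) - f (x + t *\<^sub>R b)) / s < p"
            unfolding eventually_at by (auto simp: dist_real_def)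
          have "s = t" if "s \<in> T" "dist s t < e" for s
          proof (rule ccontr)
            assume "s \<noteq> t"
            have eq: "x + t *\<^sub>R b + (s - t) *\<^sub>R b = x + s *\<^sub>R b" by (simp add: algebra_simps)
            have "f (x + s *\<^sub>R b) = c" using that by (auto simp: T_def N_def)
            then show False using e(2)[of "s - t"] that \<open>s \<noteq> t\<close> ft p unfolding eq by (simp add: dist_real_def)
          qed
          then show ?thesis using e(1) by blast
        qed
      qed
      then have "AE t in lborel. t \<notin> T" by (intro AE_not_in countable_imp_null_set_lborel)
      then show "AE t in lborel. x + t *\<^sub>R b \<notin> N" by (simp add: T_def)
    qed
    then show ?thesis by eventually_elim (auto simp: N_def)
  qed
  have lip': "L-lipschitz_on UNIV (\<lambda>x. - f x)"
    using lip by (simp add: lipschitz_on_def dist_minus)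
  define p where "p = (\<lambda>n::nat. inverse (real (Suc n)))"
  have p: "p n > 0" for n by (simp add: p_def)
  \<comment> \<open>Thresholds tending to 0 exclude a positive derivative along a basis vector; the
    version for \<open>- f\<close> excludes a negative one.\<close>
  have "AE x in lborel. \<forall>b\<in>Basis. \<forall>n. (f x = c \<longrightarrow> (\<exists>\<^sub>F t in at 0. (f (x + t *\<^sub>R b) - f x) / t < p n)) \<and>
      (- f x = - c \<longrightarrow> (\<exists>\<^sub>F t in at 0. (- f (x + t *\<^sub>R b) - - f x) / t < p n))"
    using key[OF lip p] key[OF lip' p, of "-c"]
    by (intro AE_finite_allI AE_ball_countable' AE_conjI) (auto simp: AE_all_countable)
  then show ?thesis
  proof eventually_elim
    case (elim x)
    show ?case
    proof (intro impI allI ext)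
      fix D h assume fx: "f x = c" and D: "(f has_derivative D) (at x)"
      have blD: "bounded_linear D" using D by (rule has_derivative_bounded_linear)
      then interpret D: bounded_linear D .
      have "D b = 0" if b: "b \<in> Basis" for b
      proof -
        have "((\<lambda>t. x + t *\<^sub>R b) has_derivative (\<lambda>t. t *\<^sub>R b)) (at 0)" by (auto intro!: derivative_eq_intros)
        from diff_chain_at[OF this, of f D] D
        have "((\<lambda>t. f (x + t *\<^sub>R b)) has_derivative (\<lambda>t. D (t *\<^sub>R b))) (at 0)" by (simp add: o_def)
        then have "((\<lambda>t. f (x + t *\<^sub>R b)) has_real_derivative D b) (at 0)"
          by (simp add: has_field_derivative_def D.scaleR mult_commute_abs)
        then have lim: "((\<lambda>t. (f (x + t *\<^sub>R b) - f x) / t) \<longlongrightarrow> D b) (at 0)"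
          by (simp add: DERIV_def)
        have no: False if h: "\<forall>n. \<exists>\<^sub>F t in at 0. q t < p n" "(q \<longlongrightarrow> d) (at 0)" "d > 0" for q :: "real \<Rightarrow> real" and d
        proof -
          obtain n where "p n < d" using reals_Archimedean[OF h(3)] by (auto simp: p_def)
          then have "\<forall>\<^sub>F t in at 0. p n < q t" using h(2) by (rule order_tendstoD(1)[rotated])
          then have "\<forall>\<^sub>F t in at 0. \<not> q t < p n" by eventually_elim auto
          then show False using h(1) by (auto simp: frequently_def)
        qed
        have "\<not> D b > 0" using no[OF _ lim] elim b fx by auto
        moreover have "\<not> - D b > 0"
        proof
          assume neg: "- D b > 0"
          have "((\<lambda>t. (- f (x + t *\<^sub>R b) - - f x) / t) \<longlongrightarrow> - D b) (at 0)"
            using tendsto_minus[OF lim] by (simp only: minus_divide_left) simp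
          from no[OF _ this neg] elim b fx show False by auto
        qed
        ultimately show ?thesis by linarith
      qed
      then have "(\<Sum>b\<in>Basis. (h \<bullet> b) * D b) = 0" by simp
      moreover have "D h = (\<Sum>b\<in>Basis. (h \<bullet> b) * D b)"
        using linear_sum[OF D.linear, of "\<lambda>b. (h \<bullet> b) *\<^sub>R b" Basis]
        by (simp add: euclidean_representation D.scaleR)
      ultimately show "D h = 0" by simp
    qed
  qed
qed

text \<open>The difference quotients are bounded by \<open>L\<close>, so dominated convergence
  passes from their integrals to the integral of the derivative, while the integrals themselves
  converge to \<open>k b - k a\<close> by continuity of \<open>k\<close>.\<close>

lemma lipschitz_FTC:
  fixes k g :: "real \<Rightarrow> real"
  assumes lip: "L-lipschitz_on UNIV k" and [measurable]: "g \<in> borel_measurable borel"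
    and deriv: "AE s in lborel. a < s \<and> s < b \<longrightarrow> (k has_real_derivative g s) (at s)" and ab: "a \<le> b"
  shows "(LINT s|lborel. indicator {a..b} s * g s) = k b - k a"
proof -
  have cont: "continuous_on UNIV k" using lip by (rule lipschitz_on_continuous_on)
  have [measurable]: "k \<in> borel_measurable borel" by (rule borel_measurable_continuous_onI[OF cont])
  define \<delta> where "\<delta> = (\<lambda>n. inverse (real (Suc n)))"
  have dpos: "0 < \<delta> n" for n by (auto simp: \<delta>_def)
  have d0: "filterlim \<delta> (at_right 0) sequentially"
    unfolding filterlim_at \<delta>_def using LIMSEQ_inverse_real_of_nat by auto
  define q where "q = (\<lambda>n s. (k (s + \<delta> n) - k s) / \<delta> n)"
  have 1: "(\<lambda>n. LINT s|lborel. indicator {a..b} s * q n s) \<longlonglongrightarrow> (LINT s|lborel. indicator {a..b} s * g s)"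
  proof (rule integral_dominated_convergence[where w = "\<lambda>s. indicator {a..b} s * L"])
    show "AE s in lborel. (\<lambda>n. indicator {a..b} s * q n s) \<longlonglongrightarrow> indicator {a..b} s * g s"
      using deriv AE_lborel_singleton[of a] AE_lborel_singleton[of b]
    proof eventually_elim
      case (elim s)
      show ?case
      proof (cases "s \<in> {a..b}")
        case False then show ?thesis by simp
      next
        case True
      with elim have "(k has_real_derivative g s) (at s)" by auto
      then have "((\<lambda>h. (k (s + h) - k s) / h) \<longlongrightarrow> g s) (at 0)" by (simp add: DERIV_def)
      then have "((\<lambda>h. (k (s + h) - k s) / h) \<longlongrightarrow> g s) (at_right 0)" using filterlim_at_split by blast
      from filterlim_compose[OF this d0] show ?thesis unfolding q_def by (intro tendsto_intros)
      qed
    qed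
    show "AE s in lborel. norm (indicator {a..b} s * q n s) \<le> indicator {a..b} s * L" for n
      using lipschitz_quotient_bound[OF lip, of _ "\<delta> n" 1]
      by (intro AE_I2) (auto simp: q_def indicator_def)
    show "integrable lborel (\<lambda>s. indicator {a..b} s * L)"
      by (intro integrable_mult_left integrable_real_indicator) (auto simp: ab)
  qed (unfold q_def, measurable)
  \<comment> \<open>A primitive of \<open>k\<close> turns the integral of a quotient into the
    difference of two averages of \<open>k\<close>, taken just to the right of \<open>b\<close> and
    of \<open>a\<close>.\<close>
  obtain K where K: "\<And>t. (K has_real_derivative k t) (at t)"
    using einterval_antiderivative[of "-\<infinity>" \<infinity> k] cont by (auto simp: continuous_on_eq_continuous_at has_real_derivative_iff_has_vector_derivative)
  have Kint: "(LINT s|lborel. indicator {c..d} s * k s) = K d - K c" "integrable lborel (\<lambda>s. indicator {c..d} s * k s)" if "c \<le> d" for c d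
    using integral_FTC_Icc_real[OF that, of K k] borel_integrable_atLeastAtMost'[OF continuous_on_subset[OF cont]] K cont
    by (auto simp: set_integrable_def continuous_on_eq_continuous_at mult.commute[of "indicator _ _"])
  have 2: "(LINT s|lborel. indicator {a..b} s * q n s) = (K (b + \<delta> n) - K b) / \<delta> n - (K (a + \<delta> n) - K a) / \<delta> n" for n
  proof -
    have "(LINT s|lborel. indicator {a..b} s * k (s + \<delta> n)) = (LINT s|lborel. indicator {a + \<delta> n..b + \<delta> n} s * k s)"
      using integral_lborel_translate[of "\<lambda>s. indicator {a + \<delta> n..b + \<delta> n} s * k s" "\<delta> n"]
      by (simp add: indicator_def)
    also have "\<dots> = K (b + \<delta> n) - K (a + \<delta> n)" using Kint(1)[of "a + \<delta> n" "b + \<delta> n"] ab by simp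
    finally have s1: "(LINT s|lborel. indicator {a..b} s * k (s + \<delta> n)) = K (b + \<delta> n) - K (a + \<delta> n)" .
    have i1: "integrable lborel (\<lambda>s. indicator {a..b} s * k (s + \<delta> n))"
    proof -
      have "continuous_on {a..b} (\<lambda>s. k (s + \<delta> n))"
        by (rule continuous_on_compose2[OF cont]) (auto intro!: continuous_intros)
      from borel_integrable_atLeastAtMost'[OF this] show ?thesis by (simp add: set_integrable_def)
    qed
    have "(LINT s|lborel. indicator {a..b} s * q n s)
       = (LINT s|lborel. (indicator {a..b} s * k (s + \<delta> n) - indicator {a..b} s * k s) / \<delta> n)"
      by (simp add: q_def algebra_simps diff_divide_distrib)
    also have "\<dots> = (K (b + \<delta> n) - K (a + \<delta> n) - (K b - K a)) / \<delta> n"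
      using Kint[OF ab] i1 s1 by simp
    finally show ?thesis by (simp add: diff_divide_distrib)
  qed
  have lim: "(\<lambda>n. (K (c + \<delta> n) - K c) / \<delta> n) \<longlonglongrightarrow> k c" for c
  proof -
    have "((\<lambda>h. (K (c + h) - K c) / h) \<longlongrightarrow> k c) (at_right 0)"
      using K[of c] filterlim_at_split by (auto simp: DERIV_def)
    from filterlim_compose[OF this d0] show ?thesis .
  qed
  have "(\<lambda>n. LINT s|lborel. indicator {a..b} s * q n s) \<longlonglongrightarrow> k b - k a"
    unfolding 2 by (intro tendsto_diff lim)
  then show ?thesis using 1 LIMSEQ_unique by blast
qed

lemma nn_integral_lborel_scaleR:
  fixes \<psi> :: "'a::euclidean_space \<Rightarrow> ennreal"
  assumes [measurable]: "\<psi> \<in> borel_measurable borel" and t: "t > 0"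
  shows "(\<integral>\<^sup>+x. \<psi> x \<partial>lborel) = ennreal (t ^ DIM('a)) * (\<integral>\<^sup>+x. \<psi> (t *\<^sub>R x) \<partial>lborel)"
  by (subst lborel_affine[of t 0]) (use t in \<open>auto simp: nn_integral_density nn_integral_distr nn_integral_cmult\<close>)

text \<open>For each fixed \<open>s > 0\<close> the set of \<open>x\<close> with
  \<open>s *\<^sub>R x\<close> in \<open>N\<close> is null by scaling; exchanging the order of
  integration gives the statement along rays.\<close>

lemma AE_lborel_rays:
  fixes N :: "'a::euclidean_space set"
  assumes N: "N \<in> sets borel" "AE x in lborel. x \<notin> N"
  shows "AE x in lborel. AE s::real in lborel. s > 0 \<longrightarrow> s *\<^sub>R x \<notin> N"
proof -
  have [measurable]: "N \<in> sets borel" by fact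
  have "(\<integral>\<^sup>+x. \<integral>\<^sup>+s. indicator {0<..} s * indicator N (s *\<^sub>R x) \<partial>(lborel::real measure) \<partial>lborel)
     = (\<integral>\<^sup>+s. \<integral>\<^sup>+x. indicator {0<..} s * indicator N (s *\<^sub>R x) \<partial>lborel \<partial>(lborel::real measure))"
    by (rule lborel_pair.Fubini'[symmetric]) measurable
  also have "\<dots> = (\<integral>\<^sup>+s. 0 \<partial>(lborel::real measure))"
  proof (rule nn_integral_cong)
    fix s :: real
    show "(\<integral>\<^sup>+x. indicator {0<..} s * indicator N (s *\<^sub>R x) \<partial>lborel) = 0"
    proof (cases "s > 0")
      case True
      have "emeasure lborel N = 0" using N AE_iff_measurable[of N lborel "\<lambda>x. x \<notin> N"] by auto
      then have "(\<integral>\<^sup>+x. indicator N x \<partial>lborel) = 0" by simp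
      then have "(\<integral>\<^sup>+x. indicator N (s *\<^sub>R x) \<partial>lborel) = 0"
        using nn_integral_lborel_scaleR[OF _ True, of "indicator N"] True by simp
      then show ?thesis using True by simp
    qed simp
  qed
  finally have "(\<integral>\<^sup>+x. \<integral>\<^sup>+s. indicator {0<..} s * indicator N (s *\<^sub>R x) \<partial>(lborel::real measure) \<partial>lborel) = 0" by simp
  then have "AE x in lborel. (\<integral>\<^sup>+s. indicator {0<..} s * indicator N (s *\<^sub>R x) \<partial>(lborel::real measure)) = 0"
    by (subst (asm) nn_integral_0_iff_AE) measurable
  then show ?thesis
  proof eventually_elim
    case (elim x)
    then have "AE s in lborel. indicator {0<..} s * (indicator N (s *\<^sub>R x) :: ennreal) = 0"
      by (subst (asm) nn_integral_0_iff_AE) measurable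
    then show ?case by eventually_elim (auto simp: indicator_def split: if_splits)
  qed
qed

text \<open>Source of the weight in the polar formula: integrating \<open>n / s^(n+1)\<close> over
  all \<open>s > norm y\<close> yields exactly the inverse of the factor
  \<open>norm y ^ n\<close>.\<close>

lemma nn_integral_power_tail:
  fixes r :: real
  assumes r: "r > 0" and n: "n > 0"
  shows "(\<integral>\<^sup>+s. ennreal (real n * inverse (s ^ Suc n)) * indicator {r<..} s \<partial>lborel) = ennreal (inverse (r ^ n))"
proof -
  have "(\<integral>\<^sup>+s. ennreal (real n * inverse (s ^ Suc n)) * indicator {r<..} s \<partial>lborel)
     = (\<integral>\<^sup>+s. ennreal (real n * inverse (s ^ Suc n)) * indicator {r..} s \<partial>lborel)"
    by (intro nn_integral_cong_AE, use AE_lborel_singleton[of r] in eventually_elim) (auto simp: indicator_def)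
  also have "\<dots> = ennreal (0 - (- inverse (r ^ n)))"
  proof (rule nn_integral_FTC_atLeast)
    show "((\<lambda>s. - inverse (s ^ n)) has_real_derivative real n * inverse (s ^ Suc n)) (at s)" if "r \<le> s" for s
    proof -
      have "s > 0" using that r by simp
      moreover have "s ^ n = s * s ^ (n - 1)" using n by (cases n) auto
      ultimately show ?thesis
        by (auto intro!: derivative_eq_intros simp: field_simps power2_eq_square)
    qed
    have "filterlim (\<lambda>s::real. s ^ n) at_top at_top" using n by (intro filterlim_pow_at_top filterlim_ident)
    then have "((\<lambda>s::real. inverse (s ^ n)) \<longlongrightarrow> 0) at_top" by (rule tendsto_inverse_0_at_top)
    from tendsto_minus[OF this] show "((\<lambda>s::real. - inverse (s ^ n)) \<longlongrightarrow> 0) at_top" by simp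
    show "(\<lambda>s. real n * inverse (s ^ Suc n)) \<in> borel_measurable borel" by measurable
    show "0 \<le> real n * inverse (s ^ Suc n)" if "r \<le> s" for s using that r by auto
  qed
  finally show ?thesis by simp
qed

text \<open>The unit ball, through the directions of its points, replaces the unit sphere, so no surface measure
  occurs.\<close>

lemma nn_integral_polar:
  fixes \<psi> :: "'a::euclidean_space \<Rightarrow> ennreal"
  assumes [measurable]: "\<psi> \<in> borel_measurable borel"
  defines "n \<equiv> DIM('a)"
  shows "(\<integral>\<^sup>+x. \<psi> x \<partial>lborel) = (\<integral>\<^sup>+x. \<integral>\<^sup>+s. \<psi> (s *\<^sub>R x) *
     ennreal (indicator (ball 0 1) x * indicator {0<..} s * (real n * s ^ (n - 1) * norm x ^ n)) \<partial>lborel \<partial>lborel)"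
proof -
  have n: "n > 0" by (simp add: n_def)
  have [measurable]: "ball (0::'a) 1 \<in> sets borel" by simp
  have "(\<integral>\<^sup>+x. \<integral>\<^sup>+s. \<psi> (s *\<^sub>R x) * ennreal (indicator (ball 0 1) x * indicator {0<..} s * (real n * s ^ (n - 1) * norm x ^ n)) \<partial>(lborel::real measure) \<partial>lborel)
    = (\<integral>\<^sup>+s. \<integral>\<^sup>+x. \<psi> (s *\<^sub>R x) * ennreal (indicator (ball 0 1) x * indicator {0<..} s * (real n * s ^ (n - 1) * norm x ^ n)) \<partial>lborel \<partial>(lborel::real measure))"
    by (rule lborel_pair.Fubini'[symmetric]) measurable
  \<comment> \<open>The substitution \<open>y = s *\<^sub>R x\<close> at fixed \<open>s\<close>
    turns the unit ball into \<open>norm y < s\<close>; together with the Jacobian the weight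
    becomes \<open>n * norm y ^ n / s^(n+1)\<close>.\<close>
  also have "\<dots> = (\<integral>\<^sup>+s. \<integral>\<^sup>+y. \<psi> y * ennreal (norm y ^ n) * (ennreal (real n * inverse (s ^ Suc n)) * (if norm y < s then 1 else 0)) \<partial>lborel \<partial>(lborel::real measure))"
  proof (rule nn_integral_cong)
    fix s :: real
    show "(\<integral>\<^sup>+x. \<psi> (s *\<^sub>R x) * ennreal (indicator (ball 0 1) x * indicator {0<..} s * (real n * s ^ (n - 1) * norm x ^ n)) \<partial>lborel)
       = (\<integral>\<^sup>+y. \<psi> y * ennreal (norm y ^ n) * (ennreal (real n * inverse (s ^ Suc n)) * (if norm y < s then 1 else 0)) \<partial>lborel)"
    proof (cases "s > 0")
      case True
      have sn: "s ^ n = s * s ^ (n - 1)" using n by (cases n) auto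
      have "(\<integral>\<^sup>+y. \<psi> y * ennreal (norm y ^ n) * (ennreal (real n * inverse (s ^ Suc n)) * (if norm y < s then 1 else 0)) \<partial>lborel)
        = ennreal (s ^ n) * (\<integral>\<^sup>+x. \<psi> (s *\<^sub>R x) * ennreal (norm (s *\<^sub>R x) ^ n) * (ennreal (real n * inverse (s ^ Suc n)) * (if norm (s *\<^sub>R x) < s then 1 else 0)) \<partial>lborel)"
        unfolding n_def by (rule nn_integral_lborel_scaleR[OF _ True]) measurable
      also have "\<dots> = (\<integral>\<^sup>+x. ennreal (s ^ n) * (\<psi> (s *\<^sub>R x) * ennreal (norm (s *\<^sub>R x) ^ n) * (ennreal (real n * inverse (s ^ Suc n)) * (if norm (s *\<^sub>R x) < s then 1 else 0))) \<partial>lborel)"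
        by (rule nn_integral_cmult[symmetric]) measurable
      also have "\<dots> = (\<integral>\<^sup>+x. \<psi> (s *\<^sub>R x) * ennreal (indicator (ball 0 1) x * indicator {0<..} s * (real n * s ^ (n - 1) * norm x ^ n)) \<partial>lborel)"
      proof (rule nn_integral_cong)
        fix x :: 'a
        show "ennreal (s ^ n) * (\<psi> (s *\<^sub>R x) * ennreal (norm (s *\<^sub>R x) ^ n) * (ennreal (real n * inverse (s ^ Suc n)) * (if norm (s *\<^sub>R x) < s then 1 else 0)))
          = \<psi> (s *\<^sub>R x) * ennreal (indicator (ball 0 1) x * indicator {0<..} s * (real n * s ^ (n - 1) * norm x ^ n))"
        proof (cases "norm x < 1")
          case nx: True
          then have "norm (s *\<^sub>R x) < s" using True by simp
          moreover have "s ^ n * (norm (s *\<^sub>R x) ^ n * (real n * inverse (s ^ Suc n))) = real n * s ^ (n - 1) * norm x ^ n"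
            using True by (simp add: power_mult_distrib sn field_simps)
          then have "ennreal (s ^ n) * (ennreal (norm (s *\<^sub>R x) ^ n) * ennreal (real n * inverse (s ^ Suc n))) = ennreal (real n * s ^ (n - 1) * norm x ^ n)"
            using True by (simp add: ennreal_mult[symmetric] del: norm_scaleR power_Suc)
          ultimately show ?thesis using nx True
            by (simp add: mult.assoc mult.left_commute[of "ennreal (s ^ n)"] del: norm_scaleR power_Suc)
        next
          case False
          then have "\<not> norm (s *\<^sub>R x) < s" using True by simp
          then show ?thesis using False by simp
        qed
      qed
      finally show ?thesis by simp
    next
      case False
      have "\<not> norm y < s" for y :: 'a
        using False norm_ge_zero[of y] by linarith
      then show ?thesis using False by simp
    qed
  qed
  also have "\<dots> = (\<integral>\<^sup>+y. \<integral>\<^sup>+s. \<psi> y * ennreal (norm y ^ n) * (ennreal (real n * inverse (s ^ Suc n)) * (if norm y < s then 1 else 0)) \<partial>(lborel::real measure) \<partial>lborel)"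
    by (rule lborel_pair.Fubini') measurable
  also have "\<dots> = (\<integral>\<^sup>+y. \<psi> y \<partial>lborel)"
  proof (rule nn_integral_cong_AE, use AE_lborel_singleton[of 0] in eventually_elim)
    fix y :: 'a assume y: "y \<noteq> 0"
    have "(\<integral>\<^sup>+s. \<psi> y * ennreal (norm y ^ n) * (ennreal (real n * inverse (s ^ Suc n)) * (if norm y < s then 1 else 0)) \<partial>lborel)
      = \<psi> y * ennreal (norm y ^ n) * (\<integral>\<^sup>+s. ennreal (real n * inverse (s ^ Suc n)) * (if norm y < s then 1 else 0) \<partial>lborel)"
      by (rule nn_integral_cmult) measurable
    also have "\<dots> = \<psi> y * ennreal (norm y ^ n) * ennreal (inverse (norm y ^ n))"
    proof -
      have "norm y > 0" using y by simp
      from nn_integral_power_tail[OF this n, unfolded indicator_def of_bool_def greaterThan_iff]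
      show ?thesis by (simp only:)
    qed
    also have "\<dots> = \<psi> y * ennreal (norm y ^ n * inverse (norm y ^ n))"
      by (subst ennreal_mult) (auto simp: mult.assoc)
    finally show "(\<integral>\<^sup>+s. \<psi> y * ennreal (norm y ^ n) * (ennreal (real n * inverse (s ^ Suc n)) * (if norm y < s then 1 else 0)) \<partial>lborel) = \<psi> y"
      using y by simp
  qed
  finally show ?thesis by simp
qed

lemma integral_polar:
  fixes \<psi> :: "'a::euclidean_space \<Rightarrow> real"
  assumes int: "integrable lborel \<psi>"
  defines "n \<equiv> DIM('a)"
  shows "(LINT x|lborel. \<psi> x) = (LINT x|lborel. LINT s|lborel. \<psi> (s *\<^sub>R x) *
     (indicator (ball 0 1) x * indicator {0<..} s * (real n * s ^ (n - 1) * norm x ^ n)))"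
proof -
  have [measurable]: "\<psi> \<in> borel_measurable borel" using int by auto
  have [measurable]: "ball (0::'a) 1 \<in> sets borel" by simp
  define k where "k = (\<lambda>(x::'a,s::real). indicator (ball 0 1) x * indicator {0<..} s * (real n * s ^ (n - 1) * norm x ^ n) :: real)"
  have k0: "0 \<le> k z" for z by (auto simp: k_def indicator_def split: prod.split)
  have [measurable]: "k \<in> borel_measurable (lborel \<Otimes>\<^sub>M lborel)" unfolding k_def by measurable
  define \<Psi> where "\<Psi> = (\<lambda>z. \<psi> (snd z *\<^sub>R fst z) * k z)"
  have [measurable]: "\<Psi> \<in> borel_measurable (lborel \<Otimes>\<^sub>M lborel)" unfolding \<Psi>_def by measurable
  \<comment> \<open>Applied with \<open>abs\<close> for integrability and with the positive and
    negative parts for the value.\<close>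
  have polar: "(\<integral>\<^sup>+z. ennreal (g (\<psi> (snd z *\<^sub>R fst z)) * k z) \<partial>(lborel \<Otimes>\<^sub>M lborel)) = (\<integral>\<^sup>+x. ennreal (g (\<psi> x)) \<partial>lborel)"
    if [measurable]: "g \<in> borel_measurable borel" for g :: "real \<Rightarrow> real"
  proof -
    have [measurable]: "(\<lambda>z. g (\<psi> (snd z *\<^sub>R fst z)) * k z) \<in> borel_measurable (lborel \<Otimes>\<^sub>M lborel)"
      by measurable
    then have m1: "(\<lambda>z. ennreal (g (\<psi> (snd z *\<^sub>R fst z)) * k z)) \<in> borel_measurable (lborel \<Otimes>\<^sub>M lborel)"
      by (rule measurable_compose[OF _ measurable_ennreal])
    have "(\<integral>\<^sup>+z. ennreal (g (\<psi> (snd z *\<^sub>R fst z)) * k z) \<partial>(lborel \<Otimes>\<^sub>M lborel))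
      = (\<integral>\<^sup>+x. \<integral>\<^sup>+s. ennreal (g (\<psi> (s *\<^sub>R x)) * k (x,s)) \<partial>lborel \<partial>lborel)"
      using lborel.nn_integral_fst[OF m1] by simp
    also have "\<dots> = (\<integral>\<^sup>+x. ennreal (g (\<psi> x)) \<partial>lborel)"
    proof -
      have eq: "ennreal (g (\<psi> (s *\<^sub>R x)) * k (x, s)) = ennreal (g (\<psi> (s *\<^sub>R x))) *
          ennreal (indicator (ball 0 1) x * indicator {0<..} s * (real n * s ^ (n - 1) * norm x ^ n))" for x s
        using k0[of "(x,s)"] by (subst ennreal_mult'') (simp_all add: k_def)
      show ?thesis unfolding eq n_def by (rule nn_integral_polar[symmetric]) measurable
    qed
    finally show ?thesis .
  qed
  have "(\<integral>\<^sup>+z. ennreal (norm (\<Psi> z)) \<partial>(lborel \<Otimes>\<^sub>M lborel)) = (\<integral>\<^sup>+x. ennreal (norm (\<psi> x)) \<partial>lborel)"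
    using polar[of abs] k0 by (simp add: \<Psi>_def abs_mult)
  then have i\<Psi>: "integrable (lborel \<Otimes>\<^sub>M lborel) \<Psi>"
    using int by (simp add: integrable_iff_bounded)
  have "(LINT x|lborel. \<psi> x) = integral\<^sup>L (lborel \<Otimes>\<^sub>M lborel) \<Psi>"
  proof -
    have e: "ennreal (max 0 a) = ennreal a" for a :: real by (simp add: max_def ennreal_neg)
    have m: "max 0 a * k z = max 0 (a * k z)" for a z using k0[of z] by (simp add: max_def mult_le_0_iff zero_le_mult_iff)
    have "(\<integral>\<^sup>+z. ennreal (\<Psi> z) \<partial>(lborel \<Otimes>\<^sub>M lborel)) = (\<integral>\<^sup>+x. ennreal (\<psi> x) \<partial>lborel)"
      using polar[of "max 0"] unfolding m e \<Psi>_def by simp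
    moreover have "(\<integral>\<^sup>+z. ennreal (- \<Psi> z) \<partial>(lborel \<Otimes>\<^sub>M lborel)) = (\<integral>\<^sup>+x. ennreal (- \<psi> x) \<partial>lborel)"
      using polar[of "\<lambda>x. max 0 (- x)"] unfolding m e \<Psi>_def by simp
    ultimately show ?thesis
      unfolding real_lebesgue_integral_def[OF int] real_lebesgue_integral_def[OF i\<Psi>] by simp
  qed
  also have "\<dots> = (LINT x|lborel. LINT s|lborel. \<Psi> (x, s))"
    using lborel_pair.integral_fst'[OF i\<Psi>] by simp
  finally show ?thesis by (simp add: \<Psi>_def k_def)
qed

text \<open>Differentiating in the direction \<open>g\<close> itself gives
  \<open>g \<bullet> g \<le> M * norm g\<close>. The Lipschitz bound is asked only near
  \<open>x\<close>, because for hyperbolic Lipschitz functions the constant depends on the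
  point.\<close>

lemma local_gradient_bound:
  fixes f :: "'a::euclidean_space \<Rightarrow> real"
  assumes \<delta>: "\<delta> > 0" and lip: "\<And>y. y \<in> ball x \<delta> \<Longrightarrow> \<bar>f y - f x\<bar> \<le> M * norm (y - x)"
    and d: "(f has_derivative (\<lambda>h. g \<bullet> h)) (at x)"
  shows "norm g \<le> M"
proof (cases "g = 0")
  case True
  obtain b :: 'a where b: "b \<in> Basis" using nonempty_Basis by blast
  \<comment> \<open>For \<open>g = 0\<close> the claim is \<open>M \<ge> 0\<close>, which is read
    off from the hypothesis at a second point.\<close>
  have "x + (\<delta>/2) *\<^sub>R b \<in> ball x \<delta>" using \<delta> b by (simp add: dist_norm)
  from order_trans[OF abs_ge_zero lip[OF this]]
  have "0 \<le> M * norm ((x + (\<delta>/2) *\<^sub>R b) - x)" .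
  then show ?thesis using True \<delta> b by (simp add: zero_le_mult_iff)
next
  case False
  have "((\<lambda>t. x + t *\<^sub>R g) has_derivative (\<lambda>t. t *\<^sub>R g)) (at 0)" by (auto intro!: derivative_eq_intros)
  from diff_chain_at[OF this, of f "\<lambda>h. g \<bullet> h"] d
  have "((\<lambda>t. f (x + t *\<^sub>R g)) has_real_derivative (g \<bullet> g)) (at 0)"
    by (simp add: o_def has_field_derivative_def mult_commute_abs)
  then have "((\<lambda>t. (f (x + t *\<^sub>R g) - f x) / t) \<longlongrightarrow> g \<bullet> g) (at 0)"
    by (simp add: DERIV_def)
  then have "((\<lambda>t. \<bar>(f (x + t *\<^sub>R g) - f x) / t\<bar>) \<longlongrightarrow> \<bar>g \<bullet> g\<bar>) (at 0)" by (rule tendsto_rabs)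
  then have "\<bar>g \<bullet> g\<bar> \<le> M * norm g"
  proof (rule tendsto_upperbound)
    show "\<forall>\<^sub>F t in at 0. \<bar>(f (x + t *\<^sub>R g) - f x) / t\<bar> \<le> M * norm g"
      unfolding eventually_at
    proof (intro exI[of _ "\<delta> / norm g"] conjI ballI impI)
      fix t :: real assume t: "t \<noteq> 0 \<and> dist t 0 < \<delta> / norm g"
      then have "\<bar>t\<bar> * norm g < \<delta>" using False by (simp add: field_simps)
      then have "\<bar>f (x + t *\<^sub>R g) - f x\<bar> \<le> M * (\<bar>t\<bar> * norm g)" using lip[of "x + t *\<^sub>R g"] by (simp add: dist_norm)
      then show "\<bar>(f (x + t *\<^sub>R g) - f x) / t\<bar> \<le> M * norm g" using t by (simp add: abs_divide field_simps)
    qed (use \<delta> False in auto)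
  qed simp
  then show ?thesis using False by (simp add: power2_norm_eq_inner[symmetric] power2_eq_square)
qed

lemma lipschitz_gradient_bound:
  fixes f :: "'a::euclidean_space \<Rightarrow> real"
  assumes lip: "L-lipschitz_on UNIV f" and d: "(f has_derivative (\<lambda>h. g \<bullet> h)) (at x)"
  shows "norm g \<le> L"
  by (rule local_gradient_bound[OF zero_less_one _ d]) (use lipschitz_onD[OF lip] in \<open>simp add: dist_norm\<close>)

text \<open>On almost every ray the integral over \<open>1/2 < \<bar>x\<bar> < 1\<close> is that of the derivative of \<open>f\<close>, and only the value of
  \<open>f\<close> at radius 1/2 remains.\<close>

lemma radial_flux:
  fixes f h :: "'a::euclidean_space \<Rightarrow> real" and G :: "'a \<Rightarrow> 'a"
  assumes lip: "L-lipschitz_on UNIV f" and [measurable]: "G \<in> borel_measurable borel"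
    and G: "AE x in lborel. (f has_derivative (\<lambda>y. G x \<bullet> y)) (at x)"
    and supp: "\<And>x. 1 \<le> norm x \<Longrightarrow> f x = 0"
    and [measurable]: "h \<in> borel_measurable borel" and hb: "\<And>x. \<bar>h x\<bar> \<le> H"
    and hom: "\<And>x s. s > 0 \<Longrightarrow> h (s *\<^sub>R x) = h x"
  defines "n \<equiv> DIM('a)"
  defines "\<psi> \<equiv> \<lambda>x. indicator {x. 1/2 < norm x \<and> norm x < 1} x * (h x * inverse (norm x ^ n) * (G x \<bullet> x))"
  shows "integrable lborel \<psi>"
    "(LINT x|lborel. \<psi> x) = - real n * (LINT x|lborel. indicator (ball 0 1) x * (h x * f ((1 / (2 * norm x)) *\<^sub>R x)))"
proof -
  have n: "n > 0" by (simp add: n_def)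
  have L: "L \<ge> 0" using lip by (rule lipschitz_on_nonneg)
  have H: "H \<ge> 0" using hb[of 0] by simp
  have [measurable]: "{x::'a. 1/2 < norm x \<and> norm x < 1} \<in> sets borel" by measurable
  have [measurable]: "\<psi> \<in> borel_measurable borel" unfolding \<psi>_def by measurable
  have GL: "AE x in lborel. norm (G x) \<le> L"
    using G by eventually_elim (rule lipschitz_gradient_bound[OF lip])
  show int: "integrable lborel \<psi>"
  proof (rule Bochner_Integration.integrable_bound[of _ "\<lambda>x. indicator (ball 0 1) x * (H * 2 ^ n * L)"])
    show "integrable lborel (\<lambda>x. indicator (ball (0::'a) 1) x * (H * 2 ^ n * L))"
      using emeasure_lborel_ball_finite[of "0::'a" 1]
      by (intro integrable_mult_left integrable_real_indicator) auto
    show "AE x in lborel. norm (\<psi> x) \<le> norm (indicator (ball 0 1) x * (H * 2 ^ n * L))"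
      using GL
    proof eventually_elim
      case (elim x)
      show ?case
      proof (cases "1/2 < norm x \<and> norm x < 1")
        case True
        have "inverse (norm x ^ n) = inverse (norm x) ^ n" by (simp add: power_inverse)
        also have "\<dots> \<le> 2 ^ n"
        proof (rule power_mono)
          show "inverse (norm x) \<le> 2" using True le_imp_inverse_le[of "1/2" "norm x"] by simp
        qed simp
        finally have 1: "inverse (norm x ^ n) \<le> 2 ^ n" .
        have "\<bar>G x \<bullet> x\<bar> \<le> norm (G x) * norm x" by (rule Cauchy_Schwarz_ineq2)
        also have "\<dots> \<le> L * 1" using elim True L by (intro mult_mono) auto
        finally have 2: "\<bar>G x \<bullet> x\<bar> \<le> L" by simp
        have "\<bar>h x\<bar> * inverse (norm x ^ n) * \<bar>G x \<bullet> x\<bar> \<le> H * 2 ^ n * L"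
          using hb[of x] 1 2 H by (intro mult_mono) auto
        then show ?thesis using True H L by (simp add: \<psi>_def abs_mult)
      qed (simp add: \<psi>_def)
    qed
  qed measurable
  \<comment> \<open>The set of bad points need not be Borel, whereas the statement on rays concerns
    Borel null sets; hence a Borel null set containing it.\<close>
  obtain N where N: "{x. \<not> (f has_derivative (\<lambda>y. G x \<bullet> y)) (at x)} \<subseteq> N" "N \<in> null_sets lborel"
    using G by (auto elim!: AE_E simp: null_sets_def)
  have Nb: "N \<in> sets borel" "AE x in lborel. x \<notin> N" using N(2) by (auto intro: AE_not_in)
  define k where "k = (\<lambda>x s. \<psi> (s *\<^sub>R x) * (indicator (ball 0 1) x * indicator {0<..} s * (real n * s ^ (n - 1) * norm x ^ n)))"
  have [measurable]: "ball (0::'a) 1 \<in> sets borel" by simp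
  have "(LINT x|lborel. \<psi> x) = (LINT x|lborel. LINT s|lborel. k x s)"
    unfolding k_def n_def by (rule integral_polar[OF int])
  also have "\<dots> = (LINT x|lborel. indicator (ball 0 1) x * (- real n * (h x * f ((1 / (2 * norm x)) *\<^sub>R x))))"
  proof (rule integral_cong_AE)
    have [measurable]: "(\<lambda>(x, s). k x s) \<in> borel_measurable (lborel \<Otimes>\<^sub>M lborel)" unfolding k_def by measurable
    have [measurable]: "f \<in> borel_measurable borel"
      by (rule borel_measurable_continuous_onI[OF lipschitz_on_continuous_on[OF lip]])
    show "(\<lambda>x. LINT s|lborel. k x s) \<in> borel_measurable lborel" by measurable
    show "(\<lambda>x. indicator (ball 0 1) x * (- real n * (h x * f ((1 / (2 * norm x)) *\<^sub>R x)))) \<in> borel_measurable lborel"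
      by measurable
    show "AE x in lborel. (LINT s|lborel. k x s) = indicator (ball 0 1) x * (- real n * (h x * f ((1 / (2 * norm x)) *\<^sub>R x)))"
      using AE_lborel_rays[OF Nb] AE_lborel_singleton[of "0::'a"]
    proof eventually_elim
      case (elim x)
      show ?case
      proof (cases "norm x < 1")
        case False then show ?thesis by (simp add: k_def)
      next
        case True
        \<comment> \<open>The parameters at which the ray through \<open>x\<close> crosses the radii
          1/2 and 1.\<close>
        define a b where "a = 1 / (2 * norm x)" and "b = 1 / norm x"
        have nx: "norm x > 0" using elim by simp
        have ab: "a \<le> b" "a > 0" using nx by (auto simp: a_def b_def field_simps)
        \<comment> \<open>The powers of \<open>s\<close> and of \<open>norm x\<close> cancel
          completely between \<open>1 / norm (s *\<^sub>R x) ^ n\<close>, the factor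
          \<open>s\<close> from \<open>G \<bullet> (s *\<^sub>R x)\<close> and the polar weight; a
          pure derivative along the ray remains.\<close>
        have eq: "k x s = (real n * h x) * (indicator {a<..<b} s * (G (s *\<^sub>R x) \<bullet> x))" for s
        proof (cases "a < s \<and> s < b")
          case s: True
          then have s0: "s > 0" using ab by simp
          have ns: "norm (s *\<^sub>R x) = s * norm x" using s0 by simp
          have "1/2 < norm (s *\<^sub>R x) \<and> norm (s *\<^sub>R x) < 1"
            unfolding ns using s nx by (simp add: a_def b_def field_simps)
          then have ind: "indicator {x. 1/2 < norm x \<and> norm x < 1} (s *\<^sub>R x) = (1::real)" by (simp add: indicator_def del: norm_scaleR)
          have psi: "\<psi> (s *\<^sub>R x) = h x * inverse ((s * norm x) ^ n) * (s * (G (s *\<^sub>R x) \<bullet> x))"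
            unfolding \<psi>_def ind using hom[OF s0] s0 by simp
          have "s ^ n = s * s ^ (n - 1)" using n by (cases n) auto
          then show ?thesis using s s0 True nx
            by (simp add: k_def psi power_mult_distrib field_simps)
        next
          case s: False
          show ?thesis
          proof (cases "s > 0")
            case True
            then have ns: "norm (s *\<^sub>R x) = s * norm x" by simp
            have "\<not> (1/2 < norm (s *\<^sub>R x) \<and> norm (s *\<^sub>R x) < 1)"
              unfolding ns using s nx by (simp add: a_def b_def field_simps)
            then show ?thesis using s unfolding k_def \<psi>_def by (auto simp: indicator_def)
          next
            case False then show ?thesis using s by (simp add: k_def)
          qed
        qed
        have "(LINT s|lborel. k x s) = real n * h x * (LINT s|lborel. indicator {a<..<b} s * (G (s *\<^sub>R x) \<bullet> x))"
          unfolding eq by simp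
        also have "(LINT s|lborel. indicator {a<..<b} s * (G (s *\<^sub>R x) \<bullet> x)) = (LINT s|lborel. indicator {a..b} s * (G (s *\<^sub>R x) \<bullet> x))"
          by (rule integral_cong_AE, measurable, use AE_lborel_singleton[of a] AE_lborel_singleton[of b] in eventually_elim)
             (auto simp: indicator_def)
        also have "\<dots> = f (b *\<^sub>R x) - f (a *\<^sub>R x)"
        proof (rule lipschitz_FTC[OF _ _ _ ab(1), where k = "\<lambda>s. f (s *\<^sub>R x)" and L = "L * norm x"])
          show "(L * norm x)-lipschitz_on UNIV (\<lambda>s. f (s *\<^sub>R x))"
          proof (rule lipschitz_onI)
            fix s t
            show "dist (f (s *\<^sub>R x)) (f (t *\<^sub>R x)) \<le> L * norm x * dist s t"
              using lipschitz_onD[OF lip, of "s *\<^sub>R x" "t *\<^sub>R x"]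
              by (simp add: dist_norm scaleR_diff_left[symmetric] ac_simps)
          qed (use L in auto)
          show "AE s in lborel. a < s \<and> s < b \<longrightarrow> ((\<lambda>s. f (s *\<^sub>R x)) has_real_derivative G (s *\<^sub>R x) \<bullet> x) (at s)"
            using elim(1)
          proof eventually_elim
            case (elim s)
            show ?case
            proof
              assume "a < s \<and> s < b"
              then have "s *\<^sub>R x \<notin> N" using elim ab by auto
              then have d: "(f has_derivative (\<lambda>y. G (s *\<^sub>R x) \<bullet> y)) (at (s *\<^sub>R x))" using N(1) by blast
              have "((\<lambda>s. s *\<^sub>R x) has_derivative (\<lambda>t. t *\<^sub>R x)) (at s)" by (auto intro!: derivative_eq_intros)
              from diff_chain_at[OF this d]
              show "((\<lambda>s. f (s *\<^sub>R x)) has_real_derivative G (s *\<^sub>R x) \<bullet> x) (at s)"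
                by (simp add: o_def has_field_derivative_def mult_commute_abs)
            qed
          qed
        qed measurable
        also have "f (b *\<^sub>R x) = 0" using nx by (intro supp) (simp add: b_def)
        finally show ?thesis using True by (simp add: a_def)
      qed
    qed
  qed
  also have "\<dots> = (LINT x|lborel. - real n * (indicator (ball 0 1) x * (h x * f ((1 / (2 * norm x)) *\<^sub>R x))))"
    by (simp add: ac_simps)
  finally show "(LINT x|lborel. \<psi> x) = - real n * (LINT x|lborel. indicator (ball 0 1) x * (h x * f ((1 / (2 * norm x)) *\<^sub>R x)))"
    by simp
qed

text \<open>In polar form the weight is at most \<open>n * r\<close> with \<open>r = norm x\<close>,
  and \<open>r * (1 - s * r) powr (a - 1)\<close> has integral \<open>1 / a\<close> over
  \<open>0 < s < 1 / r\<close>, its primitive being continuous up to the singular end. With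
  \<open>a = \<alpha>\<close> this supplies the dominating function for the error terms.\<close>

lemma integrable_boundary_power:
  fixes a :: real
  assumes a: "0 < a" "a \<le> 1"
  shows "integrable lborel (\<lambda>x::'a::euclidean_space. indicator (ball 0 1) x * (1 - norm x) powr (a - 1))"
proof -
  define n where "n = DIM('a)"
  have n: "n > 0" by (simp add: n_def)
  have [measurable]: "ball (0::'a) 1 \<in> sets borel" by simp
  define \<psi> where "\<psi> = (\<lambda>x::'a. indicator (ball 0 1) x * (1 - norm x) powr (a - 1))"
  have \<psi>0: "\<psi> x \<ge> 0" for x by (simp add: \<psi>_def)
  have [measurable]: "\<psi> \<in> borel_measurable borel" unfolding \<psi>_def by measurable
  have ray: "(\<integral>\<^sup>+s. ennreal (indicator {0<..<1 / r} s * (r * (1 - s * r) powr (a - 1))) \<partial>lborel) = ennreal (1 / a)"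
    if r: "r > 0" for r :: real
  proof -
    have "((\<lambda>s. r * (1 - s * r) powr (a - 1)) has_integral (- ((1 - 1 / r * r) powr a / a) - (- ((1 - 0 * r) powr a / a)))) {0..1/r}"
    proof (rule fundamental_theorem_of_calculus_interior)
      show "continuous_on {0..1 / r} (\<lambda>s. - ((1 - s * r) powr a / a))"
        using a r by (intro continuous_on_minus continuous_on_divide continuous_on_powr' continuous_intros) (auto simp: field_simps)
      show "((\<lambda>s. - ((1 - s * r) powr a / a)) has_vector_derivative r * (1 - s * r) powr (a - 1)) (at s)"
        if "s \<in> {0<..<1 / r}" for s
      proof -
        have "0 < 1 - s * r" using that r by (auto simp: field_simps)
        then show ?thesis unfolding has_real_derivative_iff_has_vector_derivative[symmetric]
          using a by (auto intro!: derivative_eq_intros)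
      qed
    qed (use r in auto)
    then have I: "((\<lambda>s. r * (1 - s * r) powr (a - 1)) has_integral (1 / a)) {0..1/r}"
      using r a by simp
    have "(\<integral>\<^sup>+s. ennreal (indicator {0<..<1 / r} s * (r * (1 - s * r) powr (a - 1))) \<partial>lborel)
      = (\<integral>\<^sup>+s. ennreal (if s \<in> {0..1/r} then r * (1 - s * r) powr (a - 1) else 0) \<partial>lborel)"
      by (intro nn_integral_cong_AE, use AE_lborel_singleton[of 0] AE_lborel_singleton[of "1/r"] in eventually_elim)
         (auto simp: indicator_def)
    also have "\<dots> = ennreal (1 / a)"
      by (rule nn_integral_has_integral_lborel) (use r I in \<open>auto simp only: has_integral_restrict_UNIV, auto\<close>)
    finally show ?thesis .
  qed
  have "(\<integral>\<^sup>+x. ennreal (\<psi> x) \<partial>lborel) = (\<integral>\<^sup>+x. \<integral>\<^sup>+s. ennreal (\<psi> (s *\<^sub>R x)) *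
     ennreal (indicator (ball 0 1) x * indicator {0<..} s * (real n * s ^ (n - 1) * norm x ^ n)) \<partial>lborel \<partial>lborel)"
    unfolding n_def by (rule nn_integral_polar) measurable
  also have "\<dots> \<le> (\<integral>\<^sup>+x. ennreal (real n * (1 / a)) * indicator (ball (0::'a) 1) x \<partial>lborel)"
  proof (rule nn_integral_mono_AE, use AE_lborel_singleton[of "0::'a"] in eventually_elim)
    fix x :: 'a assume x: "x \<noteq> 0"
    show "(\<integral>\<^sup>+s. ennreal (\<psi> (s *\<^sub>R x)) * ennreal (indicator (ball 0 1) x * indicator {0<..} s * (real n * s ^ (n - 1) * norm x ^ n)) \<partial>lborel)
       \<le> ennreal (real n * (1 / a)) * indicator (ball 0 1) x"
    proof (cases "norm x < 1")
      case True
      define r where "r = norm x"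
      have r: "r > 0" "r < 1" using x True by (auto simp: r_def)
      have "ennreal (\<psi> (s *\<^sub>R x)) * ennreal (indicator (ball 0 1) x * indicator {0<..} s * (real n * s ^ (n - 1) * norm x ^ n))
        \<le> ennreal (real n) * ennreal (indicator {0<..<1 / r} s * (r * (1 - s * r) powr (a - 1)))" for s
      proof (cases "0 < s \<and> s * r < 1")
        case s: True
        have "r ^ n = r * r ^ (n - 1)" using n by (cases n) auto
        then have "real n * s ^ (n - 1) * norm x ^ n = real n * ((s * r) ^ (n - 1) * r)"
          by (simp add: r_def[symmetric] power_mult_distrib)
        also have "\<dots> \<le> real n * (1 * r)"
          using s r by (intro mult_left_mono mult_right_mono power_le_one) auto
        finally have "real n * s ^ (n - 1) * norm x ^ n \<le> real n * r" by simp
        then have "(1 - s * r) powr (a - 1) * (real n * s ^ (n - 1) * norm x ^ n) \<le> (1 - s * r) powr (a - 1) * (real n * r)"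
          by (intro mult_left_mono) auto
        moreover have "s < 1 / r" using s r by (simp add: field_simps)
        ultimately show ?thesis using s True r
          by (simp add: \<psi>_def r_def[symmetric] ennreal_mult[symmetric] ennreal_leI mult.left_commute mult.commute)
      next
        case False
        then have "\<psi> (s *\<^sub>R x) = 0 \<or> s \<le> 0" by (auto simp: \<psi>_def r_def indicator_def)
        then show ?thesis by auto
      qed
      then have "(\<integral>\<^sup>+s. ennreal (\<psi> (s *\<^sub>R x)) * ennreal (indicator (ball 0 1) x * indicator {0<..} s * (real n * s ^ (n - 1) * norm x ^ n)) \<partial>lborel)
        \<le> (\<integral>\<^sup>+s. ennreal (real n) * ennreal (indicator {0<..<1 / r} s * (r * (1 - s * r) powr (a - 1))) \<partial>lborel)"
        by (intro nn_integral_mono) auto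
      also have "\<dots> = ennreal (real n) * ennreal (1 / a)"
        using ray[OF r(1)] by (subst nn_integral_cmult) auto
      finally show ?thesis using True a by (simp add: ennreal_mult[symmetric])
    qed simp
  qed
  also have "\<dots> = ennreal (real n * (1 / a)) * emeasure lborel (ball (0::'a) 1)"
    by (rule nn_integral_cmult_indicator) simp
  also have "\<dots> < \<infinity>" using emeasure_lborel_ball_finite[of "0::'a" 1] by (simp add: ennreal_mult_less_top)
  finally show ?thesis
    using \<psi>0 unfolding \<psi>_def[symmetric] by (intro integrableI_nonneg) auto
qed

section \<open>The conformal metric of hyperbolic space\<close>

lemma partial_has_derivative:
  assumes "(f has_derivative f') (at x)"
  shows "partial i f x = f' (axis i 1)"
  unfolding partial_def using frechet_derivative_at[OF assms] by simp

lemma partial_cong_open: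
  assumes "open U" "x \<in> U" "\<And>y. y \<in> U \<Longrightarrow> f y = g y"
  shows "partial i f x = partial i g x"
proof -
  have "(f has_derivative f') (at x) \<longleftrightarrow> (g has_derivative f') (at x)" for f'
    using has_derivative_transform_within_open[OF _ assms(1,2), of f f' UNIV g]
      has_derivative_transform_within_open[OF _ assms(1,2), of g f' UNIV f] assms(3) by auto
  then show ?thesis by (simp add: partial_def frechet_derivative_def)
qed

lemma has_derivative_partial:
  fixes f :: "real^'n::finite \<Rightarrow> real"
  assumes "f differentiable (at x)"
  shows "(f has_derivative (\<lambda>h. \<Sum>i\<in>UNIV. partial i f x * h $ i)) (at x)"
proof -
  have d: "(f has_derivative frechet_derivative f (at x)) (at x)"
    using assms frechet_derivative_works by blast
  have "frechet_derivative f (at x) = (\<lambda>h. \<Sum>i\<in>UNIV. partial i f x * h $ i)"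
  proof
    fix h :: "real^'n"
    interpret linear "frechet_derivative f (at x)"
      using d has_derivative_linear by blast
    have "h = (\<Sum>i\<in>UNIV. h $ i *\<^sub>R axis i 1)" by (simp add: vec_eq_iff axis_def if_distrib cong: if_cong)
    then have "frechet_derivative f (at x) h = frechet_derivative f (at x) (\<Sum>i\<in>UNIV. h $ i *\<^sub>R axis i 1)" by simp
    then show "frechet_derivative f (at x) h = (\<Sum>i\<in>UNIV. partial i f x * h $ i)"
      by (simp add: sum scale partial_def mult.commute)
  qed
  then show ?thesis using d by (simp only:)
qed

lemma norm_squared_sum:
  fixes x :: "real^'n::finite"
  shows "(norm x)\<^sup>2 = (\<Sum>i\<in>UNIV. x $ i * x $ i)"
  by (simp add: power2_norm_eq_inner inner_vec_def)

lemma rho_pos_iff: "rho x > 0 \<longleftrightarrow> norm x < 1"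
  unfolding rho_def by (simp add: abs_square_less_1)

lemma rho_has_derivative: "(rho has_derivative (\<lambda>h. - (x \<bullet> h))) (at x)"
proof -
  have eq: "rho = (\<lambda>x. (1 - x \<bullet> x) / 2)" by (simp add: rho_def power2_norm_eq_inner fun_eq_iff)
  show ?thesis unfolding eq by (auto intro!: derivative_eq_intros simp: inner_commute)
qed

lemma rho_power_has_derivative:
  "((\<lambda>y. rho y ^ k) has_derivative (\<lambda>h. - (real k * rho x ^ (k - 1) * (x \<bullet> h)))) (at x)"
  by (rule has_derivative_eq_rhs[OF has_derivative_power[OF rho_has_derivative]]) (simp add: fun_eq_iff)

lemma inner_axis_one: "x \<bullet> axis i (1::real) = x $ i"
  by (simp add: inner_axis)

lemma hyp_metric_nth: "hyp_metric y $ j $ l = (if j = l then 1 / (rho y)\<^sup>2 else 0)"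
  by (simp add: hyp_metric_def mat_def)

lemma sum_delta_mult:
  fixes F :: "'n::finite \<Rightarrow> 'a::semiring_0"
  shows "(\<Sum>l\<in>UNIV. (if k = l then a else 0) * F l) = a * F k"
proof -
  have "(\<Sum>l\<in>UNIV. (if k = l then a else 0) * F l) = (\<Sum>l\<in>UNIV. if k = l then a * F l else 0)"
    by (rule sum.cong) auto
  then show ?thesis by simp
qed

lemma matrix_inv_hyp_metric:
  assumes "norm x < 1"
  shows "matrix_inv (hyp_metric x) $ k $ l = (if k = l then (rho x)\<^sup>2 else 0)"
proof -
  have r: "rho x > 0" using assms by (simp add: rho_pos_iff)
  have mm: "mat a ** (mat b :: real^'n^'n) = mat (a * b)" for a b :: real
    by (simp add: matrix_matrix_mult_def mat_def vec_eq_iff sum_delta_mult)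
  have "matrix_inv (hyp_metric x) = mat ((rho x)\<^sup>2)"
  proof -
    have AB: "hyp_metric x ** mat ((rho x)\<^sup>2) = mat 1" "mat ((rho x)\<^sup>2) ** hyp_metric x = mat 1"
      unfolding hyp_metric_def mm using r by simp_all
    have "hyp_metric x ** matrix_inv (hyp_metric x) = mat 1"
      unfolding matrix_inv_def by (rule someI2[of _ "mat ((rho x)\<^sup>2)"]) (use AB in auto)
    then have "mat ((rho x)\<^sup>2) ** (hyp_metric x ** matrix_inv (hyp_metric x)) = mat ((rho x)\<^sup>2)" by simp
    then show ?thesis by (simp add: matrix_mul_assoc AB)
  qed
  then show ?thesis by (simp add: mat_def)
qed

lemma partial_hyp_metric:
  assumes "norm x < 1"
  shows "partial i (\<lambda>y. hyp_metric y $ j $ l) x = (if j = l then 2 * x $ i / (rho x) ^ 3 else 0)"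
proof (cases "j = l")
  case True
  have r: "rho x > 0" using assms by (simp add: rho_pos_iff)
  have "((\<lambda>y. 1 / (rho y)\<^sup>2) has_derivative (\<lambda>h. 2 * (x \<bullet> h) / (rho x) ^ 3)) (at x)"
    using r by (auto intro!: derivative_eq_intros rho_has_derivative simp: field_simps power2_eq_square power3_eq_cube)
  from partial_has_derivative[OF this, of i] True show ?thesis by (simp add: hyp_metric_nth inner_axis_one)
next
  case False
  have "((\<lambda>y. 0::real) has_derivative (\<lambda>h. 0)) (at x)" by simp
  from partial_has_derivative[OF this, of i] False show ?thesis by (simp add: hyp_metric_nth)
qed

text \<open>The formula for a conformal metric \<open>exp (2 f)\<close> times the Euclidean one with
  \<open>f = - ln rho\<close>, whose partial derivatives are \<open>x $ i / rho x\<close>.\<close>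

lemma christoffel_hyp_metric:
  assumes "norm x < 1"
  shows "christoffel hyp_metric k i j x =
    ((if k = i then x $ j else 0) + (if k = j then x $ i else 0) - (if i = j then x $ k else 0)) / rho x"
proof -
  have r: "rho x > 0" using assms by (simp add: rho_pos_iff)
  have "christoffel hyp_metric k i j x = (rho x)\<^sup>2 *
     ((if j = k then 2 * x $ i / (rho x) ^ 3 else 0) + (if i = k then 2 * x $ j / (rho x) ^ 3 else 0)
       - (if i = j then 2 * x $ k / (rho x) ^ 3 else 0)) / 2"
    unfolding christoffel_def partial_hyp_metric[OF assms] matrix_inv_hyp_metric[OF assms]
    by (simp add: sum_delta_mult)
  also have "\<dots> = ((if k = i then x $ j else 0) + (if k = j then x $ i else 0) - (if i = j then x $ k else 0)) / rho x"
    using r by (auto simp: field_simps power2_eq_square power3_eq_cube)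
  finally show ?thesis .
qed

lemma gradient_hyp_metric:
  assumes "norm x < 1"
  shows "gradient hyp_metric f x $ i = (rho x)\<^sup>2 * partial i f x"
  unfolding gradient_def matrix_inv_hyp_metric[OF assms] by (simp add: sum_delta_mult)

lemma tensor_trace_hyp_metric:
  assumes "norm x < 1"
  shows "tensor_trace hyp_metric e x = (rho x)\<^sup>2 * trace (e x)"
  unfolding tensor_trace_def matrix_inv_hyp_metric[OF assms] trace_def
  by (simp add: sum_delta_mult sum_distrib_left)

lemma laplacian_hyp_metric:
  fixes x :: "real^'n::finite"
  assumes "norm x < 1"
  shows "laplacian hyp_metric f x = (rho x)\<^sup>2 * (\<Sum>i\<in>UNIV. partial i (partial i f) x)
    + (real CARD('n) - 2) * rho x * (\<Sum>i\<in>UNIV. x $ i * partial i f x)"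
proof -
  have r: "rho x > 0" using assms by (simp add: rho_pos_iff)
  define S where "S = (\<Sum>k\<in>UNIV. x $ k * partial k f x)"
  have h: "hessian hyp_metric f x $ i $ i = partial i (partial i f) x - (2 * x $ i * partial i f x - S) / rho x" for i
  proof -
    have "(\<Sum>k\<in>UNIV. christoffel hyp_metric k i i x * partial k f x)
      = (\<Sum>k\<in>UNIV. (if k = i then 2 * x $ i * partial i f x else 0) / rho x - x $ k * partial k f x / rho x)"
      unfolding christoffel_hyp_metric[OF assms]
      by (intro sum.cong) (auto simp: field_simps diff_divide_distrib add_divide_distrib)
    also have "\<dots> = (2 * x $ i * partial i f x - S) / rho x"
      by (simp add: sum_subtractf S_def sum_divide_distrib[symmetric] diff_divide_distrib)
    finally show ?thesis by (simp add: hessian_def)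
  qed
  have "laplacian hyp_metric f x = (rho x)\<^sup>2 * (\<Sum>i\<in>UNIV. partial i (partial i f) x - (2 * (x $ i * partial i f x) - S) / rho x)"
    unfolding laplacian_def tensor_trace_hyp_metric[OF assms] trace_def h by (simp add: mult.assoc)
  also have "(\<Sum>i\<in>UNIV. partial i (partial i f) x - (2 * (x $ i * partial i f x) - S) / rho x)
     = (\<Sum>i\<in>UNIV. partial i (partial i f) x) - (2 * S - real CARD('n) * S) / rho x"
    by (simp add: sum_subtractf sum_divide_distrib[symmetric] sum_distrib_left[symmetric] S_def[symmetric])
  also have "(rho x)\<^sup>2 * ((\<Sum>i\<in>UNIV. partial i (partial i f) x) - (2 * S - real CARD('n) * S) / rho x)
     = (rho x)\<^sup>2 * (\<Sum>i\<in>UNIV. partial i (partial i f) x) + (real CARD('n) - 2) * rho x * S"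
    using r by (simp add: field_simps power2_eq_square)
  finally show ?thesis by (simp add: S_def)
qed

text \<open>Most Christoffel terms contract \<open>e\<close> with the radial vector and vanish by
  \<open>tang\<close>; what survives is the part pairing equal indices, which produces the
  trace.\<close>

lemma tensor_div_hyp_metric:
  fixes x :: "real^'n::finite"
  assumes x: "norm x < 1"
    and sym: "transpose (e x) = e x" and tang: "\<And>j. (\<Sum>i\<in>UNIV. e x $ i $ j * x $ i) = 0"
  shows "tensor_div hyp_metric e x $ j =
    (rho x)\<^sup>2 * (\<Sum>k\<in>UNIV. partial k (\<lambda>y. e y $ k $ j) x) - rho x * x $ j * trace (e x)"
proof -
  have r: "rho x > 0" using x by (simp add: rho_pos_iff)
  have sy: "e x $ a $ b = e x $ b $ a" for a b
  proof -
    have "transpose (e x) $ b $ a = e x $ b $ a" using sym by simp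
    then show ?thesis by (simp add: transpose_def)
  qed
  have t1: "(\<Sum>k\<in>UNIV. \<Sum>l\<in>UNIV. christoffel hyp_metric l k k x * e x $ l $ j) = 0"
  proof -
    have "(\<Sum>l\<in>UNIV. christoffel hyp_metric l k k x * e x $ l $ j)
      = (\<Sum>l\<in>UNIV. (if l = k then 2 * x $ k * e x $ k $ j else 0) / rho x - e x $ l $ j * x $ l / rho x)" for k
      unfolding christoffel_hyp_metric[OF x]
      by (intro sum.cong) (auto simp: field_simps diff_divide_distrib add_divide_distrib)
    also have "\<dots> k = 2 * (e x $ k $ j * x $ k) / rho x" for k
      by (simp add: sum_subtractf sum_divide_distrib[symmetric] tang)
    finally have "(\<Sum>l\<in>UNIV. christoffel hyp_metric l k k x * e x $ l $ j) = 2 * (e x $ k $ j * x $ k) / rho x" for k .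
    then show ?thesis by (simp add: sum_divide_distrib[symmetric] sum_distrib_left[symmetric] tang)
  qed
  have t2: "(\<Sum>k\<in>UNIV. \<Sum>l\<in>UNIV. christoffel hyp_metric l k j x * e x $ k $ l) = x $ j * trace (e x) / rho x"
  proof -
    have "(\<Sum>l\<in>UNIV. christoffel hyp_metric l k j x * e x $ k $ l)
      = (\<Sum>l\<in>UNIV. (if l = k then x $ j * e x $ k $ k else 0) / rho x + (if l = j then e x $ k $ j * x $ k else 0) / rho x
          - (if k = j then e x $ l $ j * x $ l else 0) / rho x)" for k
      unfolding christoffel_hyp_metric[OF x]
      by (intro sum.cong) (auto simp: field_simps diff_divide_distrib add_divide_distrib sy)
    also have "\<dots> k = (x $ j * e x $ k $ k) / rho x + (e x $ k $ j * x $ k) / rho x" for k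
      using tang[of j] by (cases "k = j") (simp_all add: sum_subtractf sum.distrib sum_divide_distrib[symmetric])
    finally have "(\<Sum>l\<in>UNIV. christoffel hyp_metric l k j x * e x $ k $ l) = (x $ j * e x $ k $ k) / rho x + (e x $ k $ j * x $ k) / rho x" for k .
    then show ?thesis
      by (simp add: sum.distrib sum_divide_distrib[symmetric] sum_distrib_left[symmetric] tang trace_def)
  qed
  have "tensor_div hyp_metric e x $ j = (\<Sum>k\<in>UNIV. (rho x)\<^sup>2 * cov_deriv hyp_metric e k k j x)"
    unfolding tensor_div_def matrix_inv_hyp_metric[OF x] by (simp add: sum_delta_mult)
  also have "\<dots> = (rho x)\<^sup>2 * ((\<Sum>k\<in>UNIV. partial k (\<lambda>y. e y $ k $ j) x)
      - (\<Sum>k\<in>UNIV. \<Sum>l\<in>UNIV. christoffel hyp_metric l k k x * e x $ l $ j)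
      - (\<Sum>k\<in>UNIV. \<Sum>l\<in>UNIV. christoffel hyp_metric l k j x * e x $ k $ l))"
    by (simp add: cov_deriv_def sum_subtractf sum_distrib_left[symmetric])
  finally have "tensor_div hyp_metric e x $ j = (rho x)\<^sup>2 * ((\<Sum>k\<in>UNIV. partial k (\<lambda>y. e y $ k $ j) x) - 0 - x $ j * trace (e x) / rho x)"
    unfolding t1 t2 .
  also have "\<dots> = (rho x)\<^sup>2 * (\<Sum>k\<in>UNIV. partial k (\<lambda>y. e y $ k $ j) x) - rho x * x $ j * trace (e x)"
    using r by (simp add: field_simps power2_eq_square)
  finally show ?thesis .
qed

text \<open>The coefficient \<open>n\<close> arises as \<open>(n - 1) + 1\<close>: differentiating
  \<open>rho ^ n\<close> in the trace contributes \<open>n\<close>, the divergence takes away 1, and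
  the trace term with \<open>dV\<close> returns 1, as \<open>V = W / rho\<close> contributes
  \<open>x $ j * W / rho^2\<close>. The factor \<open>rho ^ n\<close> in front cancels the
  hyperbolic volume density.\<close>

lemma charge_integrand_eq:
  fixes x :: "real^'n::finite" and ebar :: "real^'n \<Rightarrow> real^'n^'n"
  assumes n: "CARD('n) \<ge> 2" and K': "closed K'" and x: "norm x < 1" "x \<notin> K'"
    and e: "\<And>y. y \<in> ball 0 1 - K' \<Longrightarrow> e y = rho y ^ (CARD('n) - 2) *\<^sub>R ebar y"
    and V: "\<And>y. y \<in> ball 0 1 \<Longrightarrow> V y = W y / rho y"
    and dW: "W differentiable (at x)" and de: "\<And>i j. (\<lambda>y. ebar y $ i $ j) differentiable (at x)"
    and sym: "transpose (ebar x) = ebar x" and tang: "\<And>j. (\<Sum>i\<in>UNIV. ebar x $ i $ j * x $ i) = 0"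
  defines "R \<equiv> \<lambda>j. - W x * ((\<Sum>k\<in>UNIV. partial k (\<lambda>y. ebar y $ k $ j) x) - partial j (\<lambda>y. trace (ebar y)) x)
       - trace (ebar x) * partial j W x + (\<Sum>i\<in>UNIV. partial i W x * ebar x $ i $ j)"
  shows "charge_integrand K' e V \<zeta> x = rho x ^ CARD('n) *
    (- (real CARD('n) * W x * trace (ebar x) * (\<Sum>j\<in>UNIV. x $ j * partial j \<zeta> x)) + rho x * (\<Sum>j\<in>UNIV. R j * partial j \<zeta> x))"
proof -
  define p where "p = CARD('n) - 2"
  have np: "CARD('n) = Suc (Suc p)" using n by (simp add: p_def)
  define U where "U = ball 0 1 - K'"
  have U: "open U" "x \<in> U" using K' x by (auto simp: U_def)
  have r: "rho x > 0" using x by (simp add: rho_pos_iff)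
  have ex: "e x = rho x ^ p *\<^sub>R ebar x" using e U by (simp add: U_def p_def)
  define w where "w = (\<lambda>j. partial j \<zeta> x)"
  define m where "m = trace (ebar x)"
  define d where "d = (\<lambda>k j. partial k (\<lambda>y. ebar y $ k $ j) x)"
  have de': "((\<lambda>y. ebar y $ i $ j) has_derivative frechet_derivative (\<lambda>y. ebar y $ i $ j) (at x)) (at x)" for i j
    using de frechet_derivative_works by blast
  have pe: "partial k (\<lambda>y. e y $ i $ j) x = rho x ^ p * partial k (\<lambda>y. ebar y $ i $ j) x
      - real p * rho x ^ (p - 1) * x $ k * ebar x $ i $ j" for i j k
  proof -
    have "partial k (\<lambda>y. e y $ i $ j) x = partial k (\<lambda>y. rho y ^ p * ebar y $ i $ j) x"
      by (rule partial_cong_open[OF U]) (simp add: U_def e p_def)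
    also have "\<dots> = rho x ^ p * partial k (\<lambda>y. ebar y $ i $ j) x - real p * rho x ^ (p - 1) * x $ k * ebar x $ i $ j"
      using partial_has_derivative[OF has_derivative_mult[OF rho_power_has_derivative de'], of k p i j]
      by (simp add: partial_def inner_axis_one)
    finally show ?thesis .
  qed
  \<comment> \<open>The derivative of \<open>rho ^ p\<close> is radial, so tangentiality removes it
    from the divergence.\<close>
  have sume: "(\<Sum>k\<in>UNIV. partial k (\<lambda>y. e y $ k $ j) x) = rho x ^ p * (\<Sum>k\<in>UNIV. d k j)" for j
  proof -
    have "(\<Sum>k\<in>UNIV. partial k (\<lambda>y. e y $ k $ j) x)
      = rho x ^ p * (\<Sum>k\<in>UNIV. d k j) - real p * rho x ^ (p - 1) * (\<Sum>k\<in>UNIV. ebar x $ k $ j * x $ k)"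
      unfolding pe d_def by (simp add: sum_subtractf sum_distrib_left mult.assoc mult.commute[of "x $ _"])
    then show ?thesis by (simp add: tang)
  qed
  have dive: "tensor_div hyp_metric e x $ j = (rho x)\<^sup>2 * (rho x ^ p * (\<Sum>k\<in>UNIV. d k j)) - rho x * x $ j * (rho x ^ p * m)" for j
  proof -
    have "transpose (e x) = e x" unfolding ex using sym by (simp add: transpose_scalar)
    moreover have "(\<Sum>i\<in>UNIV. e x $ i $ j * x $ i) = 0" for j
      unfolding ex using tang[of j] by (simp add: mult.assoc sum_distrib_left[symmetric])
    ultimately show ?thesis
      by (subst tensor_div_hyp_metric[OF x(1)]) (simp_all add: sume ex m_def trace_def sum_distrib_left)
  qed
  have tre: "tensor_trace hyp_metric e y = rho y ^ CARD('n) * trace (ebar y)" if "y \<in> U" for y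
    using that by (subst tensor_trace_hyp_metric) (auto simp: U_def e np trace_def sum_distrib_left power2_eq_square mult.assoc)
  have dtr: "(\<lambda>y. trace (ebar y)) differentiable (at x)"
    unfolding trace_def using de by (intro differentiable_sum) auto
  have ptr: "partial j (tensor_trace hyp_metric e) x = rho x ^ CARD('n) * partial j (\<lambda>y. trace (ebar y)) x
     - real CARD('n) * rho x ^ (CARD('n) - 1) * x $ j * m" for j
  proof -
    have "partial j (tensor_trace hyp_metric e) x = partial j (\<lambda>y. rho y ^ CARD('n) * trace (ebar y)) x"
      by (rule partial_cong_open[OF U]) (simp add: tre)
    also have "\<dots> = rho x ^ CARD('n) * partial j (\<lambda>y. trace (ebar y)) x
       - real CARD('n) * rho x ^ (CARD('n) - 1) * x $ j * m"
      using partial_has_derivative[OF has_derivative_mult[OF rho_power_has_derivative frechet_derivative_works[THEN iffD1, OF dtr]], of j "CARD('n)"]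
      by (simp add: partial_def inner_axis_one m_def)
    finally show ?thesis .
  qed
  have pV: "partial j V x = x $ j * W x / (rho x)\<^sup>2 + partial j W x / rho x" for j
  proof -
    have "partial j V x = partial j (\<lambda>y. W y / rho y) x"
      by (rule partial_cong_open[of "ball 0 1"]) (use x V in auto)
    also have "\<dots> = x $ j * W x / (rho x)\<^sup>2 + partial j W x / rho x"
      using partial_has_derivative[OF has_derivative_divide[OF frechet_derivative_works[THEN iffD1, OF dW] rho_has_derivative], of j] r
      by (simp add: partial_def inner_axis_one field_simps power2_eq_square)
    finally show ?thesis .
  qed
  have Vx: "V x = W x / rho x" using V x by simp
  define X where "X = - gradient hyp_metric \<zeta> x"
  have X: "X $ j = - ((rho x)\<^sup>2 * w j)" for j by (simp add: X_def gradient_hyp_metric[OF x(1)] w_def)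
  \<comment> \<open>The singular part of the gradient of \<open>V\<close> is radial and is
    annihilated by \<open>e\<close>; only derivatives of \<open>W\<close> remain, one power of
    \<open>rho\<close> better.\<close>
  have third: "gradient hyp_metric V x \<bullet> (e x *v X)
     = (\<Sum>j\<in>UNIV. - (rho x ^ 3 * rho x ^ p * (\<Sum>i\<in>UNIV. partial i W x * ebar x $ i $ j) * w j))"
  proof -
    have "gradient hyp_metric V x \<bullet> (e x *v X)
      = (\<Sum>i\<in>UNIV. \<Sum>j\<in>UNIV. (rho x)\<^sup>2 * partial i V x * (rho x ^ p * ebar x $ i $ j) * X $ j)"
      by (simp add: inner_vec_def gradient_hyp_metric[OF x(1)] matrix_vector_mult_def ex sum_distrib_left mult.assoc)
    also have "\<dots> = (\<Sum>j\<in>UNIV. \<Sum>i\<in>UNIV. (rho x)\<^sup>2 * partial i V x * (rho x ^ p * ebar x $ i $ j) * X $ j)"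
      by (rule sum.swap)
    also have "\<dots> = (\<Sum>j\<in>UNIV. - (rho x ^ 3 * rho x ^ p * (\<Sum>i\<in>UNIV. partial i W x * ebar x $ i $ j) * w j))"
    proof (rule sum.cong[OF refl])
      fix j
      have "(\<Sum>i\<in>UNIV. (rho x)\<^sup>2 * partial i V x * (rho x ^ p * ebar x $ i $ j) * X $ j)
        = (\<Sum>i\<in>UNIV. - ((rho x)\<^sup>2 * rho x ^ p * W x * w j) * (ebar x $ i $ j * x $ i) - (rho x ^ 3 * rho x ^ p * w j) * (partial i W x * ebar x $ i $ j))"
        unfolding pV X using r by (intro sum.cong) (auto simp: field_simps power2_eq_square power3_eq_cube)
      also have "\<dots> = - (rho x ^ 3 * rho x ^ p * (\<Sum>i\<in>UNIV. partial i W x * ebar x $ i $ j) * w j)"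
        by (simp only: sum_subtractf sum_distrib_left[symmetric] tang) (simp add: ac_simps)
      finally show "(\<Sum>i\<in>UNIV. (rho x)\<^sup>2 * partial i V x * (rho x ^ p * ebar x $ i $ j) * X $ j)
        = - (rho x ^ 3 * rho x ^ p * (\<Sum>i\<in>UNIV. partial i W x * ebar x $ i $ j) * w j)" .
    qed
    finally show ?thesis .
  qed
  have "charge_integrand K' e V \<zeta> x = V x * (\<Sum>j\<in>UNIV. (tensor_div hyp_metric e x $ j
                 - partial j (tensor_trace hyp_metric e) x) * X $ j)
          + tensor_trace hyp_metric e x * (\<Sum>j\<in>UNIV. partial j V x * X $ j)
          - gradient hyp_metric V x \<bullet> (e x *v X)"
    using x by (simp add: charge_integrand_def X_def Let_def)
  also have "\<dots> = (\<Sum>j\<in>UNIV. V x * ((tensor_div hyp_metric e x $ j - partial j (tensor_trace hyp_metric e) x) * X $ j)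
       + tensor_trace hyp_metric e x * (partial j V x * X $ j)
       + rho x ^ 3 * rho x ^ p * (\<Sum>i\<in>UNIV. partial i W x * ebar x $ i $ j) * w j)"
    unfolding third by (simp add: sum.distrib sum_distrib_left sum_negf)
  also have "\<dots> = (\<Sum>j\<in>UNIV. rho x ^ CARD('n) * (- (real CARD('n) * W x * m * (x $ j * w j)) + rho x * (R j * w j)))"
  proof (rule sum.cong[OF refl])
    fix j
    define D where "D = (\<Sum>k\<in>UNIV. d k j)"
    define E where "E = (\<Sum>i\<in>UNIV. partial i W x * ebar x $ i $ j)"
    define P where "P = rho x ^ p"
    define \<rho> where "\<rho> = rho x"
    have r': "\<rho> > 0" using r by (simp add: \<rho>_def)
    have Rj: "R j = - W x * (D - partial j (\<lambda>y. trace (ebar y)) x) - m * partial j W x + E"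
      by (simp add: R_def D_def d_def m_def E_def)
    have pn: "\<rho> ^ CARD('n) = P * \<rho>\<^sup>2" "\<rho> ^ (CARD('n) - 1) = P * \<rho>" "\<rho> ^ p = P"
      by (simp_all add: np P_def \<rho>_def power2_eq_square)
    show "V x * ((tensor_div hyp_metric e x $ j - partial j (tensor_trace hyp_metric e) x) * X $ j)
       + tensor_trace hyp_metric e x * (partial j V x * X $ j)
       + rho x ^ 3 * rho x ^ p * (\<Sum>i\<in>UNIV. partial i W x * ebar x $ i $ j) * w j
      = rho x ^ CARD('n) * (- (real CARD('n) * W x * m * (x $ j * w j)) + rho x * (R j * w j))"
      unfolding dive ptr tre[OF U(2)] pV Vx X m_def[symmetric] D_def[symmetric] E_def[symmetric] Rj \<rho>_def[symmetric]
      unfolding pn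
      using r' by (simp add: field_simps power2_eq_square power3_eq_cube)
  qed
  also have "\<dots> = rho x ^ CARD('n) * (- (real CARD('n) * W x * m * (\<Sum>j\<in>UNIV. x $ j * w j)) + rho x * (\<Sum>j\<in>UNIV. R j * w j))"
    by (simp only: sum_distrib_left[symmetric] sum.distrib sum_negf)
  finally show ?thesis by (simp add: m_def w_def)
qed

section \<open>Maximum principle and uniqueness\<close>

text \<open>Lets regularity and all second partial derivatives be read off from explicit formulas;
  radial functions, linear combinations and Poisson integrals are all treated in this way.\<close>

lemma C2_onI:
  fixes f :: "real^'n::finite \<Rightarrow> real"
  assumes U: "open U"
    and g: "\<And>x. x \<in> U \<Longrightarrow> (f has_derivative (\<lambda>h. \<Sum>i\<in>UNIV. g i x * h $ i)) (at x)"
    and H: "\<And>x i. x \<in> U \<Longrightarrow> (g i has_derivative (\<lambda>h. \<Sum>j\<in>UNIV. H i j x * h $ j)) (at x)"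
    and cont: "\<And>i j. continuous_on U (H i j)"
  shows "Ck_on 2 U f" "\<And>x i. x \<in> U \<Longrightarrow> partial i f x = g i x"
    "\<And>x i j. x \<in> U \<Longrightarrow> partial j (partial i f) x = H i j x"
proof -
  have ax: "(\<Sum>j\<in>UNIV. c j * axis i 1 $ j) = c i" for c :: "'n \<Rightarrow> real" and i
    by (simp add: axis_def if_distrib cong: if_cong)
  show p1: "partial i f x = g i x" if "x \<in> U" for x i
    using partial_has_derivative[OF g[OF that], of i] by (simp add: ax)
  have pc: "partial j (partial i f) x = partial j (g i) x" if "x \<in> U" for x i j
    by (rule partial_cong_open[OF U that]) (rule p1)
  show p2: "partial j (partial i f) x = H i j x" if "x \<in> U" for x i j
    using partial_has_derivative[OF H[OF that], of j i] pc[OF that] by (simp add: ax)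
  have "partial i f differentiable (at x)" if "x \<in> U" for x i
    using has_derivative_transform_within_open[OF H[OF that] U that, of i "partial i f"] p1
    by (auto simp: differentiable_def)
  moreover have "continuous_on U (partial j (partial i f))" for i j
    using cont[of i j] p2 by (metis (no_types, lifting) continuous_on_cong)
  moreover have "f differentiable (at x)" if "x \<in> U" for x
    using g[OF that] by (auto simp: differentiable_def)
  ultimately show "Ck_on 2 U f"
    by (simp add: numeral_2_eq_2)
qed

lemma C2_onD:
  assumes "Ck_on 2 U f"
  shows "x \<in> U \<Longrightarrow> f differentiable (at x)" "x \<in> U \<Longrightarrow> partial i f differentiable (at x)"
    "continuous_on U (partial j (partial i f))"
  using assms by (auto simp: numeral_2_eq_2)

lemma C2_on_lin:
  fixes f g :: "real^'n::finite \<Rightarrow> real"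
  assumes U: "open U" and f: "Ck_on 2 U f" and g: "Ck_on 2 U g"
  shows "Ck_on 2 U (\<lambda>x. a * f x + b * g x)"
    "x \<in> U \<Longrightarrow> partial i (\<lambda>x. a * f x + b * g x) x = a * partial i f x + b * partial i g x"
    "x \<in> U \<Longrightarrow> partial j (partial i (\<lambda>x. a * f x + b * g x)) x = a * partial j (partial i f) x + b * partial j (partial i g) x"
proof -
  have lin: "((\<lambda>x. a * u x + b * v x) has_derivative (\<lambda>h. \<Sum>i\<in>UNIV. (a * partial i u x + b * partial i v x) * h $ i)) (at x)"
    if "u differentiable (at x)" "v differentiable (at x)" for u v :: "real^'n \<Rightarrow> real" and x
    by (rule has_derivative_eq_rhs[OF has_derivative_add[OF has_derivative_mult_right[OF has_derivative_partial[OF that(1)]]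
          has_derivative_mult_right[OF has_derivative_partial[OF that(2)]]]])
       (simp add: fun_eq_iff sum_distrib_left sum.distrib algebra_simps)
  have c: "continuous_on U (\<lambda>x. a * partial j (partial i f) x + b * partial j (partial i g) x)" for i j
    using C2_onD(3)[OF f] C2_onD(3)[OF g] by (intro continuous_intros)
  note * = C2_onI[OF U, of "\<lambda>x. a * f x + b * g x" "\<lambda>i x. a * partial i f x + b * partial i g x"
      "\<lambda>i j x. a * partial j (partial i f) x + b * partial j (partial i g) x",
      OF lin[OF C2_onD(1)[OF f] C2_onD(1)[OF g]] lin[OF C2_onD(2)[OF f] C2_onD(2)[OF g]] c]
  show "Ck_on 2 U (\<lambda>x. a * f x + b * g x)" using *(1) by blast
  show "x \<in> U \<Longrightarrow> partial i (\<lambda>x. a * f x + b * g x) x = a * partial i f x + b * partial i g x" using *(2) by blast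
  show "x \<in> U \<Longrightarrow> partial j (partial i (\<lambda>x. a * f x + b * g x)) x = a * partial j (partial i f) x + b * partial j (partial i g) x"
    using *(3) by blast
qed

lemma laplacian_lin:
  fixes f g :: "real^'n::finite \<Rightarrow> real"
  assumes f: "Ck_on 2 (ball 0 1) f" and g: "Ck_on 2 (ball 0 1) g" and x: "norm x < 1"
  shows "laplacian hyp_metric (\<lambda>x. a * f x + b * g x) x = a * laplacian hyp_metric f x + b * laplacian hyp_metric g x"
proof -
  have x': "x \<in> ball 0 1" using x by simp
  show ?thesis
    unfolding laplacian_hyp_metric[OF x] C2_on_lin(2)[OF open_ball f g x'] C2_on_lin(3)[OF open_ball f g x']
  proof -
    have e: "(\<Sum>i\<in>UNIV. x $ i * (a * partial i f x + b * partial i g x)) = a * (\<Sum>i\<in>UNIV. x $ i * partial i f x) + b * (\<Sum>i\<in>UNIV. x $ i * partial i g x)"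
      by (simp add: sum.distrib sum_distrib_left distrib_left mult.left_commute)
    show "(rho x)\<^sup>2 * (\<Sum>i\<in>UNIV. a * partial i (partial i f) x + b * partial i (partial i g) x) +
      (real CARD('n) - 2) * rho x * (\<Sum>i\<in>UNIV. x $ i * (a * partial i f x + b * partial i g x)) =
      a * ((rho x)\<^sup>2 * (\<Sum>i\<in>UNIV. partial i (partial i f) x) + (real CARD('n) - 2) * rho x * (\<Sum>i\<in>UNIV. x $ i * partial i f x)) +
      b * ((rho x)\<^sup>2 * (\<Sum>i\<in>UNIV. partial i (partial i g) x) + (real CARD('n) - 2) * rho x * (\<Sum>i\<in>UNIV. x $ i * partial i g x))"
      unfolding e sum.distrib sum_distrib_left[symmetric] by (simp only: distrib_left mult.left_commute mult.assoc add.assoc add.left_commute)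
  qed
qed

section \<open>The maximum principle and radial comparison functions\<close>

lemma partial_local_max:
  fixes f :: "real^'n::finite \<Rightarrow> real"
  assumes U: "open U" "x \<in> U" and d1: "\<And>y. y \<in> U \<Longrightarrow> f differentiable (at y)"
    and d2: "partial i f differentiable (at x)" and max: "\<And>y. y \<in> U \<Longrightarrow> f y \<le> f x"
  shows "partial i f x = 0" "partial i (partial i f) x \<le> 0"
proof -
  obtain \<delta> where \<delta>: "\<delta> > 0" "ball x \<delta> \<subseteq> U" using U openE by (metis subset_eq)
  define \<gamma> where "\<gamma> = (\<lambda>t. x + t *\<^sub>R axis i (1::real))"
  have \<gamma>U: "\<gamma> t \<in> U" if "\<bar>t\<bar> < \<delta>" for t
  proof -
    have "\<gamma> t \<in> ball x \<delta>" using that by (simp add: \<gamma>_def dist_norm)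
    then show ?thesis using \<delta> by blast
  qed
  have chain: "((\<lambda>t. u (\<gamma> t)) has_real_derivative partial i u (\<gamma> t)) (at t)"
    if "u differentiable (at (\<gamma> t))" for u :: "real^'n \<Rightarrow> real" and t
  proof -
    have "(\<gamma> has_derivative (\<lambda>s. s *\<^sub>R axis i 1)) (at t)" unfolding \<gamma>_def by (auto intro!: derivative_eq_intros)
    from diff_chain_at[OF this has_derivative_partial[OF that]]
    show ?thesis
      by (simp add: o_def has_field_derivative_def axis_def if_distrib mult_commute_abs cong: if_cong)
  qed
  have \<gamma>0: "\<gamma> 0 = x" by (simp add: \<gamma>_def)
  have g1: "((\<lambda>t. f (\<gamma> t)) has_real_derivative partial i f (\<gamma> t)) (at t)" if "\<bar>t\<bar> < \<delta>" for t
    using chain d1 \<gamma>U[OF that] by blast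
  have h1: "((\<lambda>t. f (\<gamma> t)) has_real_derivative partial i f (\<gamma> 0)) (at 0)" using g1[of 0] \<delta> by simp
  have h2: "\<forall>y. \<bar>0 - y\<bar> < \<delta> \<longrightarrow> f (\<gamma> y) \<le> f (\<gamma> 0)" using max \<gamma>U by (auto simp: \<gamma>0)
  have "partial i f (\<gamma> 0) = 0" by (rule DERIV_local_max[OF h1 \<delta>(1) h2])
  then show p0: "partial i f x = 0" by (simp add: \<gamma>0)
  show "partial i (partial i f) x \<le> 0"
  proof (rule ccontr)
    assume "\<not> ?thesis"
    then have pos: "partial i (partial i f) x > 0" by simp
    have "((\<lambda>t. partial i f (\<gamma> t)) has_real_derivative partial i (partial i f) x) (at 0)"
      using chain[of "partial i f" 0] d2 by (simp add: \<gamma>0)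
    from DERIV_pos_inc_right[OF this pos] obtain d where d: "d > 0" "\<And>h. 0 < h \<Longrightarrow> h < d \<Longrightarrow> partial i f (\<gamma> 0) < partial i f (\<gamma> h)"
      by auto
    define h where "h = min d \<delta> / 2"
    have h: "0 < h" "h < d" "h < \<delta>" using d \<delta> by (auto simp: h_def)
    obtain z where z: "0 < z" "z < h" "f (\<gamma> h) - f (\<gamma> 0) = (h - 0) * partial i f (\<gamma> z)"
      using MVT2[of 0 h "\<lambda>t. f (\<gamma> t)" "\<lambda>t. partial i f (\<gamma> t)"] g1 h by auto
    have "partial i f (\<gamma> z) > 0" using d(2)[of z] z h p0 by (simp add: \<gamma>0)
    then have "h * partial i f (\<gamma> z) > 0" using h by simp
    then have "f (\<gamma> h) > f (\<gamma> 0)" using z(3) by simp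
    then show False using max[OF \<gamma>U, of h] h by (simp add: \<gamma>0)
  qed
qed

lemma laplacian_local_max:
  fixes f :: "real^'n::finite \<Rightarrow> real"
  assumes f: "Ck_on 2 (ball 0 1) f" and U: "open U" "x \<in> U" "U \<subseteq> ball 0 1"
    and max: "\<And>y. y \<in> U \<Longrightarrow> f y \<le> f x"
  shows "laplacian hyp_metric f x \<le> 0"
proof -
  have x: "norm x < 1" "x \<in> ball 0 1" using U by auto
  have p: "partial i f x = 0" "partial i (partial i f) x \<le> 0" for i
    using partial_local_max[OF U(1,2) _ C2_onD(2)[OF f x(2)] max, of i] C2_onD(1)[OF f] U(3) by blast+
  show ?thesis
    unfolding laplacian_hyp_metric[OF x(1)] using p by (simp add: mult_nonneg_nonpos sum_nonpos)
qed

text \<open>A positive interior maximum contradicts the sign of the Laplacian there. That sign is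
  required only where \<open>f\<close> is positive, which suits functions whose Laplacian is at
  least a positive multiple of \<open>f\<close>.\<close>

lemma maximum_principle:
  fixes f :: "real^'n::finite \<Rightarrow> real"
  assumes f: "Ck_on 2 (ball 0 1) f" and R: "R < 1"
    and bd: "\<And>x. norm x = R \<Longrightarrow> f x \<le> 0"
    and pos: "\<And>x. norm x < R \<Longrightarrow> f x > 0 \<Longrightarrow> laplacian hyp_metric f x > 0"
    and x: "norm x \<le> R"
  shows "f x \<le> 0"
proof (rule ccontr)
  assume "\<not> ?thesis"
  then have fx: "f x > 0" by simp
  have "continuous_on (cball 0 R) f"
    using C2_onD(1)[OF f] R by (intro differentiable_imp_continuous_on differentiable_at_imp_differentiable_on) auto
  then obtain y where y: "y \<in> cball 0 R" "\<And>z. z \<in> cball 0 R \<Longrightarrow> f z \<le> f y"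
    using continuous_attains_sup[of "cball 0 R" f] x by fastforce
  have fy: "f y > 0" using fx y(2)[of x] x by simp
  then have yR: "norm y < R" using bd[of y] y(1) by fastforce
  have "laplacian hyp_metric f y \<le> 0"
    by (rule laplacian_local_max[OF f, of "ball 0 R"]) (use yR R y in auto)
  with pos[OF yR fy] show False by simp
qed

text \<open>Radial functions are written through \<open>rho\<close> rather than \<open>norm\<close>:
  \<open>rho\<close> is smooth at the origin, so no separate argument is needed there.\<close>

lemma radial_C2:
  fixes F F1 F2 :: "real \<Rightarrow> real"
  assumes F1: "\<And>r. 0 < r \<Longrightarrow> r < 1 \<Longrightarrow> (F has_real_derivative F1 r) (at r)"
    and F2: "\<And>r. 0 < r \<Longrightarrow> r < 1 \<Longrightarrow> (F1 has_real_derivative F2 r) (at r)"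
    and cont: "continuous_on {0<..<1} F2"
  defines "f \<equiv> \<lambda>x::real^'n::finite. F (rho x)"
  shows "Ck_on 2 (ball 0 1) f"
    "\<And>x. norm x < 1 \<Longrightarrow> laplacian hyp_metric f x = (rho x)\<^sup>2 * ((1 - 2 * rho x) * F2 (rho x) - real CARD('n) * F1 (rho x))
      - (real CARD('n) - 2) * rho x * ((1 - 2 * rho x) * F1 (rho x))"
proof -
  have r: "0 < rho x" "rho x < 1" if "norm x < 1" for x :: "real^'n"
    using that by (auto simp: rho_pos_iff) (simp add: rho_def, smt (verit) zero_le_power2)
  have crho: "continuous_on A rho" for A :: "(real^'n) set"
    using rho_has_derivative by (intro has_derivative_continuous_on) (auto intro: has_derivative_at_withinI)
  have ch: "((\<lambda>x. u (rho x)) has_derivative (\<lambda>h. \<Sum>i\<in>UNIV. (- (u' * x $ i)) * h $ i)) (at x)"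
    if "(u has_real_derivative u') (at (rho x))" for u u' and x :: "real^'n"
  proof -
    have "((\<lambda>x. u (rho x)) has_derivative (\<lambda>h. u' * (- (x \<bullet> h)))) (at x)"
      using diff_chain_at[OF rho_has_derivative that[unfolded has_field_derivative_def]] by (simp add: o_def)
    then show ?thesis by (rule has_derivative_eq_rhs) (simp add: fun_eq_iff inner_vec_def sum_distrib_left sum_negf mult.assoc)
  qed
  have c: "continuous_on (ball 0 1) (\<lambda>x::real^'n. F2 (rho x) * x $ j * x $ i - (if i = j then F1 (rho x) else 0))" for i j
  proof -
    have "continuous_on {0<..<1} F1" using F2 by (intro DERIV_continuous_on) (auto intro: has_field_derivative_at_within)
    then have "continuous_on (ball 0 1) (\<lambda>x::real^'n. F1 (rho x))" "continuous_on (ball 0 1) (\<lambda>x::real^'n. F2 (rho x))"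
      using r by (auto intro!: continuous_on_compose2[OF _ crho] cont)
    then show ?thesis by (cases "i = j") (auto intro!: continuous_intros)
  qed
  have H: "((\<lambda>x. - (F1 (rho x) * x $ i)) has_derivative
       (\<lambda>h. \<Sum>j\<in>UNIV. (F2 (rho x) * x $ j * x $ i - (if i = j then F1 (rho x) else 0)) * h $ j)) (at x)"
    if "x \<in> ball 0 1" for x :: "real^'n" and i
  proof -
    have d: "((\<lambda>x. x $ i) has_derivative (\<lambda>h. h $ i)) (at x)"
      by (rule bounded_linear_imp_has_derivative) (rule bounded_linear_vec_nth)
    have x: "norm x < 1" using that by simp
    show ?thesis
      by (rule has_derivative_eq_rhs[OF has_derivative_minus[OF has_derivative_mult[OF ch[OF F2[OF r[OF x]]] d]]])
         (simp only: left_diff_distrib sum_subtractf sum_delta_mult, simp add: fun_eq_iff sum_distrib_left sum_distrib_right sum_negf ac_simps)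
  qed
  have G: "(f has_derivative (\<lambda>h. \<Sum>i\<in>UNIV. (- (F1 (rho x) * x $ i)) * h $ i)) (at x)" if "x \<in> ball 0 1" for x
    unfolding f_def using that by (intro ch F1 r) auto
  note * = C2_onI[OF open_ball G H c]
  have p1: "partial i f x = - (F1 (rho x) * x $ i)" if "x \<in> ball 0 1" for x i using *(2) that by blast
  have p2: "partial j (partial i f) x = F2 (rho x) * x $ j * x $ i - (if i = j then F1 (rho x) else 0)" if "x \<in> ball 0 1" for x i j
    using *(3) that by blast
  show "Ck_on 2 (ball 0 1) f" using *(1) by blast
  show "laplacian hyp_metric f x = (rho x)\<^sup>2 * ((1 - 2 * rho x) * F2 (rho x) - real CARD('n) * F1 (rho x))
      - (real CARD('n) - 2) * rho x * ((1 - 2 * rho x) * F1 (rho x))" if "norm x < 1" for x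
  proof -
    have x: "x \<in> ball 0 1" using that by simp
    have s: "(\<Sum>i\<in>UNIV. x $ i * x $ i) = 1 - 2 * rho x" by (simp add: rho_def norm_squared_sum field_simps)
    have 1: "(\<Sum>i\<in>UNIV. partial i (partial i f) x) = (1 - 2 * rho x) * F2 (rho x) - real CARD('n) * F1 (rho x)"
      unfolding p2[OF x] s[symmetric] by (simp add: sum_subtractf sum_distrib_left mult.commute mult.left_commute)
    have 2: "(\<Sum>i\<in>UNIV. x $ i * partial i f x) = - ((1 - 2 * rho x) * F1 (rho x))"
      unfolding p1[OF x] s[symmetric] by (simp add: sum_distrib_left sum_negf mult.commute mult.left_commute)
    show ?thesis unfolding laplacian_hyp_metric[OF that] 1 2 by simp
  qed
qed

lemma laplacian_inverse_rho:
  "Ck_on 2 (ball 0 1) (\<lambda>x::real^'n::finite. 1 / rho x)"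
  "norm x < 1 \<Longrightarrow> laplacian hyp_metric (\<lambda>x::real^'n::finite. 1 / rho x) x = real CARD('n) * (1 / rho x - 1)"
proof -
  note * = radial_C2[of "\<lambda>r. 1 / r" "\<lambda>r. - 1 / r\<^sup>2" "\<lambda>r. 2 / r ^ 3", where 'n = 'n]
  have 1: "((\<lambda>r. 1 / r) has_real_derivative - 1 / r\<^sup>2) (at r)" if "0 < r" for r :: real
    using that by (auto intro!: derivative_eq_intros simp: field_simps power2_eq_square)
  have 2: "((\<lambda>r. - 1 / r\<^sup>2) has_real_derivative 2 / r ^ 3) (at r)" if "0 < r" for r :: real
    using that by (auto intro!: derivative_eq_intros simp: field_simps power2_eq_square power3_eq_cube)
  have 3: "continuous_on {0<..<1} (\<lambda>r::real. 2 / r ^ 3)" by (auto intro!: continuous_intros)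
  show "Ck_on 2 (ball 0 1) (\<lambda>x::real^'n::finite. 1 / rho x)" using *(1)[OF 1 2 3] by simp
  assume x: "norm x < 1"
  then have "rho x > 0" by (simp add: rho_pos_iff)
  then have "(rho x)\<^sup>2 * ((1 - 2 * rho x) * (2 / rho x ^ 3) - real CARD('n) * (- 1 / (rho x)\<^sup>2))
      - (real CARD('n) - 2) * rho x * ((1 - 2 * rho x) * (- 1 / (rho x)\<^sup>2)) = real CARD('n) * (1 / rho x - 1)"
    by (simp add: field_simps power2_eq_square power3_eq_cube)
  then show "laplacian hyp_metric (\<lambda>x::real^'n::finite. 1 / rho x) x = real CARD('n) * (1 / rho x - 1)"
    using *(2)[OF 1 2 3 x] by simp
qed

text \<open>\<open>1 / rho x - 1\<close> is the hyperbolic cosine of the distance from \<open>x\<close> to the origin.\<close>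

lemma laplacian_cosh_powr:
  fixes x :: "real^'n::finite"
  shows "Ck_on 2 (ball 0 1) (\<lambda>x::real^'n::finite. (1 / rho x - 1) powr a)"
  "norm x < 1 \<Longrightarrow> laplacian hyp_metric (\<lambda>x::real^'n. (1 / rho x - 1) powr a) x =
     a * (real CARD('n) - 1 + a) * (1 / rho x - 1) powr a + a * (1 - a) * (1 / rho x - 1) powr (a - 2)"
proof -
  let ?u = "\<lambda>r::real. 1 / r - 1"
  note * = radial_C2[of "\<lambda>r. ?u r powr a" "\<lambda>r. - (a * ?u r powr (a - 1) / r\<^sup>2)"
      "\<lambda>r. a * (a - 1) * ?u r powr (a - 2) / r ^ 4 + 2 * a * ?u r powr (a - 1) / r ^ 3", where 'n = 'n]
  have u: "?u r > 0" if "0 < r" "r < 1" for r :: real using that by (simp add: field_simps)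
  have du: "(?u has_real_derivative - 1 / r\<^sup>2) (at r)" if "0 < r" for r :: real
    using that by (auto intro!: derivative_eq_intros simp: field_simps power2_eq_square)
  have dp: "((\<lambda>r. ?u r powr b) has_real_derivative - (b * ?u r powr (b - 1) / r\<^sup>2)) (at r)" if "0 < r" "r < 1" for r b
    by (rule DERIV_cong[OF DERIV_fun_powr[OF du[OF that(1)] u[OF that], of b]]) simp
  have 2: "((\<lambda>r. - (a * ?u r powr (a - 1) / r\<^sup>2)) has_real_derivative
      a * (a - 1) * ?u r powr (a - 2) / r ^ 4 + 2 * a * ?u r powr (a - 1) / r ^ 3) (at r)" if "0 < r" "r < 1" for r
    using that by (auto intro!: derivative_eq_intros dp simp: field_simps power2_eq_square power3_eq_cube eval_nat_numeral)
  have 3: "continuous_on {0<..<1} (\<lambda>r. a * (a - 1) * ?u r powr (a - 2) / r ^ 4 + 2 * a * ?u r powr (a - 1) / r ^ 3)"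
    by (intro continuous_intros) (use u in \<open>auto simp: field_simps\<close>)
  show "Ck_on 2 (ball 0 1) (\<lambda>x::real^'n::finite. (1 / rho x - 1) powr a)" using *(1)[OF dp 2 3] by simp
  assume x: "norm x < 1"
  have r: "0 < rho x" using x by (simp add: rho_pos_iff)
  have r1: "rho x < 1" by (simp add: rho_def) (smt (verit) zero_le_power2)
  define u where "u = 1 / rho x - 1"
  define z where "z = u powr (a - 2)"
  have u0: "u > 0" using u[OF r r1] by (simp add: u_def)
  have rr: "rho x = 1 / (u + 1)" using r by (simp add: u_def)
  have z1: "u powr (a - 1) = z * u" "u powr a = z * u\<^sup>2"
    using u0 powr_add[of u "a - 2" 1] powr_add[of u "a - 2" 2] by (simp_all add: z_def powr_numeral)
  have "laplacian hyp_metric (\<lambda>x::real^'n. (1 / rho x - 1) powr a) x =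
     (rho x)\<^sup>2 * ((1 - 2 * rho x) * (a * (a - 1) * z / rho x ^ 4 + 2 * a * (z * u) / rho x ^ 3) + real CARD('n) * (a * (z * u) / (rho x)\<^sup>2))
      + (real CARD('n) - 2) * rho x * ((1 - 2 * rho x) * (a * (z * u) / (rho x)\<^sup>2))"
    using *(2)[OF dp 2 3 x] by (simp add: u_def[symmetric] z1 z_def[symmetric])
  also have "\<dots> = a * (real CARD('n) - 1 + a) * (z * u\<^sup>2) + a * (1 - a) * z"
  proof -
    have e: "1 - 2 * rho x = rho x * (u - 1)" using r by (simp add: u_def field_simps)
    have r': "1 / rho x = u + 1" by (simp add: u_def)
    have "(rho x)\<^sup>2 * ((1 - 2 * rho x) * (a * (a - 1) * z / rho x ^ 4 + 2 * a * (z * u) / rho x ^ 3) + real CARD('n) * (a * (z * u) / (rho x)\<^sup>2))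
      + (real CARD('n) - 2) * rho x * ((1 - 2 * rho x) * (a * (z * u) / (rho x)\<^sup>2))
      = (u - 1) * (a * (a - 1) * z * (1 / rho x) + 2 * a * (z * u)) + real CARD('n) * (a * (z * u)) + (real CARD('n) - 2) * ((u - 1) * (a * (z * u)))"
      unfolding e using r by (simp add: field_simps power2_eq_square power3_eq_cube eval_nat_numeral)
    then show ?thesis unfolding r' by (simp add: algebra_simps power2_eq_square)
  qed
  finally show "laplacian hyp_metric (\<lambda>x::real^'n. (1 / rho x - 1) powr a) x =
     a * (real CARD('n) - 1 + a) * (1 / rho x - 1) powr a + a * (1 - a) * (1 / rho x - 1) powr (a - 2)"
    unfolding u_def[symmetric] z1 z_def[symmetric] .
qed

text \<open>\<open>1 / rho\<close> is a strict supersolution: if the continuous function \<open>rho (V1 - V2)\<close> had a positive maximum \<open>M\<close>,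
  then \<open>V1 - V2 - M / rho\<close> would attain the maximum 0 there with positive Laplacian.\<close>

lemma dirichlet_solution_le:
  fixes v :: "real^'n::finite \<Rightarrow> real"
  assumes V1: "dirichlet_solution v V1" and V2: "dirichlet_solution v V2" and x: "norm x < 1"
  shows "V1 x \<le> V2 x"
proof (rule ccontr)
  assume "\<not> ?thesis"
  then have gt: "V1 x > V2 x" by simp
  obtain W1 where W1: "continuous_on (cball 0 1) W1" "\<And>x. x \<in> ball 0 1 \<Longrightarrow> W1 x = rho x * V1 x" "\<And>x. x \<in> sphere 0 1 \<Longrightarrow> W1 x = v x"
    using V1 by (auto simp: dirichlet_solution_def)
  obtain W2 where W2: "continuous_on (cball 0 1) W2" "\<And>x. x \<in> ball 0 1 \<Longrightarrow> W2 x = rho x * V2 x" "\<And>x. x \<in> sphere 0 1 \<Longrightarrow> W2 x = v x"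
    using V2 by (auto simp: dirichlet_solution_def)
  define w where "w = (\<lambda>x. W1 x - W2 x)"
  have "continuous_on (cball 0 1) w" unfolding w_def using W1 W2 by (intro continuous_intros)
  then obtain y where y: "y \<in> cball 0 1" "\<And>z. z \<in> cball 0 1 \<Longrightarrow> w z \<le> w y"
    using continuous_attains_sup[of "cball 0 1" w] by fastforce
  have "w x > 0" using gt x W1(2)[of x] W2(2)[of x] rho_pos_iff[of x] by (simp add: w_def)
  then have M: "w y > 0" using y(2)[of x] x by simp
  have "y \<notin> sphere 0 1"
  proof
    assume "y \<in> sphere 0 1"
    then have "w y = 0" using W1(3)[of y] W2(3)[of y] by (simp add: w_def)
    with M show False by simp
  qed
  then have y1: "norm y < 1" using y(1) by auto
  \<comment> \<open>The factors 1 and -1 are written out so that \<open>f\<close> has the shape of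
    the linear combinations whose regularity and Laplacian are known.\<close>
  define f where "f = (\<lambda>x. 1 * (1 * V1 x + (-1) * V2 x) + (- w y) * (1 / rho x))"
  have C1: "Ck_on 2 (ball 0 1) V1" "Ck_on 2 (ball 0 1) V2" using V1 V2 by (auto simp: dirichlet_solution_def)
  have C2: "Ck_on 2 (ball 0 1) (\<lambda>x. 1 * V1 x + (-1) * V2 x)" by (rule C2_on_lin(1)[OF open_ball C1])
  have f: "Ck_on 2 (ball 0 1) f" unfolding f_def by (rule C2_on_lin(1)[OF open_ball C2 laplacian_inverse_rho(1)])
  have fw: "f z = (w z - w y) / rho z" if "z \<in> ball 0 1" for z
    using W1(2)[OF that] W2(2)[OF that] that rho_pos_iff[of z] by (simp add: f_def w_def field_simps)
  have "laplacian hyp_metric f y \<le> 0"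
  proof (rule laplacian_local_max[OF f open_ball])
    fix z :: "real^'n" assume z: "z \<in> ball 0 1"
    then have "w z - w y \<le> 0" "rho z > 0" using y(2)[of z] by (auto simp: rho_pos_iff)
    then have "f z \<le> 0" unfolding fw[OF z] by (simp add: divide_nonpos_pos)
    then show "f z \<le> f y" using fw[of y] y1 by simp
  qed (use y1 in auto)
  moreover have "laplacian hyp_metric f y = real CARD('n) * w y"
  proof -
    have "laplacian hyp_metric f y = (laplacian hyp_metric V1 y - laplacian hyp_metric V2 y) - w y * (real CARD('n) * (1 / rho y - 1))"
      unfolding f_def laplacian_lin[OF C2 laplacian_inverse_rho(1) y1] laplacian_lin[OF C1 y1] laplacian_inverse_rho(2)[OF y1] by simp
    also have "\<dots> = real CARD('n) * (f y + w y)"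
      using V1 V2 y1 by (simp add: dirichlet_solution_def f_def algebra_simps)
    finally show ?thesis using fw[of y] y1 by simp
  qed
  ultimately show False using M by (simp add: mult_le_0_iff)
qed

section \<open>Integration over the sphere\<close>

lemma compact_product_bound:
  fixes K :: "'a::topological_space \<Rightarrow> 'b::topological_space \<Rightarrow> real"
  assumes c: "continuous_on (A \<times> B) (\<lambda>(x, \<xi>). K x \<xi>)" and "compact A" "compact B"
  obtains C where "\<And>x \<xi>. x \<in> A \<Longrightarrow> \<xi> \<in> B \<Longrightarrow> \<bar>K x \<xi>\<bar> \<le> C"
proof -
  have "compact ((\<lambda>(x, \<xi>). K x \<xi>) ` (A \<times> B))"
    using assms by (intro compact_continuous_image compact_Times)
  then have "bounded ((\<lambda>(x, \<xi>). K x \<xi>) ` (A \<times> B))" by (rule compact_imp_bounded)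
  then obtain C where C: "\<forall>z\<in>(\<lambda>(x, \<xi>). K x \<xi>) ` (A \<times> B). norm z \<le> C"
    unfolding bounded_iff ..
  show thesis
  proof (rule that)
    fix x \<xi> assume "x \<in> A" "\<xi> \<in> B"
    then have "K x \<xi> \<in> (\<lambda>(x, \<xi>). K x \<xi>) ` (A \<times> B)" by force
    then show "\<bar>K x \<xi>\<bar> \<le> C" using C by fastforce
  qed
qed

lemma continuous_on_slice:
  assumes c: "continuous_on (A \<times> B) (\<lambda>(x, \<xi>). K x \<xi>)"
  shows "y \<in> A \<Longrightarrow> continuous_on B (K y)" "\<eta> \<in> B \<Longrightarrow> continuous_on A (\<lambda>x. K x \<eta>)"
proof -
  assume y: "y \<in> A"
  have "continuous_on B ((\<lambda>(x, \<xi>). K x \<xi>) \<circ> Pair y)"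
    using y by (intro continuous_on_compose continuous_intros continuous_on_subset[OF c]) auto
  then show "continuous_on B (K y)" by (simp add: o_def)
next
  assume \<eta>: "\<eta> \<in> B"
  have "continuous_on A ((\<lambda>(x, \<xi>). K x \<xi>) \<circ> (\<lambda>x. (x, \<eta>)))"
    using \<eta> by (intro continuous_on_compose continuous_intros continuous_on_subset[OF c]) auto
  then show "continuous_on A (\<lambda>x. K x \<eta>)" by (simp add: o_def)
qed

lemma space_sphere_measure [simp]: "space sphere_measure = sphere (0::real^'n::finite) 1"
  by (simp add: sphere_measure_def space_scale_measure space_restrict_space)

lemma sets_sphere_measure: "sets sphere_measure = sets (restrict_space borel (sphere (0::real^'n::finite) 1))"
  by (simp add: sphere_measure_def)

lemma radial_projection_measurable:
  "(\<lambda>x::real^'n::finite. x /\<^sub>R norm x) \<in> restrict_space lborel (ball 0 1 - {0}) \<rightarrow>\<^sub>M restrict_space borel (sphere 0 1)"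
proof (rule measurable_restrict_space2)
  have "(\<lambda>x::real^'n. x /\<^sub>R norm x) \<in> borel_measurable borel" by measurable
  then show "(\<lambda>x::real^'n. x /\<^sub>R norm x) \<in> borel_measurable (restrict_space lborel (ball 0 1 - {0}))"
    by (intro measurable_restrict_space1) simp
qed (auto simp: space_restrict_space)

lemma sphere_measure_eq_density:
  "(sphere_measure :: (real^'n::finite) measure) = density (distr (restrict_space lborel (ball 0 1 - {0})) (restrict_space borel (sphere 0 1))
        (\<lambda>x. x /\<^sub>R norm x)) (\<lambda>_. ennreal (real CARD('n)))"
  by (rule measure_eqI) (auto simp: sphere_measure_def emeasure_density_const ennreal_of_nat_eq_real_of_nat)

lemma integral_sphere_measure:
  fixes F :: "real^'n::finite \<Rightarrow> real"
  assumes F: "F \<in> borel_measurable sphere_measure"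
  shows "(LINT \<xi>|sphere_measure. F \<xi>) =
    real CARD('n) * (LINT x|lborel. indicator (ball 0 1 - {0}) x * F (x /\<^sub>R norm x))"
proof -
  have F': "F \<in> borel_measurable (restrict_space borel (sphere 0 1))"
    using F measurable_cong_sets[OF sets_sphere_measure refl] by blast
  have "(LINT \<xi>|sphere_measure. F \<xi>) = (LINT \<xi>|distr (restrict_space lborel (ball 0 1 - {0})) (restrict_space borel (sphere 0 1)) (\<lambda>x. x /\<^sub>R norm x). real CARD('n) * F \<xi>)"
    unfolding sphere_measure_eq_density using F' by (subst integral_density) auto
  also have "\<dots> = (LINT x|restrict_space lborel (ball 0 1 - {0}). real CARD('n) * F (x /\<^sub>R norm x))"
    using F' radial_projection_measurable by (subst integral_distr) auto
  also have "\<dots> = (LINT x|lborel. indicator (ball 0 1 - {0}) x * (real CARD('n) * F (x /\<^sub>R norm x)))"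
    by (subst integral_restrict_space) auto
  also have "\<dots> = (LINT x|lborel. real CARD('n) * (indicator (ball 0 1 - {0}) x * F (x /\<^sub>R norm x)))"
    by (simp add: mult.left_commute)
  finally show ?thesis by simp
qed

lemma finite_sphere_measure: "finite_measure (sphere_measure :: (real^'n::finite) measure)"
proof
  have m: "(\<lambda>x::real^'n. x /\<^sub>R norm x) \<in> restrict_space lborel (ball 0 1 - {0}) \<rightarrow>\<^sub>M restrict_space borel (sphere 0 1)"
    by (rule radial_projection_measurable)
  have "emeasure (distr (restrict_space lborel (ball (0::real^'n) 1 - {0})) (restrict_space borel (sphere 0 1)) (\<lambda>x. x /\<^sub>R norm x)) (sphere 0 1)
     = emeasure lborel (ball (0::real^'n) 1 - {0})"
    by (subst emeasure_distr[OF m]) (auto simp: space_restrict_space sets_restrict_space emeasure_restrict_space intro!: arg_cong2[where f=emeasure])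
  also have "\<dots> \<le> emeasure lborel (ball (0::real^'n) 1)" by (rule emeasure_mono) auto
  also have "\<dots> < \<infinity>" by (rule emeasure_lborel_ball_finite)
  finally show "emeasure (sphere_measure :: (real^'n) measure) (space sphere_measure) \<noteq> \<infinity>"
    by (simp add: sphere_measure_def space_scale_measure space_restrict_space ennreal_mult_eq_top_iff ennreal_of_nat_eq_real_of_nat less_top)
qed

lemma sphere_measure_pos: "measure (sphere_measure :: (real^'n::finite) measure) (sphere 0 1) > 0"
proof -
  have "measure (sphere_measure :: (real^'n::finite) measure) (sphere 0 1) = (LINT \<xi>|(sphere_measure :: (real^'n) measure). 1)" by simp
  also have "\<dots> = real CARD('n) * (LINT x|lborel. indicator (ball (0::real^'n) 1 - {0}) x)"
    by (subst integral_sphere_measure) auto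
  also have "(LINT x|lborel. indicator (ball (0::real^'n) 1 - {0}) x) = measure lborel (ball (0::real^'n) 1 - {0})" by simp
  also have "\<dots> = measure lborel (ball (0::real^'n) 1)"
    by (rule measure_Diff_null_set) auto
  finally show ?thesis using content_ball_pos[of 1 "0::real^'n"] by simp
qed

lemma continuous_on_sphere_measurable:
  "continuous_on (sphere 0 1) F \<Longrightarrow> F \<in> borel_measurable (sphere_measure :: (real^'n::finite) measure)"
  for F :: "real^'n::finite \<Rightarrow> real"
  using borel_measurable_continuous_on_restrict measurable_cong_sets[OF sets_sphere_measure refl] by blast

lemma integrable_sphere_measure:
  fixes F :: "real^'n::finite \<Rightarrow> real"
  assumes "continuous_on (sphere 0 1) F"
  shows "integrable sphere_measure F"
proof -
  obtain B where "\<And>z. z \<in> F ` sphere 0 1 \<Longrightarrow> norm z \<le> B"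
    using compact_imp_bounded[OF compact_continuous_image[OF assms compact_sphere]] unfolding bounded_iff by blast
  then show ?thesis
    by (intro finite_measure.integrable_const_bound[OF finite_sphere_measure, of _ B])
       (auto intro!: AE_I2 continuous_on_sphere_measurable assms)
qed

section \<open>Differentiation under the integral sign\<close>

text \<open>The remainder quotient tends to 0 for every \<open>\<xi>\<close>, and the mean value
  inequality bounds it by \<open>2 * C\<close>, a constant integrable over a finite measure;
  dominated convergence along sequences gives the derivative.\<close>

lemma has_derivative_integral_param:
  fixes k :: "real^'n::finite \<Rightarrow> 'b \<Rightarrow> real"
  assumes M: "finite_measure M" and \<delta>: "\<delta> > 0"
    and d: "\<And>y \<xi>. y \<in> ball x \<delta> \<Longrightarrow> \<xi> \<in> space M \<Longrightarrow> ((\<lambda>y. k y \<xi>) has_derivative (\<lambda>h. \<Sum>i\<in>UNIV. k' i y \<xi> * h $ i)) (at y)"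
    and ik: "\<And>y. y \<in> ball x \<delta> \<Longrightarrow> integrable M (k y)" and ik': "\<And>i. integrable M (k' i x)"
    and bd: "\<And>y \<xi> i. y \<in> ball x \<delta> \<Longrightarrow> \<xi> \<in> space M \<Longrightarrow> \<bar>k' i y \<xi>\<bar> \<le> B"
  shows "((\<lambda>y. LINT \<xi>|M. k y \<xi>) has_derivative (\<lambda>h. \<Sum>i\<in>UNIV. (LINT \<xi>|M. k' i x \<xi>) * h $ i)) (at x)"
proof -
  interpret finite_measure M by fact
  define C where "C = real CARD('n) * \<bar>B\<bar>"
  have C: "C \<ge> 0" by (simp add: C_def)
  have lin: "\<bar>\<Sum>i\<in>UNIV. k' i y \<xi> * h $ i\<bar> \<le> C * norm h" if "y \<in> ball x \<delta>" "\<xi> \<in> space M" for y \<xi> h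
  proof -
    have "\<bar>\<Sum>i\<in>UNIV. k' i y \<xi> * h $ i\<bar> \<le> (\<Sum>i\<in>UNIV. \<bar>k' i y \<xi> * h $ i\<bar>)" by (rule sum_abs)
    also have "\<dots> \<le> (\<Sum>i\<in>(UNIV::'n set). \<bar>B\<bar> * norm h)"
      using order_trans[OF bd[OF that] abs_ge_self] component_le_norm_cart[of h] unfolding abs_mult
      by (intro sum_mono mult_mono) auto
    finally show ?thesis by (simp add: C_def)
  qed
  have lip: "\<bar>k y \<xi> - k x \<xi>\<bar> \<le> C * norm (y - x)" if "y \<in> ball x \<delta>" "\<xi> \<in> space M" for y \<xi>
  proof -
    have "norm (k y \<xi> - k x \<xi>) \<le> C * norm (y - x)"
    proof (rule differentiable_bound[of "ball x \<delta>" "\<lambda>y. k y \<xi>" "\<lambda>y h. \<Sum>i\<in>UNIV. k' i y \<xi> * h $ i"])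
      show "onorm (\<lambda>h. \<Sum>i\<in>UNIV. k' i z \<xi> * h $ i) \<le> C" if "z \<in> ball x \<delta>" for z
        using lin[OF that \<open>\<xi> \<in> space M\<close>] by (intro onorm_le) auto
    qed (use that \<delta> d in \<open>auto intro: has_derivative_at_withinI\<close>)
    then show ?thesis by simp
  qed
  have xb: "x \<in> ball x \<delta>" using \<delta> by simp
  have iD: "integrable M (\<lambda>\<xi>. \<Sum>i\<in>UNIV. k' i x \<xi> * h $ i)" for h using ik' by (intro Bochner_Integration.integrable_sum) auto
  have "bounded_linear (\<lambda>h::real^'n. \<Sum>i\<in>UNIV. (LINT \<xi>|M. k' i x \<xi>) * h $ i)"
    by (intro bounded_linear_sum bounded_linear_mult_right[THEN bounded_linear_compose] bounded_linear_vec_nth)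
  moreover have "((\<lambda>y. ((LINT \<xi>|M. k y \<xi>) - (LINT \<xi>|M. k x \<xi>) - (\<Sum>i\<in>UNIV. (LINT \<xi>|M. k' i x \<xi>) * (y - x) $ i)) /\<^sub>R norm (y - x)) \<longlongrightarrow> 0) (at x)"
    unfolding tendsto_at_iff_sequentially
  proof (intro allI impI)
    fix X :: "nat \<Rightarrow> real^'n"
    assume X1: "\<forall>i. X i \<in> UNIV - {x}" and X2: "X \<longlonglongrightarrow> x"
    define q where "q = (\<lambda>y \<xi>. (k y \<xi> - k x \<xi> - (\<Sum>i\<in>UNIV. k' i x \<xi> * (y - x) $ i)) /\<^sub>R norm (y - x))"
    have "\<forall>\<^sub>F n in sequentially. X n \<in> ball x \<delta>" using X2 xb by (intro topological_tendstoD) auto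
    \<comment> \<open>Only a tail of the sequence is known to lie in the ball, so all integrands are
      shifted by \<open>N\<close> and the shift is undone at the end.\<close>
    then obtain N where N: "\<And>n. n \<ge> N \<Longrightarrow> X n \<in> ball x \<delta>" by (auto simp: eventually_sequentially)
    have lim: "(\<lambda>n. LINT \<xi>|M. q (X (n + N)) \<xi>) \<longlonglongrightarrow> (LINT \<xi>|M. 0)"
    proof (rule integral_dominated_convergence[where w = "\<lambda>_. 2 * C"])
      show "(\<lambda>\<xi>. q (X (n + N)) \<xi>) \<in> borel_measurable M" for n
      proof -
        have [measurable]: "k (X (n + N)) \<in> borel_measurable M" "k x \<in> borel_measurable M"
          using ik[OF N, of "n + N"] ik[OF xb] by auto
        have [measurable]: "(\<lambda>\<xi>. \<Sum>i\<in>UNIV. k' i x \<xi> * (X (n + N) - x) $ i) \<in> borel_measurable M"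
          by (rule borel_measurable_integrable[OF iD])
        show ?thesis unfolding q_def by measurable
      qed
      show "AE \<xi> in M. (\<lambda>n. q (X (n + N)) \<xi>) \<longlonglongrightarrow> 0"
      proof (intro AE_I2)
        fix \<xi> assume \<xi>: "\<xi> \<in> space M"
        have "((\<lambda>y. q y \<xi>) \<longlongrightarrow> 0) (at x)"
          using d[OF xb \<xi>] unfolding has_derivative_at_within q_def by (simp add: diff_diff_eq)
        then have "(\<lambda>n. q (X n) \<xi>) \<longlonglongrightarrow> 0"
          using X1 X2 unfolding tendsto_at_iff_sequentially o_def by blast
        then show "(\<lambda>n. q (X (n + N)) \<xi>) \<longlonglongrightarrow> 0" by (rule LIMSEQ_ignore_initial_segment)
      qed
      show "AE \<xi> in M. norm (q (X (n + N)) \<xi>) \<le> 2 * C" for n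
      proof (intro AE_I2)
        fix \<xi> assume \<xi>: "\<xi> \<in> space M"
        have Xb: "X (n + N) \<in> ball x \<delta>" by (rule N) simp
        have pos: "norm (X (n + N) - x) > 0" using X1 by auto
        have "\<bar>k (X (n+N)) \<xi> - k x \<xi> - (\<Sum>i\<in>UNIV. k' i x \<xi> * (X (n+N) - x) $ i)\<bar> \<le> 2 * C * norm (X (n+N) - x)"
          using lip[OF Xb \<xi>] lin[OF xb \<xi>, of "X (n+N) - x"] by linarith
        then show "norm (q (X (n + N)) \<xi>) \<le> 2 * C" using pos by (simp add: q_def abs_mult field_simps)
      qed
    qed simp_all
    have "(LINT \<xi>|M. q (X (n + N)) \<xi>) = ((LINT \<xi>|M. k (X (n+N)) \<xi>) - (LINT \<xi>|M. k x \<xi>) - (\<Sum>i\<in>UNIV. (LINT \<xi>|M. k' i x \<xi>) * (X (n+N) - x) $ i)) /\<^sub>R norm (X (n+N) - x)" for n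
    proof -
      have "integrable M (k (X (n + N)))" "integrable M (k x)" using ik N xb by auto
      then show ?thesis
        unfolding q_def using iD ik' by (simp add: Bochner_Integration.integral_sum)
    qed
    with lim have "(\<lambda>n. ((LINT \<xi>|M. k (X (n+N)) \<xi>) - (LINT \<xi>|M. k x \<xi>) - (\<Sum>i\<in>UNIV. (LINT \<xi>|M. k' i x \<xi>) * (X (n+N) - x) $ i)) /\<^sub>R norm (X (n+N) - x)) \<longlonglongrightarrow> 0" by simp
    then have "(\<lambda>n. ((LINT \<xi>|M. k (X n) \<xi>) - (LINT \<xi>|M. k x \<xi>) - (\<Sum>i\<in>UNIV. (LINT \<xi>|M. k' i x \<xi>) * (X n - x) $ i)) /\<^sub>R norm (X n - x)) \<longlonglongrightarrow> 0"
      by (rule LIMSEQ_offset)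
    then show "((\<lambda>y. ((LINT \<xi>|M. k y \<xi>) - (LINT \<xi>|M. k x \<xi>) - (\<Sum>i\<in>UNIV. (LINT \<xi>|M. k' i x \<xi>) * (y - x) $ i)) /\<^sub>R norm (y - x)) \<circ> X) \<longlonglongrightarrow> 0"
      by (simp add: o_def)
  qed
  ultimately show ?thesis
    unfolding has_derivative_at_within by (simp add: diff_diff_eq)
qed

lemma continuous_on_integral_sphere:
  fixes K :: "real^'n::finite \<Rightarrow> real^'n \<Rightarrow> real"
  assumes U: "open U" and c: "continuous_on (U \<times> sphere 0 1) (\<lambda>(x, \<xi>). K x \<xi>)"
  shows "continuous_on U (\<lambda>x. LINT \<xi>|sphere_measure. K x \<xi>)"
proof (rule continuous_at_imp_continuous_on, rule ballI)
  fix x assume x: "x \<in> U"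
  obtain \<delta> where \<delta>: "\<delta> > 0" "cball x \<delta> \<subseteq> U" using U x open_contains_cball by blast
  have cc: "continuous_on (cball x \<delta> \<times> sphere 0 1) (\<lambda>(x, \<xi>). K x \<xi>)"
    using \<delta> by (intro continuous_on_subset[OF c]) auto
  obtain B where B: "\<And>y \<xi>. y \<in> cball x \<delta> \<Longrightarrow> \<xi> \<in> sphere 0 1 \<Longrightarrow> \<bar>K y \<xi>\<bar> \<le> B"
    by (rule compact_product_bound[OF cc compact_cball compact_sphere]) blast
  have cK: "continuous_on (sphere 0 1) (K y)" if "y \<in> U" for y
    using continuous_on_slice(1)[OF c that] .
  show "isCont (\<lambda>x. LINT \<xi>|sphere_measure. K x \<xi>) x"
    unfolding isCont_def tendsto_at_iff_sequentially
  proof (intro allI impI)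
    fix X :: "nat \<Rightarrow> real^'n"
    assume X: "X \<longlonglongrightarrow> x"
    have "\<forall>\<^sub>F n in sequentially. X n \<in> ball x \<delta>" using X \<delta> by (intro topological_tendstoD) auto
    then have "\<forall>\<^sub>F n in sequentially. X n \<in> cball x \<delta>" by eventually_elim auto
    then obtain N where N: "\<And>n. n \<ge> N \<Longrightarrow> X n \<in> cball x \<delta>" unfolding eventually_sequentially by blast
    have "(\<lambda>n. LINT \<xi>|sphere_measure. K (X (n + N)) \<xi>) \<longlonglongrightarrow> (LINT \<xi>|sphere_measure. K x \<xi>)"
    proof (rule integral_dominated_convergence[where w = "\<lambda>_. B"])
      show "K x \<in> borel_measurable sphere_measure" "K (X (n + N)) \<in> borel_measurable sphere_measure" for n
        using N[of "n + N"] \<delta> x by (auto intro!: continuous_on_sphere_measurable cK)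
      show "integrable sphere_measure (\<lambda>_. B)" by (rule integrable_sphere_measure) simp
      show "AE \<xi> in sphere_measure. norm (K (X (n + N)) \<xi>) \<le> B" for n
        using N[of "n + N"] by (intro AE_I2) (auto intro!: B)
      show "AE \<xi> in sphere_measure. (\<lambda>n. K (X (n + N)) \<xi>) \<longlonglongrightarrow> K x \<xi>"
      proof (intro AE_I2)
        fix \<xi> :: "real^'n" assume \<xi>: "\<xi> \<in> space sphere_measure"
        have "continuous_on U (\<lambda>y. K y \<xi>)"
          using continuous_on_slice(2)[OF c] \<xi> by simp
        then have "isCont (\<lambda>y. K y \<xi>) x" using x U by (simp add: continuous_on_eq_continuous_at)
        then have "(\<lambda>n. K (X n) \<xi>) \<longlonglongrightarrow> K x \<xi>" using X by (rule isCont_tendsto_compose)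
        then show "(\<lambda>n. K (X (n + N)) \<xi>) \<longlonglongrightarrow> K x \<xi>" by (rule LIMSEQ_ignore_initial_segment)
      qed
    qed
    then show "((\<lambda>x. LINT \<xi>|sphere_measure. K x \<xi>) \<circ> X) \<longlonglongrightarrow> (LINT \<xi>|sphere_measure. K x \<xi>)"
      unfolding o_def by (rule LIMSEQ_offset)
  qed
qed

text \<open>The uniform bound on the derivative needed for domination comes from compactness of a
  closed ball times the sphere.\<close>

lemma has_derivative_integral_sphere:
  fixes K :: "real^'n::finite \<Rightarrow> real^'n \<Rightarrow> real"
  assumes U: "open U" "x \<in> U" and c: "continuous_on (U \<times> sphere 0 1) (\<lambda>(x, \<xi>). K x \<xi>)"
    and c': "\<And>i. continuous_on (U \<times> sphere 0 1) (\<lambda>(x, \<xi>). K' i x \<xi>)"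
    and d: "\<And>y \<xi>. y \<in> U \<Longrightarrow> \<xi> \<in> sphere 0 1 \<Longrightarrow> ((\<lambda>y. K y \<xi>) has_derivative (\<lambda>h. \<Sum>i\<in>UNIV. K' i y \<xi> * h $ i)) (at y)"
  shows "((\<lambda>y. LINT \<xi>|sphere_measure. K y \<xi>) has_derivative (\<lambda>h. \<Sum>i\<in>UNIV. (LINT \<xi>|sphere_measure. K' i x \<xi>) * h $ i)) (at x)"
proof -
  obtain \<delta> where \<delta>: "\<delta> > 0" "cball x \<delta> \<subseteq> U" using U open_contains_cball by blast
  have "\<exists>B. \<forall>y\<in>cball x \<delta>. \<forall>\<xi>\<in>sphere 0 1. \<bar>K' i y \<xi>\<bar> \<le> B" for i
  proof -
    have "continuous_on (cball x \<delta> \<times> sphere 0 1) (\<lambda>(x, \<xi>). K' i x \<xi>)"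
      using \<delta> by (intro continuous_on_subset[OF c']) auto
    then show ?thesis by (rule compact_product_bound[OF _ compact_cball compact_sphere]) blast
  qed
  then obtain B where B: "\<And>i y \<xi>. y \<in> cball x \<delta> \<Longrightarrow> \<xi> \<in> sphere 0 1 \<Longrightarrow> \<bar>K' i y \<xi>\<bar> \<le> B i" by metis
  have cs: "continuous_on (sphere 0 1) (F y)" if "continuous_on (U \<times> sphere 0 1) (\<lambda>(x, \<xi>). F x \<xi>)" "y \<in> U" for F :: "real^'n \<Rightarrow> real^'n \<Rightarrow> real" and y
    using continuous_on_slice(1)[OF that] .
  show ?thesis
  proof (rule has_derivative_integral_param[OF finite_sphere_measure \<delta>(1), where B = "Max (range B)"])
    show "\<bar>K' i y \<xi>\<bar> \<le> Max (range B)" if "y \<in> ball x \<delta>" "\<xi> \<in> space sphere_measure" for y \<xi> i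
      using B[of y \<xi> i] that by (intro order_trans[OF _ Max_ge[of _ "B i"]]) auto
    show "integrable sphere_measure (K y)" if "y \<in> ball x \<delta>" for y
      using that \<delta>(2) by (intro integrable_sphere_measure cs[OF c]) auto
    show "integrable sphere_measure (K' i x)" for i
      using U by (intro integrable_sphere_measure cs[OF c'])
    show "((\<lambda>y. K y \<xi>) has_derivative (\<lambda>h. \<Sum>i\<in>UNIV. K' i y \<xi> * h $ i)) (at y)"
      if "y \<in> ball x \<delta>" "\<xi> \<in> space sphere_measure" for y \<xi>
      using that \<delta>(2) by (intro d) auto
  qed
qed

lemma nn_integral_lborel_translate:
  fixes h :: "'a::euclidean_space \<Rightarrow> ennreal"
  assumes [measurable]: "h \<in> borel_measurable borel"
  shows "(\<integral>\<^sup>+x. h (x + c) \<partial>lborel) = (\<integral>\<^sup>+x. h x \<partial>lborel)"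
proof -
  have "(\<integral>\<^sup>+x. h x \<partial>lborel) = (\<integral>\<^sup>+x. h x \<partial>distr lborel borel ((+) c))" by (simp add: lborel_distr_plus)
  also have "\<dots> = (\<integral>\<^sup>+x. h (x + c) \<partial>lborel)" by (subst nn_integral_distr) (auto simp: add.commute)
  finally show ?thesis by simp
qed

text \<open>The ball is invariant under \<open>Q\<close>. Integrating the indicator of \<open>ball \<times> B\<close> over the product and using only translations
  and Fubini, the volume of the preimage of \<open>B\<close> is compared with that of \<open>B\<close>.\<close>

lemma orthogonal_distr_lborel:
  fixes Q :: "real^'n::finite \<Rightarrow> real^'n"
  assumes Q: "orthogonal_transformation Q"
  shows "distr lborel borel Q = lborel"
proof (rule measure_eqI)
  have linQ: "linear Q" using Q by (rule orthogonal_transformation_linear)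
  have cQ [measurable]: "Q \<in> borel_measurable borel"
    using linear_continuous_on[OF linear_conv_bounded_linear[THEN iffD1, OF linQ]] by (rule borel_measurable_continuous_onI)
  define Q' where "Q' = inv Q"
  have QQ': "Q (Q' x) = x" for x
    unfolding Q'_def using orthogonal_transformation_surj[OF Q] by (rule surj_f_inv_f)
  have nQ: "norm (Q x) = norm x" for x using Q by (rule orthogonal_transformation_norm)
  fix B assume "B \<in> sets (distr lborel borel Q)"
  then have [measurable]: "B \<in> sets borel" by simp
  define A where "A = ball (0::real^'n) 1"
  have [measurable]: "A \<in> sets borel" by (simp add: A_def)
  define a where "a = emeasure lborel A"
  have a: "a \<noteq> 0" "a < \<infinity>" using emeasure_lborel_ball_finite[of "0::real^'n" 1] open_not_negligible[of A]
    by (auto simp: a_def A_def negligible_iff_null_sets null_sets_def)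
  define b where "b = (\<integral>\<^sup>+y. indicator B (Q y) \<partial>lborel)"
  have "a * b = (\<integral>\<^sup>+x. \<integral>\<^sup>+y. indicator A x * indicator B (Q y) \<partial>lborel \<partial>lborel)"
    by (simp add: nn_integral_cmult nn_integral_multc a_def b_def)
  also have "\<dots> = (\<integral>\<^sup>+x. \<integral>\<^sup>+y. indicator A x * indicator B (Q y + x) \<partial>lborel \<partial>lborel)"
  proof (rule nn_integral_cong)
    fix x
    have "Q (y + Q' x) = Q y + x" for y using linear_add[OF linQ] QQ' by simp
    then show "(\<integral>\<^sup>+y. indicator A x * indicator B (Q y) \<partial>lborel) = (\<integral>\<^sup>+y. indicator A x * indicator B (Q y + x) \<partial>lborel)"
      using nn_integral_lborel_translate[of "\<lambda>y. indicator A x * indicator B (Q y)" "Q' x"] by simp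
  qed
  also have "\<dots> = (\<integral>\<^sup>+y. \<integral>\<^sup>+x. indicator A x * indicator B (Q y + x) \<partial>lborel \<partial>lborel)"
    by (rule lborel_pair.Fubini'[symmetric]) measurable
  also have "\<dots> = (\<integral>\<^sup>+y. \<integral>\<^sup>+x. indicator A (x - Q y) * indicator B x \<partial>lborel \<partial>lborel)"
  proof (rule nn_integral_cong)
    fix y
    show "(\<integral>\<^sup>+x. indicator A x * indicator B (Q y + x) \<partial>lborel) = (\<integral>\<^sup>+x. indicator A (x - Q y) * indicator B x \<partial>lborel)"
      using nn_integral_lborel_translate[of "\<lambda>x. indicator A (x - Q y) * indicator B x" "Q y"] by (simp add: add.commute)
  qed
  also have "\<dots> = (\<integral>\<^sup>+x. \<integral>\<^sup>+y. indicator A (x - Q y) * indicator B x \<partial>lborel \<partial>lborel)"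
    by (rule lborel_pair.Fubini'[symmetric]) measurable
  \<comment> \<open>Since \<open>Q\<close> preserves norms, \<open>x - Q y\<close> lies in the unit
    ball exactly when \<open>y - Q' x\<close> does; the inner integral is thus the volume
    \<open>a\<close> of the ball for every \<open>x\<close>, and \<open>a\<close> is finite and
    nonzero.\<close>
  also have "\<dots> = (\<integral>\<^sup>+x. a * indicator B x \<partial>lborel)"
  proof (rule nn_integral_cong)
    fix x
    have "indicator A (x - Q y) = (indicator A (y - Q' x) :: ennreal)" for y
    proof -
      have "x - Q y = Q (Q' x - y)" using linear_diff[OF linQ] QQ' by simp
      then have "norm (x - Q y) = norm (y - Q' x)" using nQ by (simp add: norm_minus_commute)
      then show ?thesis by (simp add: A_def indicator_def)
    qed
    then have "(\<integral>\<^sup>+y. indicator A (x - Q y) * indicator B x \<partial>lborel) = (\<integral>\<^sup>+y. indicator A (y - Q' x) \<partial>lborel) * indicator B x"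
      by (simp add: nn_integral_multc)
    also have "(\<integral>\<^sup>+y. indicator A (y - Q' x) \<partial>lborel) = a"
      using nn_integral_lborel_translate[of "\<lambda>y. indicator A (y - Q' x)" "Q' x"] by (simp add: a_def)
    finally show "(\<integral>\<^sup>+y. indicator A (x - Q y) * indicator B x \<partial>lborel) = a * indicator B x" .
  qed
  also have "\<dots> = a * emeasure lborel B" by (simp add: nn_integral_cmult)
  finally have "b = emeasure lborel B" using a by (auto simp: ennreal_mult_cancel_left)
  moreover have "emeasure (distr lborel borel Q) B = (\<integral>\<^sup>+y. indicator B y \<partial>distr lborel borel Q)" by simp
  moreover have "\<dots> = b" unfolding b_def by (rule nn_integral_distr) measurable
  ultimately show "emeasure (distr lborel borel Q) B = emeasure lborel B" by simp
qed simp

lemma integral_sphere_orthogonal: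
  fixes F :: "real^'n::finite \<Rightarrow> real" and Q :: "real^'n \<Rightarrow> real^'n"
  assumes Q: "orthogonal_transformation Q" and F: "continuous_on (sphere 0 1) F"
  shows "(LINT \<xi>|sphere_measure. F (Q \<xi>)) = (LINT \<xi>|sphere_measure. F \<xi>)"
proof -
  have linQ: "linear Q" using Q by (rule orthogonal_transformation_linear)
  have contQ: "continuous_on A Q" for A
    using linear_continuous_on[OF linear_conv_bounded_linear[THEN iffD1, OF linQ]] .
  have cQ: "Q \<in> borel_measurable borel" using contQ by (rule borel_measurable_continuous_onI)
  have nQ: "norm (Q x) = norm x" for x using Q by (rule orthogonal_transformation_norm)
  have Fm: "F \<in> borel_measurable sphere_measure" using F by (rule continuous_on_sphere_measurable)
  have FQm: "(\<lambda>\<xi>. F (Q \<xi>)) \<in> borel_measurable sphere_measure"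
    by (rule continuous_on_sphere_measurable, rule continuous_on_compose2[OF F contQ]) (auto simp: nQ)
  define g where "g = (\<lambda>x. indicator (ball 0 1 - {0}) x * F (x /\<^sub>R norm x))"
  have gm: "g \<in> borel_measurable borel"
  proof -
    have "(\<lambda>x. F (x /\<^sub>R norm x)) \<in> borel_measurable (restrict_space borel (ball 0 1 - {0}))"
      by (intro borel_measurable_continuous_on_restrict continuous_on_compose2[OF F])
         (auto intro!: continuous_intros, metis left_inverse norm_eq_zero)
    then show ?thesis unfolding g_def
      by (subst (asm) borel_measurable_restrict_space_iff) auto
  qed
  have "(LINT x|lborel. g x) = (LINT x|distr lborel borel Q. g x)" by (simp add: orthogonal_distr_lborel[OF Q])
  also have "\<dots> = (LINT x|lborel. g (Q x))" using cQ gm by (subst integral_distr) auto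
  also have "\<dots> = (LINT x|lborel. indicator (ball 0 1 - {0}) x * F (Q (x /\<^sub>R norm x)))"
  proof (rule Bochner_Integration.integral_cong[OF refl])
    fix x
    have "Q x = 0 \<longleftrightarrow> x = 0" using nQ[of x] by (metis norm_eq_zero)
    moreover have "Q (x /\<^sub>R norm x) = Q x /\<^sub>R norm x" using linQ by (simp add: linear_cmul)
    ultimately show "g (Q x) = indicator (ball 0 1 - {0}) x * F (Q (x /\<^sub>R norm x))"
      by (auto simp: g_def nQ indicator_def)
  qed
  finally show ?thesis unfolding integral_sphere_measure[OF Fm] integral_sphere_measure[OF FQm] g_def by simp
qed

section \<open>The Poisson kernel\<close>

text \<open>\<open>kernel_dir\<close> is the logarithmic derivative of \<open>rho x / (norm (x - \<xi>))\<^sup>2\<close> in \<open>x\<close>.\<close>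

definition kernel_dir :: "'n::finite \<Rightarrow> real^'n \<Rightarrow> real^'n \<Rightarrow> real" where
  "kernel_dir i x \<xi> = - (x $ i / rho x) - 2 * (x $ i - \<xi> $ i) / (norm (x - \<xi>))\<^sup>2"

text \<open>Up to a constant this is the exponential of \<open>- s\<close> times the Busemann
  function of the boundary point \<open>\<xi>\<close>, an eigenfunction of the hyperbolic Laplacian
  with eigenvalue \<open>s * (s - n + 1)\<close>. The exponent \<open>s = n\<close> gives eigenvalue
  \<open>n\<close>, as the Dirichlet problem requires.\<close>

definition hyp_kernel :: "real \<Rightarrow> real^'n::finite \<Rightarrow> real^'n \<Rightarrow> real" where
  "hyp_kernel s x \<xi> = (rho x / (norm (x - \<xi>))\<^sup>2) powr s"

definition hyp_kernel' :: "real \<Rightarrow> 'n::finite \<Rightarrow> real^'n \<Rightarrow> real^'n \<Rightarrow> real" where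
  "hyp_kernel' s i x \<xi> = s * hyp_kernel s x \<xi> * kernel_dir i x \<xi>"

definition hyp_kernel'' :: "real \<Rightarrow> 'n::finite \<Rightarrow> 'n \<Rightarrow> real^'n \<Rightarrow> real^'n \<Rightarrow> real" where
  "hyp_kernel'' s i j x \<xi> = s * hyp_kernel s x \<xi> * (s * kernel_dir i x \<xi> * kernel_dir j x \<xi>
     - (if i = j then 1 / rho x + 2 / (norm (x - \<xi>))\<^sup>2 else 0) - x $ i * x $ j / (rho x)\<^sup>2
     + 4 * (x $ i - \<xi> $ i) * (x $ j - \<xi> $ j) / (norm (x - \<xi>)) ^ 4)"

lemma norm_diff_sphere_ge:
  assumes "norm x < 1" "norm \<xi> = 1"
  shows "0 < 1 - norm x" "1 - norm x \<le> norm (x - \<xi>)" "rho x \<le> 1 - norm x"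
proof -
  show "0 < 1 - norm x" using assms by simp
  show "1 - norm x \<le> norm (x - \<xi>)" using norm_triangle_ineq2[of \<xi> x] assms by (simp add: norm_minus_commute)
  have "rho x = (1 - norm x) * ((1 + norm x) / 2)" by (simp add: rho_def field_simps power2_eq_square)
  also have "\<dots> \<le> (1 - norm x) * 1" using assms by (intro mult_left_mono) auto
  finally show "rho x \<le> 1 - norm x" by simp
qed

lemma norm_diff_squared_has_derivative:
  "((\<lambda>x. (norm (x - \<xi>))\<^sup>2) has_derivative (\<lambda>h. 2 * ((x - \<xi>) \<bullet> h))) (at x)"
  unfolding power2_norm_eq_inner by (auto intro!: derivative_eq_intros simp: inner_commute)

lemma hyp_kernel_has_derivative:
  fixes x :: "real^'n::finite"
  assumes x: "norm x < 1" and \<xi>: "norm \<xi> = 1"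
  shows "((\<lambda>x. hyp_kernel s x \<xi>) has_derivative (\<lambda>h. \<Sum>i\<in>UNIV. hyp_kernel' s i x \<xi> * h $ i)) (at x)"
proof -
  define q where "q = (norm (x - \<xi>))\<^sup>2"
  have q: "q > 0" using x \<xi> by (auto simp: q_def)
  have r: "rho x > 0" using x by (simp add: rho_pos_iff)
  have d1: "((\<lambda>x. rho x / (norm (x - \<xi>))\<^sup>2) has_derivative (\<lambda>h. (- (x \<bullet> h) * q - rho x * (2 * ((x - \<xi>) \<bullet> h))) / (q * q))) (at x)"
    unfolding q_def by (rule has_derivative_divide'[OF rho_has_derivative norm_diff_squared_has_derivative]) (use q in \<open>simp add: q_def\<close>)
  have d2: "((\<lambda>z. z powr s) has_derivative (\<lambda>h. s * (rho x / q) powr (s - 1) * h)) (at (rho x / (norm (x - \<xi>))\<^sup>2))"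
    unfolding q_def[symmetric] using has_real_derivative_powr[of "rho x / q" s] r q by (simp add: has_field_derivative_def)
  have "((\<lambda>x. hyp_kernel s x \<xi>) has_derivative
       (\<lambda>h. s * (rho x / q) powr (s - 1) * ((- (x \<bullet> h) * q - rho x * (2 * ((x - \<xi>) \<bullet> h))) / (q * q)))) (at x)"
    using diff_chain_at[OF d1 d2] unfolding o_def hyp_kernel_def .
  then show ?thesis
  proof (rule has_derivative_eq_rhs, intro ext)
    fix h
    have e1: "(rho x / q) powr s = (rho x / q) powr (s - 1) * (rho x / q)"
      using r q powr_add[of "rho x / q" "s - 1" 1] by simp
    have e2: "(\<Sum>i\<in>UNIV. kernel_dir i x \<xi> * h $ i) = - (x \<bullet> h) / rho x - 2 * ((x - \<xi>) \<bullet> h) / q"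
    proof -
      have "(\<Sum>i\<in>UNIV. kernel_dir i x \<xi> * h $ i) = (\<Sum>i\<in>UNIV. (- 1 / rho x) * (x $ i * h $ i) - 2 / q * ((x - \<xi>) $ i * h $ i))"
        by (intro sum.cong) (auto simp: kernel_dir_def q_def left_diff_distrib)
      also have "\<dots> = (- 1 / rho x) * (x \<bullet> h) - 2 / q * ((x - \<xi>) \<bullet> h)"
        by (simp only: sum_subtractf sum_distrib_left[symmetric] inner_vec_def inner_real_def)
      finally show ?thesis by simp
    qed
    have e3: "(\<Sum>i\<in>UNIV. hyp_kernel' s i x \<xi> * h $ i) = s * hyp_kernel s x \<xi> * (\<Sum>i\<in>UNIV. kernel_dir i x \<xi> * h $ i)"
      by (simp add: hyp_kernel'_def sum_distrib_left mult.assoc)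
    show "s * (rho x / q) powr (s - 1) * ((- (x \<bullet> h) * q - rho x * (2 * ((x - \<xi>) \<bullet> h))) / (q * q)) = (\<Sum>i\<in>UNIV. hyp_kernel' s i x \<xi> * h $ i)"
      unfolding e3 hyp_kernel_def q_def[symmetric] e1 e2 using r q by (simp add: field_simps)
  qed
qed

lemma kernel_dir_has_derivative:
  fixes x :: "real^'n::finite"
  assumes x: "norm x < 1" and \<xi>: "norm \<xi> = 1"
  shows "((\<lambda>x. kernel_dir i x \<xi>) has_derivative (\<lambda>h. \<Sum>j\<in>UNIV.
     (- (if i = j then 1 / rho x + 2 / (norm (x - \<xi>))\<^sup>2 else 0) - x $ i * x $ j / (rho x)\<^sup>2
     + 4 * (x $ i - \<xi> $ i) * (x $ j - \<xi> $ j) / (norm (x - \<xi>)) ^ 4) * h $ j)) (at x)"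
proof -
  define q where "q = (norm (x - \<xi>))\<^sup>2"
  have q: "q > 0" using x \<xi> by (auto simp: q_def)
  have r: "rho x > 0" using x by (simp add: rho_pos_iff)
  have d: "((\<lambda>x. x $ i) has_derivative (\<lambda>h. h $ i)) (at x)"
    by (rule bounded_linear_imp_has_derivative) (rule bounded_linear_vec_nth)
  have d2: "((\<lambda>x. 2 * (x $ i - \<xi> $ i)) has_derivative (\<lambda>h. 2 * h $ i)) (at x)"
    by (rule has_derivative_eq_rhs[OF has_derivative_mult_right[OF has_derivative_diff[OF d has_derivative_const]]]) simp
  have "((\<lambda>x. kernel_dir i x \<xi>) has_derivative (\<lambda>h. - ((h $ i * rho x - x $ i * - (x \<bullet> h)) / (rho x * rho x))
     - (2 * h $ i * q - 2 * (x $ i - \<xi> $ i) * (2 * ((x - \<xi>) \<bullet> h))) / (q * q))) (at x)"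
    unfolding kernel_dir_def q_def
    by (intro has_derivative_diff has_derivative_minus has_derivative_divide'[OF d rho_has_derivative]
        has_derivative_divide'[OF d2 norm_diff_squared_has_derivative]) (use q r in \<open>auto simp: q_def\<close>)
  then show ?thesis
  proof (rule has_derivative_eq_rhs, intro ext)
    fix h
    have q4: "norm (x - \<xi>) ^ 4 = q * q" by (simp add: q_def power2_eq_square eval_nat_numeral)
    have "(\<Sum>j\<in>UNIV. (- (if i = j then 1 / rho x + 2 / q else 0) - x $ i * x $ j / (rho x)\<^sup>2
       + 4 * (x $ i - \<xi> $ i) * (x $ j - \<xi> $ j) / (q * q)) * h $ j)
      = (\<Sum>j\<in>UNIV. - ((if i = j then 1 / rho x + 2 / q else 0) * h $ j) - x $ i / (rho x)\<^sup>2 * (x $ j * h $ j)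
         + 4 * (x $ i - \<xi> $ i) / (q * q) * ((x - \<xi>) $ j * h $ j))"
      by (intro sum.cong) (auto simp: algebra_simps)
    also have "\<dots> = - ((1 / rho x + 2 / q) * h $ i) - x $ i / (rho x)\<^sup>2 * (x \<bullet> h) + 4 * (x $ i - \<xi> $ i) / (q * q) * ((x - \<xi>) \<bullet> h)"
      by (simp only: sum.distrib sum_subtractf sum_negf sum_delta_mult sum_distrib_left[symmetric] inner_vec_def inner_real_def)
    also have "\<dots> = - ((h $ i * rho x - x $ i * - (x \<bullet> h)) / (rho x * rho x))
     - (2 * h $ i * q - 2 * (x $ i - \<xi> $ i) * (2 * ((x - \<xi>) \<bullet> h))) / (q * q)"
      using r q by (simp add: field_simps power2_eq_square)
    finally show "- ((h $ i * rho x - x $ i * - (x \<bullet> h)) / (rho x * rho x))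
     - (2 * h $ i * q - 2 * (x $ i - \<xi> $ i) * (2 * ((x - \<xi>) \<bullet> h))) / (q * q) = (\<Sum>j\<in>UNIV.
     (- (if i = j then 1 / rho x + 2 / (norm (x - \<xi>))\<^sup>2 else 0) - x $ i * x $ j / (rho x)\<^sup>2
     + 4 * (x $ i - \<xi> $ i) * (x $ j - \<xi> $ j) / (norm (x - \<xi>)) ^ 4) * h $ j)"
      unfolding q4 q_def[symmetric] by simp
  qed
qed

lemma hyp_kernel'_has_derivative:
  fixes x :: "real^'n::finite"
  assumes x: "norm x < 1" and \<xi>: "norm \<xi> = 1"
  shows "((\<lambda>x. hyp_kernel' s i x \<xi>) has_derivative (\<lambda>h. \<Sum>j\<in>UNIV. hyp_kernel'' s i j x \<xi> * h $ j)) (at x)"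
  unfolding hyp_kernel'_def
  by (rule has_derivative_eq_rhs[OF has_derivative_mult[OF has_derivative_mult_right[OF hyp_kernel_has_derivative[OF assms]] kernel_dir_has_derivative[OF assms]]])
     (simp add: fun_eq_iff hyp_kernel''_def hyp_kernel'_def sum_distrib_left sum_distrib_right sum.distrib[symmetric] algebra_simps)

text \<open>All sums reduce to \<open>norm x\<close>, \<open>norm (x - \<xi>)\<close> and the
  product of \<open>x\<close> with \<open>x - \<xi>\<close>, the last being determined by
  \<open>norm \<xi> = 1\<close>. The term quadratic in \<open>s\<close> comes from the square of the
  logarithmic derivative.\<close>

lemma hyp_kernel_laplace:
  fixes x :: "real^'n::finite"
  assumes x: "norm x < 1" and \<xi>: "norm \<xi> = 1"
  shows "(rho x)\<^sup>2 * (\<Sum>i\<in>UNIV. hyp_kernel'' s i i x \<xi>) + (real CARD('n) - 2) * rho x * (\<Sum>i\<in>UNIV. x $ i * hyp_kernel' s i x \<xi>)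
    = s * (s - real CARD('n) + 1) * hyp_kernel s x \<xi>"
proof -
  define q where "q = (norm (x - \<xi>))\<^sup>2"
  define k where "k = hyp_kernel s x \<xi>"
  define \<rho> where "\<rho> = rho x"
  define N where "N = real CARD('n)"
  have q: "q > 0" using x \<xi> by (auto simp: q_def)
  have r: "\<rho> > 0" using x by (simp add: rho_pos_iff \<rho>_def)
  have q4: "norm (x - \<xi>) ^ 4 = q * q" by (simp add: q_def power2_eq_square eval_nat_numeral)
  have s1: "(\<Sum>i\<in>UNIV. x $ i * x $ i) = 1 - 2 * \<rho>" by (simp add: \<rho>_def rho_def norm_squared_sum field_simps)
  have s2: "(\<Sum>i\<in>UNIV. (x $ i - \<xi> $ i) * (x $ i - \<xi> $ i)) = q"
    by (simp add: q_def norm_squared_sum)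
  have s3: "(\<Sum>i\<in>UNIV. x $ i * (x $ i - \<xi> $ i)) = q / 2 - \<rho>"
  proof -
    have "(norm \<xi>)\<^sup>2 = (norm x)\<^sup>2 - 2 * (x \<bullet> (x - \<xi>)) + (norm (x - \<xi>))\<^sup>2"
      by (simp add: power2_norm_eq_inner inner_diff_left inner_diff_right inner_commute)
    moreover have "x \<bullet> (x - \<xi>) = (\<Sum>i\<in>UNIV. x $ i * (x $ i - \<xi> $ i))" by (simp add: inner_vec_def)
    ultimately show ?thesis using \<xi> by (simp add: q_def \<rho>_def rho_def field_simps)
  qed
  have d: "kernel_dir i x \<xi> = - (x $ i / \<rho>) - 2 * (x $ i - \<xi> $ i) / q" for i
    by (simp add: kernel_dir_def q_def \<rho>_def)
  \<comment> \<open>Equivalently, the logarithm of \<open>rho x / (norm (x - \<xi>))\<^sup>2\<close>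
    has hyperbolic gradient of norm 1, as befits a Busemann function.\<close>
  have S1: "(\<Sum>i\<in>UNIV. kernel_dir i x \<xi> * kernel_dir i x \<xi>) = 1 / \<rho>\<^sup>2"
  proof -
    have "(\<Sum>i\<in>UNIV. kernel_dir i x \<xi> * kernel_dir i x \<xi>) =
      (\<Sum>i\<in>UNIV. 1 / \<rho>\<^sup>2 * (x $ i * x $ i) + 4 / (\<rho> * q) * (x $ i * (x $ i - \<xi> $ i)) + 4 / q\<^sup>2 * ((x $ i - \<xi> $ i) * (x $ i - \<xi> $ i)))"
      unfolding d using r q by (intro sum.cong) (auto simp: field_simps power2_eq_square)
    also have "\<dots> = 1 / \<rho>\<^sup>2 * (1 - 2 * \<rho>) + 4 / (\<rho> * q) * (q / 2 - \<rho>) + 4 / q\<^sup>2 * q"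
      by (simp only: sum.distrib sum_distrib_left[symmetric] s1 s2 s3)
    also have "\<dots> = 1 / \<rho>\<^sup>2" using r q by (simp add: field_simps power2_eq_square)
    finally show ?thesis .
  qed
  have S2: "(\<Sum>i\<in>UNIV. x $ i * kernel_dir i x \<xi>) = - (1 - 2 * \<rho>) / \<rho> - 1 + 2 * \<rho> / q"
  proof -
    have "(\<Sum>i\<in>UNIV. x $ i * kernel_dir i x \<xi>) = (\<Sum>i\<in>UNIV. - 1 / \<rho> * (x $ i * x $ i) - 2 / q * (x $ i * (x $ i - \<xi> $ i)))"
      unfolding d using r q by (intro sum.cong) (auto simp: field_simps)
    also have "\<dots> = - 1 / \<rho> * (1 - 2 * \<rho>) - 2 / q * (q / 2 - \<rho>)"
      by (simp only: sum_subtractf sum_distrib_left[symmetric] s1 s3)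
    also have "\<dots> = - (1 - 2 * \<rho>) / \<rho> - 1 + 2 * \<rho> / q" using r q by (simp add: field_simps)
    finally show ?thesis .
  qed
  have A: "(\<Sum>i\<in>UNIV. hyp_kernel'' s i i x \<xi>) = s * k * (s / \<rho>\<^sup>2 - N * (1 / \<rho> + 2 / q) - (1 - 2 * \<rho>) / \<rho>\<^sup>2 + 4 / q)"
  proof -
    have "(\<Sum>i\<in>UNIV. hyp_kernel'' s i i x \<xi>) = (\<Sum>i\<in>UNIV. s * k * (s * (kernel_dir i x \<xi> * kernel_dir i x \<xi>)
      - (1 / \<rho> + 2 / q) - 1 / \<rho>\<^sup>2 * (x $ i * x $ i) + 4 / (q * q) * ((x $ i - \<xi> $ i) * (x $ i - \<xi> $ i))))"
      unfolding hyp_kernel''_def q4 q_def[symmetric] k_def[symmetric] \<rho>_def[symmetric] by (intro sum.cong) (auto simp: mult.assoc)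
    also have "\<dots> = s * k * (s * (1 / \<rho>\<^sup>2) - N * (1 / \<rho> + 2 / q) - 1 / \<rho>\<^sup>2 * (1 - 2 * \<rho>) + 4 / (q * q) * q)"
      by (simp only: sum.distrib sum_subtractf sum_distrib_left[symmetric] s1 s2 S1 sum_constant N_def distrib_left)
    also have "\<dots> = s * k * (s / \<rho>\<^sup>2 - N * (1 / \<rho> + 2 / q) - (1 - 2 * \<rho>) / \<rho>\<^sup>2 + 4 / q)" using q by simp
    finally show ?thesis .
  qed
  have B: "(\<Sum>i\<in>UNIV. x $ i * hyp_kernel' s i x \<xi>) = s * k * (- (1 - 2 * \<rho>) / \<rho> - 1 + 2 * \<rho> / q)"
    unfolding S2[symmetric] by (simp add: hyp_kernel'_def k_def sum_distrib_left ac_simps)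
  have "(rho x)\<^sup>2 * (\<Sum>i\<in>UNIV. hyp_kernel'' s i i x \<xi>) + (real CARD('n) - 2) * rho x * (\<Sum>i\<in>UNIV. x $ i * hyp_kernel' s i x \<xi>)
    = s * k * (\<rho>\<^sup>2 * (s / \<rho>\<^sup>2 - N * (1 / \<rho> + 2 / q) - (1 - 2 * \<rho>) / \<rho>\<^sup>2 + 4 / q) + (N - 2) * \<rho> * (- (1 - 2 * \<rho>) / \<rho> - 1 + 2 * \<rho> / q))"
    unfolding A B \<rho>_def[symmetric] N_def[symmetric] by (simp only: distrib_left mult.left_commute mult.assoc)
  also have "\<rho>\<^sup>2 * (s / \<rho>\<^sup>2 - N * (1 / \<rho> + 2 / q) - (1 - 2 * \<rho>) / \<rho>\<^sup>2 + 4 / q) + (N - 2) * \<rho> * (- (1 - 2 * \<rho>) / \<rho> - 1 + 2 * \<rho> / q)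
     = s - N + 1"
    using r q by (simp add: field_simps power2_eq_square)
  finally show ?thesis by (simp add: k_def N_def)
qed

lemma hyp_kernel_continuous:
  "continuous_on (ball 0 1 \<times> sphere 0 1) (\<lambda>(x, \<xi>). hyp_kernel s x \<xi>)"
  "continuous_on (ball 0 1 \<times> sphere 0 1) (\<lambda>(x, \<xi>). hyp_kernel' s i x \<xi>)"
  "continuous_on (ball 0 1 \<times> sphere 0 1) (\<lambda>(x, \<xi>). hyp_kernel'' s i j x \<xi>)"
proof -
  let ?A = "ball (0::real^'n) 1 \<times> sphere (0::real^'n) 1"
  have r: "rho a \<noteq> 0" if "norm a < 1" for a :: "real^'n"
    using that rho_pos_iff[of a] by auto
  have cr: "continuous_on ?A (\<lambda>z. rho (fst z))"
    unfolding rho_def by (intro continuous_intros) auto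
  have ck: "continuous_on ?A (\<lambda>z. hyp_kernel s (fst z) (snd z))"
    unfolding hyp_kernel_def by (intro continuous_intros cr) (auto dest: r)
  have cd: "continuous_on ?A (\<lambda>z. kernel_dir i (fst z) (snd z))" for i
    unfolding kernel_dir_def by (intro continuous_intros cr) (auto dest: r)
  show "continuous_on ?A (\<lambda>(x, \<xi>). hyp_kernel s x \<xi>)" using ck by (simp add: case_prod_unfold)
  show "continuous_on ?A (\<lambda>(x, \<xi>). hyp_kernel' s i x \<xi>)"
    using continuous_on_mult[OF continuous_on_mult_left[OF ck] cd] by (simp add: case_prod_unfold hyp_kernel'_def)
  have ci: "continuous_on ?A (\<lambda>z. if i = j then 1 / rho (fst z) + 2 / (norm (fst z - snd z))\<^sup>2 else 0)"
    by (cases "i = j") (auto intro!: continuous_intros cr dest: r)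
  show "continuous_on ?A (\<lambda>(x, \<xi>). hyp_kernel'' s i j x \<xi>)"
    unfolding hyp_kernel''_def case_prod_unfold
    by (intro continuous_on_mult continuous_on_add continuous_on_diff ci ck cd continuous_on_const continuous_on_divide continuous_intros cr) (auto dest: r)
qed

section \<open>Poisson integrals\<close>

text \<open>Left unnormalised and with free exponent, because besides \<open>s = n\<close> for the
  Dirichlet problem the exponent \<open>n - \<alpha> / 2\<close> is needed for the weighted
  bound.\<close>

definition poisson_integral :: "real \<Rightarrow> (real^'n::finite \<Rightarrow> real) \<Rightarrow> real^'n \<Rightarrow> real" where
  "poisson_integral s v x = (LINT \<xi>|sphere_measure. hyp_kernel s x \<xi> * v \<xi>)"

lemma continuous_on_times_sphere:
  assumes "continuous_on (A \<times> B) (\<lambda>(x, \<xi>). K x \<xi> :: real)" "continuous_on B v"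
  shows "continuous_on (A \<times> B) (\<lambda>(x, \<xi>). K x \<xi> * v \<xi>)"
proof -
  have "continuous_on (A \<times> B) (\<lambda>z. v (snd z))"
    by (rule continuous_on_compose2[OF assms(2)]) (auto intro!: continuous_intros)
  from continuous_on_mult[OF assms(1) this] show ?thesis by (simp add: case_prod_unfold)
qed

lemma poisson_integral_C2:
  fixes v :: "real^'n::finite \<Rightarrow> real"
  assumes v: "continuous_on (sphere 0 1) v"
  shows "Ck_on 2 (ball 0 1) (poisson_integral s v)"
    "norm x < 1 \<Longrightarrow> partial i (poisson_integral s v) x = (LINT \<xi>|sphere_measure. hyp_kernel' s i x \<xi> * v \<xi>)"
    "norm x < 1 \<Longrightarrow> laplacian hyp_metric (poisson_integral s v) x = s * (s - real CARD('n) + 1) * poisson_integral s v x"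
proof -
  note c = continuous_on_times_sphere[OF hyp_kernel_continuous(1)[of s] v]
    continuous_on_times_sphere[OF hyp_kernel_continuous(2)[of s] v]
    continuous_on_times_sphere[OF hyp_kernel_continuous(3)[of s] v]
  have times: "((\<lambda>x. f x * a) has_derivative (\<lambda>h. \<Sum>i\<in>UNIV. g i * a * h $ i)) (at x)"
    if "(f has_derivative (\<lambda>h. \<Sum>i\<in>UNIV. g i * h $ i)) (at x)" for f :: "real^'n \<Rightarrow> real" and g a x
    by (rule has_derivative_eq_rhs[OF has_derivative_mult_left[OF that]]) (simp add: fun_eq_iff sum_distrib_left ac_simps)
  have d1: "((\<lambda>x. poisson_integral s v x) has_derivative (\<lambda>h. \<Sum>i\<in>UNIV. (LINT \<xi>|sphere_measure. hyp_kernel' s i x \<xi> * v \<xi>) * h $ i)) (at x)"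
    if "x \<in> ball 0 1" for x
    unfolding poisson_integral_def
    by (rule has_derivative_integral_sphere[OF open_ball that c(1) c(2)]) (auto intro!: times hyp_kernel_has_derivative)
  have d2: "((\<lambda>x. LINT \<xi>|sphere_measure. hyp_kernel' s i x \<xi> * v \<xi>) has_derivative (\<lambda>h. \<Sum>j\<in>UNIV. (LINT \<xi>|sphere_measure. hyp_kernel'' s i j x \<xi> * v \<xi>) * h $ j)) (at x)"
    if "x \<in> ball 0 1" for x i
    by (rule has_derivative_integral_sphere[OF open_ball that c(2) c(3)]) (auto intro!: times hyp_kernel'_has_derivative)
  have c3: "continuous_on (ball 0 1) (\<lambda>x. LINT \<xi>|sphere_measure. hyp_kernel'' s i j x \<xi> * v \<xi>)" for i j
    by (rule continuous_on_integral_sphere[OF open_ball c(3)])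
  note * = C2_onI[OF open_ball d1 d2 c3]
  show "Ck_on 2 (ball 0 1) (poisson_integral s v)" using *(1) by blast
  have p1: "partial i (poisson_integral s v) x = (LINT \<xi>|sphere_measure. hyp_kernel' s i x \<xi> * v \<xi>)" if "x \<in> ball 0 1" for x i
    using *(2) that by blast
  have p2: "partial j (partial i (poisson_integral s v)) x = (LINT \<xi>|sphere_measure. hyp_kernel'' s i j x \<xi> * v \<xi>)" if "x \<in> ball 0 1" for x i j
    using *(3) that by blast
  show "norm x < 1 \<Longrightarrow> partial i (poisson_integral s v) x = (LINT \<xi>|sphere_measure. hyp_kernel' s i x \<xi> * v \<xi>)"
    using p1 by simp
  assume x: "norm x < 1"
  then have xb: "x \<in> ball 0 1" by simp
  have i1: "integrable sphere_measure (\<lambda>\<xi>. hyp_kernel' s i x \<xi> * v \<xi>)" for i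
    by (rule integrable_sphere_measure) (rule continuous_on_slice(1)[OF c(2) xb])
  have i2: "integrable sphere_measure (\<lambda>\<xi>. hyp_kernel'' s i j x \<xi> * v \<xi>)" for i j
    by (rule integrable_sphere_measure) (rule continuous_on_slice(1)[OF c(3) xb])
  have "laplacian hyp_metric (poisson_integral s v) x = (LINT \<xi>|sphere_measure.
     (rho x)\<^sup>2 * (\<Sum>i\<in>UNIV. hyp_kernel'' s i i x \<xi> * v \<xi>) + (real CARD('n) - 2) * rho x * (\<Sum>i\<in>UNIV. x $ i * (hyp_kernel' s i x \<xi> * v \<xi>)))"
    unfolding laplacian_hyp_metric[OF x] p1[OF xb] p2[OF xb]
    using i1 i2 by (simp add: Bochner_Integration.integral_sum)
  also have "\<dots> = (LINT \<xi>|sphere_measure. s * (s - real CARD('n) + 1) * (hyp_kernel s x \<xi> * v \<xi>))"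
  proof (rule Bochner_Integration.integral_cong[OF refl])
    fix \<xi> :: "real^'n" assume "\<xi> \<in> space sphere_measure"
    then have "norm \<xi> = 1" by simp
    from hyp_kernel_laplace[OF x this, of s]
    show "(rho x)\<^sup>2 * (\<Sum>i\<in>UNIV. hyp_kernel'' s i i x \<xi> * v \<xi>) + (real CARD('n) - 2) * rho x * (\<Sum>i\<in>UNIV. x $ i * (hyp_kernel' s i x \<xi> * v \<xi>))
      = s * (s - real CARD('n) + 1) * (hyp_kernel s x \<xi> * v \<xi>)"
      by (simp add: sum_distrib_right[symmetric] mult.assoc[symmetric] distrib_right[symmetric])
  qed
  finally show "laplacian hyp_metric (poisson_integral s v) x = s * (s - real CARD('n) + 1) * poisson_integral s v x"
    by (simp add: poisson_integral_def)
qed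

text \<open>The kernel is unchanged when an orthogonal map acts on both arguments, and such a map
  carries \<open>x\<close> to \<open>y\<close>.\<close>

lemma poisson_integral_radial:
  fixes x y :: "real^'n::finite"
  assumes "norm x = norm y" "norm x < 1"
  shows "poisson_integral s (\<lambda>_. 1) x = poisson_integral s (\<lambda>_. 1) y"
proof -
  obtain Q where Q: "orthogonal_transformation Q" "Q x = y"
    using orthogonal_transformation_exists[OF assms(1)] by blast
  have linQ: "linear Q" using Q(1) by (rule orthogonal_transformation_linear)
  have rQ: "rho y = rho x" using assms by (simp add: rho_def)
  have "hyp_kernel s y (Q \<xi>) = hyp_kernel s x \<xi>" for \<xi>
  proof -
    have "y - Q \<xi> = Q (x - \<xi>)" using linear_diff[OF linQ] Q(2) by simp
    then have "norm (y - Q \<xi>) = norm (x - \<xi>)" using orthogonal_transformation_norm[OF Q(1)] by simp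
    then show ?thesis by (simp add: hyp_kernel_def rQ)
  qed
  moreover have "continuous_on (sphere 0 1) (hyp_kernel s y)"
    by (rule continuous_on_slice(1)[OF hyp_kernel_continuous(1)]) (use assms in auto)
  ultimately show ?thesis
    using integral_sphere_orthogonal[OF Q(1), of "hyp_kernel s y"] by (simp add: poisson_integral_def)
qed

lemma rho_le_half: "rho x \<le> 1 / 2"
  by (simp add: rho_def)

lemma cosh_pos:
  assumes "norm x < 1" shows "1 \<le> 1 / rho x - 1"
proof -
  have "rho x > 0" using assms by (simp add: rho_pos_iff)
  then show ?thesis using rho_le_half[of x] by (simp add: field_simps)
qed

text \<open>Both sides are constant on spheres about the origin and solve the same linear equation, so by the maximum
  principle they are proportional. This avoids evaluating the integral of the kernel.\<close>

lemma poisson_integral_one_eq: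
  fixes x :: "real^'n::finite"
  assumes x: "norm x < 1"
  shows "poisson_integral (real CARD('n)) (\<lambda>_. 1) x = poisson_integral (real CARD('n)) (\<lambda>_. 1) (0::real^'n) * (1 / rho x - 1)"
proof -
  define n where "n = real CARD('n)"
  define I where "I = poisson_integral n (\<lambda>_::real^'n. 1)"
  \<comment> \<open>The exponent 1 is kept so that the Laplacian is the case \<open>a = 1\<close> of
    the general power.\<close>
  define V0 where "V0 = (\<lambda>x::real^'n. (1 / rho x - 1) powr 1)"
  have n: "n > 0" by (simp add: n_def)
  have V0: "V0 z = 1 / rho z - 1" if "norm z < 1" for z
    using cosh_pos[OF that] by (simp add: V0_def)
  have C: "Ck_on 2 (ball 0 1) I" "Ck_on 2 (ball 0 1) V0"
    unfolding I_def V0_def by (rule poisson_integral_C2(1)[OF continuous_on_const], rule laplacian_cosh_powr(1))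
  have lI: "laplacian hyp_metric I z = n * I z" if "norm z < 1" for z
    using poisson_integral_C2(3)[of "\<lambda>_. 1" z n] that by (simp add: I_def n_def)
  have lV: "laplacian hyp_metric V0 z = n * V0 z" if "norm z < 1" for z
    using laplacian_cosh_powr(2)[OF that, of 1] by (simp add: V0_def n_def)
  \<comment> \<open>A combination of \<open>I\<close> and \<open>V0\<close> that vanishes at
    \<open>x0\<close> vanishes on the whole sphere through \<open>x0\<close>, hence is nonpositive
    inside. Used with both signs it vanishes at the origin, which identifies the ratio
    \<open>c\<close> with \<open>I 0\<close>.\<close>
  have le: "a * I y + b * V0 y \<le> 0" if R: "norm x0 < 1" and 0: "a * I x0 + b * V0 x0 = 0" and y: "norm y \<le> norm x0" for a b y and x0 :: "real^'n"
  proof (rule maximum_principle[OF C2_on_lin(1)[OF open_ball C] R _ _ y])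
    fix z :: "real^'n" assume "norm z = norm x0"
    then have "I z = I x0" "V0 z = V0 x0"
      using poisson_integral_radial[of z x0 n] R by (auto simp: I_def V0_def rho_def)
    then show "a * I z + b * V0 z \<le> 0" using 0 by simp
  next
    fix z :: "real^'n" assume z: "norm z < norm x0" "a * I z + b * V0 z > 0"
    have "norm z < 1" using z R by simp
    then have "laplacian hyp_metric (\<lambda>x. a * I x + b * V0 x) z = n * (a * I z + b * V0 z)"
      by (simp add: laplacian_lin[OF C] lI lV algebra_simps)
    then show "laplacian hyp_metric (\<lambda>x. a * I x + b * V0 x) z > 0" using z(2) n by simp
  qed
  define c where "c = I x / V0 x"
  have V0x: "V0 x > 0" using V0[OF x] cosh_pos[OF x] by simp
  have "1 * I 0 + (- c) * V0 0 \<le> 0" by (rule le[OF x]) (use V0x in \<open>auto simp: c_def\<close>)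
  moreover have "(-1) * I 0 + c * V0 0 \<le> 0" by (rule le[OF x]) (use V0x in \<open>auto simp: c_def\<close>)
  moreover have "V0 0 = 1" by (simp add: V0_def rho_def)
  ultimately have "I 0 = c" by simp
  then have "I x = I 0 * V0 x" using V0x by (simp add: c_def)
  then show ?thesis unfolding I_def n_def using V0[OF x] by simp
qed

lemma poisson_integral_one_pos: "poisson_integral s (\<lambda>_. 1) (0::real^'n::finite) > 0"
proof -
  have "poisson_integral s (\<lambda>_. 1) (0::real^'n) = (LINT \<xi>|(sphere_measure :: (real^'n) measure). (1 / 2) powr s)"
    unfolding poisson_integral_def by (rule Bochner_Integration.integral_cong) (auto simp: hyp_kernel_def rho_def)
  also have "\<dots> = measure (sphere_measure :: (real^'n) measure) (sphere 0 1) * (1 / 2) powr s" by simp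
  finally show ?thesis using sphere_measure_pos[where 'n='n] by simp
qed

text \<open>The left side has eigenvalue \<open>a (n - 1 + a)\<close>, for which \<open>(1 / rho - 1)\<^sup>a\<close> is a subsolution.\<close>

lemma poisson_integral_one_le:
  fixes x :: "real^'n::finite"
  assumes x: "norm x < 1" and a: "0 < a" "a < 1"
  shows "poisson_integral (real CARD('n) - 1 + a) (\<lambda>_. 1) x \<le>
    poisson_integral (real CARD('n) - 1 + a) (\<lambda>_. 1) (0::real^'n) * (1 / rho x - 1) powr a"
proof -
  define s where "s = real CARD('n) - 1 + a"
  define \<mu> where "\<mu> = a * s"
  define I where "I = poisson_integral s (\<lambda>_::real^'n. 1)"
  define V0 where "V0 = (\<lambda>x::real^'n. (1 / rho x - 1) powr a)"
  have s: "s > 0" unfolding s_def using a by (smt (verit) of_nat_0_less_iff of_nat_1 of_nat_le_iff zero_less_card_finite One_nat_def Suc_leI)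
  have mu: "\<mu> > 0" using s a by (simp add: \<mu>_def)
  have C: "Ck_on 2 (ball 0 1) I" "Ck_on 2 (ball 0 1) V0"
    unfolding I_def V0_def by (rule poisson_integral_C2(1)[OF continuous_on_const], rule laplacian_cosh_powr(1))
  have lI: "laplacian hyp_metric I z = \<mu> * I z" if "norm z < 1" for z
    using poisson_integral_C2(3)[of "\<lambda>_. 1" z s] that by (simp add: I_def \<mu>_def s_def mult.commute)
  \<comment> \<open>The additional term has the factor \<open>a * (1 - a)\<close>, which is positive
    for \<open>0 < a < 1\<close>.\<close>
  have lV: "laplacian hyp_metric V0 z \<ge> \<mu> * V0 z" if "norm z < 1" for z
    using laplacian_cosh_powr(2)[OF that, of a] a by (simp add: V0_def \<mu>_def s_def)
  have "1 / rho x - 1 \<noteq> 0" using cosh_pos[OF x] by linarith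
  then have V0x: "V0 x > 0" unfolding V0_def powr_gt_zero .
  define c where "c = I x / V0 x"
  have I0: "I z \<ge> 0" for z
    unfolding I_def poisson_integral_def by (rule Bochner_Integration.integral_nonneg) (simp add: hyp_kernel_def)
  have c: "c \<ge> 0" using I0[of x] V0x by (simp add: c_def)
  have "(-1) * I 0 + c * V0 0 \<le> 0"
  proof (rule maximum_principle[OF C2_on_lin(1)[OF open_ball C] x])
    fix z :: "real^'n" assume "norm z = norm x"
    then have "I z = I x" "V0 z = V0 x"
      using poisson_integral_radial[of z x s] x by (auto simp: I_def V0_def rho_def)
    then show "(-1) * I z + c * V0 z \<le> 0" using V0x by (simp add: c_def)
  next
    fix z :: "real^'n" assume z: "norm z < norm x" "(-1) * I z + c * V0 z > 0"
    have z1: "norm z < 1" using z x by simp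
    have "0 < \<mu> * ((-1) * I z + c * V0 z)" using z(2) mu by simp
    also have "\<dots> \<le> - (\<mu> * I z) + c * laplacian hyp_metric V0 z"
      using mult_left_mono[OF lV[OF z1] c] by (simp add: algebra_simps)
    also have "\<dots> = laplacian hyp_metric (\<lambda>x. (-1) * I x + c * V0 x) z"
      by (simp only: laplacian_lin[OF C z1] lI[OF z1])
    finally show "laplacian hyp_metric (\<lambda>x. (-1) * I x + c * V0 x) z > 0" .
  qed simp
  moreover have "V0 0 = 1" by (simp add: V0_def rho_def)
  ultimately have "c \<le> I 0" by simp
  then have "I x \<le> I 0 * V0 x" using V0x by (simp add: c_def field_simps)
  then show ?thesis by (simp add: I_def V0_def s_def)
qed

text \<open>The weight lowers the exponent of the kernel from \<open>n\<close> to \<open>n - \<alpha> / 2\<close>.\<close>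

lemma hyp_kernel_weighted_bound:
  assumes al: "0 < \<alpha>" "\<alpha> \<le> 1"
  obtains C where "C \<ge> 0"
    "\<And>x::real^'n::finite. norm x < 1 \<Longrightarrow>
      (LINT \<xi>|sphere_measure. hyp_kernel (real CARD('n)) x \<xi> * norm (x - \<xi>) powr \<alpha>) \<le> C * rho x powr (\<alpha> - 1)"
proof -
  define n where "n = real CARD('n)"
  \<comment> \<open>Chosen so that \<open>n - 1 + a = n - \<alpha> / 2\<close>: the weight equals
    \<open>rho powr (\<alpha> / 2)\<close> times the kernel base to the power
    \<open>- \<alpha> / 2\<close>. The final exponent is
    \<open>\<alpha> / 2 - a = \<alpha> - 1\<close>.\<close>
  define a where "a = 1 - \<alpha> / 2"
  have a: "0 < a" "a < 1" using al by (auto simp: a_def)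
  define C where "C = poisson_integral (n - 1 + a) (\<lambda>_. 1) (0::real^'n)"
  have C: "C \<ge> 0" using poisson_integral_one_pos[of "n - 1 + a", where 'n='n] by (simp add: C_def)
  have "(LINT \<xi>|sphere_measure. hyp_kernel n x \<xi> * norm (x - \<xi>) powr \<alpha>) \<le> C * rho x powr (\<alpha> - 1)"
    if x: "norm x < 1" for x :: "real^'n"
  proof -
    have r: "rho x > 0" using x by (simp add: rho_pos_iff)
    have "(LINT \<xi>|sphere_measure. hyp_kernel n x \<xi> * norm (x - \<xi>) powr \<alpha>)
      = (LINT \<xi>|sphere_measure. rho x powr (\<alpha> / 2) * hyp_kernel (n - 1 + a) x \<xi>)"
    proof (rule Bochner_Integration.integral_cong[OF refl])
      fix \<xi> :: "real^'n" assume "\<xi> \<in> space sphere_measure"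
      then have d: "norm (x - \<xi>) > 0" using x by auto
      have "((norm (x - \<xi>))\<^sup>2) powr (\<alpha> / 2) = norm (x - \<xi>) powr \<alpha>"
        using d powr_powr[of "norm (x - \<xi>)" 2 "\<alpha> / 2"] by (simp add: powr_numeral)
      then have "norm (x - \<xi>) powr \<alpha> = rho x powr (\<alpha> / 2) * (rho x / (norm (x - \<xi>))\<^sup>2) powr (- (\<alpha> / 2))"
        using r d by (simp add: powr_minus powr_divide field_simps)
      then show "hyp_kernel n x \<xi> * norm (x - \<xi>) powr \<alpha> = rho x powr (\<alpha> / 2) * hyp_kernel (n - 1 + a) x \<xi>"
        by (simp add: hyp_kernel_def a_def powr_add[symmetric])
    qed
    also have "\<dots> = rho x powr (\<alpha> / 2) * poisson_integral (n - 1 + a) (\<lambda>_. 1) x"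
      by (simp add: poisson_integral_def)
    also have "\<dots> \<le> rho x powr (\<alpha> / 2) * (C * (1 / rho x - 1) powr a)"
      unfolding C_def n_def by (intro mult_left_mono poisson_integral_one_le[OF x a]) simp
    also have "\<dots> \<le> rho x powr (\<alpha> / 2) * (C * (1 / rho x) powr a)"
      using C a cosh_pos[OF x] by (intro mult_left_mono powr_mono2) auto
    also have "\<dots> = C * rho x powr (\<alpha> / 2 - a)"
      using r by (simp add: powr_divide powr_diff)
    also have "\<alpha> / 2 - a = \<alpha> - 1" by (simp add: a_def)
    finally show ?thesis .
  qed
  with C that show thesis unfolding n_def by blast
qed

section \<open>The Dirichlet problem\<close>

lemma Ck_on_cong:
  assumes "open U" "\<And>x. x \<in> U \<Longrightarrow> f x = g x" "Ck_on k U f"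
  shows "Ck_on k U g"
  using assms(2,3)
proof (induction k arbitrary: f g)
  case 0
  then show ?case using continuous_on_cong[OF refl, of U f g] by simp
next
  case (Suc k)
  have "g differentiable (at x)" if x: "x \<in> U" for x
  proof -
    obtain D where "(f has_derivative D) (at x)" using Suc.prems(2) x by (auto simp: differentiable_def)
    then have "(g has_derivative D) (at x)"
      by (rule has_derivative_transform_within_open[OF _ assms(1) x]) (use Suc.prems in auto)
    then show ?thesis by (auto simp: differentiable_def)
  qed
  moreover have "Ck_on k U (partial i g)" for i
  proof (rule Suc.IH[of "partial i f"])
    show "partial i f x = partial i g x" if "x \<in> U" for x
      by (rule partial_cong_open[OF assms(1) that Suc.prems(1)])
  qed (use Suc.prems in simp)
  ultimately show ?case by simp
qed

lemma laplacian_cong: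
  assumes "\<And>x. x \<in> ball 0 1 \<Longrightarrow> f x = g x" and x: "norm x < 1"
  shows "laplacian hyp_metric f x = laplacian hyp_metric g x"
proof -
  have p: "partial i f y = partial i g y" if "y \<in> ball 0 1" for i y
    by (rule partial_cong_open[OF open_ball that assms(1)])
  have "partial j (partial i f) x = partial j (partial i g) x" for i j
    by (rule partial_cong_open[of "ball 0 1"]) (use x p in auto)
  then show ?thesis using p x by (simp add: laplacian_hyp_metric)
qed

text \<open>The comparison lemma used in both directions gives uniqueness on the ball; restriction
  to the ball makes the solution extensional, so that the description operator selects it.\<close>

lemma dirichlet_op_eqI:
  assumes V: "dirichlet_solution v V" and x: "norm x < 1"
  shows "dirichlet_op v x = V x"
proof -
  define V' where "V' = restrict V (ball 0 1)"
  have V': "dirichlet_solution v V'"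
    unfolding dirichlet_solution_def
  proof (intro conjI ballI)
    show "Ck_on 2 (ball 0 1) V'"
      by (rule Ck_on_cong[of _ V]) (use V in \<open>auto simp: V'_def dirichlet_solution_def\<close>)
    fix x :: "real^'a" assume x: "x \<in> ball 0 1"
    have "laplacian hyp_metric V' x = laplacian hyp_metric V x"
      by (rule laplacian_cong) (use x in \<open>auto simp: V'_def\<close>)
    then show "laplacian hyp_metric V' x = real CARD('a) * V' x"
      using V x by (simp add: V'_def dirichlet_solution_def)
  next
    obtain W where "continuous_on (cball 0 1) W" "\<forall>x\<in>ball 0 1. W x = rho x * V x" "\<forall>x\<in>sphere 0 1. W x = v x"
      using V unfolding dirichlet_solution_def by blast
    then show "\<exists>W. continuous_on (cball 0 1) W \<and> (\<forall>x\<in>ball 0 1. W x = rho x * V' x) \<and> (\<forall>x\<in>sphere 0 1. W x = v x)"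
      by (intro exI[of _ W]) (auto simp: V'_def)
  qed
  have "dirichlet_op v = V'"
    unfolding dirichlet_op_def
  proof (rule the_equality)
    show "dirichlet_solution v V' \<and> V' \<in> extensional (ball 0 1)" using V' by (simp add: V'_def)
    fix V2 assume V2: "dirichlet_solution v V2 \<and> V2 \<in> extensional (ball 0 1)"
    show "V2 = V'"
    proof (rule extensionalityI[of _ "ball 0 1"])
      fix x :: "real^'a" assume "x \<in> ball 0 1"
      then show "V2 x = V' x"
        using dirichlet_solution_le[of v V2 V' x] dirichlet_solution_le[of v V' V2 x] V2 V' by auto
    qed (use V2 in \<open>auto simp: V'_def\<close>)
  qed
  then show ?thesis using x by (simp add: V'_def)
qed

lemma continuous_on_sphere_hoelder:
  fixes v :: "real^'n::finite \<Rightarrow> real"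
  assumes al: "0 < \<alpha>"
    and hol: "\<And>\<xi> \<eta>. norm \<xi> = 1 \<Longrightarrow> norm \<eta> = 1 \<Longrightarrow> \<bar>v \<xi> - v \<eta>\<bar> \<le> C * norm (\<xi> - \<eta>) powr \<alpha>"
  shows "continuous_on (sphere 0 1) v"
  unfolding continuous_on_def
proof
  fix \<eta> :: "real^'n" assume \<eta>: "\<eta> \<in> sphere 0 1"
  have "((\<lambda>\<xi>. C * norm (\<xi> - \<eta>) powr \<alpha>) \<longlongrightarrow> C * norm (\<eta> - \<eta>) powr \<alpha>) (at \<eta> within sphere 0 1)"
    using al by (intro tendsto_intros) auto
  then have "((\<lambda>\<xi>. C * norm (\<xi> - \<eta>) powr \<alpha>) \<longlongrightarrow> 0) (at \<eta> within sphere 0 1)" using al by simp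
  then have "((\<lambda>\<xi>. v \<xi> - v \<eta>) \<longlongrightarrow> 0) (at \<eta> within sphere 0 1)"
    by (rule Lim_null_comparison[rotated]) (use hol \<eta> in \<open>auto simp: eventually_at_filter\<close>)
  then show "(v \<longlongrightarrow> v \<eta>) (at \<eta> within sphere 0 1)" by (simp add: LIM_zero_iff)
qed

text \<open>At each \<open>x\<close> the solution is compared with the one for the constant datum
  \<open>c = v (x / |x|)\<close>, which is \<open>c * (1 / rho - 1)\<close>. The difference
  integrates the kernel against \<open>v \<xi> - c\<close>, and this oscillation is at most a
  multiple of \<open>norm (x - \<xi>) powr \<alpha>\<close>. The resulting bound also shows that
  \<open>W\<close> extends continuously by \<open>v\<close>, so that \<open>V\<close> does solve the
  Dirichlet problem.\<close>

lemma dirichlet_op_estimates: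
  fixes v :: "real^'n::finite \<Rightarrow> real"
  assumes al: "0 < \<alpha>" "\<alpha> \<le> 1"
    and hol: "\<And>\<xi> \<eta>. norm \<xi> = 1 \<Longrightarrow> norm \<eta> = 1 \<Longrightarrow> \<bar>v \<xi> - v \<eta>\<bar> \<le> C0 * norm (\<xi> - \<eta>) powr \<alpha>"
  obtains W C where "C \<ge> 0" "\<And>x. norm x < 1 \<Longrightarrow> dirichlet_op v x = W x / rho x"
    "Ck_on 2 (ball 0 1) W"
    "\<And>x i. norm x < 1 \<Longrightarrow> \<bar>partial i W x\<bar> \<le> C * rho x powr (\<alpha> - 1)"
    "\<And>x. norm x < 1 \<Longrightarrow> x \<noteq> 0 \<Longrightarrow> \<bar>W x - v (x /\<^sub>R norm x)\<bar> \<le> C * rho x powr \<alpha>"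
    "\<And>x. norm x < 1 \<Longrightarrow> \<bar>W x\<bar> \<le> C"
proof -
  define n where "n = real CARD('n)"
  define \<kappa> where "\<kappa> = poisson_integral n (\<lambda>_. 1) (0::real^'n)"
  have \<kappa>: "\<kappa> > 0" unfolding \<kappa>_def by (rule poisson_integral_one_pos)
  \<comment> \<open>Evaluated at a pair of antipodal points, where the distance is positive.\<close>
  have C0: "C0 \<ge> 0"
  proof -
    obtain k :: 'n where True by simp
    have "0 \<le> C0 * norm (axis k (1::real) - - axis k 1) powr \<alpha>"
      using hol[of "axis k 1" "- axis k 1"] by simp
    moreover have "norm (axis k (1::real) - - axis k 1) powr \<alpha> > 0" by (auto simp: vec_eq_iff axis_def)
    ultimately show ?thesis by (simp add: zero_le_mult_iff)
  qed
  have vc: "continuous_on (sphere 0 1) v" by (rule continuous_on_sphere_hoelder[OF al(1) hol])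
  obtain B where B: "\<forall>z\<in>v ` sphere 0 1. norm z \<le> B"
    using compact_imp_bounded[OF compact_continuous_image[OF vc compact_sphere]] unfolding bounded_iff ..
  have vB: "\<bar>v \<xi>\<bar> \<le> B" if "norm \<xi> = 1" for \<xi> using B that by auto
  have B0: "B \<ge> 0" using vB[of "axis undefined 1"] by simp
  obtain D where D: "D \<ge> 0" "\<And>x::real^'n. norm x < 1 \<Longrightarrow>
      (LINT \<xi>|sphere_measure. hyp_kernel n x \<xi> * norm (x - \<xi>) powr \<alpha>) \<le> D * rho x powr (\<alpha> - 1)"
    unfolding n_def using hyp_kernel_weighted_bound[OF al] by blast
  define V where "V = (\<lambda>x. poisson_integral n v x / \<kappa>)"
  define W where "W = (\<lambda>x. rho x * V x)"
  \<comment> \<open>\<open>C0 * 2\<close> serves for \<open>x \<noteq> 0\<close> because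
    \<open>2 powr \<alpha> \<le> 2\<close>; \<open>2 * B\<close> serves at the origin, whose
    distance to every \<open>\<xi>\<close> is 1.\<close>
  define C1 where "C1 = max (C0 * 2) (2 * B)"
  have C1: "C1 \<ge> 0" using C0 by (simp add: C1_def)

  \<comment> \<open>Comparison value at an interior point\<close>
  have osc: "\<exists>c. \<bar>c\<bar> \<le> B \<and> (x \<noteq> 0 \<longrightarrow> c = v (x /\<^sub>R norm x)) \<and> (\<forall>\<xi>. norm \<xi> = 1 \<longrightarrow> \<bar>v \<xi> - c\<bar> \<le> C1 * norm (x - \<xi>) powr \<alpha>)"
    if x: "norm x < 1" for x :: "real^'n"
  proof (cases "x = 0")
    case True
    have "\<bar>v \<xi> - v (axis undefined 1)\<bar> \<le> C1 * norm (x - \<xi>) powr \<alpha>" if "norm \<xi> = 1" for \<xi>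
      using vB[OF that] vB[of "axis undefined 1"] that True
      by (simp add: C1_def max_def) linarith
    then show ?thesis using True vB[of "axis undefined 1"] by (intro exI[of _ "v (axis undefined 1)"]) auto
  next
    case False
    define \<omega> where "\<omega> = x /\<^sub>R norm x"
    have \<omega>: "norm \<omega> = 1" using False by (simp add: \<omega>_def)
    have "\<bar>v \<xi> - v \<omega>\<bar> \<le> C1 * norm (x - \<xi>) powr \<alpha>" if \<xi>: "norm \<xi> = 1" for \<xi>
    proof -
      have "norm (\<omega> - x) = 1 - norm x"
      proof -
        have "\<omega> - x = (1 / norm x - 1) *\<^sub>R x" by (simp add: \<omega>_def scaleR_diff_left divide_inverse)
        moreover have "1 / norm x - 1 \<ge> 0" using x False by simp
        ultimately have "norm (\<omega> - x) = (1 / norm x - 1) * norm x" by simp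
        then show ?thesis using False by (simp add: left_diff_distrib)
      qed
      \<comment> \<open>The radial projection \<open>\<omega>\<close> has distance
        \<open>1 - norm x\<close> from \<open>x\<close>, and no point of the sphere is closer to
        \<open>x\<close> than that.\<close>
      then have "norm (\<xi> - \<omega>) \<le> 2 * norm (x - \<xi>)"
        using norm_diff_sphere_ge(2)[OF x \<xi>] norm_triangle_ineq[of "\<xi> - x" "x - \<omega>"] by (simp add: norm_minus_commute)
      then have "norm (\<xi> - \<omega>) powr \<alpha> \<le> (2 * norm (x - \<xi>)) powr \<alpha>"
        using al by (intro powr_mono2) auto
      also have "\<dots> = 2 powr \<alpha> * norm (x - \<xi>) powr \<alpha>" by (simp add: powr_mult)
      also have "\<dots> \<le> 2 * norm (x - \<xi>) powr \<alpha>"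
        using powr_mono[of \<alpha> 1 2] al by (intro mult_right_mono) auto
      finally have "norm (\<xi> - \<omega>) powr \<alpha> \<le> 2 * norm (x - \<xi>) powr \<alpha>" .
      then have "C0 * norm (\<xi> - \<omega>) powr \<alpha> \<le> C0 * 2 * norm (x - \<xi>) powr \<alpha>"
        using C0 by (simp add: mult_left_mono mult.assoc)
      also have "\<dots> \<le> C1 * norm (x - \<xi>) powr \<alpha>" by (intro mult_right_mono) (auto simp: C1_def)
      finally show ?thesis using hol[OF \<xi> \<omega>] by simp
    qed
    then show ?thesis using vB[OF \<omega>] False by (intro exI[of _ "v \<omega>"]) (auto simp: \<omega>_def)
  qed

  \<comment> \<open>The normalised Poisson integral\<close>
  \<comment> \<open>Division by \<open>\<kappa>\<close> is treated as a linear combination with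
    second coefficient 0.\<close>
  have VC2: "Ck_on 2 (ball 0 1) V"
    unfolding V_def by (rule Ck_on_cong[OF open_ball _ C2_on_lin(1)[OF open_ball poisson_integral_C2(1)[OF vc] poisson_integral_C2(1)[OF vc], of "1 / \<kappa>" n 0 n]]) simp
  have Vl: "laplacian hyp_metric V x = n * V x" if "norm x < 1" for x
  proof -
    have "laplacian hyp_metric V x = laplacian hyp_metric (\<lambda>x. (1 / \<kappa>) * poisson_integral n v x + 0 * poisson_integral n v x) x"
      by (rule laplacian_cong[OF _ that]) (simp add: V_def)
    then show ?thesis
      unfolding laplacian_lin[OF poisson_integral_C2(1)[OF vc] poisson_integral_C2(1)[OF vc] that]
      unfolding poisson_integral_C2(3)[OF vc that] by (simp add: V_def n_def)
  qed
  have cK: "continuous_on (sphere 0 1) (\<lambda>\<xi>. hyp_kernel n x \<xi>)" if "norm x < 1" for x :: "real^'n"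
    using continuous_on_slice(1)[OF hyp_kernel_continuous(1)] that by simp
  have cK': "continuous_on (sphere 0 1) (\<lambda>\<xi>. hyp_kernel' n i x \<xi>)" if "norm x < 1" for x :: "real^'n" and i
    using continuous_on_slice(1)[OF hyp_kernel_continuous(2)] that by simp
  have k0: "hyp_kernel n x \<xi> \<ge> 0" for x \<xi> :: "real^'n" by (simp add: hyp_kernel_def)

  \<comment> \<open>Deviation from the solution with constant data\<close>
  have wb: "(LINT \<xi>|sphere_measure. hyp_kernel n x \<xi> * \<bar>v \<xi> - c\<bar>) \<le> C1 * (D * rho x powr (\<alpha> - 1))"
    if x: "norm x < 1" and c: "\<And>\<xi>. norm \<xi> = 1 \<Longrightarrow> \<bar>v \<xi> - c\<bar> \<le> C1 * norm (x - \<xi>) powr \<alpha>" for x :: "real^'n" and c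
  proof -
    have "(LINT \<xi>|sphere_measure. hyp_kernel n x \<xi> * \<bar>v \<xi> - c\<bar>) \<le> (LINT \<xi>|sphere_measure. C1 * (hyp_kernel n x \<xi> * norm (x - \<xi>) powr \<alpha>))"
    proof (rule integral_mono)
      show "integrable sphere_measure (\<lambda>\<xi>. hyp_kernel n x \<xi> * \<bar>v \<xi> - c\<bar>)"
        by (intro integrable_sphere_measure continuous_intros cK x vc)
      show "integrable sphere_measure (\<lambda>\<xi>. C1 * (hyp_kernel n x \<xi> * norm (x - \<xi>) powr \<alpha>))"
        by (intro integrable_sphere_measure continuous_intros cK x) (use x in auto)
      fix \<xi> :: "real^'n" assume "\<xi> \<in> space sphere_measure"
      then have "norm \<xi> = 1" by simp
      from mult_left_mono[OF c[OF this] k0[of x \<xi>]]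
      show "hyp_kernel n x \<xi> * \<bar>v \<xi> - c\<bar> \<le> C1 * (hyp_kernel n x \<xi> * norm (x - \<xi>) powr \<alpha>)" by (simp add: mult.left_commute)
    qed
    also have "\<dots> \<le> C1 * (D * rho x powr (\<alpha> - 1))"
      using D(2)[OF x] C1 by (simp add: mult_left_mono)
    finally show ?thesis .
  qed
  define E where "E = C1 * D / \<kappa>"
  have E0: "E \<ge> 0" using C1 D(1) \<kappa> by (simp add: E_def)
  have diffV: "\<bar>V x - c * (1 / rho x - 1)\<bar> \<le> E * rho x powr (\<alpha> - 1)"
    if x: "norm x < 1" and c: "\<And>\<xi>. norm \<xi> = 1 \<Longrightarrow> \<bar>v \<xi> - c\<bar> \<le> C1 * norm (x - \<xi>) powr \<alpha>" for x :: "real^'n" and c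
  proof -
    have "poisson_integral n v x - c * poisson_integral n (\<lambda>_. 1) x = (LINT \<xi>|sphere_measure. hyp_kernel n x \<xi> * (v \<xi> - c))"
      unfolding poisson_integral_def right_diff_distrib
      by (subst Bochner_Integration.integral_diff) (auto intro!: integrable_sphere_measure continuous_intros cK x vc simp: mult.commute)
    moreover have "\<kappa> * (V x - c * (1 / rho x - 1)) = poisson_integral n v x - c * poisson_integral n (\<lambda>_. 1) x"
    proof -
      have "\<kappa> * (V x - c * (1 / rho x - 1)) = poisson_integral n v x - c * (\<kappa> * (1 / rho x - 1))"
        unfolding V_def using \<kappa> by (simp add: algebra_simps)
      then show ?thesis using poisson_integral_one_eq[OF x] by (simp only: \<kappa>_def n_def)
    qed
    ultimately have "\<kappa> * (V x - c * (1 / rho x - 1)) = (LINT \<xi>|sphere_measure. hyp_kernel n x \<xi> * (v \<xi> - c))"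
      by (simp only:)
    then have "\<kappa> * \<bar>V x - c * (1 / rho x - 1)\<bar> = \<bar>LINT \<xi>|sphere_measure. hyp_kernel n x \<xi> * (v \<xi> - c)\<bar>"
      using \<kappa> by (metis abs_mult abs_of_pos)
    also have "\<dots> \<le> (LINT \<xi>|sphere_measure. \<bar>hyp_kernel n x \<xi> * (v \<xi> - c)\<bar>)" by (rule integral_abs_bound)
    also have "\<dots> = (LINT \<xi>|sphere_measure. hyp_kernel n x \<xi> * \<bar>v \<xi> - c\<bar>)" using k0 by (simp add: abs_mult)
    also have "\<dots> \<le> C1 * (D * rho x powr (\<alpha> - 1))" by (rule wb[OF x c])
    finally show ?thesis using \<kappa> by (simp add: E_def field_simps)
  qed
  have diffV': "\<bar>rho x * (partial i V x - c * (x $ i / (rho x)\<^sup>2))\<bar> \<le> 3 * n * E * rho x powr (\<alpha> - 1)"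
    if x: "norm x < 1" and c: "\<And>\<xi>. norm \<xi> = 1 \<Longrightarrow> \<bar>v \<xi> - c\<bar> \<le> C1 * norm (x - \<xi>) powr \<alpha>" for x :: "real^'n" and c i
  proof -
    have r: "rho x > 0" using x by (simp add: rho_pos_iff)
    have pv: "partial i (poisson_integral n u) x = (LINT \<xi>|sphere_measure. hyp_kernel' n i x \<xi> * u \<xi>)"
      if "continuous_on (sphere 0 1) u" for u
      by (rule poisson_integral_C2(2)[OF that x])
    have pV: "partial i V x = partial i (poisson_integral n v) x / \<kappa>"
    proof -
      have "((\<lambda>x. poisson_integral n v x / \<kappa>) has_derivative (\<lambda>h. (\<Sum>i\<in>UNIV. partial i (poisson_integral n v) x * h $ i) / \<kappa>)) (at x)"
        using C2_onD(1)[OF poisson_integral_C2(1)[OF vc], of x n] x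
        by (intro has_derivative_divide has_derivative_partial bounded_linear.has_derivative[OF bounded_linear_divide]) auto
      from partial_has_derivative[OF this, of i] show ?thesis
        by (simp add: V_def axis_def if_distrib cong: if_cong)
    qed
    have p1: "partial i (poisson_integral n (\<lambda>_. 1)) x = \<kappa> * (x $ i / (rho x)\<^sup>2)"
    proof -
      have "partial i (poisson_integral n (\<lambda>_. 1)) x = partial i (\<lambda>x. \<kappa> * (1 / rho x - 1)) x"
        by (rule partial_cong_open[of "ball 0 1"]) (use x poisson_integral_one_eq in \<open>auto simp: \<kappa>_def n_def\<close>)
      also have "((\<lambda>x. \<kappa> * (1 / rho x - 1)) has_derivative (\<lambda>h. \<kappa> * ((x \<bullet> h) / (rho x)\<^sup>2))) (at x)"
        using r by (auto intro!: derivative_eq_intros rho_has_derivative simp: power2_eq_square)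
      from partial_has_derivative[OF this, of i] have "partial i (\<lambda>x. \<kappa> * (1 / rho x - 1)) x = \<kappa> * (x $ i / (rho x)\<^sup>2)"
        by (simp add: inner_axis_one)
      finally show ?thesis .
    qed
    have "(LINT \<xi>|sphere_measure. hyp_kernel' n i x \<xi> * (v \<xi> - c)) = partial i (poisson_integral n v) x - c * partial i (poisson_integral n (\<lambda>_. 1)) x"
      unfolding right_diff_distrib pv[OF vc] pv[OF continuous_on_const]
      by (subst Bochner_Integration.integral_diff) (auto intro!: integrable_sphere_measure continuous_intros cK' x vc simp: mult.commute)
    then have "\<kappa> * (rho x * (partial i V x - c * (x $ i / (rho x)\<^sup>2))) = rho x * (LINT \<xi>|sphere_measure. hyp_kernel' n i x \<xi> * (v \<xi> - c))"
    proof -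
      assume I: "(LINT \<xi>|sphere_measure. hyp_kernel' n i x \<xi> * (v \<xi> - c)) = partial i (poisson_integral n v) x - c * partial i (poisson_integral n (\<lambda>_. 1)) x"
      have alg: "\<kappa> * (b * (A / \<kappa> - c * t)) = b * (A - c * (\<kappa> * t))" for A b t
        using \<kappa> by (simp add: algebra_simps)
      show ?thesis unfolding I pV p1 alg ..
    qed
    also have "\<dots> = (LINT \<xi>|sphere_measure. rho x * (hyp_kernel' n i x \<xi> * (v \<xi> - c)))" by simp
    finally have "\<kappa> * \<bar>rho x * (partial i V x - c * (x $ i / (rho x)\<^sup>2))\<bar> = \<bar>LINT \<xi>|sphere_measure. rho x * (hyp_kernel' n i x \<xi> * (v \<xi> - c))\<bar>"
      using \<kappa> by (metis abs_mult abs_of_pos)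
    also have "\<dots> \<le> (LINT \<xi>|sphere_measure. \<bar>rho x * (hyp_kernel' n i x \<xi> * (v \<xi> - c))\<bar>)" by (rule integral_abs_bound)
    also have "\<dots> \<le> (LINT \<xi>|sphere_measure. 3 * n * (hyp_kernel n x \<xi> * \<bar>v \<xi> - c\<bar>))"
    proof (rule integral_mono)
      show "integrable sphere_measure (\<lambda>\<xi>. \<bar>rho x * (hyp_kernel' n i x \<xi> * (v \<xi> - c))\<bar>)"
        by (intro integrable_sphere_measure continuous_intros cK' x vc)
      show "integrable sphere_measure (\<lambda>\<xi>. 3 * n * (hyp_kernel n x \<xi> * \<bar>v \<xi> - c\<bar>))"
        by (intro integrable_sphere_measure continuous_intros cK x vc)
      fix \<xi> :: "real^'n" assume "\<xi> \<in> space sphere_measure"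
      then have \<xi>: "norm \<xi> = 1" by simp
      have d: "norm (x - \<xi>) > 0" using x \<xi> by auto
      \<comment> \<open>The derivative costs one power of \<open>rho\<close>: the radial part
        contributes at most 1 and the remaining part at most 2, since
        \<open>rho x \<le> norm (x - \<xi>)\<close>. Hence the constant 3.\<close>
      have "rho x * kernel_dir i x \<xi> = - x $ i - 2 * (rho x / norm (x - \<xi>)) * ((x - \<xi>) $ i / norm (x - \<xi>))"
        using r d by (simp add: kernel_dir_def field_simps power2_eq_square)
      also have "\<bar>\<dots>\<bar> \<le> \<bar>x $ i\<bar> + 2 * (rho x / norm (x - \<xi>)) * (\<bar>(x - \<xi>) $ i\<bar> / norm (x - \<xi>))"
        using r d abs_triangle_ineq4[of "- x $ i" "2 * (rho x / norm (x - \<xi>)) * ((x - \<xi>) $ i / norm (x - \<xi>))"]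
        by (simp add: abs_mult)
      also have "\<dots> \<le> 1 + 2 * 1 * 1"
      proof (intro add_mono mult_mono)
        show "\<bar>x $ i\<bar> \<le> 1" using component_le_norm_cart[of x i] x by simp
        show "rho x / norm (x - \<xi>) \<le> 1" using norm_diff_sphere_ge[OF x \<xi>] d by simp
        show "\<bar>(x - \<xi>) $ i\<bar> / norm (x - \<xi>) \<le> 1" using component_le_norm_cart[of "x - \<xi>" i] d by simp
      qed (use r d in auto)
      finally have "\<bar>rho x * kernel_dir i x \<xi>\<bar> \<le> 3" by simp
      then have "n * (hyp_kernel n x \<xi> * \<bar>v \<xi> - c\<bar>) * \<bar>rho x * kernel_dir i x \<xi>\<bar> \<le> n * (hyp_kernel n x \<xi> * \<bar>v \<xi> - c\<bar>) * 3"
        using k0[of x \<xi>] by (intro mult_left_mono) (auto simp: n_def)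
      then show "\<bar>rho x * (hyp_kernel' n i x \<xi> * (v \<xi> - c))\<bar> \<le> 3 * n * (hyp_kernel n x \<xi> * \<bar>v \<xi> - c\<bar>)"
        using k0[of x \<xi>] by (simp add: hyp_kernel'_def abs_mult n_def ac_simps)
    qed
    also have "\<dots> = 3 * n * (LINT \<xi>|sphere_measure. hyp_kernel n x \<xi> * \<bar>v \<xi> - c\<bar>)" by simp
    also have "\<dots> \<le> 3 * n * (C1 * (D * rho x powr (\<alpha> - 1)))"
      by (intro mult_left_mono wb[OF x c]) (auto simp: n_def)
    finally show ?thesis using \<kappa> by (simp add: E_def field_simps)
  qed

  \<comment> \<open>Bounds for \<open>W\<close> and its derivatives\<close>
  define C where "C = E + 3 * n * E + 2 * B"
  have C: "C \<ge> 0" using E0 B0 by (simp add: C_def n_def)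
  have powr_split: "rho x * rho x powr (\<alpha> - 1) = rho x powr \<alpha>" if "norm x < 1" for x :: "real^'n"
    using that rho_pos_iff[of x] powr_add[of "rho x" 1 "\<alpha> - 1"] by simp
  have r_le: "rho x \<le> rho x powr \<alpha>" "1 \<le> rho x powr (\<alpha> - 1)" "rho x powr \<alpha> \<le> 1" if "norm x < 1" for x :: "real^'n"
  proof -
    have r: "rho x > 0" "rho x \<le> 1" using that rho_le_half[of x] by (auto simp: rho_pos_iff)
    show "rho x \<le> rho x powr \<alpha>" using powr_mono'[of \<alpha> 1 "rho x"] r al by simp
    show "1 \<le> rho x powr (\<alpha> - 1)" using powr_mono'[of "\<alpha> - 1" 0 "rho x"] r al by simp
    show "rho x powr \<alpha> \<le> 1" using powr_mono'[of 0 \<alpha> "rho x"] r al by simp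
  qed
  have W_c: "\<bar>W x - c\<bar> \<le> (E + B) * rho x powr \<alpha>"
    if x: "norm x < 1" and cB: "\<bar>c\<bar> \<le> B" and c: "\<And>\<xi>. norm \<xi> = 1 \<Longrightarrow> \<bar>v \<xi> - c\<bar> \<le> C1 * norm (x - \<xi>) powr \<alpha>" for x c
  proof -
    have r: "rho x > 0" using x by (simp add: rho_pos_iff)
    \<comment> \<open>The shift by -1 in \<open>1 / rho - 1\<close> leaves the term
      \<open>rho x * c\<close>, harmless because \<open>rho \<le> rho powr \<alpha>\<close>.\<close>
    have "W x - c = rho x * (V x - c * (1 / rho x - 1)) - rho x * c"
      using r by (simp add: W_def field_simps)
    then have "\<bar>W x - c\<bar> \<le> rho x * \<bar>V x - c * (1 / rho x - 1)\<bar> + rho x * \<bar>c\<bar>"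
      using r abs_triangle_ineq4[of "rho x * (V x - c * (1 / rho x - 1))" "rho x * c"] by (simp add: abs_mult)
    also have "\<dots> \<le> rho x * (E * rho x powr (\<alpha> - 1)) + rho x powr \<alpha> * B"
      using r diffV[OF x c] cB r_le(1)[OF x] B0 by (intro add_mono mult_left_mono mult_mono) auto
    also have "\<dots> = (E + B) * rho x powr \<alpha>" using powr_split[OF x] by (simp add: algebra_simps)
    finally show ?thesis .
  qed
  have diffVx: "V differentiable (at x)" if "norm x < 1" for x using C2_onD(1)[OF VC2, of x] that by simp
  have WC2: "Ck_on 2 (ball 0 1) W"
  proof (rule C2_onI(1)[OF open_ball])
    have dr: "(rho has_derivative (\<lambda>h. \<Sum>i\<in>UNIV. (- x $ i) * h $ i)) (at x)" for x :: "real^'n"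
      by (rule has_derivative_eq_rhs[OF rho_has_derivative]) (simp add: fun_eq_iff inner_vec_def sum_negf)
    have dpr: "((\<lambda>x. f x * g x) has_derivative (\<lambda>h. \<Sum>i\<in>UNIV. (f x * g' i + f' i * g x) * h $ i)) (at x)"
      if "(f has_derivative (\<lambda>h. \<Sum>i\<in>UNIV. f' i * h $ i)) (at x)" "(g has_derivative (\<lambda>h. \<Sum>i\<in>UNIV. g' i * h $ i)) (at x)"
      for f g :: "real^'n \<Rightarrow> real" and f' g' x
      by (rule has_derivative_eq_rhs[OF has_derivative_mult[OF that]])
         (simp add: fun_eq_iff sum_distrib_left sum_distrib_right sum.distrib[symmetric], intro allI sum.cong refl, simp add: algebra_simps)
    have dsum: "((\<lambda>x. f x + g x) has_derivative (\<lambda>h. \<Sum>i\<in>UNIV. (f' i + g' i) * h $ i)) (at x)"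
      if "(f has_derivative (\<lambda>h. \<Sum>i\<in>UNIV. f' i * h $ i)) (at x)" "(g has_derivative (\<lambda>h. \<Sum>i\<in>UNIV. g' i * h $ i)) (at x)"
      for f g :: "real^'n \<Rightarrow> real" and f' g' x
      by (rule has_derivative_eq_rhs[OF has_derivative_add[OF that]]) (simp add: fun_eq_iff distrib_right sum.distrib)
    have dcomp: "((\<lambda>x. - x $ i) has_derivative (\<lambda>h. \<Sum>j\<in>UNIV. (if i = j then -1 else 0) * h $ j)) (at x)" for i and x :: "real^'n"
      by (rule has_derivative_eq_rhs[OF has_derivative_minus[OF bounded_linear_imp_has_derivative[OF bounded_linear_vec_nth[of i]]]])
         (simp add: fun_eq_iff sum_delta_mult)
    show "(W has_derivative (\<lambda>h. \<Sum>i\<in>UNIV. (rho x * partial i V x + (- x $ i) * V x) * h $ i)) (at x)" if "x \<in> ball 0 1" for x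
      unfolding W_def by (rule dpr[OF dr has_derivative_partial[OF diffVx]]) (use that in simp)
    show "((\<lambda>x. rho x * partial i V x + (- x $ i) * V x) has_derivative (\<lambda>h. \<Sum>j\<in>UNIV.
        ((rho x * partial j (partial i V) x + (- x $ j) * partial i V x) + ((- x $ i) * partial j V x + (if i = j then -1 else 0) * V x)) * h $ j)) (at x)"
      if "x \<in> ball 0 1" for x i
      by (intro dsum dpr dr dcomp has_derivative_partial diffVx C2_onD(2)[OF VC2 that]) (use that in simp)
    show "continuous_on (ball 0 1) (\<lambda>x. (rho x * partial j (partial i V) x + (- x $ j) * partial i V x) + ((- x $ i) * partial j V x + (if i = j then -1 else 0) * V x))" for i j
    proof -
      have "continuous_on (ball 0 1) (partial k V)" "continuous_on (ball 0 1) V" for k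
        using C2_onD(1,2)[OF VC2] by (auto intro!: differentiable_imp_continuous_on differentiable_at_imp_differentiable_on)
      moreover have "continuous_on (ball 0 1) (rho :: real^'n \<Rightarrow> real)" unfolding rho_def by (intro continuous_intros) auto
      ultimately show ?thesis using C2_onD(3)[OF VC2] by (intro continuous_intros)
    qed
  qed
  have pW: "partial i W x = rho x * partial i V x - x $ i * V x" if x: "norm x < 1" for x i
    unfolding W_def
    using partial_has_derivative[OF has_derivative_mult[OF rho_has_derivative frechet_derivative_works[THEN iffD1, OF diffVx[OF x]]], of i]
    by (simp add: partial_def inner_axis_one)
  have b1: "\<bar>partial i W x\<bar> \<le> C * rho x powr (\<alpha> - 1)" if x: "norm x < 1" for x i
  proof -
    have r: "rho x > 0" using x by (simp add: rho_pos_iff)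
    obtain c where c: "\<bar>c\<bar> \<le> B" "\<And>\<xi>. norm \<xi> = 1 \<Longrightarrow> \<bar>v \<xi> - c\<bar> \<le> C1 * norm (x - \<xi>) powr \<alpha>" using osc[OF x] by blast
    have xi: "\<bar>x $ i\<bar> \<le> 1" using component_le_norm_cart[of x i] x by simp
    define T1 where "T1 = rho x * (partial i V x - c * (x $ i / (rho x)\<^sup>2))"
    define T2 where "T2 = V x - c * (1 / rho x - 1)"
    \<comment> \<open>The singular contributions \<open>c * x $ i / rho x\<close> contained in
      \<open>T1\<close> and in \<open>x $ i * T2\<close> cancel.\<close>
    have "partial i W x = T1 - x $ i * T2 + c * x $ i"
      unfolding pW[OF x] T1_def T2_def using r by (simp add: field_simps power2_eq_square)
    then have "\<bar>partial i W x\<bar> \<le> \<bar>T1\<bar> + \<bar>x $ i\<bar> * \<bar>T2\<bar> + \<bar>c\<bar> * \<bar>x $ i\<bar>"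
      by (simp add: abs_mult[symmetric])
    also have "\<dots> \<le> 3 * n * E * rho x powr (\<alpha> - 1) + 1 * (E * rho x powr (\<alpha> - 1)) + B * 1"
      using diffV'[OF x c(2), of i] diffV[OF x c(2)] xi c(1) B0 unfolding T1_def T2_def by (intro add_mono mult_mono) auto
    also have "\<dots> \<le> 3 * n * E * rho x powr (\<alpha> - 1) + 1 * (E * rho x powr (\<alpha> - 1)) + 2 * B * rho x powr (\<alpha> - 1)"
      using mult_left_mono[OF r_le(2)[OF x], of "B"] B0 by simp
    finally show ?thesis by (simp add: C_def algebra_simps)
  qed
  have EB: "E + B \<le> C" using E0 B0 by (simp add: C_def n_def)
  have b2: "\<bar>W x - v (x /\<^sub>R norm x)\<bar> \<le> C * rho x powr \<alpha>" if x: "norm x < 1" "x \<noteq> 0" for x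
  proof -
    obtain c where c: "\<bar>c\<bar> \<le> B" "c = v (x /\<^sub>R norm x)" "\<And>\<xi>. norm \<xi> = 1 \<Longrightarrow> \<bar>v \<xi> - c\<bar> \<le> C1 * norm (x - \<xi>) powr \<alpha>" using osc[OF x(1)] x(2) by blast
    show ?thesis using W_c[OF x(1) c(1,3)] mult_right_mono[OF EB, of "rho x powr \<alpha>"] by (simp add: c(2))
  qed
  have b3: "\<bar>W x\<bar> \<le> C" if x: "norm x < 1" for x
  proof -
    obtain c where c: "\<bar>c\<bar> \<le> B" "\<And>\<xi>. norm \<xi> = 1 \<Longrightarrow> \<bar>v \<xi> - c\<bar> \<le> C1 * norm (x - \<xi>) powr \<alpha>" using osc[OF x] by blast
    have "\<bar>W x - c\<bar> \<le> (E + B) * 1"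
      using W_c[OF x c] mult_left_mono[OF r_le(3)[OF x], of "E + B"] E0 B0 by simp
    moreover have "E + 2 * B \<le> C" using E0 by (simp add: C_def n_def)
    moreover have "\<bar>W x\<bar> \<le> \<bar>W x - c\<bar> + \<bar>c\<bar>" using abs_triangle_ineq[of "W x - c" c] by simp
    ultimately show ?thesis using c(1) by simp
  qed

  \<comment> \<open>Continuity up to the sphere\<close>
  define W' where "W' = (\<lambda>x. if norm x < 1 then W x else v x)"
  have W'c: "continuous_on (cball 0 1) W'"
    unfolding continuous_on_def
  proof
    fix y :: "real^'n" assume y: "y \<in> cball 0 1"
    show "(W' \<longlongrightarrow> W' y) (at y within cball 0 1)"
    proof (cases "norm y < 1")
      case True
      have "isCont W y" using C2_onD(1)[OF WC2, of y] True by (auto intro: differentiable_imp_continuous_within)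
      then have "(W \<longlongrightarrow> W y) (at y within cball 0 1)" unfolding isCont_def by (rule tendsto_within_subset) simp
      moreover have "\<forall>\<^sub>F x in at y within cball 0 1. W x = W' x"
        using eventually_at_in_open'[of "ball 0 1" y] True
        by (auto simp: W'_def eventually_at_filter elim!: eventually_mono dest!: eventually_nhds_in_open[OF open_ball, of y 0 1])
      ultimately have "(W' \<longlongrightarrow> W y) (at y within cball 0 1)" by (rule Lim_transform_eventually)
      then show ?thesis using True by (simp add: W'_def)
    next
      case False
      then have y1: "norm y = 1" using y by simp
      define u where "u = (\<lambda>x::real^'n. v (x /\<^sub>R norm x))"
      have ucont: "continuous_on (- {0}) u"
        unfolding u_def by (rule continuous_on_compose2[OF vc]) (auto intro!: continuous_intros, metis left_inverse norm_eq_zero)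
      have "isCont u y" using ucont y1 by (subst (asm) continuous_on_eq_continuous_at) auto
      then have "(u \<longlongrightarrow> u y) (at y within cball 0 1)" unfolding isCont_def by (rule tendsto_within_subset) simp
      \<comment> \<open>Near the sphere \<open>W'\<close> is compared with the radial extension
        \<open>u\<close> of \<open>v\<close>, which is continuous there; the gap is at most
        \<open>C * rho x powr \<alpha>\<close>.\<close>
      moreover have "((\<lambda>x. W' x - u x) \<longlongrightarrow> 0) (at y within cball 0 1)"
      proof (rule Lim_null_comparison)
        have "((\<lambda>x. C * rho x powr \<alpha>) \<longlongrightarrow> C * rho y powr \<alpha>) (at y within cball 0 1)"
        proof -
          have "((\<lambda>x. rho x) \<longlongrightarrow> rho y) (at y within cball 0 1)" unfolding rho_def by (intro tendsto_intros) auto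
          moreover have "\<forall>\<^sub>F x in at y within cball 0 1. 0 \<le> rho x"
            by (auto simp: eventually_at_filter rho_def abs_square_le_1)
          ultimately show ?thesis using al by (intro tendsto_mult tendsto_const tendsto_powr') auto
        qed
        then show "((\<lambda>x. C * rho x powr \<alpha>) \<longlongrightarrow> 0) (at y within cball 0 1)" using y1 al by (simp add: rho_def)
        have "\<forall>\<^sub>F x in at y within cball 0 1. x \<noteq> 0 \<and> x \<in> cball 0 1"
        proof -
          have "\<forall>\<^sub>F x in nhds y. x \<in> - {0}" using y1 by (intro eventually_nhds_in_open) auto
          then show ?thesis unfolding eventually_at_filter by eventually_elim auto
        qed
        then show "\<forall>\<^sub>F x in at y within cball 0 1. norm (W' x - u x) \<le> C * rho x powr \<alpha>"
        proof eventually_elim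
          case (elim x)
          show ?case
          proof (cases "norm x < 1")
            case True then show ?thesis using b2[of x] elim by (simp add: W'_def u_def)
          next
            case False
            then have "norm x = 1" using elim by simp
            then show ?thesis using C by (simp add: W'_def u_def)
          qed
        qed
      qed
      ultimately have "((\<lambda>x. u x + (W' x - u x)) \<longlongrightarrow> u y + 0) (at y within cball 0 1)" by (rule tendsto_add)
      then show ?thesis using y1 by (simp add: u_def W'_def)
    qed
  qed
  have "dirichlet_solution v V"
    unfolding dirichlet_solution_def
  proof (intro conjI)
    show "Ck_on 2 (ball 0 1) V" by (rule VC2)
    show "\<forall>x\<in>ball 0 1. laplacian hyp_metric V x = real CARD('n) * V x" using Vl by (simp add: n_def)
    show "\<exists>W. continuous_on (cball 0 1) W \<and> (\<forall>x\<in>ball 0 1. W x = rho x * V x) \<and> (\<forall>x\<in>sphere 0 1. W x = v x)"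
      by (intro exI[of _ W'] conjI W'c) (auto simp: W'_def W_def)
  qed
  then have "dirichlet_op v x = W x / rho x" if "norm x < 1" for x
    using dirichlet_op_eqI that rho_pos_iff[of x] by (simp add: W_def)
  then show thesis using that[of C W] C WC2 b1 b2 b3 by blast
qed

section \<open>Hoelder functions on the sphere\<close>

lemma Ck_on_imp_continuous_on:
  assumes "Ck_on k U f" "open U"
  shows "continuous_on U f"
  using assms by (cases k) (auto intro!: differentiable_imp_continuous_on differentiable_at_imp_differentiable_on)

lemma C1_lipschitz_cball:
  fixes f :: "real^'n::finite \<Rightarrow> real"
  assumes d: "\<And>y. y \<in> cball x r \<Longrightarrow> f differentiable (at y)"
    and c: "\<And>i. continuous_on (cball x r) (partial i f)"
  obtains L where "L \<ge> 0" "\<And>y z. y \<in> cball x r \<Longrightarrow> z \<in> cball x r \<Longrightarrow> \<bar>f y - f z\<bar> \<le> L * norm (y - z)"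
    "\<And>i y. y \<in> cball x r \<Longrightarrow> \<bar>partial i f y\<bar> \<le> L"
proof -
  have "\<exists>B. \<forall>y\<in>cball x r. \<bar>partial i f y\<bar> \<le> B" for i
    using compact_imp_bounded[OF compact_continuous_image[OF c compact_cball], of i] unfolding bounded_iff by auto
  then obtain B where B: "\<And>i y. y \<in> cball x r \<Longrightarrow> \<bar>partial i f y\<bar> \<le> B i" by metis
  define L where "L = (\<Sum>i\<in>UNIV. \<bar>B i\<bar>)"
  have L: "L \<ge> 0" by (simp add: L_def sum_nonneg)
  have Bi: "\<bar>B i\<bar> \<le> L" for i unfolding L_def by (rule member_le_sum) auto
  have "\<bar>f y - f z\<bar> \<le> L * norm (y - z)" if yz: "y \<in> cball x r" "z \<in> cball x r" for y z
  proof -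
    have "norm (f y - f z) \<le> L * norm (y - z)"
    proof (rule differentiable_bound[of "cball x r" f "\<lambda>w h. \<Sum>i\<in>UNIV. partial i f w * h $ i"])
      fix w assume w: "w \<in> cball x r"
      show "(f has_derivative (\<lambda>h. \<Sum>i\<in>UNIV. partial i f w * h $ i)) (at w within cball x r)"
        using has_derivative_partial[OF d[OF w]] by (rule has_derivative_at_withinI)
      show "onorm (\<lambda>h. \<Sum>i\<in>UNIV. partial i f w * h $ i) \<le> L"
      proof (rule onorm_le)
        fix h :: "real^'n"
        have "norm (\<Sum>i\<in>UNIV. partial i f w * h $ i) \<le> (\<Sum>i\<in>UNIV. norm (partial i f w * h $ i))" by (rule norm_sum)
        also have "\<dots> \<le> (\<Sum>i\<in>UNIV. \<bar>B i\<bar> * norm h)"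
          using order_trans[OF B[OF w] abs_ge_self] component_le_norm_cart[of h] by (intro sum_mono) (auto simp: abs_mult intro!: mult_mono)
        finally show "norm (\<Sum>i\<in>UNIV. partial i f w * h $ i) \<le> L * norm h" by (simp add: L_def sum_distrib_right)
      qed
    qed (use yz in auto)
    then show ?thesis by simp
  qed
  moreover have "\<bar>partial i f y\<bar> \<le> L" if "y \<in> cball x r" for i y
    using B[OF that, of i] Bi[of i] by linarith
  ultimately show thesis using that L by blast
qed

text \<open>Nearby points share one ball of a finite cover; points at distance at least
  \<open>\<delta>\<close> are handled by boundedness of \<open>f\<close>. The sets in question, the
  sphere and the closed ball with a neighbourhood of \<open>K'\<close> removed, are not convex in
  general, so a mean value argument along segments does not apply.\<close>

lemma locally_lipschitz_on_compact:
  fixes f :: "'a::metric_space \<Rightarrow> real"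
  assumes S: "compact S" and loc: "\<And>x. x \<in> S \<Longrightarrow> \<exists>r>0. \<exists>L. \<forall>y\<in>ball x r \<inter> S. \<forall>z\<in>ball x r \<inter> S. \<bar>f y - f z\<bar> \<le> L * dist y z"
  obtains L where "L \<ge> 0" "\<And>y z. y \<in> S \<Longrightarrow> z \<in> S \<Longrightarrow> \<bar>f y - f z\<bar> \<le> L * dist y z"
proof (cases "S = {}")
  case True
  show thesis by (rule that[of 0]) (use True in auto)
next
  case False
  obtain r L where rL: "\<And>x. x \<in> S \<Longrightarrow> r x > 0"
    "\<And>x y z. x \<in> S \<Longrightarrow> y \<in> ball x (r x) \<inter> S \<Longrightarrow> z \<in> ball x (r x) \<inter> S \<Longrightarrow> \<bar>f y - f z\<bar> \<le> L x * dist y z"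
    using loc by metis
  have cont: "continuous_on S f"
    unfolding continuous_on_iff
  proof (intro ballI allI impI)
    fix x and e :: real assume x: "x \<in> S" and e: "e > 0"
    define d where "d = min (r x) (e / (\<bar>L x\<bar> + 1))"
    have d: "d > 0" using rL(1)[OF x] e by (simp add: d_def)
    have "dist (f y) (f x) < e" if y: "y \<in> S" "dist y x < d" for y
    proof -
      have "\<bar>f y - f x\<bar> \<le> L x * dist y x"
        using rL(2)[OF x, of y x] y x rL(1)[OF x] by (simp add: d_def dist_commute)
      also have "\<dots> \<le> (\<bar>L x\<bar> + 1) * dist y x" by (intro mult_right_mono) auto
      also have "\<dots> < (\<bar>L x\<bar> + 1) * (e / (\<bar>L x\<bar> + 1))" using y by (intro mult_strict_left_mono) (auto simp: d_def)
      also have "\<dots> = e" by (simp add: field_simps)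
      finally show ?thesis by (simp add: dist_real_def)
    qed
    then show "\<exists>d>0. \<forall>x'\<in>S. dist x' x < d \<longrightarrow> dist (f x') (f x) < e" using d by blast
  qed
  obtain B where B: "\<forall>z\<in>f ` S. norm z \<le> B"
    using compact_imp_bounded[OF compact_continuous_image[OF cont S]] unfolding bounded_iff ..
  \<comment> \<open>Halving the radii produces a Lebesgue number: if one point lies in a half ball,
    every point closer than \<open>\<delta>\<close> lies in the full ball.\<close>
  have "S \<subseteq> (\<Union>x\<in>S. ball x (r x / 2))" using rL(1) by force
  then obtain T where T: "T \<subseteq> S" "finite T" "S \<subseteq> (\<Union>x\<in>T. ball x (r x / 2))"
    using compactE_image[OF S, of S "\<lambda>x. ball x (r x / 2)"] by auto
  have Tne: "T \<noteq> {}" using T False by auto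
  define \<delta> where "\<delta> = Min ((\<lambda>x. r x / 2) ` T)"
  have \<delta>: "\<delta> > 0" unfolding \<delta>_def using T Tne rL(1) by (subst Min_gr_iff) auto
  define M where "M = (\<Sum>x\<in>T. \<bar>L x\<bar>) + 2 * \<bar>B\<bar> / \<delta>"
  have M: "M \<ge> 0" using \<delta> by (simp add: M_def sum_nonneg)
  have "\<bar>f y - f z\<bar> \<le> M * dist y z" if yz: "y \<in> S" "z \<in> S" for y z
  proof (cases "dist y z < \<delta>")
    case True
    obtain x where x: "x \<in> T" "y \<in> ball x (r x / 2)" using T(3) yz by auto
    have "\<delta> \<le> r x / 2" unfolding \<delta>_def using T(2) x by (intro Min_le) auto
    then have "dist x z < r x" using x(2) True dist_triangle[of x z y] by (simp add: dist_commute)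
    moreover have "dist x y < r x" using x T rL(1)[of x] by auto
    ultimately have "\<bar>f y - f z\<bar> \<le> L x * dist y z" using rL(2)[of x y z] x T yz by auto
    also have "\<dots> \<le> M * dist y z"
    proof (rule mult_right_mono)
      have "\<bar>L x\<bar> \<le> (\<Sum>x\<in>T. \<bar>L x\<bar>)" by (rule member_le_sum) (use T x in auto)
      then show "L x \<le> M" using \<delta> by (simp add: M_def) (smt (verit) divide_nonneg_pos abs_ge_zero)
    qed simp
    finally show ?thesis .
  next
    case False
    have "\<bar>f y\<bar> \<le> B" "\<bar>f z\<bar> \<le> B" using B yz by auto
    then have "\<bar>f y - f z\<bar> \<le> 2 * \<bar>B\<bar>" by linarith
    also have "\<dots> = 2 * \<bar>B\<bar> / \<delta> * \<delta>" using \<delta> by simp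
    also have "\<dots> \<le> M * dist y z"
      using False \<delta> M by (intro mult_mono) (auto simp: M_def sum_nonneg)
    finally show ?thesis .
  qed
  then show thesis using that M by blast
qed

text \<open>All later estimates need only some exponent at most 1. For \<open>\<epsilon> < 1\<close>
  it is \<open>\<epsilon>\<close> itself; otherwise the degree 0 extension of \<open>v\<close> is
  continuously differentiable off the origin, hence Lipschitz on the sphere.\<close>

lemma holder_spaceD:
  fixes v :: "real^'n::finite \<Rightarrow> real"
  assumes v: "v \<in> holder_space \<epsilon>" and \<epsilon>: "\<epsilon> > 0"
  obtains \<alpha> C where "0 < \<alpha>" "\<alpha> \<le> 1"
    "\<And>\<xi> \<eta>. norm \<xi> = 1 \<Longrightarrow> norm \<eta> = 1 \<Longrightarrow> \<bar>v \<xi> - v \<eta>\<bar> \<le> C * norm (\<xi> - \<eta>) powr \<alpha>"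
proof (cases "\<epsilon> < 1")
  case True
  then have k: "nat \<lfloor>\<epsilon>\<rfloor> = 0" using \<epsilon> by simp
  have "\<exists>C. \<forall>x\<in>sphere 0 1. \<forall>y\<in>sphere 0 1. \<bar>v (x /\<^sub>R norm x) - v (y /\<^sub>R norm y)\<bar> \<le> C * dist x y powr \<epsilon>"
    \<comment> \<open>With \<open>k = 0\<close> the condition concerns only the empty list of
      derivatives, that is, \<open>w\<close> itself.\<close>
    using v \<epsilon> unfolding holder_space_def Let_def k by (auto dest: spec[of _ "[]"])
  then obtain C where C: "\<forall>x\<in>sphere 0 1. \<forall>y\<in>sphere 0 1. \<bar>v (x /\<^sub>R norm x) - v (y /\<^sub>R norm y)\<bar> \<le> C * dist x y powr \<epsilon>" ..
  show thesis
  proof (rule that[of \<epsilon> C])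
    fix \<xi> \<eta> :: "real^'n" assume "norm \<xi> = 1" "norm \<eta> = 1"
    then show "\<bar>v \<xi> - v \<eta>\<bar> \<le> C * norm (\<xi> - \<eta>) powr \<epsilon>"
      using C[rule_format, of \<xi> \<eta>] by (simp add: dist_norm)
  qed (use True \<epsilon> in auto)
next
  case False
  define w where "w = (\<lambda>x. v (x /\<^sub>R norm x))"
  obtain k where k: "nat \<lfloor>\<epsilon>\<rfloor> = Suc k"
    using False by (metis One_nat_def Suc_leI le_nat_floor not_less of_nat_1 not0_implies_Suc less_numeral_extra(3) zero_less_one_class.zero_less_one order_less_le_trans)
  have w: "Ck_on (Suc k) (- {0}) w" using v unfolding holder_space_def Let_def k w_def by simp
  have wd: "w differentiable (at x)" if "x \<noteq> 0" for x using w that by simp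
  have wc: "continuous_on (- {0}) (partial i w)" for i
    using w by (intro Ck_on_imp_continuous_on) auto
  obtain L where L: "L \<ge> 0" "\<And>y z. y \<in> sphere 0 1 \<Longrightarrow> z \<in> sphere 0 1 \<Longrightarrow> \<bar>w y - w z\<bar> \<le> L * dist y z"
  proof (rule locally_lipschitz_on_compact[OF compact_sphere])
    fix x :: "real^'n" assume x: "x \<in> sphere 0 1"
    have "y \<noteq> 0" if "y \<in> cball x (1/2)" for y using that x by auto
    then obtain L where L: "\<And>y z. y \<in> cball x (1/2) \<Longrightarrow> z \<in> cball x (1/2) \<Longrightarrow> \<bar>w y - w z\<bar> \<le> L * norm (y - z)"
      using C1_lipschitz_cball[of x "1/2" w] wd continuous_on_subset[OF wc, of "cball x (1/2)"]
      by (metis (no_types, lifting) ComplI singletonD subsetI)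
    show "\<exists>r>0. \<exists>L. \<forall>y\<in>ball x r \<inter> sphere 0 1. \<forall>z\<in>ball x r \<inter> sphere 0 1. \<bar>w y - w z\<bar> \<le> L * dist y z"
      by (intro exI[of _ "1/2"] conjI exI[of _ L]) (auto intro!: L simp: dist_norm less_imp_le)
  qed blast
  show thesis
  proof (rule that[of 1 L])
    fix \<xi> \<eta> :: "real^'n" assume "norm \<xi> = 1" "norm \<eta> = 1"
    then show "\<bar>v \<xi> - v \<eta>\<bar> \<le> L * norm (\<xi> - \<eta>) powr 1"
      using L(2)[of \<xi> \<eta>] by (simp add: w_def dist_norm)
  qed simp_all
qed

section \<open>Hyperbolic Lipschitz functions\<close>

abbreviation hyp_atlas :: "(real^'n::finite, 'n) chart set" where
  "hyp_atlas \<equiv> {(ball 0 1, id)}"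

lemma speed_hyp:
  assumes "norm (\<gamma> t) < 1" "(\<gamma> has_vector_derivative u) (at t)"
  shows "speed hyp_atlas (\<lambda>_. hyp_metric) \<gamma> t = norm u / rho (\<gamma> t)"
proof -
  have r: "rho (\<gamma> t) > 0" using assms by (simp add: rho_pos_iff)
  have c: "chart_at hyp_atlas (\<gamma> t) = (ball 0 1, id)"
    unfolding chart_at_def by (rule some_equality) (use assms in auto)
  have v: "vector_derivative \<gamma> (at t) = u" using assms(2) by (rule vector_derivative_at)
  have "hyp_metric (\<gamma> t) *v u = (1 / (rho (\<gamma> t))\<^sup>2) *\<^sub>R u"
    by (simp add: vec_eq_iff matrix_vector_mult_def hyp_metric_nth sum_delta_mult)
  then have "u \<bullet> (hyp_metric (\<gamma> t) *v u) = (norm u / rho (\<gamma> t))\<^sup>2"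
    by (simp add: power2_norm_eq_inner[symmetric] power_divide)
  then show ?thesis using r by (simp add: speed_def c Let_def v)
qed

text \<open>The straight segment is a competitor: it stays in the closed ball of radius
  \<open>r\<close>, where \<open>rho\<close> is at least \<open>(1 - r\<^sup>2) / 2\<close>.\<close>

lemma hyp_dist_le:
  fixes x y :: "real^'n::finite"
  assumes r: "r < 1" and x: "norm x \<le> r" and y: "norm y \<le> r"
  shows "hyp_dist x y \<le> ennreal (norm (x - y) / ((1 - r\<^sup>2) / 2))"
proof -
  have r0: "0 \<le> r" using x norm_ge_zero[of x] by linarith
  have R: "(1 - r\<^sup>2) / 2 > 0" using r r0 by (simp add: abs_square_less_1)
  define \<gamma> where "\<gamma> = (\<lambda>t::real. x + t *\<^sub>R (y - x))"
  have \<gamma>r: "norm (\<gamma> t) \<le> r" if "t \<in> {0..1}" for t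
  proof -
    have "\<gamma> t = (1 - t) *\<^sub>R x + t *\<^sub>R y" by (simp add: \<gamma>_def algebra_simps)
    then have "\<gamma> t \<in> cball 0 r" using convexD[OF convex_cball, of x 0 r y "1 - t" t] x y that by simp
    then show ?thesis by simp
  qed
  have d: "(\<gamma> has_vector_derivative (y - x)) (at t)" for t
    unfolding \<gamma>_def has_vector_derivative_def by (auto intro!: derivative_eq_intros)
  have "\<gamma> \<in> curves hyp_atlas x y"
    unfolding curves_def
  proof (intro CollectI conjI ballI allI impI)
    show "continuous_on {0..1} \<gamma>" unfolding \<gamma>_def by (intro continuous_intros)
    show "\<gamma> ` {0..1} \<subseteq> carrier_of hyp_atlas" using \<gamma>r r by (force simp: carrier_of_def)
    show "\<gamma> 0 = x" "\<gamma> 1 = y" by (simp_all add: \<gamma>_def)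
    fix c a b assume "c \<in> (hyp_atlas :: (real^'n, 'n) chart set)"
    then have "snd c \<circ> \<gamma> = \<gamma>" by auto
    moreover have "\<gamma> C1_differentiable_on {a..b}"
      unfolding C1_differentiable_on_def using d by (intro exI[of _ "\<lambda>_. y - x"]) auto
    ultimately show "(snd c \<circ> \<gamma>) piecewise_C1_differentiable_on {a..b}"
      by (simp add: C1_differentiable_imp_piecewise)
  qed
  then have "hyp_dist x y \<le> (\<integral>\<^sup>+t\<in>{0..1}. ennreal (speed hyp_atlas (\<lambda>_. hyp_metric) \<gamma> t) \<partial>lborel)"
    unfolding hyp_dist_def riem_dist_def by (rule INF_lower)
  also have "\<dots> \<le> (\<integral>\<^sup>+t. ennreal (norm (x - y) / ((1 - r\<^sup>2) / 2)) * indicator {0..1::real} t \<partial>lborel)"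
  proof (rule nn_integral_mono)
    fix t :: real
    show "ennreal (speed hyp_atlas (\<lambda>_. hyp_metric) \<gamma> t) * indicator {0..1} t \<le> ennreal (norm (x - y) / ((1 - r\<^sup>2) / 2)) * indicator {0..1} t"
    proof (cases "t \<in> {0..1}")
      case True
      have n: "norm (\<gamma> t) \<le> r" using \<gamma>r True by simp
      then have "(norm (\<gamma> t))\<^sup>2 \<le> r\<^sup>2" by (intro power_mono) auto
      then have "(1 - r\<^sup>2) / 2 \<le> rho (\<gamma> t)" by (simp add: rho_def)
      then have "norm (y - x) / rho (\<gamma> t) \<le> norm (x - y) / ((1 - r\<^sup>2) / 2)"
        using R by (intro frac_le) (auto simp: norm_minus_commute)
      then show ?thesis using speed_hyp[OF _ d, of t] n r True by (simp add: ennreal_leI)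
    qed simp
  qed
  also have "\<dots> = ennreal (norm (x - y) / ((1 - r\<^sup>2) / 2))"
    by (subst nn_integral_cmult_indicator) auto
  finally show ?thesis .
qed

text \<open>The hyperbolic gradient of \<open>ln rho\<close> has norm \<open>norm x < 1\<close>, so
  along any curve \<open>ln rho\<close> changes by at most the length. This makes cutoffs built from
  \<open>ln rho\<close> uniformly Lipschitz.\<close>

lemma hyp_dist_ge_ln_rho:
  fixes x y :: "real^'n::finite"
  shows "ennreal \<bar>ln (rho x) - ln (rho y)\<bar> \<le> hyp_dist x y"
  unfolding hyp_dist_def riem_dist_def
proof (rule INF_greatest)
  fix \<gamma> assume \<gamma>: "\<gamma> \<in> curves (hyp_atlas :: (real^'n, 'n) chart set) x y"
  then have c: "continuous_on {0..1} \<gamma>" and im: "\<And>t. t \<in> {0..1} \<Longrightarrow> norm (\<gamma> t) < 1" and e: "\<gamma> 0 = x" "\<gamma> 1 = y"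
    unfolding curves_def carrier_of_def by (auto simp: image_subset_iff)
  have "\<forall>c\<in>(hyp_atlas :: (real^'n, 'n) chart set). \<forall>a b. 0 \<le> a \<and> a < b \<and> b \<le> 1 \<and> \<gamma> ` {a..b} \<subseteq> fst c \<longrightarrow>
        (snd c \<circ> \<gamma>) piecewise_C1_differentiable_on {a..b}"
    using \<gamma> unfolding curves_def by blast
  then have "\<gamma> piecewise_C1_differentiable_on {0..1}"
    using im by (auto simp: image_subset_iff dest!: spec[of _ 0] spec[of _ 1])
  then obtain S where S: "finite S" "\<gamma> C1_differentiable_on ({0..1} - S)"
    unfolding piecewise_C1_differentiable_on_def by blast
  then obtain D where D: "\<And>t. t \<in> {0..1} - S \<Longrightarrow> (\<gamma> has_vector_derivative D t) (at t)" "continuous_on ({0..1} - S) D"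
    unfolding C1_differentiable_on_def by blast
  have r: "rho (\<gamma> t) > 0" if "t \<in> {0..1}" for t using im[OF that] by (simp add: rho_pos_iff)
  define f where "f = (\<lambda>t. ln (rho (\<gamma> t)))"
  define f' where "f' = (\<lambda>t. - (\<gamma> t \<bullet> D t) / rho (\<gamma> t))"
  have crho: "continuous_on A (\<lambda>t. rho (\<gamma> t))" if "A \<subseteq> {0..1}" for A
    unfolding rho_def using that by (intro continuous_intros continuous_on_subset[OF c]) auto
  have cf: "continuous_on {0..1} f"
    unfolding f_def using r by (intro continuous_intros crho) (auto simp: less_imp_neq[symmetric])
  have df: "(f has_vector_derivative f' t) (at t)" if t: "t \<in> {0..1} - S" for t
  proof -
    have "((\<lambda>t. rho (\<gamma> t)) has_derivative (\<lambda>h. - (\<gamma> t \<bullet> (h *\<^sub>R D t)))) (at t)"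
      using diff_chain_at[OF D(1)[OF t, unfolded has_vector_derivative_def] rho_has_derivative] by (simp add: o_def)
    then have "((\<lambda>t. rho (\<gamma> t)) has_real_derivative - (\<gamma> t \<bullet> D t)) (at t)"
      unfolding has_field_derivative_def by (rule has_derivative_eq_rhs) (simp add: fun_eq_iff)
    then have "(f has_real_derivative f' t) (at t)"
      unfolding f_def f'_def using r t by (auto intro!: derivative_eq_intros simp: divide_inverse mult.commute)
    then show ?thesis by (simp add: has_real_derivative_iff_has_vector_derivative)
  qed
  \<comment> \<open>The gauge integral requires no prior integrability of \<open>f'\<close>. It is
    compared with the Lebesgue integral only when the latter is finite; in the other case the
    estimate is trivial.\<close>
  have I: "(f' has_integral (f 1 - f 0)) {0..1}"
    by (rule fundamental_theorem_of_calculus_strong[of S]) (use S cf df in \<open>auto intro: has_vector_derivative_at_within\<close>)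
  \<comment> \<open>Off the finite exceptional set \<open>f'\<close> is continuous; replacing it by
    0 on that set gives a Borel function.\<close>
  define A where "A = {0..1::real} - S"
  have "S \<in> sets borel" using S(1) by (intro borel_closed finite_imp_closed)
  then have A: "A \<in> sets borel" by (simp add: A_def sets.Diff)
  define F where "F = (\<lambda>t. indicator A t * f' t)"
  have cf': "continuous_on A f'"
    unfolding f'_def A_def using r
    by (intro continuous_intros crho D(2) continuous_on_subset[OF c]) (auto simp: less_imp_neq[symmetric])
  have Fm: "F \<in> borel_measurable borel"
    using borel_measurable_continuous_on_indicator[OF A cf'] by (simp add: F_def)
  have IF: "(F has_integral (f 1 - f 0)) UNIV"
  proof -
    have "((\<lambda>t. if t \<in> {0..1} then f' t else 0) has_integral (f 1 - f 0)) UNIV"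
      unfolding has_integral_restrict_UNIV by (rule I)
    then show ?thesis
      by (rule has_integral_spike_finite[OF S(1), rotated]) (auto simp: F_def A_def indicator_def)
  qed
  have Fspeed: "ennreal \<bar>F t\<bar> \<le> ennreal (speed hyp_atlas (\<lambda>_. hyp_metric) \<gamma> t) * indicator {0..1} t" for t
  proof (cases "t \<in> A")
    case True
    then have t: "t \<in> {0..1}" "t \<in> {0..1} - S" by (auto simp: A_def)
    have "\<bar>f' t\<bar> = \<bar>\<gamma> t \<bullet> D t\<bar> / rho (\<gamma> t)" using r[OF t(1)] by (simp add: f'_def abs_divide)
    also have "\<bar>\<gamma> t \<bullet> D t\<bar> \<le> norm (\<gamma> t) * norm (D t)" by (rule Cauchy_Schwarz_ineq2)
    also have "\<dots> \<le> 1 * norm (D t)" using im[OF t(1)] by (intro mult_right_mono) auto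
    finally have "\<bar>f' t\<bar> \<le> norm (D t) / rho (\<gamma> t)" using r[OF t(1)] by (simp add: divide_right_mono)
    then show ?thesis using True t speed_hyp[of \<gamma> t, OF im[OF t(1)] D(1)[OF t(2)]] by (simp add: F_def ennreal_leI)
  qed (simp add: F_def)
  have "ennreal \<bar>f 1 - f 0\<bar> \<le> (\<integral>\<^sup>+t. ennreal \<bar>F t\<bar> \<partial>lborel)"
  proof (cases "(\<integral>\<^sup>+t. ennreal \<bar>F t\<bar> \<partial>lborel) = \<infinity>")
    case False
    then have iF: "integrable lborel F" using Fm by (simp add: integrable_iff_bounded less_top)
    have "(F has_integral (LINT t|lborel. F t)) UNIV" by (rule has_integral_integral_lborel[OF iF])
    then have "f 1 - f 0 = (LINT t|lborel. F t)" using IF has_integral_unique by blast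
    then have "\<bar>f 1 - f 0\<bar> \<le> (LINT t|lborel. \<bar>F t\<bar>)" using integral_abs_bound by metis
    then have "ennreal \<bar>f 1 - f 0\<bar> \<le> ennreal (LINT t|lborel. \<bar>F t\<bar>)" by (rule ennreal_leI)
    also have "\<dots> = (\<integral>\<^sup>+t. ennreal \<bar>F t\<bar> \<partial>lborel)"
      using iF by (intro nn_integral_eq_integral[symmetric]) auto
    finally show ?thesis .
  qed simp
  also have "\<dots> \<le> (\<integral>\<^sup>+t\<in>{0..1}. ennreal (speed hyp_atlas (\<lambda>_. hyp_metric) \<gamma> t) \<partial>lborel)"
    by (intro nn_integral_mono Fspeed)
  finally show "ennreal \<bar>ln (rho x) - ln (rho y)\<bar> \<le> (\<integral>\<^sup>+t\<in>{0..1}. ennreal (speed hyp_atlas (\<lambda>_. hyp_metric) \<gamma> t) \<partial>lborel)"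
    by (simp add: f_def e abs_minus_commute)
qed

lemma compact_subset_smaller_ball:
  fixes S :: "'a::real_normed_vector set"
  assumes "compact S" "S \<subseteq> ball 0 1"
  obtains r where "0 \<le> r" "r < 1" "S \<subseteq> cball 0 r"
proof (cases "S = {}")
  case True
  show thesis by (rule that[of 0]) (use True in auto)
next
  case False
  obtain x where "x \<in> S" "\<And>y. y \<in> S \<Longrightarrow> norm y \<le> norm x"
    using continuous_attains_sup[OF assms(1) False, of norm] continuous_on_norm_id by blast
  then show thesis using assms by (intro that[of "norm x"]) auto
qed

text \<open>Without a cutoff sequence every number would satisfy \<open>charge_limit\<close>
  vacuously; existence is what makes the limit unique.\<close>

lemma cutoff_sequence_exists:
  fixes K' :: "(real^'n::finite) set"
  assumes K': "compact K'" "K' \<subseteq> ball 0 1"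
  shows "\<exists>\<zeta>. cutoff_sequence K' \<zeta>"
proof -
  \<comment> \<open>The value is 1 where \<open>2 * rho x \<ge> exp (- k)\<close>, that is, on the
    ball of radius \<open>s k\<close>, and 0 beyond radius \<open>s (k + 1)\<close>; clamping does
    not increase the Lipschitz constant of \<open>ln rho\<close>.\<close>
  define \<zeta> where "\<zeta> = (\<lambda>(k::nat) (x::real^'n). max 0 (min 1 (real k + 1 + ln (2 * rho x))))"
  define s where "s = (\<lambda>k::nat. sqrt (1 - exp (- real k)))"
  have s1: "0 \<le> s k" "s k < 1" for k by (auto simp: s_def)
  have iff: "0 \<le> a + ln (2 * rho x) \<longleftrightarrow> (norm x)\<^sup>2 \<le> 1 - exp (- a)" if "norm x < 1" for x :: "real^'n" and a
  proof -
    have r: "rho x > 0" using that by (simp add: rho_pos_iff)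
    have "0 \<le> a + ln (2 * rho x) \<longleftrightarrow> - a \<le> ln (2 * rho x)" by linarith
    also have "\<dots> \<longleftrightarrow> exp (- a) \<le> 2 * rho x" using r by (simp add: ln_ge_iff)
    finally show ?thesis by (auto simp: rho_def)
  qed
  have lev: "{x\<in>ball 0 1. \<zeta> k x = 1} = cball 0 (s k)" for k
  proof -
    have "norm x < 1 \<and> \<zeta> k x = 1 \<longleftrightarrow> norm x \<le> s k" for x
    proof (cases "norm x < 1")
      case True
      have "\<zeta> k x = 1 \<longleftrightarrow> 0 \<le> real k + ln (2 * rho x)" by (auto simp: \<zeta>_def)
      also have "\<dots> \<longleftrightarrow> (norm x)\<^sup>2 \<le> 1 - exp (- real k)" by (rule iff[OF True])
      also have "\<dots> \<longleftrightarrow> norm x \<le> s k"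
      proof
        assume "norm x \<le> s k"
        then have "(norm x)\<^sup>2 \<le> (s k)\<^sup>2" by (intro power_mono) auto
        then show "(norm x)\<^sup>2 \<le> 1 - exp (- real k)" by (simp add: s_def)
      qed (auto simp: s_def intro: real_le_rsqrt)
      finally show ?thesis using True by simp
    next
      case False then show ?thesis using s1(2)[of k] by auto
    qed
    then show ?thesis by (simp add: set_eq_iff)
  qed
  have slim: "\<exists>k. t < s k" if "t < 1" for t
  proof -
    have "s \<longlonglongrightarrow> sqrt (1 - 0)" unfolding s_def
      by (intro tendsto_intros filterlim_compose[OF exp_at_bot] filterlim_compose[OF filterlim_uminus_at_bot_at_top] filterlim_real_sequentially)
    then have "\<forall>\<^sub>F k in sequentially. t < s k" using that by (intro order_tendstoD) auto
    then show ?thesis using eventually_happens trivial_limit_sequentially by blast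
  qed
  have "cutoff_sequence K' \<zeta>"
    unfolding cutoff_sequence_def lev
  proof (intro conjI allI)
    fix k
    show "\<exists>S. compact S \<and> S \<subseteq> ball 0 1 \<and> (\<forall>x\<in>ball 0 1 - S. \<zeta> k x = 0)"
    proof (intro exI[of _ "cball 0 (s (Suc k))"] conjI ballI)
      show "cball 0 (s (Suc k)) \<subseteq> ball 0 1" using s1(2)[of "Suc k"] by auto
      fix x :: "real^'n" assume x: "x \<in> ball 0 1 - cball 0 (s (Suc k))"
      then have "\<not> (norm x)\<^sup>2 \<le> 1 - exp (- (real k + 1))"
        unfolding s_def by (auto intro: real_le_rsqrt simp: add.commute)
      then have "\<not> 0 \<le> real k + 1 + ln (2 * rho x)" using iff[of x "real k + 1"] x by simp
      then show "\<zeta> k x = 0" by (simp add: \<zeta>_def)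
    qed simp
    show "compact (cball (0::real^'n) (s k))" by simp
  next
    show "\<exists>B. \<forall>k. \<forall>x\<in>ball 0 1. \<bar>\<zeta> k x\<bar> \<le> B" by (intro exI[of _ 1]) (auto simp: \<zeta>_def)
    show "\<exists>L. \<forall>k. \<forall>x\<in>ball 0 1. \<forall>y\<in>ball 0 1. ennreal \<bar>\<zeta> k x - \<zeta> k y\<bar> \<le> ennreal L * hyp_dist x y"
    proof (intro exI[of _ 1] allI ballI)
      fix k and x y :: "real^'n" assume xy: "x \<in> ball 0 1" "y \<in> ball 0 1"
      then have r: "rho x > 0" "rho y > 0" by (auto simp: rho_pos_iff)
      have "\<bar>\<zeta> k x - \<zeta> k y\<bar> \<le> \<bar>ln (2 * rho x) - ln (2 * rho y)\<bar>" unfolding \<zeta>_def by linarith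
      also have "\<dots> = \<bar>ln (rho x) - ln (rho y)\<bar>" using r by (simp add: ln_mult)
      finally have "ennreal \<bar>\<zeta> k x - \<zeta> k y\<bar> \<le> ennreal \<bar>ln (rho x) - ln (rho y)\<bar>" by (rule ennreal_leI)
      also have "\<dots> \<le> hyp_dist x y" by (rule hyp_dist_ge_ln_rho)
      finally show "ennreal \<bar>\<zeta> k x - \<zeta> k y\<bar> \<le> ennreal 1 * hyp_dist x y" by simp
    qed
    show "incseq (\<lambda>k. cball (0::real^'n) (s k))"
      by (rule incseq_SucI, rule subset_cball) (simp add: s_def)
    show "(\<Union>k. cball 0 (s k)) = ball (0::real^'n) 1"
    proof (intro set_eqI iffI)
      fix x :: "real^'n" assume "x \<in> ball 0 1"
      then obtain k where "norm x < s k" using slim[of "norm x"] by auto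
      then show "x \<in> (\<Union>k. cball 0 (s k))" by (auto intro: less_imp_le)
    next
      fix x :: "real^'n" assume "x \<in> (\<Union>k. cball 0 (s k))"
      then obtain k where "norm x \<le> s k" by auto
      then show "x \<in> ball 0 1" using s1(2)[of k] by simp
    qed
    obtain r where r: "r < 1" "K' \<subseteq> cball 0 r" using compact_subset_smaller_ball[OF K'] by blast
    obtain k where "r < s k" using slim[OF r(1)] by blast
    then show "\<exists>k. K' \<subseteq> interior (cball 0 (s k))" using r(2) by (intro exI[of _ k]) (force simp: subset_iff)
  qed
  then show ?thesis by blast
qed

lemma hyp_lipschitz_local:
  fixes \<zeta> :: "real^'n::finite \<Rightarrow> real"
  assumes lip: "\<And>x y. x \<in> ball 0 1 \<Longrightarrow> y \<in> ball 0 1 \<Longrightarrow> ennreal \<bar>\<zeta> x - \<zeta> y\<bar> \<le> ennreal L * hyp_dist x y"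
    and L: "L \<ge> 0" and r: "r < 1" and x: "norm x \<le> r" and y: "norm y \<le> r"
  shows "\<bar>\<zeta> x - \<zeta> y\<bar> \<le> L / ((1 - r\<^sup>2) / 2) * norm (x - y)"
proof -
  have r0: "0 \<le> r" using x norm_ge_zero[of x] by linarith
  have R: "(1 - r\<^sup>2) / 2 > 0" using r r0 by (simp add: abs_square_less_1)
  have "ennreal \<bar>\<zeta> x - \<zeta> y\<bar> \<le> ennreal L * ennreal (norm (x - y) / ((1 - r\<^sup>2) / 2))"
    using lip[of x y] mult_left_mono[OF hyp_dist_le[OF r x y], of "ennreal L"] x y r by (auto intro: order_trans)
  also have "\<dots> = ennreal (L * (norm (x - y) / ((1 - r\<^sup>2) / 2)))" by (simp only: ennreal_mult[OF L divide_nonneg_pos[OF norm_ge_zero R]])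
  finally have "\<bar>\<zeta> x - \<zeta> y\<bar> \<le> L * (norm (x - y) / ((1 - r\<^sup>2) / 2))"
    using L R by (subst (asm) ennreal_le_iff) (auto intro!: mult_nonneg_nonneg)
  then show ?thesis by (simp add: ac_simps)
qed

text \<open>The Euclidean Lipschitz constant may depend on the support and serves only to make the
  almost everywhere theorems applicable. The gradient bound contains no trace of the support, and so
  is uniform along a cutoff sequence.\<close>

lemma cutoff_extension:
  fixes \<zeta> :: "real^'n::finite \<Rightarrow> real"
  assumes lip: "\<And>x y. x \<in> ball 0 1 \<Longrightarrow> y \<in> ball 0 1 \<Longrightarrow> ennreal \<bar>\<zeta> x - \<zeta> y\<bar> \<le> ennreal L * hyp_dist x y"
    and L: "L \<ge> 0" and B: "\<And>x. x \<in> ball 0 1 \<Longrightarrow> \<bar>\<zeta> x\<bar> \<le> B"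
    and S: "compact S" "S \<subseteq> ball 0 1" "\<And>x. x \<in> ball 0 1 - S \<Longrightarrow> \<zeta> x = 0"
  defines "\<eta> \<equiv> (\<lambda>x. (if norm x < 1 then \<zeta> x else 0))"
  shows "\<exists>M. M-lipschitz_on UNIV \<eta>"
    "\<And>x g. norm x < 1 \<Longrightarrow> (\<eta> has_derivative (\<lambda>h. g \<bullet> h)) (at x) \<Longrightarrow> norm g \<le> 2 * L / rho x"
proof -
  obtain r where r: "0 \<le> r" "r < 1" "S \<subseteq> cball 0 r" using compact_subset_smaller_ball[OF S(1,2)] by blast
  \<comment> \<open>A radius strictly between the support and the sphere: up to \<open>r'\<close>
    the hyperbolic bound applies, beyond it the gap \<open>r' - r\<close> turns boundedness into a
    Lipschitz estimate.\<close>
  define r' where "r' = (1 + r) / 2"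
  have r': "r < r'" "r' < 1" using r by (auto simp: r'_def)
  have B0: "B \<ge> 0" using B[of 0] by simp
  define M1 where "M1 = L / ((1 - r'\<^sup>2) / 2)"
  define M where "M = M1 + B / (r' - r)"
  have M1: "M1 \<ge> 0" using L r' r by (simp add: M1_def abs_square_le_1)
  have M2: "B / (r' - r) \<ge> 0" using B0 r' by simp
  have zero: "\<eta> x = 0" if "norm x > r" for x
    using S(3)[of x] subsetD[OF r(3), of x] that by (auto simp: \<eta>_def)
  have bd: "\<bar>\<eta> x\<bar> \<le> B" for x using B[of x] B0 by (simp add: \<eta>_def)
  have key: "\<bar>\<eta> x - \<eta> y\<bar> \<le> M * norm (x - y)" if x: "norm x \<le> r" for x y
  proof (cases "norm y \<le> r'")
    case True
    have "\<bar>\<eta> x - \<eta> y\<bar> \<le> M1 * norm (x - y)"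
      using hyp_lipschitz_local[OF lip L r'(2), of x y] x r' True by (simp add: \<eta>_def M1_def)
    also have "\<dots> \<le> M * norm (x - y)" using M2 by (intro mult_right_mono) (auto simp: M_def)
    finally show ?thesis .
  next
    case False
    then have "\<eta> y = 0" using zero r' by simp
    then have "\<bar>\<eta> x - \<eta> y\<bar> \<le> B / (r' - r) * (r' - r)" using bd[of x] r' by simp
    also have "\<dots> \<le> M * norm (x - y)"
    proof (rule mult_mono)
      show "r' - r \<le> norm (x - y)" using norm_triangle_ineq3[of y x] False x by (simp add: norm_minus_commute)
    qed (use M1 M2 r' in \<open>auto simp: M_def\<close>)
    finally show ?thesis .
  qed
  have "M-lipschitz_on UNIV \<eta>"
  proof (rule lipschitz_onI)
    fix x y
    show "dist (\<eta> x) (\<eta> y) \<le> M * dist x y"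
    proof (cases "norm x \<le> r \<or> norm y \<le> r")
      case True
      then show ?thesis using key[of x y] key[of y x] by (auto simp: dist_norm norm_minus_commute abs_minus_commute)
    next
      case False
      then have "\<eta> x = 0" "\<eta> y = 0" using zero by auto
      then show ?thesis using M1 M2 by (simp add: M_def)
    qed
  qed (use M1 M2 in \<open>simp add: M_def\<close>)
  then show "\<exists>M. M-lipschitz_on UNIV \<eta>" ..
  show "norm g \<le> 2 * L / rho x" if x: "norm x < 1" and d: "(\<eta> has_derivative (\<lambda>h. g \<bullet> h)) (at x)" for x g
  proof (rule local_gradient_bound[OF _ _ d])
    \<comment> \<open>Within a quarter of the distance to the sphere \<open>rho\<close> stays above
      half its value at \<open>x\<close>; hence the factor 2.\<close>
    define \<delta> where "\<delta> = (1 - norm x) / 4"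
    define t where "t = norm x + \<delta>"
    have t: "t < 1" "norm x \<le> t" using x by (simp_all add: t_def \<delta>_def field_simps)
    show "\<delta> > 0" using x by (simp add: \<delta>_def)
    have rx: "rho x > 0" using x by (simp add: rho_pos_iff)
    have "(1 - t\<^sup>2) / 2 = (1 - t) * (1 + t) / 2" by (simp add: power2_eq_square algebra_simps)
    also have "\<dots> \<ge> ((1 - norm x) / 2) * (1 + norm x) / 2"
    proof -
      have "(1 - norm x) / 2 \<le> 1 - t" using x by (simp add: t_def \<delta>_def field_simps)
      then show ?thesis using t by (intro divide_right_mono mult_mono) auto
    qed
    finally have rt: "rho x / 2 \<le> (1 - t\<^sup>2) / 2" by (simp add: rho_def power2_eq_square algebra_simps)
    fix y assume y: "y \<in> ball x \<delta>"
    then have "norm y \<le> t" using norm_triangle_ineq2[of y x] by (simp add: t_def dist_norm norm_minus_commute)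
    then have "\<bar>\<zeta> y - \<zeta> x\<bar> \<le> L / ((1 - t\<^sup>2) / 2) * norm (y - x)"
      by (intro hyp_lipschitz_local[OF lip L t(1)]) (use t in auto)
    also have "\<dots> \<le> L / (rho x / 2) * norm (y - x)"
      using rt rx L by (intro mult_right_mono divide_left_mono) (auto intro!: mult_pos_pos)
    finally show "\<bar>\<eta> y - \<eta> x\<bar> \<le> 2 * L / rho x * norm (y - x)"
      using x \<open>norm y \<le> t\<close> t(1) by (simp add: \<eta>_def mult.commute)
  qed
qed

section \<open>The charge\<close>

text \<open>The charge integrand agrees with a Borel function only almost everywhere; completeness
  of Lebesgue measure yields its measurability.\<close>

lemma borel_measurable_lebesgue_AE:
  fixes f g :: "'a::euclidean_space \<Rightarrow> real"
  assumes g: "g \<in> borel_measurable borel" and ae: "AE x in lborel. f x = g x"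
  shows "f \<in> borel_measurable lebesgue"
proof (rule measurableI)
  fix A :: "real set" assume A: "A \<in> sets borel"
  have 1: "g -` A \<in> sets lebesgue" using measurable_sets[OF g A] by simp
  have 2: "AE x in lebesgue. x \<in> g -` A \<longleftrightarrow> x \<in> f -` A"
    using AE_completion[OF ae] by eventually_elim auto
  have "f -` A \<in> sets lebesgue" by (rule completion.in_sets_AE[OF 2 1]) simp
  then show "f -` A \<inter> space lebesgue \<in> sets lebesgue" by simp
qed simp

lemma sqrt_det_hyp_metric:
  fixes x :: "real^'n::finite"
  assumes "norm x < 1"
  shows "sqrt (det (hyp_metric x)) = 1 / rho x ^ CARD('n)"
proof -
  have r: "rho x > 0" using assms by (simp add: rho_pos_iff)
  have "det (hyp_metric x) = (\<Prod>i\<in>(UNIV::'n set). hyp_metric x $ i $ i)"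
    by (rule det_diagonal) (simp add: hyp_metric_nth)
  also have "\<dots> = (1 / rho x ^ CARD('n))\<^sup>2"
    by (simp add: hyp_metric_nth power_divide power_mult[symmetric] mult.commute)
  finally show ?thesis using r by (simp add: real_sqrt_abs)
qed

text \<open>The density of \<open>hyp_volume\<close> is \<open>1 / rho ^ n\<close>, so the factor
  \<open>rho ^ n\<close> disappears and a Lebesgue integral of the Borel function \<open>q\<close>
  remains.\<close>

lemma hyp_volume_integral:
  fixes f q :: "real^'n::finite \<Rightarrow> real"
  assumes q: "q \<in> borel_measurable borel"
    and ae: "AE x in lborel. norm x < 1 \<longrightarrow> f x = rho x ^ CARD('n) * q x"
    and int: "integrable lborel (\<lambda>x. indicator (ball 0 1) x * q x)"
  shows "integrable hyp_volume f" "integral\<^sup>L hyp_volume f = (LINT x|lborel. indicator (ball 0 1) x * q x)"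
proof -
  let ?B = "ball (0::real^'n) 1"
  let ?M = "restrict_space lebesgue ?B"
  have B: "?B \<in> sets lebesgue" "?B \<in> sets borel" by auto
  have crho: "continuous_on UNIV (rho :: real^'n \<Rightarrow> real)" unfolding rho_def by (intro continuous_intros) auto
  have [measurable]: "(rho :: real^'n \<Rightarrow> real) \<in> borel_measurable borel" using crho by (rule borel_measurable_continuous_onI)
  note q[measurable] B(2)[measurable]
  define w where "w = (\<lambda>x::real^'n. indicator ?B x * (1 / rho x ^ CARD('n)))"
  have wm: "w \<in> borel_measurable borel" unfolding w_def by measurable
  have w0: "w x \<ge> 0" for x
    using rho_pos_iff[of x] by (auto simp: w_def indicator_def)
  have dens: "hyp_volume = density ?M (\<lambda>x. ennreal (w x))"
    unfolding hyp_volume_def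
  proof (rule density_cong)
    show m1: "(\<lambda>x. ennreal (w x)) \<in> borel_measurable ?M"
      using wm by (intro measurable_restrict_space1 measurable_completion) simp
    have eq: "ennreal (sqrt (det (hyp_metric x))) = ennreal (w x)" if "x \<in> space ?M" for x
      using that by (simp add: space_restrict_space sqrt_det_hyp_metric w_def)
    then show "AE x in ?M. ennreal (sqrt (det (hyp_metric x))) = ennreal (w x)" by (intro AE_I2)
    show "(\<lambda>x. ennreal (sqrt (det (hyp_metric x)))) \<in> borel_measurable ?M"
    proof -
      have "(\<lambda>x. ennreal (sqrt (det (hyp_metric x)))) \<in> borel_measurable ?M \<longleftrightarrow> (\<lambda>x. ennreal (w x)) \<in> borel_measurable ?M"
        by (rule measurable_cong) (rule eq)
      then show ?thesis using m1 by simp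
    qed
  qed
  have fm: "(\<lambda>x. indicator ?B x * f x) \<in> borel_measurable lebesgue"
    by (rule borel_measurable_lebesgue_AE[of "\<lambda>x. indicator ?B x * (rho x ^ CARD('n) * q x)"])
       (measurable, use ae in eventually_elim, auto simp: indicator_def)
  then have fM: "f \<in> borel_measurable ?M"
    by (subst borel_measurable_restrict_space_iff) (auto simp: mult.commute)
  have wM: "w \<in> borel_measurable ?M"
    using wm by (intro measurable_restrict_space1 measurable_completion) simp
  have ae2: "AE x in lebesgue. indicator ?B x * (w x * f x) = indicator ?B x * q x"
    using AE_completion[OF ae]
  proof eventually_elim
    case (elim x)
    then show ?case using rho_pos_iff[of x] by (auto simp: w_def indicator_def)
  qed
  have qm: "(\<lambda>x. indicator ?B x * q x) \<in> borel_measurable lebesgue"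
    by (intro measurable_completion) measurable
  have wfm: "(\<lambda>x. indicator ?B x * (w x * f x)) \<in> borel_measurable lebesgue"
    by (rule borel_measurable_lebesgue_AE[of "\<lambda>x. indicator ?B x * q x"]) (measurable, use ae2 in \<open>simp add: AE_completion_iff\<close>)
  have intl: "integrable lebesgue (\<lambda>x. indicator ?B x * q x)"
    using int by (subst integrable_completion) auto
  have "integrable lebesgue (\<lambda>x. indicator ?B x * (w x * f x))"
    using integrable_cong_AE[OF wfm qm ae2] intl by simp
  then have "integrable ?M (\<lambda>x. w x * f x)"
    by (subst integrable_restrict_space) auto
  then show "integrable hyp_volume f"
    unfolding dens using w0 fM wM by (subst integrable_density) (auto intro!: AE_I2)
  have "integral\<^sup>L hyp_volume f = (LINT x|?M. w x * f x)"
    unfolding dens using w0 fM wM by (subst integral_density) (auto intro!: AE_I2)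
  also have "\<dots> = (LINT x|lebesgue. indicator ?B x * (w x * f x))"
    by (subst integral_restrict_space) auto
  also have "\<dots> = (LINT x|lebesgue. indicator ?B x * q x)"
    by (rule integral_cong_AE[OF wfm qm ae2])
  also have "\<dots> = (LINT x|lborel. indicator ?B x * q x)"
    by (rule integral_completion) measurable
  finally show "integral\<^sup>L hyp_volume f = (LINT x|lborel. indicator (ball 0 1) x * q x)" .
qed

text \<open>\<open>S\<close> and \<open>T\<close> are kept apart because compactness is that of a
  subset of the closed ball, while derivatives are bounded only at points of the open ball.\<close>

lemma locally_bounded_on_compact:
  fixes f :: "'a::metric_space \<Rightarrow> real"
  assumes S: "compact S" and loc: "\<And>x. x \<in> S \<Longrightarrow> \<exists>r>0. \<exists>B. \<forall>y\<in>ball x r \<inter> T. \<bar>f y\<bar> \<le> B"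
  obtains B where "\<And>y. y \<in> S \<Longrightarrow> y \<in> T \<Longrightarrow> \<bar>f y\<bar> \<le> B"
proof -
  obtain r B where rB: "\<And>x. x \<in> S \<Longrightarrow> r x > 0" "\<And>x y. x \<in> S \<Longrightarrow> y \<in> ball x (r x) \<inter> T \<Longrightarrow> \<bar>f y\<bar> \<le> B x"
    using loc by metis
  have "S \<subseteq> (\<Union>x\<in>S. ball x (r x))" using rB(1) by force
  then obtain F where F: "F \<subseteq> S" "finite F" "S \<subseteq> (\<Union>x\<in>F. ball x (r x))"
    using compactE_image[OF S, of S "\<lambda>x. ball x (r x)"] by auto
  show thesis
  proof (rule that[of "\<Sum>x\<in>F. \<bar>B x\<bar>"])
    fix y assume y: "y \<in> S" "y \<in> T"
    then obtain x where x: "x \<in> F" "y \<in> ball x (r x)" using F(3) by auto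
    have "\<bar>f y\<bar> \<le> B x" using rB(2)[of x y] x y F(1) by auto
    also have "\<dots> \<le> \<bar>B x\<bar>" by simp
    also have "\<dots> \<le> (\<Sum>x\<in>F. \<bar>B x\<bar>)" using F(2) x by (intro member_le_sum) auto
    finally show "\<bar>f y\<bar> \<le> (\<Sum>x\<in>F. \<bar>B x\<bar>)" .
  qed
qed

lemma Ck_on_matrix_component:
  fixes F :: "real^'n::finite \<Rightarrow> real^'n^'n"
  assumes "Ck_on 1 U F" "open U"
  shows "x \<in> U \<Longrightarrow> (\<lambda>y. F y $ i $ j) differentiable (at x)" "continuous_on U (partial k (\<lambda>y. F y $ i $ j))"
proof -
  have bl: "bounded_linear (\<lambda>M::real^'n^'n. M $ i $ j)"
    using bounded_linear_compose[OF bounded_linear_vec_nth[of j] bounded_linear_vec_nth[of i]] by (simp add: o_def)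
  have d: "F differentiable (at x)" if "x \<in> U" for x using assms(1) that by simp
  have dc: "((\<lambda>y. F y $ i $ j) has_derivative (\<lambda>h. frechet_derivative F (at x) h $ i $ j)) (at x)" if "x \<in> U" for x
    using bounded_linear.has_derivative[OF bl frechet_derivative_works[THEN iffD1, OF d[OF that]]] .
  show "x \<in> U \<Longrightarrow> (\<lambda>y. F y $ i $ j) differentiable (at x)" using dc by (auto simp: differentiable_def)
  have p: "partial k (\<lambda>y. F y $ i $ j) x = partial k F x $ i $ j" if "x \<in> U" for x
    using partial_has_derivative[OF dc[OF that], of k] by (simp add: partial_def)
  have "continuous_on U (partial k F)" using assms(1) by simp
  then have "continuous_on U (\<lambda>x. partial k F x $ i $ j)" by (intro continuous_intros)
  moreover have "continuous_on U (partial k (\<lambda>y. F y $ i $ j)) \<longleftrightarrow> continuous_on U (\<lambda>x. partial k F x $ i $ j)"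
    by (rule continuous_on_cong) (auto simp: p)
  ultimately show "continuous_on U (partial k (\<lambda>y. F y $ i $ j))" by simp
qed

text \<open>A partial derivative of \<open>ebar\<close> at a point of the sphere would involve
  arbitrary values outside the ball. Derivatives are therefore estimated in the open ball, through
  local smooth extensions living on neighbourhoods of closed ball points. The open set
  \<open>N\<close> is removed because nothing bounds the derivatives near \<open>K'\<close>.\<close>

lemma smooth_tensor_bounds:
  fixes ebar :: "real^'n::finite \<Rightarrow> real^'n^'n"
  assumes K': "compact K'" "K' \<subseteq> ball 0 1" and sm: "smooth_on (cball 0 1 - K') ebar"
    and N: "open N" "K' \<subseteq> N"
  shows "\<And>i j x. x \<in> ball 0 1 - K' \<Longrightarrow> (\<lambda>y. ebar y $ i $ j) differentiable (at x)"
    "\<And>i j k. continuous_on (ball 0 1 - K') (partial k (\<lambda>y. ebar y $ i $ j))"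
    "\<And>i j k. \<exists>C. \<forall>x\<in>ball 0 1 - N. \<bar>partial k (\<lambda>y. ebar y $ i $ j) x\<bar> \<le> C"
    "\<And>i j. \<exists>L\<ge>0. \<forall>x\<in>cball 0 1 - N. \<forall>y\<in>cball 0 1 - N. \<bar>ebar x $ i $ j - ebar y $ i $ j\<bar> \<le> L * dist x y"
proof -
  let ?a = "\<lambda>i j y. ebar y $ i $ j"
  have opn: "open (ball 0 1 - K')" using K'(1) by (intro open_Diff compact_imp_closed) auto
  have comp: "compact (cball 0 1 - N)" using N(1) by (intro compact_diff) auto
  have loc: "\<exists>U F. open U \<and> x \<in> U \<and> (\<forall>y\<in>U \<inter> (cball 0 1 - K'). F y = ebar y) \<and> Ck_on 1 U F" if "x \<in> cball 0 1 - K'" for x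
    using sm that unfolding smooth_on_def by meson
  have part: "partial k (?a i j) y = partial k (\<lambda>y. F y $ i $ j) y"
    if "open U" "\<forall>y\<in>U \<inter> (cball 0 1 - K'). F y = ebar y" "y \<in> U" "y \<in> ball 0 1 - K'" for U F y i j k
    by (rule partial_cong_open[OF open_Int[OF that(1) opn]]) (use that in auto)
  show diff: "(?a i j) differentiable (at x)" if x: "x \<in> ball 0 1 - K'" for i j x
  proof -
    obtain U F where U: "open U" "x \<in> U" "\<forall>y\<in>U \<inter> (cball 0 1 - K'). F y = ebar y" "Ck_on 1 U F"
      using loc[of x] x ball_subset_cball[of 0 1] by blast
    obtain D where "((\<lambda>y. F y $ i $ j) has_derivative D) (at x)"
      using Ck_on_matrix_component(1)[OF U(4,1,2)] by (auto simp: differentiable_def)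
    then have "((?a i j) has_derivative D) (at x)"
      by (rule has_derivative_transform_within_open[OF _ open_Int[OF U(1) opn]]) (use U x in auto)
    then show ?thesis by (auto simp: differentiable_def)
  qed
  show "continuous_on (ball 0 1 - K') (partial k (?a i j))" for i j k
  proof (rule continuous_at_imp_continuous_on, rule ballI)
    fix x assume x: "x \<in> ball 0 1 - K'"
    obtain U F where U: "open U" "x \<in> U" "\<forall>y\<in>U \<inter> (cball 0 1 - K'). F y = ebar y" "Ck_on 1 U F"
      using loc[of x] x ball_subset_cball[of 0 1] by blast
    have "continuous_on (U \<inter> (ball 0 1 - K')) (partial k (\<lambda>y. F y $ i $ j))"
      using Ck_on_matrix_component(2)[OF U(4,1)] by (rule continuous_on_subset) auto
    moreover have "continuous_on (U \<inter> (ball 0 1 - K')) (partial k (?a i j)) \<longleftrightarrow>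
        continuous_on (U \<inter> (ball 0 1 - K')) (partial k (\<lambda>y. F y $ i $ j))"
      by (rule continuous_on_cong) (use part[OF U(1,3)] in auto)
    ultimately have "continuous_on (U \<inter> (ball 0 1 - K')) (partial k (?a i j))" by simp
    then show "isCont (partial k (?a i j)) x"
      using U x continuous_on_eq_continuous_at[OF open_Int[OF U(1) opn]] by blast
  qed
  have lb: "\<exists>r>0. \<exists>L. (\<forall>y\<in>ball x r \<inter> (ball 0 1 - K'). \<bar>partial k (?a i j) y\<bar> \<le> L) \<and>
      (\<forall>y\<in>ball x r \<inter> (cball 0 1 - N). \<forall>z\<in>ball x r \<inter> (cball 0 1 - N). \<bar>?a i j y - ?a i j z\<bar> \<le> L * dist y z)"
    if x: "x \<in> cball 0 1 - N" for x i j k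
  proof -
    obtain U F where U: "open U" "x \<in> U" "\<forall>y\<in>U \<inter> (cball 0 1 - K'). F y = ebar y" "Ck_on 1 U F"
      using loc[of x] x N(2) by blast
    obtain r where r: "r > 0" "cball x r \<subseteq> U" using U open_contains_cball by blast
    have d: "(\<lambda>y. F y $ i $ j) differentiable (at y)" if "y \<in> cball x r" for y
      using Ck_on_matrix_component(1)[OF U(4,1)] r(2) that by blast
    have c: "continuous_on (cball x r) (partial k (\<lambda>y. F y $ i $ j))" for k
      using Ck_on_matrix_component(2)[OF U(4,1)] r(2) by (rule continuous_on_subset)
    obtain L where L: "L \<ge> 0" "\<And>y z. y \<in> cball x r \<Longrightarrow> z \<in> cball x r \<Longrightarrow> \<bar>F y $ i $ j - F z $ i $ j\<bar> \<le> L * norm (y - z)"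
      "\<And>k y. y \<in> cball x r \<Longrightarrow> \<bar>partial k (\<lambda>y. F y $ i $ j) y\<bar> \<le> L"
      by (rule C1_lipschitz_cball[OF d c]) blast+
    show ?thesis
    proof (rule exI[of _ r], rule conjI[OF r(1)], rule exI[of _ L], intro conjI ballI)
      fix y assume y: "y \<in> ball x r \<inter> (ball 0 1 - K')"
      then have "y \<in> cball x r" "y \<in> U" "y \<in> ball 0 1 - K'" using r(2) by auto
      then show "\<bar>partial k (?a i j) y\<bar> \<le> L" using part[OF U(1,3), of y k i j] L(3)[of y k] by simp
    next
      fix y z assume yz: "y \<in> ball x r \<inter> (cball 0 1 - N)" "z \<in> ball x r \<inter> (cball 0 1 - N)"
      then have c: "y \<in> cball x r" "z \<in> cball x r" by auto
      have "F y = ebar y" "F z = ebar z" using U(3) yz c r(2) N(2) by blast+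
      then show "\<bar>?a i j y - ?a i j z\<bar> \<le> L * dist y z" using L(2)[OF c] by (simp add: dist_norm)
    qed
  qed
  show "\<exists>C. \<forall>x\<in>ball 0 1 - N. \<bar>partial k (?a i j) x\<bar> \<le> C" for i j k
  proof -
    have "\<exists>r>0. \<exists>L. \<forall>y\<in>ball x r \<inter> (ball 0 1 - K'). \<bar>partial k (?a i j) y\<bar> \<le> L" if "x \<in> cball 0 1 - N" for x
      using lb[OF that, of k i j] by blast
    then obtain C where "\<And>y. y \<in> cball 0 1 - N \<Longrightarrow> y \<in> ball 0 1 - K' \<Longrightarrow> \<bar>partial k (?a i j) y\<bar> \<le> C"
      by (rule locally_bounded_on_compact[OF comp]) blast+
    moreover have "x \<in> cball 0 1 - N" "x \<in> ball 0 1 - K'" if "x \<in> ball 0 1 - N" for x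
      using that N(2) by auto
    ultimately show ?thesis by blast
  qed
  show "\<exists>L\<ge>0. \<forall>x\<in>cball 0 1 - N. \<forall>y\<in>cball 0 1 - N. \<bar>?a i j x - ?a i j y\<bar> \<le> L * dist x y" for i j
  proof -
    have "\<exists>r>0. \<exists>L. \<forall>y\<in>ball x r \<inter> (cball 0 1 - N). \<forall>z\<in>ball x r \<inter> (cball 0 1 - N). \<bar>?a i j y - ?a i j z\<bar> \<le> L * dist y z"
      if "x \<in> cball 0 1 - N" for x
      using lb[OF that, of undefined i j] by blast
    then obtain L where "L \<ge> 0" "\<And>y z. y \<in> cball 0 1 - N \<Longrightarrow> z \<in> cball 0 1 - N \<Longrightarrow> \<bar>?a i j y - ?a i j z\<bar> \<le> L * dist y z"
      by (rule locally_lipschitz_on_compact[OF comp]) blast+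
    then show ?thesis by blast
  qed
qed

lemma boundary_distance_bounds:
  assumes "norm x < 1"
  shows "1 - norm x \<le> 2 * rho x" "rho x \<le> 1 - norm x"
proof -
  have e: "rho x = (1 - norm x) * (1 + norm x) / 2" by (simp add: rho_def field_simps power2_eq_square)
  have "(1 - norm x) * 1 \<le> (1 - norm x) * (1 + norm x)" using assms by (intro mult_left_mono) auto
  then show "1 - norm x \<le> 2 * rho x" using e by simp
  have "(1 - norm x) * (1 + norm x) \<le> (1 - norm x) * 2" using assms by (intro mult_left_mono) auto
  then show "rho x \<le> 1 - norm x" using e by simp
qed

lemma rho_powr_bounds:
  assumes x: "norm x < 1" and al: "0 < \<alpha>" "\<alpha> \<le> 1"
  shows "rho x * rho x powr (\<alpha> - 1) = rho x powr \<alpha>" "rho x \<le> rho x powr \<alpha>"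
    "rho x powr (\<alpha> - 1) \<le> 2 * (1 - norm x) powr (\<alpha> - 1)"
proof -
  have r: "rho x > 0" "rho x \<le> 1" using x rho_le_half[of x] by (auto simp: rho_pos_iff)
  show "rho x * rho x powr (\<alpha> - 1) = rho x powr \<alpha>" using r powr_add[of "rho x" 1 "\<alpha> - 1"] by simp
  show "rho x \<le> rho x powr \<alpha>" using powr_mono'[of \<alpha> 1 "rho x"] r al by simp
  have "rho x powr (\<alpha> - 1) \<le> ((1 - norm x) / 2) powr (\<alpha> - 1)"
    using boundary_distance_bounds[OF x] x al by (intro powr_mono2') auto
  also have "\<dots> = 2 powr (1 - \<alpha>) * (1 - norm x) powr (\<alpha> - 1)"
    using x powr_minus_divide[of 2 "1 - \<alpha>"] by (simp add: powr_divide field_simps)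
  also have "\<dots> \<le> 2 * (1 - norm x) powr (\<alpha> - 1)"
    using powr_mono[of "1 - \<alpha>" 1 2] al by (intro mult_right_mono) auto
  finally show "rho x powr (\<alpha> - 1) \<le> 2 * (1 - norm x) powr (\<alpha> - 1)" .
qed

text \<open>Bernoulli's inequality. It controls the error made by inserting the weight
  \<open>1 / |x|^n\<close> into the main term.\<close>

lemma inverse_power_near_one:
  fixes t :: real
  assumes "1 / 2 < t" "t < 1"
  shows "\<bar>1 - inverse (t ^ n)\<bar> \<le> real n * 2 ^ n * (1 - t)"
proof -
  have b: "1 - real n * (1 - t) \<le> t ^ n" using Bernoulli_inequality[of "t - 1" n] assms by (simp add: algebra_simps)
  have "inverse (t ^ n) = inverse t ^ n" by (simp add: power_inverse)
  also have "\<dots> \<le> 2 ^ n"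
  proof (rule power_mono)
    show "inverse t \<le> 2" using le_imp_inverse_le[of "1/2" t] assms by simp
  qed (use assms in simp)
  finally have i: "inverse (t ^ n) \<le> 2 ^ n" .
  have t1: "t ^ n \<le> 1" using assms by (intro power_le_one) auto
  have tp: "t ^ n > 0" using assms by simp
  have "\<bar>1 - inverse (t ^ n)\<bar> = inverse (t ^ n) * (1 - t ^ n)"
    using one_le_inverse[OF tp t1] left_inverse[OF less_imp_neq[OF tp, symmetric]] by (simp add: right_diff_distrib)
  also have "\<dots> \<le> 2 ^ n * (real n * (1 - t))"
    using i b t1 by (intro mult_mono) auto
  finally show ?thesis by (simp add: ac_simps)
qed

text \<open>The Lebesgue density \<open>q k\<close> of the integrand is split as
  \<open>- nn * \<psi> k + \<tau> k\<close>. The integral of \<open>\<psi> k\<close> is known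
  exactly for every cutoff, and \<open>\<tau> k\<close> tends to 0 under an integrable bound
  independent of \<open>k\<close>.\<close>

lemma charge_limit_asymptotic:
  fixes K' :: "(real^'n::finite) set" and e ebar :: "real^'n \<Rightarrow> real^'n^'n" and v :: "real^'n \<Rightarrow> real"
  assumes n2: "CARD('n) \<ge> 2" and K': "compact K'" "K' \<subseteq> ball 0 1"
    and e: "\<And>x. x \<in> ball 0 1 - K' \<Longrightarrow> e x = rho x ^ (CARD('n) - 2) *\<^sub>R ebar x"
    and sm: "smooth_on (cball 0 1 - K') ebar"
    and sym: "\<And>x. x \<in> cball 0 1 - K' \<Longrightarrow> transpose (ebar x) = ebar x"
    and tang: "\<And>x j. x \<in> cball 0 1 - K' \<Longrightarrow> (\<Sum>i\<in>UNIV. ebar x $ i $ j * x $ i) = 0"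
    and al: "0 < \<alpha>" "\<alpha> \<le> 1"
    and hol: "\<And>\<xi> \<eta>. norm \<xi> = 1 \<Longrightarrow> norm \<eta> = 1 \<Longrightarrow> \<bar>v \<xi> - v \<eta>\<bar> \<le> C0 * norm (\<xi> - \<eta>) powr \<alpha>"
  shows "charge_limit K' e (dirichlet_op v) (real CARD('n) * (LINT x|sphere_measure. trace (ebar x) * v x))"
  unfolding charge_limit_def
proof (rule allI, rule impI)
  fix \<zeta> assume cut: "cutoff_sequence K' \<zeta>"
  define n where "n = CARD('n)"
  define nn where "nn = real n"
  obtain W CW where W: "CW \<ge> 0" "\<And>x. norm x < 1 \<Longrightarrow> dirichlet_op v x = W x / rho x" "Ck_on 2 (ball 0 1) W"
    "\<And>x i. norm x < 1 \<Longrightarrow> \<bar>partial i W x\<bar> \<le> CW * rho x powr (\<alpha> - 1)"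
    "\<And>x. norm x < 1 \<Longrightarrow> x \<noteq> 0 \<Longrightarrow> \<bar>W x - v (x /\<^sub>R norm x)\<bar> \<le> CW * rho x powr \<alpha>"
    "\<And>x. norm x < 1 \<Longrightarrow> \<bar>W x\<bar> \<le> CW"
    by (rule dirichlet_op_estimates[OF al hol]) blast+

  \<comment> \<open>Data of the cutoff sequence\<close>
  define Z where "Z = (\<lambda>k. {x\<in>ball 0 1. \<zeta> k x = 1})"
  note c = cut[unfolded cutoff_sequence_def]
  note c2 = conjunct2[OF c]
  note c3 = conjunct2[OF c2]
  note c5 = conjunct2[OF conjunct2[OF c3]]
  have cS: "\<exists>S. compact S \<and> S \<subseteq> ball 0 1 \<and> (\<forall>x\<in>ball 0 1 - S. \<zeta> k x = 0)" for k
    using conjunct1[OF c] by blast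
  obtain B where B: "\<And>k x. x \<in> ball 0 1 \<Longrightarrow> \<bar>\<zeta> k x\<bar> \<le> B" using conjunct1[OF c2] by blast
  obtain L' where L': "\<And>k x y. x \<in> ball 0 1 \<Longrightarrow> y \<in> ball 0 1 \<Longrightarrow> ennreal \<bar>\<zeta> k x - \<zeta> k y\<bar> \<le> ennreal L' * hyp_dist x y"
    using conjunct1[OF c3] by blast
  \<comment> \<open>A negative constant becomes 0 under \<open>ennreal\<close>, so it may be
    replaced by 0 at the outset.\<close>
  define L where "L = max 0 L'"
  have eL: "ennreal L = ennreal L'" by (simp add: L_def max_def ennreal_neg)
  have L: "L \<ge> 0" "\<And>k x y. x \<in> ball 0 1 \<Longrightarrow> y \<in> ball 0 1 \<Longrightarrow> ennreal \<bar>\<zeta> k x - \<zeta> k y\<bar> \<le> ennreal L * hyp_dist x y"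
    unfolding eL using L' by (simp add: L_def, blast)
  have incZ: "incseq Z" using conjunct1[OF c5] by (simp only: Z_def)
  have unZ: "(\<Union>k. Z k) = ball 0 1" using conjunct1[OF conjunct2[OF c5]] by (simp only: Z_def)
  obtain k0 where k0: "K' \<subseteq> interior (Z k0)" using conjunct2[OF conjunct2[OF c5]] unfolding Z_def by blast
  \<comment> \<open>From \<open>k0\<close> on all cutoffs equal 1 on this neighbourhood of
    \<open>K'\<close>; gradients vanish almost everywhere there, and all bounds are needed only
    outside.\<close>
  define N where "N = interior (Z k0)"
  have N: "open N" "K' \<subseteq> N" "N \<subseteq> Z k0" using k0 interior_subset by (auto simp: N_def)
  have Nz: "\<zeta> k x = 1 \<and> norm x < 1" if "k \<ge> k0" "x \<in> N" for k x
    using incseqD[OF incZ that(1)] N(3) that(2) by (auto simp: Z_def)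
  have evZ: "\<exists>k1. \<forall>k\<ge>k1. \<zeta> k x = 1" if "norm x < 1" for x
  proof -
    have "x \<in> (\<Union>k. Z k)" using unZ that by simp
    then obtain k1 where "x \<in> Z k1" by blast
    then have "x \<in> Z k" if "k \<ge> k1" for k using incseqD[OF incZ that] by blast
    then show ?thesis by (auto simp: Z_def)
  qed

  \<comment> \<open>Bounds for the tensor up to the sphere\<close>
  define S0 where "S0 = cball (0::real^'n) 1 - N"
  have compS0: "compact S0" unfolding S0_def using N(1) by (intro compact_diff) auto
  have S0sub: "S0 \<subseteq> cball 0 1 - K'" using N(2) by (auto simp: S0_def)
  have Nball: "N \<subseteq> ball 0 1" using N(3) by (auto simp: Z_def)
  have sphS0: "x \<in> S0" if "norm x = 1" for x using that Nball by (auto simp: S0_def)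
  define a where "a = (\<lambda>i j (y::real^'n). ebar y $ i $ j)"
  note sb = smooth_tensor_bounds[OF K' sm N(1,2)]
  have da: "a i j differentiable (at x)" if "norm x < 1" "x \<notin> K'" for i j x
    unfolding a_def by (rule sb(1)) (use that in simp)
  have ca: "continuous_on (ball 0 1 - K') (partial k (a i j))" for i j k unfolding a_def by (rule sb(2))
  have "\<exists>C. \<forall>x\<in>ball 0 1 - N. \<bar>partial k (a i j) x\<bar> \<le> C" for i j k unfolding a_def by (rule sb(3))
  note exC = this
  define Ca where "Ca = (\<lambda>i j k. SOME C. \<forall>x\<in>ball 0 1 - N. \<bar>partial k (a i j) x\<bar> \<le> C)"
  have Ca: "\<bar>partial k (a i j) x\<bar> \<le> Ca i j k" if "x \<in> ball 0 1 - N" for i j k x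
    unfolding Ca_def by (rule bspec[OF someI_ex[OF exC] that])
  have "\<exists>L\<ge>0. \<forall>x\<in>S0. \<forall>y\<in>S0. \<bar>a i j x - a i j y\<bar> \<le> L * dist x y" for i j unfolding a_def S0_def by (rule sb(4))
  then obtain La where La: "\<And>i j. La i j \<ge> 0" "\<And>i j x y. x \<in> S0 \<Longrightarrow> y \<in> S0 \<Longrightarrow> \<bar>a i j x - a i j y\<bar> \<le> La i j * dist x y"
    by metis
  have ca0: "continuous_on S0 (a i j)" for i j
    by (rule lipschitz_on_continuous_on[of "La i j"], rule lipschitz_onI) (use La in \<open>auto simp: dist_real_def\<close>)
  define m where "m = (\<lambda>x. trace (ebar x))"
  have ma: "m = (\<lambda>x. \<Sum>i\<in>UNIV. a i i x)" by (simp add: m_def a_def trace_def)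
  have mc: "continuous_on S0 m" unfolding ma by (intro continuous_intros ca0)
  define Lm where "Lm = (\<Sum>i\<in>UNIV. La i i)"
  have Lm: "Lm \<ge> 0" "\<bar>m x - m y\<bar> \<le> Lm * dist x y" if "x \<in> S0" "y \<in> S0" for x y
  proof -
    show "Lm \<ge> 0" using La(1) by (simp add: Lm_def sum_nonneg)
    have "\<bar>m x - m y\<bar> \<le> (\<Sum>i\<in>UNIV. \<bar>a i i x - a i i y\<bar>)" unfolding ma sum_subtractf[symmetric] by (rule sum_abs)
    also have "\<dots> \<le> Lm * dist x y" unfolding Lm_def sum_distrib_right using La(2)[OF that] by (intro sum_mono)
    finally show "\<bar>m x - m y\<bar> \<le> Lm * dist x y" .
  qed
  have "\<exists>A. \<forall>x\<in>S0. \<bar>a i j x\<bar> \<le> A" for i j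
    using compact_imp_bounded[OF compact_continuous_image[OF ca0 compS0], of i j] unfolding bounded_iff by auto
  then obtain Ba where Ba: "\<And>i j x. x \<in> S0 \<Longrightarrow> \<bar>a i j x\<bar> \<le> Ba i j" by metis
  have "\<exists>A. \<forall>x\<in>S0. \<bar>m x\<bar> \<le> A"
    using compact_imp_bounded[OF compact_continuous_image[OF mc compS0]] unfolding bounded_iff by auto
  then obtain Bm where Bm: "\<And>x. x \<in> S0 \<Longrightarrow> \<bar>m x\<bar> \<le> Bm" by blast
  have Bm0: "Bm \<ge> 0" using Bm[OF sphS0, of "axis undefined 1"] by (simp add: order_trans[OF abs_ge_zero])
  have vc: "continuous_on (sphere 0 1) v" by (rule continuous_on_sphere_hoelder[OF al(1) hol])
  have "\<exists>A. \<forall>x\<in>sphere 0 1. \<bar>v x\<bar> \<le> A"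
    using compact_imp_bounded[OF compact_continuous_image[OF vc compact_sphere]] unfolding bounded_iff by auto
  then obtain Bv where "\<forall>x\<in>sphere 0 1. \<bar>v x\<bar> \<le> Bv" ..
  then have Bv: "\<bar>v x\<bar> \<le> Bv" if "norm x = 1" for x using that by simp
  have Bv0: "Bv \<ge> 0" using Bv[of "axis undefined 1"] by (simp add: order_trans[OF abs_ge_zero])

  \<comment> \<open>The homogeneous boundary function\<close>
  define h where "h = (\<lambda>x. if x = 0 then 0 else m (x /\<^sub>R norm x) * v (x /\<^sub>R norm x))"
  have mvc: "continuous_on (sphere 0 1) (\<lambda>x. m x * v x)"
    by (intro continuous_intros vc continuous_on_subset[OF mc]) (use sphS0 in auto)
  have hm: "h \<in> borel_measurable borel"
  proof -
    have "continuous_on (- {0}) (\<lambda>x. m (x /\<^sub>R norm x) * v (x /\<^sub>R norm x))"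
      by (rule continuous_on_compose2[OF mvc]) (auto intro!: continuous_intros, metis left_inverse norm_eq_zero)
    from borel_measurable_continuous_on_indicator[OF _ this]
    have "(\<lambda>x. indicator (- {0}) x *\<^sub>R (m (x /\<^sub>R norm x) * v (x /\<^sub>R norm x))) \<in> borel_measurable borel" by simp
    moreover have "h = (\<lambda>x. indicator (- {0}) x *\<^sub>R (m (x /\<^sub>R norm x) * v (x /\<^sub>R norm x)))"
      by (auto simp: h_def fun_eq_iff)
    ultimately show ?thesis by simp
  qed
  have hb: "\<bar>h x\<bar> \<le> Bm * Bv" for x
  proof (cases "x = 0")
    case False
    then have "norm (x /\<^sub>R norm x) = 1" by simp
    then show ?thesis using Bm[OF sphS0] Bv Bm0 False by (auto simp: h_def abs_mult intro!: mult_mono)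
  qed (use Bm0 Bv0 in \<open>simp add: h_def\<close>)
  have hom: "h (s *\<^sub>R x) = h x" if "s > 0" for s x
  proof -
    have "(s *\<^sub>R x) /\<^sub>R norm (s *\<^sub>R x) = x /\<^sub>R norm x" using that by simp
    then show ?thesis using that unfolding h_def by (simp only: scaleR_eq_0_iff) simp
  qed

  \<comment> \<open>Gradients of the cutoff functions\<close>
  define \<eta> where "\<eta> = (\<lambda>k x. if norm x < 1 then \<zeta> k x else 0)"
  have \<eta>lip: "\<exists>M. M-lipschitz_on UNIV (\<eta> k)" for k
    using cS[of k] cutoff_extension(1)[OF L(2) L(1) B] unfolding \<eta>_def by blast
  have \<eta>grad: "norm g \<le> 2 * L / rho x" if "norm x < 1" "(\<eta> k has_derivative (\<lambda>h. g \<bullet> h)) (at x)" for k x g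
    using cS[of k] cutoff_extension(2)[OF L(2) L(1) B] that unfolding \<eta>_def by blast
  have "\<exists>G. G \<in> borel_measurable borel \<and> (AE x in lborel. (\<eta> k has_derivative (\<lambda>h. G x \<bullet> h)) (at x))" for k
    using \<eta>lip[of k] rademacher by blast
  note exG = this
  \<comment> \<open>A Borel representative of the gradient: where \<open>\<zeta> k\<close> is not
    differentiable, \<open>partial\<close> yields an unspecified value.\<close>
  define G where "G = (\<lambda>k. SOME G. G \<in> borel_measurable borel \<and> (AE x in lborel. (\<eta> k has_derivative (\<lambda>h. G x \<bullet> h)) (at x)))"
  have G [measurable]: "G k \<in> borel_measurable borel" for k
    unfolding G_def by (rule conjunct1[OF someI_ex[OF exG]])
  have Gd: "AE x in lborel. (\<eta> k has_derivative (\<lambda>h. G k x \<bullet> h)) (at x)" for k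
    unfolding G_def by (rule conjunct2[OF someI_ex[OF exG]])
  have G0: "AE x in lborel. norm x < 1 \<and> \<zeta> k x = 1 \<longrightarrow> G k x = 0" for k
  proof -
    obtain M where "M-lipschitz_on UNIV (\<eta> k)" using \<eta>lip by blast
    from lipschitz_level_set_AE[OF this, of 1] Gd[of k]
    show ?thesis
    proof eventually_elim
      case (elim x)
      show ?case
      proof
        assume "norm x < 1 \<and> \<zeta> k x = 1"
        then have "\<eta> k x = 1" by (simp add: \<eta>_def)
        then have "(\<lambda>h. G k x \<bullet> h) = (\<lambda>_. 0)" using elim by blast
        then have "G k x \<bullet> G k x = 0" by (rule fun_cong)
        then show "G k x = 0" by simp
      qed
    qed
  qed
  have pG: "AE x in lborel. norm x < 1 \<longrightarrow> (\<forall>j. partial j (\<zeta> k) x = G k x $ j)" for k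
    using Gd[of k]
  proof eventually_elim
    case (elim x)
    show ?case
    proof (intro impI allI)
      fix j assume x: "norm x < 1"
      have "partial j (\<zeta> k) x = partial j (\<eta> k) x"
        by (rule partial_cong_open[of "ball 0 1"]) (use x in \<open>auto simp: \<eta>_def\<close>)
      also have "\<dots> = G k x $ j" using partial_has_derivative[OF elim, of j] by (simp add: inner_axis_one)
      finally show "partial j (\<zeta> k) x = G k x $ j" .
    qed
  qed
  have GL: "AE x in lborel. norm x < 1 \<longrightarrow> norm (G k x) \<le> 2 * L / rho x" for k
    using Gd[of k] by eventually_elim (use \<eta>grad in blast)

  \<comment> \<open>Splitting of the integrand\<close>
  define R where "R = (\<lambda>j x. - W x * ((\<Sum>k\<in>UNIV. partial k (a k j) x) - (\<Sum>i\<in>UNIV. partial j (a i i) x))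
       - m x * partial j W x + (\<Sum>i\<in>UNIV. partial i W x * a i j x))"
  have formula: "charge_integrand K' e (dirichlet_op v) (\<zeta> k) x = rho x ^ n *
      (- (nn * W x * m x * (\<Sum>j\<in>UNIV. x $ j * partial j (\<zeta> k) x)) + rho x * (\<Sum>j\<in>UNIV. R j x * partial j (\<zeta> k) x))"
    if x: "norm x < 1" "x \<notin> K'" for k x
  proof -
    have tr: "partial j m x = (\<Sum>i\<in>UNIV. partial j (a i i) x)" for j
    proof -
      have "((\<lambda>y. \<Sum>i\<in>UNIV. a i i y) has_derivative (\<lambda>h. \<Sum>i\<in>UNIV. frechet_derivative (a i i) (at x) h)) (at x)"
        by (intro has_derivative_sum frechet_derivative_works[THEN iffD1] da x)
      from partial_has_derivative[OF this, of j] show ?thesis by (simp add: ma partial_def)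
    qed
    have Wd: "W differentiable (at x)" using C2_onD(1)[OF W(3)] x by simp
    have xs: "x \<in> cball 0 1 - K'" using x by simp
    have V: "dirichlet_op v y = W y / rho y" if "y \<in> ball 0 1" for y using W(2) that by simp
    have de: "(\<lambda>y. ebar y $ i $ j) differentiable (at x)" for i j using da[OF x, of i j] unfolding a_def .
    have Rx: "R j x = - W x * ((\<Sum>k\<in>UNIV. partial k (\<lambda>y. ebar y $ k $ j) x) - partial j (\<lambda>y. trace (ebar y)) x)
       - trace (ebar x) * partial j W x + (\<Sum>i\<in>UNIV. partial i W x * ebar x $ i $ j)" for j
      unfolding R_def tr[symmetric] unfolding a_def m_def ..
    show ?thesis
      unfolding nn_def n_def m_def Rx
      by (rule charge_integrand_eq[OF n2 compact_imp_closed[OF K'(1)] x _ V Wd de sym[OF xs] tang[OF xs]]) (rule e)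
  qed
  define \<psi> where "\<psi> = (\<lambda>k x. indicator {x. 1/2 < norm x \<and> norm x < 1} x * (h x * inverse (norm x ^ n) * (G k x \<bullet> x)))"
  define BN where "BN = ball (0::real^'n) 1 - N"
  have BNm [measurable]: "BN \<in> sets borel" using N(1) by (auto simp: BN_def)
  have BNS0: "x \<in> S0" "norm x < 1" "x \<notin> K'" if "x \<in> BN" for x using that N(2) by (auto simp: BN_def S0_def)
  \<comment> \<open>The coefficient of the gradient that remains after the main term has been taken
    out; for \<open>norm x \<le> 1/2\<close> nothing is subtracted.\<close>
  define T where "T = (\<lambda>j x. rho x * R j x - nn * (W x * m x - indicator {x. 1/2 < norm x \<and> norm x < 1} x * (h x * inverse (norm x ^ n))) * x $ j)"
  define \<tau> where "\<tau> = (\<lambda>k x. indicator BN x * (\<Sum>j\<in>UNIV. G k x $ j * T j x))"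
  have contBN: "continuous_on BN f" if "continuous_on (ball 0 1 - K') f" for f :: "real^'n \<Rightarrow> real"
    using that by (rule continuous_on_subset) (use N(2) in \<open>auto simp: BN_def\<close>)
  have Wc: "continuous_on (ball 0 1) W" "\<And>i. continuous_on (ball 0 1) (partial i W)"
    using C2_onD(1,2)[OF W(3)] by (auto intro!: differentiable_imp_continuous_on differentiable_at_imp_differentiable_on)
  have WcB: "continuous_on BN W" "\<And>i. continuous_on BN (partial i W)"
    using Wc by (auto intro: continuous_on_subset simp: BN_def)
  have acB: "continuous_on BN (a i j)" for i j using ca0 by (rule continuous_on_subset) (use BNS0 in auto)
  have mcB: "continuous_on BN m" using mc by (rule continuous_on_subset) (use BNS0 in auto)
  have Rc: "continuous_on BN (R j)" for j
    unfolding R_def by (intro continuous_intros WcB acB mcB contBN[OF ca])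
  have crho: "continuous_on UNIV (rho :: real^'n \<Rightarrow> real)" unfolding rho_def by (intro continuous_intros) auto
  have rhom [measurable]: "(rho :: real^'n \<Rightarrow> real) \<in> borel_measurable borel" using crho by (rule borel_measurable_continuous_onI)
  have Rm [measurable]: "(\<lambda>x. indicator BN x * R j x) \<in> borel_measurable borel" for j
    using borel_measurable_continuous_on_indicator[OF BNm Rc[of j]] by simp
  have Wmm [measurable]: "(\<lambda>x. indicator BN x * (W x * m x)) \<in> borel_measurable borel"
    using borel_measurable_continuous_on_indicator[OF BNm continuous_on_mult[OF WcB(1) mcB]] by simp
  have ring [measurable]: "{x::real^'n. 1/2 < norm x \<and> norm x < 1} \<in> sets borel" by measurable
  note hm[measurable]
  \<comment> \<open>\<open>W\<close>, \<open>m\<close> and \<open>R\<close> are known to be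
    continuous only on \<open>BN\<close>. Attaching its indicator to each of them separately makes
    measurability a matter of sums and products.\<close>
  have \<tau>alt: "\<tau> k x = (\<Sum>j\<in>UNIV. G k x $ j * (rho x * (indicator BN x * R j x) - nn * (indicator BN x * (W x * m x) -
      indicator BN x * (indicator {x. 1/2 < norm x \<and> norm x < 1} x * (h x * inverse (norm x ^ n)))) * x $ j))" for k x
    by (cases "x \<in> BN") (simp_all add: \<tau>_def T_def)
  have nth [measurable]: "(\<lambda>x::real^'n. x $ j) \<in> borel_measurable borel" for j
    by (intro borel_measurable_continuous_onI continuous_intros)
  have [measurable]: "(\<lambda>x. G k x $ j) \<in> borel_measurable borel" for k j
    by (rule measurable_compose[OF G nth])
  have \<tau>m [measurable]: "\<tau> k \<in> borel_measurable borel" for k unfolding \<tau>alt[abs_def] by measurable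
  have \<psi>m [measurable]: "\<psi> k \<in> borel_measurable borel" for k unfolding \<psi>_def by measurable
  define q where "q = (\<lambda>k x. - (nn * \<psi> k x) + \<tau> k x)"
  have qm: "q k \<in> borel_measurable borel" for k unfolding q_def by measurable
  have key: "AE x in lborel. norm x < 1 \<longrightarrow> charge_integrand K' e (dirichlet_op v) (\<zeta> k) x = rho x ^ CARD('n) * q k x" if k: "k \<ge> k0" for k
    using G0[of k] pG[of k]
  proof eventually_elim
    case (elim x)
    show ?case
    proof
      assume x: "norm x < 1"
      have p: "partial j (\<zeta> k) x = G k x $ j" for j using elim(2) x by blast
      show "charge_integrand K' e (dirichlet_op v) (\<zeta> k) x = rho x ^ CARD('n) * q k x"
      proof (cases "x \<in> N")
        case True
        then have G0: "G k x = 0" using elim(1) x Nz[OF k True] by blast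
        have "charge_integrand K' e (dirichlet_op v) (\<zeta> k) x = 0"
        proof (cases "x \<in> K'")
          case True then show ?thesis by (simp add: charge_integrand_def)
        next
          case False then show ?thesis using formula[OF x False, of k] p G0 by simp
        qed
        moreover have "q k x = 0" using True G0 by (simp add: q_def \<psi>_def \<tau>_def BN_def)
        ultimately show ?thesis by simp
      next
        case False
        then have xK: "x \<notin> K'" using N(2) by blast
        have xB: "x \<in> BN" using False x by (simp add: BN_def)
        define I where "I = (indicator {x. 1/2 < norm x \<and> norm x < 1} x * (h x * inverse (norm x ^ n)) :: real)"
        have "\<psi> k x = I * (\<Sum>j\<in>UNIV. x $ j * G k x $ j)"
          by (simp add: \<psi>_def I_def inner_vec_def mult.commute)
        moreover have "\<tau> k x = rho x * (\<Sum>j\<in>UNIV. R j x * G k x $ j) - nn * (W x * m x - I) * (\<Sum>j\<in>UNIV. x $ j * G k x $ j)"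
        proof -
          define c where "c = nn * (W x * m x - I)"
          have "T j x = rho x * R j x - c * x $ j" for j by (simp only: T_def I_def c_def)
          then show ?thesis unfolding c_def[symmetric] using xB
            by (simp add: \<tau>_def right_diff_distrib sum_subtractf sum_distrib_left ac_simps)
        qed
        ultimately have "q k x = - (nn * W x * m x * (\<Sum>j\<in>UNIV. x $ j * G k x $ j)) + rho x * (\<Sum>j\<in>UNIV. R j x * G k x $ j)"
          by (simp add: q_def algebra_simps)
        then show ?thesis using formula[OF x xK, of k] p by (simp add: n_def)
      qed
    qed
  qed
  have flux: "integrable lborel (\<psi> k)"
    "(LINT x|lborel. \<psi> k x) = - nn * (LINT x|lborel. indicator (ball 0 1) x * (h x * \<eta> k ((1 / (2 * norm x)) *\<^sub>R x)))" for k
  proof -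
    obtain M where M: "M-lipschitz_on UNIV (\<eta> k)" using \<eta>lip by blast
    have d: "DIM(real^'n) = n" by (simp add: n_def)
    note rf = radial_flux[OF M G Gd _ hm hb hom, unfolded d, folded nn_def]
    show "integrable lborel (\<psi> k)" unfolding \<psi>_def by (rule rf(1)) (auto simp: \<eta>_def)
    show "(LINT x|lborel. \<psi> k x) = - nn * (LINT x|lborel. indicator (ball 0 1) x * (h x * \<eta> k ((1 / (2 * norm x)) *\<^sub>R x)))"
      unfolding \<psi>_def by (rule rf(2)) (auto simp: \<eta>_def)
  qed

  \<comment> \<open>The pointwise bound on the error coefficient\<close>
  obtain D where D: "\<And>x j. x \<in> BN \<Longrightarrow> \<bar>T j x\<bar> \<le> D * rho x powr \<alpha>" "D \<ge> 0"
  proof -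
    define Bp where "Bp = (\<lambda>j. (\<Sum>k\<in>UNIV. \<bar>Ca k j k\<bar>) + (\<Sum>i\<in>UNIV. \<bar>Ca i i j\<bar>))"
    define BR where "BR = (\<lambda>j. CW * Bp j + Bm * CW + (\<Sum>i\<in>UNIV. CW * \<bar>Ba i j\<bar>))"
    \<comment> \<open>The first three terms bound, in this order, the errors of replacing
      \<open>W x\<close> by \<open>v\<close>, \<open>m x\<close> by its value on the sphere, and 1
      by the weight. The last one covers \<open>norm x \<le> 1/2\<close>, where
      \<open>rho \<ge> 3 / 8\<close>.\<close>
    define E where "E = CW * Bm + Bv * Lm * 2 + Bm * Bv * (nn * 2 ^ n) * 2 + CW * Bm * (8 / 3)"
    define Dj where "Dj = (\<lambda>j. \<bar>BR j\<bar> + nn * E)"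
    have Lm0: "Lm \<ge> 0" using La(1) by (simp add: Lm_def sum_nonneg)
    have nn0: "nn \<ge> 0" by (simp add: nn_def)
    have E0: "CW * Bm \<ge> 0" "Bv * Lm * 2 \<ge> 0" "Bm * Bv * (nn * 2 ^ n) * 2 \<ge> 0" using W(1) Bm0 Bv0 Lm0 nn0 by auto
    have ES: "CW * Bm + Bv * Lm * 2 + Bm * Bv * (nn * 2 ^ n) * 2 \<le> E" "CW * Bm * (8 / 3) \<le> E"
      using E0 unfolding E_def by linarith+
    have TB: "\<bar>T j x\<bar> \<le> Dj j * rho x powr \<alpha>" if xB: "x \<in> BN" for j x
    proof -
      have x: "norm x < 1" "x \<in> S0" "x \<notin> K'" using BNS0[OF xB] by auto
      have r: "rho x > 0" using x by (simp add: rho_pos_iff)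
      note rp = rho_powr_bounds[OF x(1) al]
      have p1: "1 \<le> rho x powr (\<alpha> - 1)"
        using powr_mono'[of "\<alpha> - 1" 0 "rho x"] r rho_le_half[of x] al by simp
      have xb: "x \<in> ball 0 1 - N" using xB by (simp add: BN_def)
      have P: "\<bar>(\<Sum>k\<in>UNIV. partial k (a k j) x) - (\<Sum>i\<in>UNIV. partial j (a i i) x)\<bar> \<le> Bp j"
      proof -
        have "\<bar>\<Sum>k\<in>UNIV. partial k (a k j) x\<bar> \<le> (\<Sum>k\<in>UNIV. \<bar>Ca k j k\<bar>)"
          by (rule order_trans[OF sum_abs sum_mono]) (rule order_trans[OF Ca[OF xb] abs_ge_self])
        moreover have "\<bar>\<Sum>i\<in>UNIV. partial j (a i i) x\<bar> \<le> (\<Sum>i\<in>UNIV. \<bar>Ca i i j\<bar>)"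
          by (rule order_trans[OF sum_abs sum_mono]) (rule order_trans[OF Ca[OF xb] abs_ge_self])
        ultimately show ?thesis unfolding Bp_def by linarith
      qed
      have Bp0: "Bp j \<ge> 0" by (simp add: Bp_def sum_nonneg)
      have "\<bar>R j x\<bar> \<le> \<bar>W x\<bar> * \<bar>(\<Sum>k\<in>UNIV. partial k (a k j) x) - (\<Sum>i\<in>UNIV. partial j (a i i) x)\<bar>
          + \<bar>m x\<bar> * \<bar>partial j W x\<bar> + \<bar>\<Sum>i\<in>UNIV. partial i W x * a i j x\<bar>"
        unfolding R_def by (rule order_trans[OF abs_triangle_ineq add_mono[OF order_trans[OF abs_triangle_ineq4]]]) (simp_all add: abs_mult)
      also have "\<dots> \<le> CW * Bp j * rho x powr (\<alpha> - 1) + Bm * (CW * rho x powr (\<alpha> - 1)) + (\<Sum>i\<in>UNIV. CW * \<bar>Ba i j\<bar>) * rho x powr (\<alpha> - 1)"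
      proof (intro add_mono)
        have "\<bar>W x\<bar> * \<bar>(\<Sum>k\<in>UNIV. partial k (a k j) x) - (\<Sum>i\<in>UNIV. partial j (a i i) x)\<bar> \<le> CW * Bp j * 1"
          using mult_mono[OF W(6)[OF x(1)] P] W(1) by simp
        also have "\<dots> \<le> CW * Bp j * rho x powr (\<alpha> - 1)" using p1 W(1) Bp0 by (intro mult_left_mono) auto
        finally show "\<bar>W x\<bar> * \<bar>(\<Sum>k\<in>UNIV. partial k (a k j) x) - (\<Sum>i\<in>UNIV. partial j (a i i) x)\<bar> \<le> CW * Bp j * rho x powr (\<alpha> - 1)" .
        show "\<bar>m x\<bar> * \<bar>partial j W x\<bar> \<le> Bm * (CW * rho x powr (\<alpha> - 1))"
          using Bm[OF x(2)] W(4)[OF x(1)] Bm0 by (intro mult_mono) auto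
        have "\<bar>\<Sum>i\<in>UNIV. partial i W x * a i j x\<bar> \<le> (\<Sum>i\<in>UNIV. \<bar>partial i W x * a i j x\<bar>)" by (rule sum_abs)
        also have "\<dots> \<le> (\<Sum>i\<in>UNIV. (CW * rho x powr (\<alpha> - 1)) * \<bar>Ba i j\<bar>)"
          unfolding abs_mult using W(4)[OF x(1)] order_trans[OF Ba[OF x(2)] abs_ge_self] W(1)
          by (intro sum_mono mult_mono) auto
        finally show "\<bar>\<Sum>i\<in>UNIV. partial i W x * a i j x\<bar> \<le> (\<Sum>i\<in>UNIV. CW * \<bar>Ba i j\<bar>) * rho x powr (\<alpha> - 1)"
          unfolding sum_distrib_right by (simp only: ac_simps)
      qed
      also have "\<dots> = BR j * rho x powr (\<alpha> - 1)" by (simp add: BR_def algebra_simps)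
      finally have RB: "\<bar>R j x\<bar> \<le> BR j * rho x powr (\<alpha> - 1)" .
      then have "rho x * \<bar>R j x\<bar> \<le> rho x * (BR j * rho x powr (\<alpha> - 1))" using r by (intro mult_left_mono) auto
      also have "\<dots> = BR j * rho x powr \<alpha>" using rp(1) by (simp add: ac_simps)
      also have "\<dots> \<le> \<bar>BR j\<bar> * rho x powr \<alpha>" by (intro mult_right_mono) auto
      finally have t1: "\<bar>rho x * R j x\<bar> \<le> \<bar>BR j\<bar> * rho x powr \<alpha>" using r by (simp add: abs_mult)
      have t2: "\<bar>W x * m x - indicator {x. 1/2 < norm x \<and> norm x < 1} x * (h x * inverse (norm x ^ n))\<bar> \<le> E * rho x powr \<alpha>"
      proof (cases "1/2 < norm x")
        case True
        then have x0: "x \<noteq> 0" by auto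
        define \<omega> where "\<omega> = x /\<^sub>R norm x"
        have \<omega>1: "norm \<omega> = 1" using x0 by (simp add: \<omega>_def)
        have dxo: "dist x \<omega> \<le> 2 * rho x powr \<alpha>"
        proof -
          have "x - \<omega> = (1 - 1 / norm x) *\<^sub>R x" by (simp add: \<omega>_def scaleR_diff_left divide_inverse)
          then have "dist x \<omega> = \<bar>1 - 1 / norm x\<bar> * norm x" by (simp add: dist_norm)
          also have "\<dots> = \<bar>(1 - 1 / norm x) * norm x\<bar>" by (simp only: abs_mult abs_norm_cancel)
          also have "\<dots> = \<bar>norm x - 1\<bar>" using x0 by (simp add: left_diff_distrib)
          also have "\<dots> \<le> 2 * rho x" using boundary_distance_bounds(1)[OF x(1)] x(1) by simp
          finally show ?thesis using rp(2) by simp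
        qed
        \<comment> \<open>Changing one factor at a time, so that each difference is of order
          \<open>rho powr \<alpha>\<close>.\<close>
        have "W x * m x - h x * inverse (norm x ^ n) = (W x - v \<omega>) * m x + v \<omega> * (m x - m \<omega>) + h x * (1 - inverse (norm x ^ n))"
          using x0 by (simp add: h_def \<omega>_def algebra_simps)
        also have "\<bar>\<dots>\<bar> \<le> \<bar>W x - v \<omega>\<bar> * \<bar>m x\<bar> + \<bar>v \<omega>\<bar> * \<bar>m x - m \<omega>\<bar> + \<bar>h x\<bar> * \<bar>1 - inverse (norm x ^ n)\<bar>"
          by (rule order_trans[OF abs_triangle_ineq add_mono[OF order_trans[OF abs_triangle_ineq]]]) (simp_all add: abs_mult)
        also have "\<dots> \<le> (CW * rho x powr \<alpha>) * Bm + Bv * (Lm * (2 * rho x powr \<alpha>)) + (Bm * Bv) * (nn * 2 ^ n * (2 * rho x powr \<alpha>))"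
        proof (intro add_mono mult_mono)
          show "\<bar>W x - v \<omega>\<bar> \<le> CW * rho x powr \<alpha>" using W(5)[OF x(1) x0] by (simp add: \<omega>_def)
          show "\<bar>m x\<bar> \<le> Bm" by (rule Bm[OF x(2)])
          show "\<bar>v \<omega>\<bar> \<le> Bv" by (rule Bv[OF \<omega>1])
          show "\<bar>m x - m \<omega>\<bar> \<le> Lm * (2 * rho x powr \<alpha>)"
            using Lm(2)[OF x(2) sphS0[OF \<omega>1]] mult_left_mono[OF dxo Lm0] by linarith
          show "\<bar>h x\<bar> \<le> Bm * Bv" by (rule hb)
          have "nn * 2 ^ n * (1 - norm x) \<le> nn * 2 ^ n * (2 * rho x powr \<alpha>)"
            using boundary_distance_bounds(1)[OF x(1)] rp(2) nn0 by (intro mult_left_mono) auto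
          then show "\<bar>1 - inverse (norm x ^ n)\<bar> \<le> nn * 2 ^ n * (2 * rho x powr \<alpha>)"
            using inverse_power_near_one[OF True x(1), of n] by (simp add: nn_def)
        qed (use W(1) Bm0 Bv0 in auto)
        also have "\<dots> = (CW * Bm + Bv * Lm * 2 + Bm * Bv * (nn * 2 ^ n) * 2) * rho x powr \<alpha>" by (simp add: algebra_simps)
        also have "\<dots> \<le> E * rho x powr \<alpha>" by (rule mult_right_mono[OF ES(1)]) simp
        finally show ?thesis using True x(1) by simp
      next
        case False
        have "(norm x)\<^sup>2 \<le> (1 / 2)\<^sup>2" using False by (intro power_mono) auto
        then have "3 / 8 \<le> rho x" by (simp add: rho_def power2_eq_square)
        then have "1 \<le> (8 / 3) * rho x powr \<alpha>" using rp(2) by linarith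
        then have "CW * Bm * 1 \<le> CW * Bm * ((8 / 3) * rho x powr \<alpha>)" using E0(1) by (rule mult_left_mono)
        moreover have "\<bar>W x * m x\<bar> \<le> CW * Bm"
          unfolding abs_mult using W(6)[OF x(1)] Bm[OF x(2)] W(1) by (intro mult_mono) auto
        moreover have "CW * Bm * (8 / 3) * rho x powr \<alpha> \<le> E * rho x powr \<alpha>" by (rule mult_right_mono[OF ES(2)]) simp
        ultimately show ?thesis using False by simp
      qed
      have xj: "\<bar>x $ j\<bar> \<le> 1" using component_le_norm_cart[of x j] x(1) by simp
      have "\<bar>T j x\<bar> \<le> \<bar>rho x * R j x\<bar> + \<bar>nn * (W x * m x - indicator {x. 1/2 < norm x \<and> norm x < 1} x * (h x * inverse (norm x ^ n))) * x $ j\<bar>"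
        unfolding T_def by (rule abs_triangle_ineq4)
      also have "\<dots> \<le> \<bar>BR j\<bar> * rho x powr \<alpha> + nn * (E * rho x powr \<alpha>) * 1"
      proof (rule add_mono[OF t1])
        show "\<bar>nn * (W x * m x - indicator {x. 1/2 < norm x \<and> norm x < 1} x * (h x * inverse (norm x ^ n))) * x $ j\<bar> \<le> nn * (E * rho x powr \<alpha>) * 1"
          unfolding abs_mult[of _ "x $ j"] abs_mult[of nn] abs_of_nonneg[OF nn0]
          by (intro mult_mono[OF mult_left_mono[OF t2 nn0] xj] mult_nonneg_nonneg nn0 order_trans[OF abs_ge_zero t2]) simp
      qed
      finally show ?thesis by (simp add: Dj_def algebra_simps)
    qed
    show thesis
    proof (rule that[of "\<Sum>j\<in>UNIV. \<bar>Dj j\<bar>"])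
      fix x j assume "x \<in> BN"
      then have "\<bar>T j x\<bar> \<le> Dj j * rho x powr \<alpha>" by (rule TB)
      also have "\<dots> \<le> (\<Sum>j\<in>UNIV. \<bar>Dj j\<bar>) * rho x powr \<alpha>"
        using order_trans[OF abs_ge_self member_le_sum[of j UNIV "\<lambda>j. \<bar>Dj j\<bar>"]] by (intro mult_right_mono) auto
      finally show "\<bar>T j x\<bar> \<le> (\<Sum>j\<in>UNIV. \<bar>Dj j\<bar>) * rho x powr \<alpha>" .
    qed (simp add: sum_nonneg)
  qed

  \<comment> \<open>Convergence of the error and of the main term\<close>
  \<comment> \<open>One factor 2 comes from the gradient bound, another from passing from
    \<open>rho\<close> to \<open>1 - norm x\<close>; \<open>nn\<close> counts the components in the
    sum.\<close>
  define w where "w = (\<lambda>x::real^'n. 4 * nn * L * D * (indicator (ball 0 1) x * (1 - norm x) powr (\<alpha> - 1)))"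
  have wi: "integrable lborel w"
    unfolding w_def using integrable_boundary_power[OF al, where 'a = "real^'n"] by simp
  have \<tau>w: "AE x in lborel. norm (\<tau> k x) \<le> w x" for k
    using GL[of k]
  proof eventually_elim
    case (elim x)
    show ?case
    proof (cases "x \<in> BN")
      case True
      have x: "norm x < 1" using BNS0[OF True] by simp
      have r: "rho x > 0" using x by (simp add: rho_pos_iff)
      note rp = rho_powr_bounds[OF x al]
      have "\<bar>\<Sum>j\<in>UNIV. G k x $ j * T j x\<bar> \<le> (\<Sum>j\<in>UNIV. \<bar>G k x $ j * T j x\<bar>)" by (rule sum_abs)
      also have "\<dots> \<le> (\<Sum>j\<in>(UNIV::'n set). (2 * L / rho x) * (D * rho x powr \<alpha>))"
        unfolding abs_mult using D(1)[OF True] order_trans[OF component_le_norm_cart elim[rule_format, OF x]] L(1) r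
        by (intro sum_mono mult_mono) auto
      also have "\<dots> = nn * (2 * L * D * rho x powr (\<alpha> - 1))"
        unfolding rp(1)[symmetric] using r by (simp add: nn_def n_def)
      also have "\<dots> \<le> nn * (2 * L * D * (2 * (1 - norm x) powr (\<alpha> - 1)))"
        using rp(3) L(1) D(2) by (intro mult_left_mono) (auto simp: nn_def)
      finally show ?thesis using True x by (simp add: \<tau>_def w_def)
    next
      case False
      then show ?thesis using L(1) D(2) by (simp add: \<tau>_def w_def nn_def)
    qed
  qed
  have \<tau>i: "integrable lborel (\<tau> k)" for k
  proof (rule Bochner_Integration.integrable_bound[OF wi])
    show "AE x in lborel. norm (\<tau> k x) \<le> norm (w x)" using \<tau>w[of k] by eventually_elim auto
  qed auto
  have \<tau>lim: "(\<lambda>k. LINT x|lborel. \<tau> k x) \<longlonglongrightarrow> (LINT x|(lborel :: (real^'n) measure). 0)"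
  proof (rule integral_dominated_convergence[OF _ _ wi _ \<tau>w])
    have "AE x in lborel. \<forall>k. norm x < 1 \<and> \<zeta> k x = 1 \<longrightarrow> G k x = 0" unfolding AE_all_countable using G0 by blast
    then show "AE x in lborel. (\<lambda>k. \<tau> k x) \<longlonglongrightarrow> 0"
    proof eventually_elim
      case (elim x)
      show ?case
      proof (cases "x \<in> BN")
        case True
        then have x: "norm x < 1" using BNS0 by blast
        obtain k1 where "\<forall>k\<ge>k1. \<zeta> k x = 1" using evZ[OF x] by blast
        then have "\<forall>k\<ge>k1. \<tau> k x = 0" using elim x by (simp add: \<tau>_def)
        then have "\<forall>\<^sub>F k in sequentially. \<tau> k x = 0" unfolding eventually_sequentially by blast
        then show ?thesis by (rule tendsto_eventually)
      qed (simp add: \<tau>_def)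
    qed
  qed auto
  \<comment> \<open>The cutoff is evaluated only on the sphere of radius 1/2, where it is eventually
    1 at every point.\<close>
  have \<psi>lim: "(\<lambda>k. LINT x|lborel. indicator (ball 0 1) x * (h x * \<eta> k ((1 / (2 * norm x)) *\<^sub>R x)))
      \<longlonglongrightarrow> (LINT x|lborel. indicator (ball 0 1) x * h x)"
  proof (rule integral_dominated_convergence[where w = "\<lambda>x. indicator (ball 0 1) x * (Bm * Bv * \<bar>B\<bar>)"])
    have bm: "ball (0::real^'n) 1 \<in> sets borel" by simp
    note bm[measurable]
    show "(\<lambda>x. indicator (ball 0 1) x * h x) \<in> borel_measurable lborel" by measurable
    show "(\<lambda>x. indicator (ball 0 1) x * (h x * \<eta> k ((1 / (2 * norm x)) *\<^sub>R x))) \<in> borel_measurable lborel" for k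
    proof -
      have [measurable]: "\<eta> k \<in> borel_measurable borel"
        using \<eta>lip[of k] lipschitz_on_continuous_on borel_measurable_continuous_onI by blast
      show ?thesis by measurable
    qed
    show "integrable lborel (\<lambda>x. indicator (ball (0::real^'n) 1) x * (Bm * Bv * \<bar>B\<bar>))"
      using emeasure_lborel_ball_finite[of "0::real^'n" 1]
      by (intro integrable_mult_left integrable_real_indicator) auto
    show "AE x in lborel. norm (indicator (ball 0 1) x * (h x * \<eta> k ((1 / (2 * norm x)) *\<^sub>R x))) \<le> indicator (ball 0 1) x * (Bm * Bv * \<bar>B\<bar>)" for k
    proof (intro AE_I2)
      fix x :: "real^'n"
      have "\<bar>\<eta> k y\<bar> \<le> \<bar>B\<bar>" for y using B[of y k] by (auto simp: \<eta>_def)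
      then have "\<bar>h x\<bar> * \<bar>\<eta> k ((1 / (2 * norm x)) *\<^sub>R x)\<bar> \<le> Bm * Bv * \<bar>B\<bar>" using hb[of x] Bm0 Bv0 by (intro mult_mono) auto
      then show "norm (indicator (ball 0 1) x * (h x * \<eta> k ((1 / (2 * norm x)) *\<^sub>R x))) \<le> indicator (ball 0 1) x * (Bm * Bv * \<bar>B\<bar>)"
        by (simp add: indicator_def abs_mult)
    qed
    show "AE x in lborel. (\<lambda>k. indicator (ball 0 1) x * (h x * \<eta> k ((1 / (2 * norm x)) *\<^sub>R x))) \<longlonglongrightarrow> indicator (ball 0 1) x * h x"
    proof (rule AE_I2)
      fix x :: "real^'n"
      show "(\<lambda>k. indicator (ball 0 1) x * (h x * \<eta> k ((1 / (2 * norm x)) *\<^sub>R x))) \<longlonglongrightarrow> indicator (ball 0 1) x * h x"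
      proof (cases "x = 0")
        case True then show ?thesis by (simp add: h_def)
      next
        case False
        define y where "y = (1 / (2 * norm x)) *\<^sub>R x"
        have y: "norm y < 1" using False by (simp add: y_def)
        obtain k1 where "\<forall>k\<ge>k1. \<zeta> k y = 1" using evZ[OF y] by blast
        then have "\<forall>k\<ge>k1. indicator (ball 0 1) x * (h x * \<eta> k y) = indicator (ball 0 1) x * h x" using y by (simp add: \<eta>_def)
        then have "\<forall>\<^sub>F k in sequentially. indicator (ball 0 1) x * (h x * \<eta> k y) = indicator (ball 0 1) x * h x"
          unfolding eventually_sequentially by blast
        then show ?thesis unfolding y_def by (rule tendsto_eventually)
      qed
    qed
  qed
  \<comment> \<open>By its cone normalisation \<open>sphere_measure\<close> absorbs one of the two
    factors \<open>nn\<close>.\<close>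
  have sph: "(LINT x|sphere_measure. trace (ebar x) * v x) = nn * (LINT x|lborel. indicator (ball 0 1) x * h x)"
  proof -
    have "(LINT x|sphere_measure. m x * v x) = nn * (LINT x|lborel. indicator (ball 0 1 - {0}) x * (m (x /\<^sub>R norm x) * v (x /\<^sub>R norm x)))"
      unfolding nn_def n_def by (rule integral_sphere_measure[OF continuous_on_sphere_measurable[OF mvc]])
    also have "(LINT x|lborel. indicator (ball 0 1 - {0}) x * (m (x /\<^sub>R norm x) * v (x /\<^sub>R norm x))) = (LINT x|lborel. indicator (ball 0 1) x * h x)"
      by (rule Bochner_Integration.integral_cong[OF refl]) (auto simp: h_def indicator_def)
    finally show ?thesis by (simp add: m_def)
  qed
  have ballq: "indicator (ball 0 1) x * q k x = q k x" for k x
    by (auto simp: q_def \<psi>_def \<tau>_def BN_def indicator_def)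
  have qi: "integrable lborel (\<lambda>x. indicator (ball 0 1) x * q k x)" for k
    unfolding ballq unfolding q_def using flux(1)[of k] \<tau>i[of k] by (intro Bochner_Integration.integrable_add) auto
  have main: "integrable hyp_volume (charge_integrand K' e (dirichlet_op v) (\<zeta> k))"
    "integral\<^sup>L hyp_volume (charge_integrand K' e (dirichlet_op v) (\<zeta> k)) =
       nn * (nn * (LINT x|lborel. indicator (ball 0 1) x * (h x * \<eta> k ((1 / (2 * norm x)) *\<^sub>R x)))) + (LINT x|lborel. \<tau> k x)" if k: "k \<ge> k0" for k
  proof -
    note hv = hyp_volume_integral[OF qm key[OF k] qi]
    show "integrable hyp_volume (charge_integrand K' e (dirichlet_op v) (\<zeta> k))" by (rule hv(1))
    have "integral\<^sup>L hyp_volume (charge_integrand K' e (dirichlet_op v) (\<zeta> k)) = (LINT x|lborel. q k x)"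
      using hv(2) unfolding ballq .
    also have "\<dots> = - (nn * (LINT x|lborel. \<psi> k x)) + (LINT x|lborel. \<tau> k x)"
      unfolding q_def using flux(1)[of k] \<tau>i[of k] by (subst Bochner_Integration.integral_add) auto
    finally show "integral\<^sup>L hyp_volume (charge_integrand K' e (dirichlet_op v) (\<zeta> k)) =
       nn * (nn * (LINT x|lborel. indicator (ball 0 1) x * (h x * \<eta> k ((1 / (2 * norm x)) *\<^sub>R x)))) + (LINT x|lborel. \<tau> k x)"
      unfolding flux(2) by simp
  qed
  have "\<forall>\<^sub>F k in sequentially. integrable hyp_volume (charge_integrand K' e (dirichlet_op v) (\<zeta> k))"
    unfolding eventually_sequentially using main(1) by blast
  moreover have "(\<lambda>k. integral\<^sup>L hyp_volume (charge_integrand K' e (dirichlet_op v) (\<zeta> k)))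
      \<longlonglongrightarrow> real CARD('n) * (LINT x|sphere_measure. trace (ebar x) * v x)"
  proof (rule Lim_transform_eventually)
    show "(\<lambda>k. nn * (nn * (LINT x|lborel. indicator (ball 0 1) x * (h x * \<eta> k ((1 / (2 * norm x)) *\<^sub>R x)))) + (LINT x|lborel. \<tau> k x))
      \<longlonglongrightarrow> real CARD('n) * (LINT x|sphere_measure. trace (ebar x) * v x)"
      using tendsto_add[OF tendsto_mult_left[OF tendsto_mult_left[OF \<psi>lim, of nn], of nn] \<tau>lim]
      unfolding sph by (simp add: nn_def n_def)
    show "\<forall>\<^sub>F k in sequentially. nn * (nn * (LINT x|lborel. indicator (ball 0 1) x * (h x * \<eta> k ((1 / (2 * norm x)) *\<^sub>R x)))) + (LINT x|lborel. \<tau> k x)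
       = integral\<^sup>L hyp_volume (charge_integrand K' e (dirichlet_op v) (\<zeta> k))"
      unfolding eventually_sequentially using main(2) by (intro exI[of _ k0]) auto
  qed
  ultimately show "(\<forall>\<^sub>F k in sequentially. integrable hyp_volume (charge_integrand K' e (dirichlet_op v) (\<zeta> k))) \<and>
     (\<lambda>k. integral\<^sup>L hyp_volume (charge_integrand K' e (dirichlet_op v) (\<zeta> k)))
      \<longlonglongrightarrow> real CARD('n) * (LINT x|sphere_measure. trace (ebar x) * v x)" ..
qed

theorem proposition4p4:
  fixes A :: "('m::{t2_space, second_countable_topology}, 'n::finite) chart set"
    and g :: "('m, 'n) chart \<Rightarrow> 'm \<Rightarrow> real^'n^'n"
    and K :: "'m set" and K' :: "(real^'n) set"
    and \<Phi> :: "'m \<Rightarrow> real^'n"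
    and e ebar :: "real^'n \<Rightarrow> real^'n^'n"
    and \<epsilon> :: real
  assumes "CARD('n) \<ge> 3"
    and "smooth_atlas A" and "riemannian_metric A g" and "riem_complete A g"
    and "chart_at_infinity A g K K' \<Phi>"
    and "\<And>x. x \<in> ball 0 1 - K' \<Longrightarrow> e x = pushforward A g K \<Phi> x - hyp_metric x"
    and "\<And>x. x \<in> ball 0 1 - K' \<Longrightarrow> ebar x = (rho x powi (2 - int CARD('n))) *\<^sub>R e x"
    and "smooth_on (cball 0 1 - K') ebar"
    and "\<And>x. x \<in> cball 0 1 - K' \<Longrightarrow> transpose (ebar x) = ebar x"
    and "\<And>x j. x \<in> cball 0 1 - K' \<Longrightarrow> (\<Sum>i\<in>UNIV. ebar x $ i $ j * x $ i) = 0"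
    and "\<epsilon> > 0"
  shows "charge_P_well_defined K' e (holder_space \<epsilon>) \<and>
    (\<forall>v\<in>holder_space \<epsilon>.
       charge_P K' e v
         = real CARD('n) * (LINT x|sphere_measure. trace (ebar x) * v x))"
proof -
  have K': "compact K'" "K' \<subseteq> ball 0 1" using assms(5) by (auto simp: chart_at_infinity_def)
  have e: "e x = rho x ^ (CARD('n) - 2) *\<^sub>R ebar x" if x: "x \<in> ball 0 1 - K'" for x
  proof -
    have r: "rho x > 0" using x by (simp add: rho_pos_iff)
    have "2 - int CARD('n) = - int (CARD('n) - 2)" using assms(1) by simp
    then have "rho x powi (2 - int CARD('n)) = inverse (rho x ^ (CARD('n) - 2))"
      by (simp only: power_int_minus power_int_of_nat)
    then show ?thesis using assms(7)[OF x] r by simp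
  qed
  have lim: "charge_limit K' e (dirichlet_op v) (real CARD('n) * (LINT x|sphere_measure. trace (ebar x) * v x))"
    if v: "v \<in> holder_space \<epsilon>" for v
  proof -
    obtain \<alpha> C where al: "0 < \<alpha>" "\<alpha> \<le> 1"
      and hol: "\<And>\<xi> \<eta>. norm \<xi> = 1 \<Longrightarrow> norm \<eta> = 1 \<Longrightarrow> \<bar>v \<xi> - v \<eta>\<bar> \<le> C * norm (\<xi> - \<eta>) powr \<alpha>"
      by (rule holder_spaceD[OF v assms(11)]) blast
    show ?thesis
      by (rule charge_limit_asymptotic[OF _ K' e assms(8,9,10) al hol]) (use assms(1) in auto)
  qed
  \<comment> \<open>One cutoff sequence suffices to compare two candidate limits.\<close>
  obtain \<zeta> where \<zeta>: "cutoff_sequence K' \<zeta>" using cutoff_sequence_exists[OF K'] by blast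
  have unique: "l = l'" if "charge_limit K' e V l" "charge_limit K' e V l'" for V l l'
    using that \<zeta> LIMSEQ_unique unfolding charge_limit_def by blast
  have "charge_P K' e v = real CARD('n) * (LINT x|sphere_measure. trace (ebar x) * v x)" if "v \<in> holder_space \<epsilon>" for v
    unfolding charge_P_def charge_p_def by (rule the_equality) (use lim[OF that] unique in blast)+
  moreover have "charge_P_well_defined K' e (holder_space \<epsilon>)"
    unfolding charge_P_well_defined_def using lim unique by blast
  ultimately show ?thesis by blast
qed

end
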